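(* Let $\Lambda=KQ/I$ be a basic finite dimensional algebra over an algebraically closed field $K$ whose Jacobson radical $J$ satisfies $J^2=0$, and let $T$ be a semisimple left $\Lambda$-module which is realizable with respect to the dimension vector $\mathbf d$. The image of the map $$\rho:\mathcal C(T,\mathbf d)\to\{\text{isomorphism classes of }\Lambda\text{-modules with dimension vector }\mathbf d\}$$ equals the set of isomorphism classes of modules in $\overline{\mathbf{Rep}^T_{\mathbf d}}$, and the fibers of $\rho$ coincide with the orbits of the action of $G(T)$ on $\mathcal C(T,\mathbf d)$.
   Context: $Q$ is a finite quiver with vertices $e_1,\dots,e_n$ and arrow set $Q_1$, $I$ is the ideal generated by all paths of length $2$, $S_i=\Lambda e_i/Je_i$. For $\mathbf d=(d_1,\dots,d_n)$, $\mathbf{Rep}_{\mathbf d}(\Lambda)$ is the affine variety of tuples $(x_\alpha)_{\alpha\in Q_1}\in\prod_\alpha \operatorname{Hom}_K(K^{d_{\mathrm{start}(\alpha)}},K^{d_{\mathrm{end}(\alpha)}})$ satisfying all relations in $I$; points correspond to modules with dimension vector $\mathbf d$. $\mathbf{Rep}^T_{\mathbf d}$ is the locally closed subvariety of points whose modules $M$ have top $M/JM\cong T$; closure is in $\mathbf{Rep}_{\mathbf d}(\Lambda)$. $T$ is realizable with respect to $\mathbf d$ if $\mathbf{Rep}^T_{\mathbf d}\neq\varnothing$. Write $T=\bigoplus_{1\le i\le n}T_i$ with $T_i=S_i^{t_i}$, and $R=\bigoplus_{1\le i\le n}R_i$ with $R_i=S_i^{d_i-t_i}$. Set $$\mathcal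 C(T,\mathbf d)=\{(x_\alpha)_{\alpha\in Q_1}\mid x_\alpha\in\operatorname{Hom}_K(T_{\mathrm{start}(\alpha)},R_{\mathrm{end}(\alpha)})\}.$$ For $x\in\mathcal C(T,\mathbf d)$, $\rho(x)$ is the isomorphism class of the $\Lambda$-module with underlying space $T\oplus R$ on which $e_i$ acts as the projection onto $T_i\oplus R_i$ and each arrow acts by $\alpha(v+w)=x_\alpha(v_{\mathrm{start}(\alpha)})$ for $v=v_1+\cdots+v_n\in T$ ($v_i\in T_i$), $w\in R$. $G(T)=\bigl(\prod_{1\le i\le n}\operatorname{GL}(T_i)\bigr)\times\bigl(\prod_{1\le i\le n}\operatorname{GL}(R_i)\bigr)$ (general linear groups of the underlying $K$-spaces) acts on $\mathcal C(T,\mathbf d)$ by $\bigl((g_i),(h_i)\bigr).x=\bigl(h_{\mathrm{end}(\alpha)}\,x_\alpha\,g^{-1}_{\mathrm{start}(\alpha)}\bigr)_{\alpha}$. *)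

theory Defs
  imports
    "Graph_Theory.Arc_Walk"
    "Jordan_Normal_Form.VS_Connect"
    "HOL-Algebra.QuotRing"
    "HOL-Algebra.Group_Action"
    "HOL-Algebra.Product_Groups"
begin

section \<open>Left modules over a not necessarily commutative ring\<close>

text \<open>The record \<^type>\<open>module\<close> of HOL-Algebra is reused; its library locale asks for a
  commutative ring of scalars. The fields \<open>mult\<close> and \<open>one\<close> of module records are never used.\<close>

locale left_module = R?: ring R + M?: abelian_group M
  for R :: "('r, 'x) ring_scheme" (structure) and M :: "('r, 'm, 'y) module_scheme" (structure) +
  assumes smult_closed:
      "\<lbrakk>a \<in> carrier R; x \<in> carrier M\<rbrakk> \<Longrightarrow> a \<odot>\<^bsub>M\<^esub> x \<in> carrier M"
    and smult_l_distr:
      "\<lbrakk>a \<in> carrier R; b \<in> carrier R; x \<in> carrier M\<rbrakk> \<Longrightarrow>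
        (a \<oplus>\<^bsub>R\<^esub> b) \<odot>\<^bsub>M\<^esub> x = a \<odot>\<^bsub>M\<^esub> x \<oplus>\<^bsub>M\<^esub> b \<odot>\<^bsub>M\<^esub> x"
    and smult_r_distr:
      "\<lbrakk>a \<in> carrier R; x \<in> carrier M; y \<in> carrier M\<rbrakk> \<Longrightarrow>
        a \<odot>\<^bsub>M\<^esub> (x \<oplus>\<^bsub>M\<^esub> y) = a \<odot>\<^bsub>M\<^esub> x \<oplus>\<^bsub>M\<^esub> a \<odot>\<^bsub>M\<^esub> y"
    and smult_assoc:
      "\<lbrakk>a \<in> carrier R; b \<in> carrier R; x \<in> carrier M\<rbrakk> \<Longrightarrow>
        (a \<otimes>\<^bsub>R\<^esub> b) \<odot>\<^bsub>M\<^esub> x = a \<odot>\<^bsub>M\<^esub> (b \<odot>\<^bsub>M\<^esub> x)"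
    and smult_one: "x \<in> carrier M \<Longrightarrow> \<one>\<^bsub>R\<^esub> \<odot>\<^bsub>M\<^esub> x = x"

definition module_iso ::
    "('r, 'x) ring_scheme \<Rightarrow> ('r, 'm) module \<Rightarrow> ('r, 'n) module \<Rightarrow> ('m \<Rightarrow> 'n) set" where
  "module_iso R M N = {h. bij_betw h (carrier M) (carrier N) \<and>
     (\<forall>x\<in>carrier M. \<forall>y\<in>carrier M. h (x \<oplus>\<^bsub>M\<^esub> y) = h x \<oplus>\<^bsub>N\<^esub> h y) \<and>
     (\<forall>a\<in>carrier R. \<forall>x\<in>carrier M. h (a \<odot>\<^bsub>M\<^esub> x) = a \<odot>\<^bsub>N\<^esub> h x)}"

definition modules_isomorphic ::
    "('r, 'x) ring_scheme \<Rightarrow> ('r, 'm) module \<Rightarrow> ('r, 'n) module \<Rightarrow> bool" where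
  "modules_isomorphic R M N \<longleftrightarrow> module_iso R M N \<noteq> {}"

definition quotient_module :: "('r, 'm) module \<Rightarrow> 'm set \<Rightarrow> ('r, 'm set) module" where
  "quotient_module M N =
    \<lparr>carrier = a_rcosets\<^bsub>M\<^esub> N, mult = undefined, one = undefined,
     zero = N, add = set_add M,
     smult = (\<lambda>a X. \<Union>x\<in>X. N +>\<^bsub>M\<^esub> (a \<odot>\<^bsub>M\<^esub> x))\<rparr>"

text \<open>For a finite index set this is the direct sum.\<close>

definition direct_sum_module :: "'i set \<Rightarrow> ('i \<Rightarrow> ('r, 'm) module) \<Rightarrow> ('r, 'i \<Rightarrow> 'm) module" where
  "direct_sum_module I M =
    \<lparr>carrier = (\<Pi>\<^sub>E i\<in>I. carrier (M i)), mult = undefined, one = undefined,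
     zero = (\<lambda>i\<in>I. \<zero>\<^bsub>M i\<^esub>), add = (\<lambda>x y. \<lambda>i\<in>I. x i \<oplus>\<^bsub>M i\<^esub> y i),
     smult = (\<lambda>a x. \<lambda>i\<in>I. a \<odot>\<^bsub>M i\<^esub> x i)\<rparr>"

definition left_ideal :: "('r, 'x) ring_scheme \<Rightarrow> 'r set \<Rightarrow> bool" where
  "left_ideal R L \<longleftrightarrow> subgroup L (add_monoid R) \<and> (\<forall>a\<in>carrier R. \<forall>l\<in>L. a \<otimes>\<^bsub>R\<^esub> l \<in> L)"

definition maximal_left_ideal :: "('r, 'x) ring_scheme \<Rightarrow> 'r set \<Rightarrow> bool" where
  "maximal_left_ideal R L \<longleftrightarrow> left_ideal R L \<and> L \<noteq> carrier R \<and>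
     (\<forall>L'. left_ideal R L' \<longrightarrow> L \<subseteq> L' \<longrightarrow> L' = L \<or> L' = carrier R)"

definition jacobson_radical :: "('r, 'x) ring_scheme \<Rightarrow> 'r set" where
  "jacobson_radical R = carrier R \<inter> \<Inter>{L. maximal_left_ideal R L}"

definition left_ideal_module :: "('r, 'x) ring_scheme \<Rightarrow> 'r set \<Rightarrow> ('r, 'r) module" where
  "left_ideal_module R L =
    \<lparr>carrier = L, mult = undefined, one = undefined,
     zero = \<zero>\<^bsub>R\<^esub>, add = add R, smult = mult R\<rparr>"

definition ideal_times_module :: "'r set \<Rightarrow> ('r, 'm) module \<Rightarrow> 'm set" where
  "ideal_times_module J M = generate (add_monoid M) {a \<odot>\<^bsub>M\<^esub> x | a x. a \<in> J \<and> x \<in> carrier M}"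

definition module_top :: "('r, 'x) ring_scheme \<Rightarrow> ('r, 'm) module \<Rightarrow> ('r, 'm set) module" where
  "module_top R M = quotient_module M (ideal_times_module (jacobson_radical R) M)"


section \<open>The algebra \<open>\<Lambda> = KQ/I\<close>\<close>

text \<open>A quiver is a finite digraph with loops and multiple arrows allowed. A path is a pair
  \<open>(u, p)\<close> of its starting vertex and its list of arrows in the order in which they are
  traversed; \<open>(u, [])\<close> is the idempotent \<open>e\<^sub>u\<close>.\<close>

definition quiver_paths :: "('v, 'a) pre_digraph \<Rightarrow> ('v \<times> 'a list) set" where
  "quiver_paths Q = {(u, p). \<exists>v. pre_digraph.awalk Q u p v}"

definition path_elem :: "'v \<times> 'a list \<Rightarrow> ('v \<times> 'a list \<Rightarrow> 'k::field)" where
  "path_elem p = (\<lambda>q. if q = p then 1 else 0)"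

text \<open>Elements of \<open>KQ\<close> are finitely supported coefficient functions. The product \<open>q \<cdot> p\<close> of two
  paths is ``first \<open>p\<close>, then \<open>q\<close>'', so that left modules are covariant representations; the
  coefficient of \<open>f \<cdot> g\<close> at a path sums over all its factorizations.\<close>

definition path_algebra :: "('v, 'a) pre_digraph \<Rightarrow> ('v \<times> 'a list \<Rightarrow> 'k::field) ring" where
  "path_algebra Q =
    \<lparr>carrier = {f. finite {p. f p \<noteq> 0} \<and> {p. f p \<noteq> 0} \<subseteq> quiver_paths Q},
     mult = (\<lambda>f g. \<lambda>(u, p). \<Sum>k\<le>length p.
       f (pre_digraph.awlast Q u (take k p), drop k p) * g (u, take k p)),
     one = (\<lambda>(u, p). if u \<in> verts Q \<and> p = [] then 1 else 0),
     zero = (\<lambda>_. 0),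
     add = (\<lambda>f g p. f p + g p)\<rparr>"

definition length2_ideal :: "('v, 'a) pre_digraph \<Rightarrow> ('v \<times> 'a list \<Rightarrow> 'k::field) set" where
  "length2_ideal Q =
     Idl\<^bsub>path_algebra Q\<^esub> (path_elem ` {(u, p) \<in> quiver_paths Q. length p = 2})"

definition bound_algebra :: "('v, 'a) pre_digraph \<Rightarrow> ('v \<times> 'a list \<Rightarrow> 'k::field) set ring" where
  "bound_algebra Q = path_algebra Q Quot length2_ideal Q"

definition residue ::
    "('v, 'a) pre_digraph \<Rightarrow> ('v \<times> 'a list \<Rightarrow> 'k::field) \<Rightarrow> ('v \<times> 'a list \<Rightarrow> 'k) set" where
  "residue Q f = length2_ideal Q +>\<^bsub>path_algebra Q\<^esub> f"

definition scalar :: "('v, 'a) pre_digraph \<Rightarrow> 'k::field \<Rightarrow> ('v \<times> 'a list \<Rightarrow> 'k) set" where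
  "scalar Q c = residue Q (\<lambda>p. c * \<one>\<^bsub>path_algebra Q\<^esub> p)"

definition vertex_idem :: "('v, 'a) pre_digraph \<Rightarrow> 'v \<Rightarrow> ('v \<times> 'a list \<Rightarrow> 'k::field) set" where
  "vertex_idem Q i = residue Q (path_elem (i, []))"

text \<open>\<open>S\<^sub>i = \<Lambda>e\<^sub>i/Je\<^sub>i\<close>, and \<open>T = \<Oplus>\<^sub>i S\<^sub>i^{t\<^sub>i}\<close>.\<close>

definition simple_module ::
    "('v, 'a) pre_digraph \<Rightarrow> 'v \<Rightarrow>
      (('v \<times> 'a list \<Rightarrow> 'k::field) set, ('v \<times> 'a list \<Rightarrow> 'k) set set) module" where
  "simple_module Q i =
     (let \<Lambda> = bound_algebra Q; e = vertex_idem Q i in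
      quotient_module
        (left_ideal_module \<Lambda> {a \<otimes>\<^bsub>\<Lambda>\<^esub> e | a. a \<in> carrier \<Lambda>})
        {a \<otimes>\<^bsub>\<Lambda>\<^esub> e | a. a \<in> jacobson_radical \<Lambda>})"

definition semisimple_module ::
    "('v, 'a) pre_digraph \<Rightarrow> ('v \<Rightarrow> nat) \<Rightarrow>
      (('v \<times> 'a list \<Rightarrow> 'k::field) set, 'v \<times> nat \<Rightarrow> ('v \<times> 'a list \<Rightarrow> 'k) set set) module" where
  "semisimple_module Q t =
     direct_sum_module (SIGMA i:verts Q. {..<t i}) (\<lambda>(i, j). simple_module Q i)"

definition vertex_space ::
    "('v, 'a) pre_digraph \<Rightarrow> (('v \<times> 'a list \<Rightarrow> 'k::field) set, 'm) module \<Rightarrow> 'v \<Rightarrow> ('k, 'm) module"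
  where
  "vertex_space Q M i =
    \<lparr>carrier = {vertex_idem Q i \<odot>\<^bsub>M\<^esub> x | x. x \<in> carrier M}, mult = undefined, one = undefined,
     zero = \<zero>\<^bsub>M\<^esub>, add = add M, smult = (\<lambda>c x. scalar Q c \<odot>\<^bsub>M\<^esub> x)\<rparr>"

definition has_dim_vector ::
    "('v, 'a) pre_digraph \<Rightarrow> ('v \<Rightarrow> nat) \<Rightarrow> (('v \<times> 'a list \<Rightarrow> 'k::field) set, 'm) module \<Rightarrow> bool" where
  "has_dim_vector Q d M \<longleftrightarrow>
     (\<forall>i\<in>verts Q. vectorspace.fin_dim class_ring (vertex_space Q M i) \<and>
                  vectorspace.dim class_ring (vertex_space Q M i) = d i)"


section \<open>Modules given by operators for the vertices and arrows\<close>

text \<open>In what follows \<open>V\<close> is a \<open>K\<close>-space on which \<open>e\<^sub>i\<close> acts as \<open>E i\<close> and \<open>\<alpha>\<close> as \<open>A \<alpha>\<close>.\<close>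

definition path_act :: "('v \<Rightarrow> 'm \<Rightarrow> 'm) \<Rightarrow> ('a \<Rightarrow> 'm \<Rightarrow> 'm) \<Rightarrow> 'v \<times> 'a list \<Rightarrow> 'm \<Rightarrow> 'm" where
  "path_act E A = (\<lambda>(u, p) x. fold A p (E u x))"

definition path_algebra_act ::
    "('k::field, 'm) module \<Rightarrow> ('v \<Rightarrow> 'm \<Rightarrow> 'm) \<Rightarrow> ('a \<Rightarrow> 'm \<Rightarrow> 'm) \<Rightarrow>
      ('v \<times> 'a list \<Rightarrow> 'k) \<Rightarrow> 'm \<Rightarrow> 'm" where
  "path_algebra_act V E A f x = (\<Oplus>\<^bsub>V\<^esub>p\<in>{p. f p \<noteq> 0}. f p \<odot>\<^bsub>V\<^esub> path_act E A p x)"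

text \<open>A residue class acts through any representative; this is meant for operators for which
  the ideal acts as zero, where the choice is immaterial.\<close>

definition operator_module ::
    "('k::field, 'm) module \<Rightarrow> ('v \<Rightarrow> 'm \<Rightarrow> 'm) \<Rightarrow> ('a \<Rightarrow> 'm \<Rightarrow> 'm) \<Rightarrow>
      (('v \<times> 'a list \<Rightarrow> 'k) set, 'm) module" where
  "operator_module V E A =
    \<lparr>carrier = carrier V, mult = undefined, one = undefined, zero = \<zero>\<^bsub>V\<^esub>, add = add V,
     smult = (\<lambda>X x. path_algebra_act V E A (SOME f. f \<in> X) x)\<rparr>"

text \<open>\<open>\<Oplus>\<^sub>i K^{d\<^sub>i}\<close> as a \<open>K\<close>-space, and the projection onto its \<open>i\<close>-th summand.\<close>

definition coord_space ::
    "('v, 'a) pre_digraph \<Rightarrow> ('v \<Rightarrow> nat) \<Rightarrow> ('k::field, 'v \<Rightarrow> 'k vec) module" where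
  "coord_space Q d =
    \<lparr>carrier = (\<Pi>\<^sub>E i\<in>verts Q. carrier_vec (d i)), mult = undefined, one = undefined,
     zero = (\<lambda>i\<in>verts Q. 0\<^sub>v (d i)), add = (\<lambda>x y. \<lambda>i\<in>verts Q. x i + y i),
     smult = (\<lambda>c x. \<lambda>i\<in>verts Q. c \<cdot>\<^sub>v x i)\<rparr>"

definition coord_proj ::
    "('v, 'a) pre_digraph \<Rightarrow> ('v \<Rightarrow> nat) \<Rightarrow> 'v \<Rightarrow> ('v \<Rightarrow> 'k::field vec) \<Rightarrow> ('v \<Rightarrow> 'k vec)" where
  "coord_proj Q d i x = (\<lambda>j\<in>verts Q. if j = i then x j else 0\<^sub>v (d j))"

text \<open>The map from a coordinate space to the one with dimensions \<open>d\<close> that applies the matrix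
  \<open>x \<alpha>\<close> to the component at the start of \<open>\<alpha>\<close> and places the result at its end.\<close>

definition arrow_map ::
    "('v, 'a) pre_digraph \<Rightarrow> ('v \<Rightarrow> nat) \<Rightarrow> ('a \<Rightarrow> 'k::field mat) \<Rightarrow> 'a \<Rightarrow>
      ('v \<Rightarrow> 'k vec) \<Rightarrow> ('v \<Rightarrow> 'k vec)" where
  "arrow_map Q d x \<alpha> v =
     (\<lambda>j\<in>verts Q. if j = head Q \<alpha> then x \<alpha> *\<^sub>v v (tail Q \<alpha>) else 0\<^sub>v (d j))"


section \<open>The variety \<open>Rep\<^sub>d(\<Lambda>)\<close> and closures in it\<close>

definition matrix_tuples ::
    "('v, 'a) pre_digraph \<Rightarrow> ('v \<Rightarrow> nat) \<Rightarrow> ('v \<Rightarrow> nat) \<Rightarrow> ('a \<Rightarrow> 'k::field mat) set" where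
  "matrix_tuples Q m n = (\<Pi>\<^sub>E \<alpha>\<in>arcs Q. carrier_mat (n (head Q \<alpha>)) (m (tail Q \<alpha>)))"

definition rep_variety ::
    "('v, 'a) pre_digraph \<Rightarrow> ('v \<Rightarrow> nat) \<Rightarrow> ('a \<Rightarrow> 'k::field mat) set" where
  "rep_variety Q d = {x \<in> matrix_tuples Q d d.
     \<forall>f\<in>length2_ideal Q. \<forall>v\<in>carrier (coord_space Q d).
       path_algebra_act (coord_space Q d) (coord_proj Q d) (arrow_map Q d x) f v
         = \<zero>\<^bsub>coord_space Q d\<^esub>}"

definition point_module ::
    "('v, 'a) pre_digraph \<Rightarrow> ('v \<Rightarrow> nat) \<Rightarrow> ('a \<Rightarrow> 'k::field mat) \<Rightarrow>
      (('v \<times> 'a list \<Rightarrow> 'k) set, 'v \<Rightarrow> 'k vec) module" where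
  "point_module Q d x = operator_module (coord_space Q d) (coord_proj Q d) (arrow_map Q d x)"

definition rep_with_top ::
    "('v, 'a) pre_digraph \<Rightarrow> ('v \<Rightarrow> nat) \<Rightarrow> ('v \<Rightarrow> nat) \<Rightarrow> ('a \<Rightarrow> 'k::field mat) set" where
  "rep_with_top Q t d = {x \<in> rep_variety Q d.
     modules_isomorphic (bound_algebra Q)
       (module_top (bound_algebra Q) (point_module Q d x)) (semisimple_module Q t)}"

text \<open>Polynomial functions in the matrix entries.\<close>

inductive_set polynomial_functions ::
    "('v, 'a) pre_digraph \<Rightarrow> ('v \<Rightarrow> nat) \<Rightarrow> (('a \<Rightarrow> 'k::field mat) \<Rightarrow> 'k) set"
  for Q :: "('v, 'a) pre_digraph" and d :: "'v \<Rightarrow> nat" where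
  const: "(\<lambda>x. c) \<in> polynomial_functions Q d"
| coord: "\<lbrakk>\<alpha> \<in> arcs Q; i < d (head Q \<alpha>); j < d (tail Q \<alpha>)\<rbrakk> \<Longrightarrow>
    (\<lambda>x. x \<alpha> $$ (i, j)) \<in> polynomial_functions Q d"
| add: "\<lbrakk>f \<in> polynomial_functions Q d; g \<in> polynomial_functions Q d\<rbrakk> \<Longrightarrow>
    (\<lambda>x. f x + g x) \<in> polynomial_functions Q d"
| mult: "\<lbrakk>f \<in> polynomial_functions Q d; g \<in> polynomial_functions Q d\<rbrakk> \<Longrightarrow>
    (\<lambda>x. f x * g x) \<in> polynomial_functions Q d"

definition zariski_closed ::
    "('v, 'a) pre_digraph \<Rightarrow> ('v \<Rightarrow> nat) \<Rightarrow> ('a \<Rightarrow> 'k::field mat) set \<Rightarrow> bool" where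
  "zariski_closed Q d Z \<longleftrightarrow>
     (\<exists>F \<subseteq> polynomial_functions Q d. Z = {x \<in> matrix_tuples Q d d. \<forall>f\<in>F. f x = 0})"

definition closure_in_rep ::
    "('v, 'a) pre_digraph \<Rightarrow> ('v \<Rightarrow> nat) \<Rightarrow> ('a \<Rightarrow> 'k::field mat) set \<Rightarrow> ('a \<Rightarrow> 'k mat) set" where
  "closure_in_rep Q d S = rep_variety Q d \<inter> \<Inter>{Z. zariski_closed Q d Z \<and> S \<subseteq> Z}"


section \<open>Isomorphism classes\<close>

text \<open>Isomorphism classes are formed among the modules with elements of type
  \<^typ>\<open>'v \<Rightarrow> 'k vec\<close>. Every module with a dimension vector is isomorphic to one of these, so
  two such modules, of whatever type, have the same class iff they are isomorphic.\<close>

definition iso_class ::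
    "('v, 'a) pre_digraph \<Rightarrow> (('v \<times> 'a list \<Rightarrow> 'k::field) set, 'm) module \<Rightarrow>
      (('v \<times> 'a list \<Rightarrow> 'k) set, 'v \<Rightarrow> 'k vec) module set" where
  "iso_class Q M = {N. left_module (bound_algebra Q) N \<and> modules_isomorphic (bound_algebra Q) M N}"

definition iso_classes ::
    "('v, 'a) pre_digraph \<Rightarrow> ('v \<Rightarrow> nat) \<Rightarrow>
      (('v \<times> 'a list \<Rightarrow> 'k::field) set, 'v \<Rightarrow> 'k vec) module set set" where
  "iso_classes Q d =
     iso_class Q ` {M :: (('v \<times> 'a list \<Rightarrow> 'k) set, 'v \<Rightarrow> 'k vec) module.
       left_module (bound_algebra Q) M \<and> has_dim_vector Q d M}"


section \<open>The map \<open>\<rho>\<close> on \<open>C(T, d)\<close> and the action of \<open>G(T)\<close>\<close>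

text \<open>The \<open>K\<close>-space of the one-dimensional module \<open>S\<^sub>i\<close> is identified with \<open>K\<close> through the
  basis vector \<open>e\<^sub>i + Je\<^sub>i\<close>, so \<open>T\<^sub>i = K^{t\<^sub>i}\<close> and \<open>R\<^sub>i = K^{d\<^sub>i - t\<^sub>i}\<close> as \<open>K\<close>-spaces.\<close>

abbreviation dim_R :: "('v \<Rightarrow> nat) \<Rightarrow> ('v \<Rightarrow> nat) \<Rightarrow> 'v \<Rightarrow> nat" where
  "dim_R t d \<equiv> (\<lambda>i. d i - t i)"

definition C_space ::
    "('v, 'a) pre_digraph \<Rightarrow> ('v \<Rightarrow> nat) \<Rightarrow> ('v \<Rightarrow> nat) \<Rightarrow> ('a \<Rightarrow> 'k::field mat) set" where
  "C_space Q t d = matrix_tuples Q t (dim_R t d)"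

definition sum_space :: "('k, 'm) module \<Rightarrow> ('k, 'n) module \<Rightarrow> ('k, 'm \<times> 'n) module" where
  "sum_space V W =
    \<lparr>carrier = carrier V \<times> carrier W, mult = undefined, one = undefined,
     zero = (\<zero>\<^bsub>V\<^esub>, \<zero>\<^bsub>W\<^esub>), add = (\<lambda>(v, w) (v', w'). (v \<oplus>\<^bsub>V\<^esub> v', w \<oplus>\<^bsub>W\<^esub> w')),
     smult = (\<lambda>c (v, w). (c \<odot>\<^bsub>V\<^esub> v, c \<odot>\<^bsub>W\<^esub> w))\<rparr>"

definition rho_module ::
    "('v, 'a) pre_digraph \<Rightarrow> ('v \<Rightarrow> nat) \<Rightarrow> ('v \<Rightarrow> nat) \<Rightarrow> ('a \<Rightarrow> 'k::field mat) \<Rightarrow>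
      (('v \<times> 'a list \<Rightarrow> 'k) set, ('v \<Rightarrow> 'k vec) \<times> ('v \<Rightarrow> 'k vec)) module" where
  "rho_module Q t d x =
     operator_module (sum_space (coord_space Q t) (coord_space Q (dim_R t d)))
       (\<lambda>i (v, w). (coord_proj Q t i v, coord_proj Q (dim_R t d) i w))
       (\<lambda>\<alpha> (v, w). (\<zero>\<^bsub>coord_space Q t\<^esub>, arrow_map Q (dim_R t d) x \<alpha> v))"

definition rho ::
    "('v, 'a) pre_digraph \<Rightarrow> ('v \<Rightarrow> nat) \<Rightarrow> ('v \<Rightarrow> nat) \<Rightarrow> ('a \<Rightarrow> 'k::field mat) \<Rightarrow>
      (('v \<times> 'a list \<Rightarrow> 'k) set, 'v \<Rightarrow> 'k vec) module set" where
  "rho Q t d x = iso_class Q (rho_module Q t d x)"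

definition GL :: "nat \<Rightarrow> 'k::field mat monoid" where
  "GL n = units_of (ring_mat TYPE('k) n ())"

definition G_group ::
    "('v, 'a) pre_digraph \<Rightarrow> ('v \<Rightarrow> nat) \<Rightarrow> ('v \<Rightarrow> nat) \<Rightarrow>
      (('v \<Rightarrow> 'k::field mat) \<times> ('v \<Rightarrow> 'k mat)) monoid" where
  "G_group Q t d =
     product_group (verts Q) (\<lambda>i. GL (t i)) \<times>\<times> product_group (verts Q) (\<lambda>i. GL (dim_R t d i))"

definition G_action ::
    "('v, 'a) pre_digraph \<Rightarrow> ('v \<Rightarrow> nat) \<Rightarrow> ('v \<Rightarrow> 'k::field mat) \<times> ('v \<Rightarrow> 'k mat) \<Rightarrow>
      ('a \<Rightarrow> 'k mat) \<Rightarrow> ('a \<Rightarrow> 'k mat)" where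
  "G_action Q t = (\<lambda>(g, h) x. \<lambda>\<alpha>\<in>arcs Q.
     h (head Q \<alpha>) * x \<alpha> * inv\<^bsub>GL (t (tail Q \<alpha>))\<^esub> g (tail Q \<alpha>))"

end

(* With J^2 = 0, a point x of the representation variety is a tuple of matrices with x_b x_a = 0 for
   composable arrows. Let U_i be the sum of the images of the x_a with a ending in i, and K_i the
   common kernel of the x_a with a starting in i; then U_i is contained in K_i, and the top of x is T
   iff dim U_i = d_i - t_i for all i. The module of x is rho of some element of C(T,d) iff
   dim U_i <= d_i - t_i <= dim K_i for all i: choose a subspace of dimension d_i - t_i between U_i and
   K_i as R_i. By semicontinuity of rank both inequalities persist on the closure of Rep^T_d.
   Conversely, join a point of C(T,d) to a point of C(T,d) with top T by a line; the rank condition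
   defining Rep^T_d is the nonvanishing of finitely many polynomials in the parameter, so it holds at
   infinitely many points of the line, and every polynomial vanishing on Rep^T_d vanishes on the line.
   For the fibres, a module isomorphism induces bijections between the U_i and between the quotients
   M_i/K_i, and any extensions of these to automorphisms of R_i and T_i give an element of G(T). *)

theory Submission
  imports Defs
begin


section \<open>Subspaces of \<open>K\<^sup>n\<close> in adapted coordinates\<close>

text \<open>Two encodings shape the proof. Dimension is replaced by an invertible matrix that moves
  a subspace onto the last \<open>k\<close> coordinates. The T part of each \<open>K^(d i)\<close>
  comes first and the R part last, so choosing R_i means choosing a base change, and semicontinuity
  becomes the nonvanishing of explicit determinants. An element of the algebra is replaced by its
  coordinates \<open>ev\<close> at vertices and \<open>ar\<close> at arrows, since the ideal
  consists of all elements supported on paths of length at least 2; the arbitrary representative in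
  the definition of the action then disappears. T, given as a sum of quotients of left ideals,
  becomes the point module of the zero representation, so that comparing it with a top is a question
  about matrices. The obstacle for the fibres is that an isomorphism need not respect the
  decomposition into T and R, because R_i is merely some subspace between U_i and K_i. Its diagonal
  blocks may be singular, and have to be repaired outside the subspaces on which they matter.
  Algebraic closedness supplies the infinitely many points of the line.\<close>

definition vec_subspace :: "nat \<Rightarrow> 'k::field vec set \<Rightarrow> bool" where
  "vec_subspace n W \<longleftrightarrow> W \<subseteq> carrier_vec n \<and> 0\<^sub>v n \<in> W \<and>
     (\<forall>u\<in>W. \<forall>v\<in>W. u + v \<in> W) \<and> (\<forall>c. \<forall>v\<in>W. c \<cdot>\<^sub>v v \<in> W)"

text \<open>The block convention puts T before R, so for \<open>n = d i\<close> and
  \<open>k = d i - t i\<close> these vectors form the summand R_i.\<close>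

definition last_coords :: "nat \<Rightarrow> nat \<Rightarrow> 'k::field vec set" where
  "last_coords n k = {v \<in> carrier_vec n. \<forall>i<n-k. v $ i = 0}"

definition inverse_mats :: "nat \<Rightarrow> 'k::field mat \<Rightarrow> 'k mat \<Rightarrow> bool" where
  "inverse_mats n P P' \<longleftrightarrow>
     P \<in> carrier_mat n n \<and> P' \<in> carrier_mat n n \<and> P * P' = 1\<^sub>m n \<and> P' * P = 1\<^sub>m n"

text \<open>This expresses that \<open>W\<close> has dimension \<open>k\<close> and keeps a base
  change that proves it: \<open>P\<close> carries \<open>W\<close> onto the last \<open>k\<close>
  coordinates. Subspaces that share \<open>P\<close> form a flag.\<close>

definition adapted :: "nat \<Rightarrow> 'k::field vec set \<Rightarrow> nat \<Rightarrow> 'k mat \<Rightarrow> 'k mat \<Rightarrow> bool" where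
  "adapted n W k P P' \<longleftrightarrow> k \<le> n \<and> inverse_mats n P P' \<and>
     (\<forall>v\<in>carrier_vec n. v \<in> W \<longleftrightarrow> P *\<^sub>v v \<in> last_coords n k)"

lemma inverse_matsD:
  assumes "inverse_mats n P P'"
  shows "P \<in> carrier_mat n n" "P' \<in> carrier_mat n n" "P * P' = 1\<^sub>m n" "P' * P = 1\<^sub>m n"
  using assms by (auto simp: inverse_mats_def)

lemma inverse_mats_sym: "inverse_mats n P P' \<Longrightarrow> inverse_mats n P' P"
  by (auto simp: inverse_mats_def)

lemma inverse_mats_cancel:
  assumes "inverse_mats n P P'" "v \<in> carrier_vec n"
  shows "P' *\<^sub>v (P *\<^sub>v v) = v" "P *\<^sub>v (P' *\<^sub>v v) = v"
  using assms assoc_mult_mat_vec[of P' n n P n v] assoc_mult_mat_vec[of P n n P' n v]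
  by (auto simp: inverse_mats_def)

lemma inverse_mats_mult:
  assumes P: "inverse_mats n P P'" and R: "inverse_mats n R R'"
  shows "inverse_mats n (R * P) (P' * R')"
proof -
  note c = inverse_matsD[OF P] inverse_matsD[OF R]
  have "(R * P) * (P' * R') = R * ((P * P') * R')"
    using c(1,2,5,6) by (simp add: assoc_mult_mat[of _ n n _ n _ n])
  moreover have "(P' * R') * (R * P) = P' * ((R' * R) * P)"
    using c(1,2,5,6) by (simp add: assoc_mult_mat[of _ n n _ n _ n])
  ultimately show ?thesis using c by (simp add: inverse_mats_def)
qed

lemma inverse_mats_one: "inverse_mats n (1\<^sub>m n) (1\<^sub>m n)"
  by (simp add: inverse_mats_def)

lemma inverse_mats_of_inj:
  assumes A: "A \<in> carrier_mat n n"
    and inj: "\<And>v. v \<in> carrier_vec n \<Longrightarrow> A *\<^sub>v v = 0\<^sub>v n \<Longrightarrow> v = 0\<^sub>v n"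
  obtains A' where "inverse_mats n A A'"
proof -
  have "det A \<noteq> 0" using det_0_iff_vec_prod_zero_field[OF A] inj by blast
  from det_non_zero_imp_unit[OF A this, of "()"] obtain B
    where "B \<in> carrier_mat n n" "B * A = 1\<^sub>m n" "A * B = 1\<^sub>m n"
    unfolding Units_def ring_mat_def by auto
  with A that show thesis by (auto simp: inverse_mats_def)
qed

lemma inverse_mats_transpose:
  assumes "inverse_mats n P P'" shows "inverse_mats n (P\<^sup>T) (P'\<^sup>T)"
proof -
  note c = inverse_matsD[OF assms]
  have "P\<^sup>T * P'\<^sup>T = 1\<^sub>m n"
    unfolding transpose_mult[OF c(2,1), symmetric] c(4) by simp
  moreover have "P'\<^sup>T * P\<^sup>T = 1\<^sub>m n"
    unfolding transpose_mult[OF c(1,2), symmetric] c(3) by simp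
  ultimately show ?thesis using c(1,2) unfolding inverse_mats_def by simp
qed

text \<open>Padding with zero rows gives a square matrix whose last row vanishes because
  \<open>m < n\<close>; its transpose kills the last unit vector, so the determinant is 0. The
  dimension counts below rest on this fact.\<close>

lemma wide_mat_kernel:
  assumes A: "(A :: 'k::field mat) \<in> carrier_mat m n" and mn: "m < n"
  obtains v where "v \<in> carrier_vec n" "v \<noteq> 0\<^sub>v n" "A *\<^sub>v v = 0\<^sub>v m"
proof -
  define B where "B = mat n n (\<lambda>(i,j). if i < m then A $$ (i,j) else 0)"
  have B: "B \<in> carrier_mat n n" by (simp add: B_def)
  have "B\<^sup>T *\<^sub>v unit_vec n (n-1) = 0\<^sub>v n"
  proof (rule eq_vecI)
    fix i assume "i < dim_vec (0\<^sub>v n :: 'k vec)"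
    then show "(B\<^sup>T *\<^sub>v unit_vec n (n-1)) $ i = 0\<^sub>v n $ i"
      using mn by (auto simp: B_def scalar_prod_def unit_vec_def intro!: sum.neutral)
  qed (auto simp: B_def)
  moreover have "unit_vec n (n-1) \<noteq> (0\<^sub>v n :: 'k vec)" using mn by simp
  ultimately have "det (B\<^sup>T) = 0"
    using det_0_iff_vec_prod_zero_field[of "B\<^sup>T" n] B by (metis transpose_carrier_mat unit_vec_carrier)
  then have "det B = 0" using det_transpose[OF B] by simp
  then obtain v where v: "v \<in> carrier_vec n" "v \<noteq> 0\<^sub>v n" "B *\<^sub>v v = 0\<^sub>v n"
    using det_0_iff_vec_prod_zero_field[OF B] by auto
  have "A *\<^sub>v v = 0\<^sub>v m"
  proof (rule eq_vecI)
    fix i assume i: "i < dim_vec (0\<^sub>v m :: 'k vec)"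
    then have "(A *\<^sub>v v) $ i = (B *\<^sub>v v) $ i"
      using mn A v(1) by (auto simp: B_def scalar_prod_def intro!: sum.cong)
    then show "(A *\<^sub>v v) $ i = 0\<^sub>v m $ i" using i mn v(3) by simp
  qed (use A in auto)
  with v that show thesis by blast
qed

lemma last_coordsI: "v \<in> carrier_vec n \<Longrightarrow> (\<And>i. i < n - k \<Longrightarrow> v $ i = 0) \<Longrightarrow> v \<in> last_coords n k"
  by (auto simp: last_coords_def)

lemma last_coords_mono: "k \<le> l \<Longrightarrow> last_coords n k \<subseteq> last_coords n l"
  by (auto simp: last_coords_def)

lemma subspace_last_coords: "vec_subspace n (last_coords n k)"
  by (auto simp: vec_subspace_def last_coords_def)

lemma last_coords_n: "last_coords n n = carrier_vec n"
  by (auto simp: last_coords_def)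

lemma subspace_image:
  assumes W: "vec_subspace n W" and A: "A \<in> carrier_mat m n"
  shows "vec_subspace m ((*\<^sub>v) A ` W)"
  unfolding vec_subspace_def
proof (intro conjI ballI allI)
  have sub: "W \<subseteq> carrier_vec n" using W by (auto simp: vec_subspace_def)
  show "(*\<^sub>v) A ` W \<subseteq> carrier_vec m" using A sub by auto
  have "0\<^sub>v m = A *\<^sub>v 0\<^sub>v n" "0\<^sub>v n \<in> W" using A W by (auto simp: vec_subspace_def)
  then show "0\<^sub>v m \<in> (*\<^sub>v) A ` W" by (rule image_eqI)
  fix u assume "u \<in> (*\<^sub>v) A ` W"
  then obtain u' where u: "u' \<in> W" "u = A *\<^sub>v u'" by auto
  { fix v assume "v \<in> (*\<^sub>v) A ` W"
    then obtain v' where v: "v' \<in> W" "v = A *\<^sub>v v'" by auto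
    have "u + v = A *\<^sub>v (u' + v')"
      using u v mult_add_distrib_mat_vec[OF A subsetD[OF sub] subsetD[OF sub], of u' v'] by simp
    moreover have "u' + v' \<in> W" using u v W by (simp add: vec_subspace_def)
    ultimately show "u + v \<in> (*\<^sub>v) A ` W" by (rule image_eqI) }
  fix c
  have "c \<cdot>\<^sub>v u = A *\<^sub>v (c \<cdot>\<^sub>v u')" using u mult_mat_vec[OF A subsetD[OF sub], of u' c] by simp
  moreover have "c \<cdot>\<^sub>v u' \<in> W" using u W by (simp add: vec_subspace_def)
  ultimately show "c \<cdot>\<^sub>v u \<in> (*\<^sub>v) A ` W" by (rule image_eqI)
qed

lemma mult_mat_vec_sum:
  assumes A: "(A :: 'k::field mat) \<in> carrier_mat m n" and v: "v \<in> carrier_vec n" and i: "i < m"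
  shows "(A *\<^sub>v v) $ i = (\<Sum>j<n. A $$ (i,j) * v $ j)"
  using assms by (auto simp: scalar_prod_def row_def lessThan_atLeast0)

text \<open>A vector of \<open>W\<close> outside \<open>last_coords n k\<close> has, after subtraction of an element of
  \<open>last_coords n k\<close>, a pivot among the first \<open>n - k\<close> entries; exchanging it with the unit vector
  at position \<open>n - k - 1\<close> enlarges \<open>k\<close>.\<close>

lemma extend_last_coords_step:
  assumes W: "vec_subspace n (W :: 'k::field vec set)" and k: "last_coords n k \<subseteq> W" "k \<le> n"
    and ne: "W \<noteq> last_coords n k"
  obtains R R' where "k < n" "inverse_mats n R R'" "\<And>v. v \<in> last_coords n k \<Longrightarrow> R *\<^sub>v v = v"
    "last_coords n (Suc k) \<subseteq> (*\<^sub>v) R ` W"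
proof -
  from ne k obtain w where w: "w \<in> W" "w \<notin> last_coords n k" by blast
  have wc: "w \<in> carrier_vec n" using w W by (auto simp: vec_subspace_def)
  obtain p where p: "p < n - k" "w $ p \<noteq> 0" using w wc by (auto simp: last_coords_def)
  define l where "l = n - k - 1"
  have l: "l < n - k" "l < n" and nl: "n - Suc k = l" and pn: "p < n" using p by (auto simp: l_def)
  define S where "S = mat n n (\<lambda>(i,j). if j = l then w $ i
    else if j = p then (if i = l then 1 else 0) else (if i = j then 1 else 0))"
  have S: "S \<in> carrier_mat n n" by (simp add: S_def)
  have Sv: "(S *\<^sub>v v) $ i = v $ l * w $ i + (if i = l then (if p = l then 0 else v $ p)
      else if i = p then 0 else v $ i)" if v: "v \<in> carrier_vec n" and i: "i < n" for v i
  proof -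
    have "(S *\<^sub>v v) $ i = (\<Sum>j<n. S $$ (i,j) * v $ j)"
      using mult_mat_vec_sum[OF S v i] .
    also have "\<dots> = S $$ (i,l) * v $ l + (\<Sum>j\<in>{..<n}-{l}. S $$ (i,j) * v $ j)"
      using l by (simp add: sum.remove)
    \<comment> \<open>Off column \<open>l\<close> each row of \<open>S\<close> has at most one
      nonzero entry. For \<open>i = p\<close> there is none, which is encoded by naming the excluded
      index \<open>l\<close>; the same happens for \<open>i = l\<close> when
      \<open>p = l\<close>.\<close>
    also have "(\<Sum>j\<in>{..<n}-{l}. S $$ (i,j) * v $ j) = (\<Sum>j\<in>{..<n}-{l}.
        if j = (if i = l then p else if i = p then l else i) then v $ j else 0)"
      by (rule sum.cong) (use i l p in \<open>auto simp: S_def\<close>)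
    also have "\<dots> = (if i = l then (if p = l then 0 else v $ p) else if i = p then 0 else v $ i)"
      using i l p by (auto simp: sum.delta)
    finally show ?thesis using l i by (simp add: S_def mult.commute)
  qed
  have inj: "v = 0\<^sub>v n" if v: "v \<in> carrier_vec n" and 0: "S *\<^sub>v v = 0\<^sub>v n" for v
  proof -
    have z: "(S *\<^sub>v v) $ i = 0" if "i < n" for i using 0 that by simp
    have vl: "v $ l = 0" using z[OF pn] Sv[OF v pn] p(2) by (auto split: if_splits)
    have "v $ i = 0" if "i < n" for i
      using z[OF that] Sv[OF v that] z[OF l(2)] Sv[OF v l(2)] vl by (auto split: if_splits)
    then show ?thesis using v by (intro eq_vecI) auto
  qed
  obtain R where R: "inverse_mats n S R" using inverse_mats_of_inj[OF S inj] by metis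
  have fix_S: "S *\<^sub>v v = v" if v: "v \<in> last_coords n k" for v
  proof -
    have vc: "v \<in> carrier_vec n" and "v $ l = 0" "v $ p = 0"
      using v l p by (auto simp: last_coords_def)
    then show ?thesis using Sv[OF vc] S by (intro eq_vecI) (auto simp del: index_mult_mat_vec)
  qed
  have fix_R: "R *\<^sub>v v = v" if v: "v \<in> last_coords n k" for v
    using inverse_mats_cancel(1)[OF R, of v] fix_S[OF v] v by (auto simp: last_coords_def)
  have Sl: "S *\<^sub>v unit_vec n l = w"
    using wc S Sv[of "unit_vec n l"] l pn by (intro eq_vecI) (auto simp: unit_vec_def simp del: index_mult_mat_vec)
  have "v \<in> (*\<^sub>v) R ` W" if v: "v \<in> last_coords n (Suc k)" for v
  proof -
    have vc: "v \<in> carrier_vec n" using v by (auto simp: last_coords_def)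
    \<comment> \<open>Removing the entry at position \<open>l\<close> leaves a vector of
      \<open>last_coords n k\<close>, on which \<open>S\<close> is the identity; hence
      \<open>S v\<close> is that vector plus a multiple of \<open>w\<close>, both in
      \<open>W\<close>.\<close>
    define u where "u = v - v $ l \<cdot>\<^sub>v unit_vec n l"
    have u: "u \<in> last_coords n k"
    proof (rule last_coordsI)
      show "u \<in> carrier_vec n" using vc by (simp add: u_def)
      fix i assume i: "i < n - k"
      then have "i = l \<or> i < n - Suc k" unfolding l_def by linarith
      then show "u $ i = 0" using v i l by (auto simp: u_def last_coords_def unit_vec_def)
    qed
    have uc: "u \<in> carrier_vec n" using u by (auto simp: last_coords_def)
    have "v = u + v $ l \<cdot>\<^sub>v unit_vec n l" using vc by (intro eq_vecI) (auto simp: u_def)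
    then have "S *\<^sub>v v = S *\<^sub>v u + v $ l \<cdot>\<^sub>v (S *\<^sub>v unit_vec n l)"
      using mult_add_distrib_mat_vec[OF S uc, of "v $ l \<cdot>\<^sub>v unit_vec n l"]
        mult_mat_vec[OF S, of "unit_vec n l" "v $ l"] by simp
    also have "\<dots> = u + v $ l \<cdot>\<^sub>v w" using fix_S[OF u] Sl by simp
    finally have "S *\<^sub>v v \<in> W" using W w u k by (auto simp: vec_subspace_def)
    moreover have "v = R *\<^sub>v (S *\<^sub>v v)" using inverse_mats_cancel(1)[OF R vc] by simp
    ultimately show ?thesis by blast
  qed
  then have "last_coords n (Suc k) \<subseteq> (*\<^sub>v) R ` W" by blast
  moreover have "k < n" using p by simp
  ultimately show thesis using that[OF _ inverse_mats_sym[OF R] fix_R] by blast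
qed

text \<open>The exchange step is iterated until \<open>W\<close> is reached; each step lowers
  \<open>n - k\<close>. Fixing \<open>last_coords n k\<close> pointwise lets a second subspace be
  adapted without disturbing the first.\<close>

lemma extend_last_coords:
  assumes W: "vec_subspace n (W :: 'k::field vec set)" and k: "last_coords n k \<subseteq> W" "k \<le> n"
  shows "\<exists>R R' l. k \<le> l \<and> (\<forall>v\<in>last_coords n k. R *\<^sub>v v = v) \<and> adapted n W l R R'"
  using W k
proof (induction "n - k" arbitrary: k W rule: less_induct)
  case less
  show ?case
  proof (cases "W = last_coords n k")
    case True
    have "adapted n W k (1\<^sub>m n) (1\<^sub>m n)"
      using True less by (auto simp: adapted_def inverse_mats_one)
    moreover have "\<forall>v\<in>last_coords n k. 1\<^sub>m n *\<^sub>v v = v" by (auto simp: last_coords_def)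
    ultimately show ?thesis by blast
  next
    case False
    obtain R R' where R: "k < n" "inverse_mats n R R'"
        "\<And>v. v \<in> last_coords n k \<Longrightarrow> R *\<^sub>v v = v" "last_coords n (Suc k) \<subseteq> (*\<^sub>v) R ` W"
      using extend_last_coords_step[OF less.prems False] by blast
    have "vec_subspace n ((*\<^sub>v) R ` W)"
      using subspace_image[OF less.prems(1)] inverse_matsD(1)[OF R(2)] by blast
    then have "\<exists>S S' l. Suc k \<le> l \<and> (\<forall>v\<in>last_coords n (Suc k). S *\<^sub>v v = v) \<and>
        adapted n ((*\<^sub>v) R ` W) l S S'"
      using R(1,4) by (intro less.hyps) auto
    then obtain S S' l where S: "Suc k \<le> l" "\<forall>v\<in>last_coords n (Suc k). S *\<^sub>v v = v"
        "adapted n ((*\<^sub>v) R ` W) l S S'"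
      by blast
    have Sinv: "inverse_mats n S S'" using S by (auto simp: adapted_def)
    have sub: "W \<subseteq> carrier_vec n" using less.prems by (auto simp: vec_subspace_def)
    have "adapted n W l (S * R) (R' * S')"
      unfolding adapted_def
    proof (intro conjI ballI)
      show "l \<le> n" using S by (auto simp: adapted_def)
      show "inverse_mats n (S * R) (R' * S')" by (rule inverse_mats_mult[OF R(2) Sinv])
      fix v :: "'k vec" assume v: "v \<in> carrier_vec n"
      have Rv: "R *\<^sub>v v \<in> carrier_vec n" using v inverse_matsD(1)[OF R(2)] by auto
      have "v \<in> W \<longleftrightarrow> R *\<^sub>v v \<in> (*\<^sub>v) R ` W"
        using inverse_mats_cancel(1)[OF R(2)] v sub by (metis (no_types, lifting) imageE image_eqI subsetD)
      also have "\<dots> \<longleftrightarrow> S *\<^sub>v (R *\<^sub>v v) \<in> last_coords n l"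
        using S(3) Rv by (auto simp: adapted_def)
      also have "S *\<^sub>v (R *\<^sub>v v) = (S * R) *\<^sub>v v"
        using v inverse_matsD(1)[OF R(2)] inverse_matsD(1)[OF Sinv] by simp
      finally show "v \<in> W \<longleftrightarrow> (S * R) *\<^sub>v v \<in> last_coords n l" .
    qed
    moreover have "(S * R) *\<^sub>v v = v" if v: "v \<in> last_coords n k" for v
    proof -
      have "v \<in> carrier_vec n" using v by (auto simp: last_coords_def)
      then have "(S * R) *\<^sub>v v = S *\<^sub>v (R *\<^sub>v v)"
        using inverse_matsD(1)[OF R(2)] inverse_matsD(1)[OF Sinv] by simp
      then show ?thesis using R(3)[OF v] S(2) v last_coords_mono[of k "Suc k" n] by auto
    qed
    ultimately show ?thesis using S(1) Suc_leD by blast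
  qed
qed

lemma adapted_exists:
  assumes "vec_subspace n (W :: 'k::field vec set)"
  obtains k P P' where "adapted n W k P P'"
proof -
  have "v = 0\<^sub>v n" if "v \<in> last_coords n 0" for v :: "'k vec"
    using that by (intro eq_vecI) (auto simp: last_coords_def)
  then have "last_coords n 0 \<subseteq> W" using assms by (auto simp: vec_subspace_def)
  from extend_last_coords[OF assms this] that show thesis by blast
qed

text \<open>\<open>U\<close> is straightened first, and then the image of \<open>W\<close> by a
  matrix \<open>R\<close> that fixes the straightened \<open>U\<close> pointwise, so the product
  \<open>R * P\<close> serves both. A subspace of any dimension in between is then available as some
  \<open>last_coords\<close>.\<close>

lemma adapted_flag_exists:
  assumes U: "vec_subspace n (U :: 'k::field vec set)" and W: "vec_subspace n W" and UW: "U \<subseteq> W"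
  obtains a b P P' where "adapted n U a P P'" "adapted n W b P P'"
proof -
  obtain a P P' where P: "adapted n U a P P'" using adapted_exists[OF U] by blast
  have Pinv: "inverse_mats n P P'" and an: "a \<le> n" using P by (auto simp: adapted_def)
  note Pc = inverse_matsD[OF Pinv]
  have W': "vec_subspace n ((*\<^sub>v) P ` W)" using subspace_image[OF W Pc(1)] .
  have "v \<in> (*\<^sub>v) P ` W" if v: "v \<in> last_coords n a" for v
  proof -
    have vc: "v \<in> carrier_vec n" using v by (auto simp: last_coords_def)
    then have "P' *\<^sub>v v \<in> carrier_vec n" using Pc by auto
    moreover have "P *\<^sub>v (P' *\<^sub>v v) = v" using inverse_mats_cancel(2)[OF Pinv vc] .
    ultimately have "P' *\<^sub>v v \<in> U" using P v by (auto simp: adapted_def)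
    then show ?thesis using UW \<open>P *\<^sub>v (P' *\<^sub>v v) = v\<close> by (metis image_eqI subsetD)
  qed
  then obtain R R' b where R: "\<forall>v\<in>last_coords n a. R *\<^sub>v v = v" "adapted n ((*\<^sub>v) P ` W) b R R'"
    using extend_last_coords[OF W' _ an] by blast
  have Rinv: "inverse_mats n R R'" using R by (auto simp: adapted_def)
  note Rc = inverse_matsD[OF Rinv]
  have comp: "(R * P) *\<^sub>v v = R *\<^sub>v (P *\<^sub>v v)" if "v \<in> carrier_vec n" for v using that Pc Rc by simp
  have Wc: "W \<subseteq> carrier_vec n" using W by (auto simp: vec_subspace_def)
  have "adapted n U a (R * P) (P' * R')"
    unfolding adapted_def
  proof (intro conjI ballI an inverse_mats_mult[OF Pinv Rinv])
    fix v :: "'k vec" assume v: "v \<in> carrier_vec n"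
    have Pv: "P *\<^sub>v v \<in> carrier_vec n" using v Pc by auto
    have "R *\<^sub>v (P *\<^sub>v v) \<in> last_coords n a \<longleftrightarrow> P *\<^sub>v v \<in> last_coords n a"
    proof
      \<comment> \<open>A vector outside \<open>last_coords n a\<close> cannot be moved into it:
        \<open>R\<close> fixes \<open>R (P v)\<close>, and injectivity gives
        \<open>R (P v) = P v\<close>.\<close>
      assume *: "R *\<^sub>v (P *\<^sub>v v) \<in> last_coords n a"
      then have "R *\<^sub>v (R *\<^sub>v (P *\<^sub>v v)) = R *\<^sub>v (P *\<^sub>v v)" using R(1) by auto
      then have "R *\<^sub>v (P *\<^sub>v v) = P *\<^sub>v v"
        using inverse_mats_cancel(1)[OF Rinv] Pv Rc by (metis mult_mat_vec_carrier)
      with * show "P *\<^sub>v v \<in> last_coords n a" by simp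
    next
      assume *: "P *\<^sub>v v \<in> last_coords n a"
      then show "R *\<^sub>v (P *\<^sub>v v) \<in> last_coords n a" using R(1) by auto
    qed
    then show "v \<in> U \<longleftrightarrow> (R * P) *\<^sub>v v \<in> last_coords n a"
      using P v comp by (auto simp: adapted_def)
  qed
  moreover have "adapted n W b (R * P) (P' * R')"
    unfolding adapted_def
  proof (intro conjI ballI inverse_mats_mult[OF Pinv Rinv])
    show "b \<le> n" using R by (auto simp: adapted_def)
    fix v :: "'k vec" assume v: "v \<in> carrier_vec n"
    have Pv: "P *\<^sub>v v \<in> carrier_vec n" using v Pc by auto
    have "v \<in> W \<longleftrightarrow> P *\<^sub>v v \<in> (*\<^sub>v) P ` W"
      using inverse_mats_cancel(1)[OF Pinv] v Wc by (metis (no_types, lifting) imageE image_eqI subsetD)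
    also have "\<dots> \<longleftrightarrow> R *\<^sub>v (P *\<^sub>v v) \<in> last_coords n b" using R(2) Pv by (auto simp: adapted_def)
    finally show "v \<in> W \<longleftrightarrow> (R * P) *\<^sub>v v \<in> last_coords n b" using comp v by simp
  qed
  ultimately show thesis using that by blast
qed


section \<open>Comparison of dimensions, linear forms, and extension of injections\<close>

lemma mult_mat_zero_vec: "(A :: 'k::field mat) \<in> carrier_mat m n \<Longrightarrow> A *\<^sub>v 0\<^sub>v n = 0\<^sub>v m"
  by (intro eq_vecI) auto

lemma inverse_mats_inj:
  "inverse_mats n P P' \<Longrightarrow> v \<in> carrier_vec n \<Longrightarrow> P *\<^sub>v v = 0\<^sub>v n \<Longrightarrow> v = 0\<^sub>v n"
  using inverse_mats_cancel(1)[of n P P' v] mult_mat_zero_vec[of P' n n] by (simp add: inverse_mats_def)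

text \<open>If \<open>k > l\<close>, the lower right \<open>l\<close> by \<open>k\<close> block of
  \<open>M\<close> has a nonzero kernel vector. Padded with leading zeros it is killed by all of
  \<open>M\<close>, since by \<open>maps\<close> the upper rows vanish on
  \<open>last_coords n k\<close>.\<close>

lemma last_coords_inj_le:
  assumes M: "(M :: 'k::field mat) \<in> carrier_mat m n" and k: "k \<le> n" and l: "l \<le> m"
    and maps: "\<And>v. v \<in> last_coords n k \<Longrightarrow> M *\<^sub>v v \<in> last_coords m l"
    and inj: "\<And>v. v \<in> last_coords n k \<Longrightarrow> M *\<^sub>v v = 0\<^sub>v m \<Longrightarrow> v = 0\<^sub>v n"
  shows "k \<le> l"
proof (rule ccontr)
  assume "\<not> k \<le> l"
  define B where "B = mat l k (\<lambda>(i,j). M $$ (m - l + i, n - k + j))"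
  obtain c where c: "c \<in> carrier_vec k" "c \<noteq> 0\<^sub>v k" "B *\<^sub>v c = 0\<^sub>v l"
    using wide_mat_kernel[of B l k] \<open>\<not> k \<le> l\<close> by (auto simp: B_def)
  define v where "v = vec n (\<lambda>j. if j < n - k then 0 else c $ (j - (n - k)))"
  have v: "v \<in> last_coords n k" by (auto simp: v_def last_coords_def)
  have vc: "v \<in> carrier_vec n" by (simp add: v_def)
  have "M *\<^sub>v v = 0\<^sub>v m"
  proof (rule eq_vecI)
    fix i assume "i < dim_vec (0\<^sub>v m :: 'k vec)"
    then have i: "i < m" by simp
    show "(M *\<^sub>v v) $ i = 0\<^sub>v m $ i"
    proof (cases "i < m - l")
      case True
      then show ?thesis using maps[OF v] i by (auto simp: last_coords_def simp del: index_mult_mat_vec)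
    next
      case False
      have "(M *\<^sub>v v) $ i = (\<Sum>j<n. M $$ (i,j) * v $ j)"
        by (rule mult_mat_vec_sum[OF M vc i])
      also have "\<dots> = (\<Sum>j\<in>{n-k..<n}. M $$ (i,j) * v $ j)"
        by (rule sum.mono_neutral_right) (auto simp: v_def)
      also have "\<dots> = (\<Sum>j<k. M $$ (i, n - k + j) * c $ j)"
        by (rule sum.reindex_bij_witness[of _ "\<lambda>j. n - k + j" "\<lambda>j. j - (n - k)"])
          (use k in \<open>auto simp: v_def\<close>)
      also have "\<dots> = (B *\<^sub>v c) $ (i - (m - l))"
        using mult_mat_vec_sum[of B l k c "i - (m - l)"] False i l c(1)
        by (auto simp: B_def)
      finally show ?thesis using c(3) False i l by simp
    qed
  qed (use M in auto)
  then have v0: "v = 0\<^sub>v n" using inj[OF v] by simp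
  have "c = 0\<^sub>v k"
  proof (rule eq_vecI)
    fix j assume "j < dim_vec (0\<^sub>v k :: 'k vec)"
    then have "c $ j = v $ (n - k + j)" "n - k + j < n" "j < k" using k by (auto simp: v_def)
    then show "c $ j = 0\<^sub>v k $ j" using v0 by simp
  qed (use c in auto)
  with c(2) show False by simp
qed

lemma adapted_inverse:
  assumes P: "adapted n W k P P'" and v: "v \<in> last_coords n k"
  shows "P' *\<^sub>v v \<in> W"
proof -
  have "v \<in> carrier_vec n" using v by (auto simp: last_coords_def)
  then show ?thesis
    using P v inverse_mats_cancel(2)[of n P P' v] inverse_matsD(2)[of n P P'] by (auto simp: adapted_def)
qed

text \<open>The base change \<open>R * P'\<close> maps \<open>last_coords n k\<close> injectively
  into \<open>last_coords n l\<close>. With \<open>V = W\<close> this shows that the dimension in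
  \<open>adapted\<close> is unique.\<close>

lemma adapted_mono:
  assumes P: "adapted n W k P P'" and R: "adapted n V l R R'" and WV: "W \<subseteq> V"
  shows "k \<le> l"
proof -
  have Pinv: "inverse_mats n P P'" and Rinv: "inverse_mats n R R'" and kl: "k \<le> n" "l \<le> n"
    using P R by (auto simp: adapted_def)
  note c = inverse_matsD[OF Pinv] inverse_matsD[OF Rinv]
  have RP: "inverse_mats n (R * P') (P * R')"
    by (rule inverse_mats_mult[OF inverse_mats_sym[OF Pinv] Rinv])
  show ?thesis
  proof (rule last_coords_inj_le[OF inverse_matsD(1)[OF RP] kl])
    fix v :: "'a vec" assume v: "v \<in> last_coords n k"
    then have vc: "v \<in> carrier_vec n" by (auto simp: last_coords_def)
    then have "(R * P') *\<^sub>v v = R *\<^sub>v (P' *\<^sub>v v)" using c by simp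
    moreover have "P' *\<^sub>v v \<in> V" using adapted_inverse[OF P v] WV by blast
    ultimately show "(R * P') *\<^sub>v v \<in> last_coords n l" using R c vc by (auto simp: adapted_def)
    assume "(R * P') *\<^sub>v v = 0\<^sub>v n"
    then show "v = 0\<^sub>v n" by (rule inverse_mats_inj[OF RP vc])
  qed
qed

lemma adapted_last_coords: "k \<le> n \<Longrightarrow> adapted n (last_coords n k) k (1\<^sub>m n) (1\<^sub>m n)"
  by (auto simp: adapted_def inverse_mats_one)

text \<open>If \<open>W\<close> is proper, then \<open>k < n\<close>, so the first row of an
  adapting matrix is a linear form that vanishes on \<open>W\<close>; it is nonzero because the
  matrix is invertible.\<close>

lemma proper_subspace_annihilated:
  assumes W: "vec_subspace n (W :: 'k::field vec set)" and ne: "W \<noteq> carrier_vec n"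
  obtains p where "p \<in> carrier_vec n" "p \<noteq> 0\<^sub>v n" "\<And>w. w \<in> W \<Longrightarrow> p \<bullet> w = 0"
proof -
  obtain k P P' where P: "adapted n W k P P'" using adapted_exists[OF W] by blast
  have Pinv: "inverse_mats n P P'" using P by (auto simp: adapted_def)
  note c = inverse_matsD[OF Pinv]
  have Wc: "W \<subseteq> carrier_vec n" using W by (auto simp: vec_subspace_def)
  have "k \<noteq> n"
  proof
    assume "k = n"
    then have "v \<in> W" if "v \<in> carrier_vec n" for v
      using P that c by (auto simp: adapted_def last_coords_n)
    with ne Wc show False by blast
  qed
  then have k: "0 < n - k" "0 < n" using P by (auto simp: adapted_def)
  show thesis
  proof (rule that)
    show "row P 0 \<in> carrier_vec n" using c k by auto
    show "row P 0 \<bullet> w = 0" if "w \<in> W" for w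
    proof -
      have "P *\<^sub>v w \<in> last_coords n k" using P that Wc by (auto simp: adapted_def)
      then have "(P *\<^sub>v w) $ 0 = 0" using k by (auto simp: last_coords_def)
      then show ?thesis using c k by simp
    qed
    show "row P 0 \<noteq> 0\<^sub>v n"
    proof
      assume 0: "row P 0 = 0\<^sub>v n"
      have "(P * P') $$ (0,0) = row P 0 \<bullet> col P' 0" using c(1,2) k by simp
      also have "\<dots> = 0" unfolding 0 by (rule scalar_prod_left_zero[OF col_carrier_vec[OF k(2) c(2)]])
      finally show False using c(3) k by simp
    qed
  qed
qed

lemma linear_map_mat:
  fixes L :: "'k::field vec \<Rightarrow> 'k vec"
  assumes closed: "\<And>v. v \<in> carrier_vec n \<Longrightarrow> L v \<in> carrier_vec m"
    and add: "\<And>u v. u \<in> carrier_vec n \<Longrightarrow> v \<in> carrier_vec n \<Longrightarrow> L (u + v) = L u + L v"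
    and smult: "\<And>c v. v \<in> carrier_vec n \<Longrightarrow> L (c \<cdot>\<^sub>v v) = c \<cdot>\<^sub>v L v"
  obtains F where "F \<in> carrier_mat m n" "\<And>v. v \<in> carrier_vec n \<Longrightarrow> L v = F *\<^sub>v v"
proof -
  define F where "F = mat m n (\<lambda>(i,j). L (unit_vec n j) $ i)"
  have F: "F \<in> carrier_mat m n" by (simp add: F_def)
  \<comment> \<open>Truncations add one coordinate at a time, so that additivity of \<open>L\<close>
    is applied to two summands in each step.\<close>
  define tr where "tr k v = vec n (\<lambda>j. if j < k then v $ j else 0)" for k and v :: "'k vec"
  have tr: "tr k v \<in> carrier_vec n" for k v by (simp add: tr_def)
  have L0: "L (0\<^sub>v n) = 0\<^sub>v m"
  proof -
    have "L (0 \<cdot>\<^sub>v 0\<^sub>v n) = 0 \<cdot>\<^sub>v L (0\<^sub>v n)" by (rule smult) simp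
    moreover have "0 \<cdot>\<^sub>v 0\<^sub>v n = (0\<^sub>v n :: 'k vec)" by (intro eq_vecI) auto
    moreover have "0 \<cdot>\<^sub>v L (0\<^sub>v n) = 0\<^sub>v m" using closed[of "0\<^sub>v n"] by (intro eq_vecI) auto
    ultimately show ?thesis by simp
  qed
  have L: "L (tr k v) $ i = (\<Sum>j<k. F $$ (i,j) * v $ j)" if "k \<le> n" "v \<in> carrier_vec n" "i < m" for k v i
    using that
  proof (induction k)
    case 0
    have "tr 0 v = 0\<^sub>v n" by (auto simp: tr_def)
    then show ?case using L0 0 by simp
  next
    case (Suc k)
    have "tr (Suc k) v = tr k v + v $ k \<cdot>\<^sub>v unit_vec n k"
      using Suc.prems by (intro eq_vecI) (auto simp: tr_def unit_vec_def less_Suc_eq)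
    then have "L (tr (Suc k) v) = L (tr k v) + v $ k \<cdot>\<^sub>v L (unit_vec n k)"
      using add[OF tr, of "v $ k \<cdot>\<^sub>v unit_vec n k" k v] smult[of "unit_vec n k" "v $ k"] by simp
    then show ?case
      using Suc closed[OF tr, of k v] closed[of "unit_vec n k"] by (auto simp: F_def mult.commute)
  qed
  have "L v = F *\<^sub>v v" if v: "v \<in> carrier_vec n" for v
  proof (rule eq_vecI)
    fix i assume "i < dim_vec (F *\<^sub>v v)"
    then have i: "i < m" using F by simp
    have "tr n v = v" using v by (intro eq_vecI) (auto simp: tr_def)
    then show "L v $ i = (F *\<^sub>v v) $ i"
      using L[OF order_refl v i] mult_mat_vec_sum[OF F v i] by simp
  qed (use closed[OF v] F in auto)
  with F that show thesis by blast
qed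

text \<open>In coordinates adapted to \<open>U\<close> and to its image, \<open>D\<close> becomes a
  matrix \<open>M\<close> that maps the last \<open>a\<close> coordinates injectively into the last
  \<open>b\<close>. Once \<open>b \<le> a\<close> is known, the identity on the first
  \<open>n - a\<close> coordinates together with \<open>M\<close> on the last \<open>a\<close> is
  block triangular and invertible.\<close>

lemma extend_injection_to_invertible:
  assumes D: "(D :: 'k::field mat) \<in> carrier_mat n n" and U: "vec_subspace n U"
    and inj: "\<And>u. u \<in> U \<Longrightarrow> D *\<^sub>v u = 0\<^sub>v n \<Longrightarrow> u = 0\<^sub>v n"
  obtains H H' where "inverse_mats n H H'" "\<And>u. u \<in> U \<Longrightarrow> H *\<^sub>v u = D *\<^sub>v u"
proof -
  obtain a P P' where P: "adapted n U a P P'" using adapted_exists[OF U] by blast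
  obtain b R R' where R: "adapted n ((*\<^sub>v) D ` U) b R R'"
    using adapted_exists[OF subspace_image[OF U D]] by blast
  have Pinv: "inverse_mats n P P'" and Rinv: "inverse_mats n R R'" and ab: "a \<le> n" "b \<le> n"
    using P R by (auto simp: adapted_def)
  note c = inverse_matsD[OF Pinv] inverse_matsD[OF Rinv]
  have Uc: "U \<subseteq> carrier_vec n" using U by (auto simp: vec_subspace_def)
  define M where "M = R * D * P'"
  have M: "M \<in> carrier_mat n n" using c D by (simp add: M_def)
  have Mv: "M *\<^sub>v v = R *\<^sub>v (D *\<^sub>v (P' *\<^sub>v v))" if "v \<in> carrier_vec n" for v
    using that c D by (simp add: M_def assoc_mult_mat_vec[of _ n n _ n])
  have lc: "v \<in> carrier_vec n" if "v \<in> last_coords n k" for k and v :: "'k vec"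
    using that by (auto simp: last_coords_def)
  have M_maps: "M *\<^sub>v v \<in> last_coords n b" if v: "v \<in> last_coords n a" for v
  proof -
    have "D *\<^sub>v (P' *\<^sub>v v) \<in> (*\<^sub>v) D ` U" using adapted_inverse[OF P v] by blast
    then show ?thesis using R Mv[OF lc[OF v]] D c lc[OF v] by (auto simp: adapted_def)
  qed
  have M_inj: "v = 0\<^sub>v n" if v: "v \<in> last_coords n a" and 0: "M *\<^sub>v v = 0\<^sub>v n" for v
  proof -
    have P'v: "P' *\<^sub>v v \<in> U" "P' *\<^sub>v v \<in> carrier_vec n" using adapted_inverse[OF P v] Uc by auto
    have "D *\<^sub>v (P' *\<^sub>v v) = R' *\<^sub>v 0\<^sub>v n"
      using inverse_mats_cancel(1)[OF Rinv, of "D *\<^sub>v (P' *\<^sub>v v)"] 0 Mv[OF lc[OF v]] D P'v by simp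
    then have "P' *\<^sub>v v = 0\<^sub>v n" using inj[OF P'v(1)] mult_mat_zero_vec[OF c(6)] by simp
    then show ?thesis by (rule inverse_mats_inj[OF inverse_mats_sym[OF Pinv] lc[OF v]])
  qed
  \<comment> \<open>Preimages in \<open>U\<close> of the basis vectors of the image. Their
    coordinates form the columns of \<open>N\<close>, a right inverse of \<open>M\<close> on
    \<open>last_coords n b\<close>; this yields \<open>b \<le> a\<close>.\<close>
  have "\<forall>j. \<exists>u. j < n \<longrightarrow> n - b \<le> j \<longrightarrow> u \<in> U \<and> R *\<^sub>v (D *\<^sub>v u) = unit_vec n j"
  proof (intro allI)
    fix j
    show "\<exists>u. j < n \<longrightarrow> n - b \<le> j \<longrightarrow> u \<in> U \<and> R *\<^sub>v (D *\<^sub>v u) = unit_vec n j"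
    proof (cases "j < n \<and> n - b \<le> j")
      case True
      then have "unit_vec n j \<in> (last_coords n b :: 'k vec set)"
        by (auto simp: last_coords_def unit_vec_def)
      then have "R' *\<^sub>v unit_vec n j \<in> (*\<^sub>v) D ` U" by (rule adapted_inverse[OF R])
      then obtain u where u: "u \<in> U" "R' *\<^sub>v unit_vec n j = D *\<^sub>v u" by auto
      then have "R *\<^sub>v (D *\<^sub>v u) = unit_vec n j"
        using inverse_mats_cancel(2)[OF Rinv, of "unit_vec n j"] by simp
      with u show ?thesis by blast
    qed auto
  qed
  then obtain u where u: "\<And>j. j < n \<Longrightarrow> n - b \<le> j \<Longrightarrow> u j \<in> U \<and> R *\<^sub>v (D *\<^sub>v u j) = unit_vec n j"
    by metis
  define N where "N = mat n n (\<lambda>(i,j). if j < n - b then 0 else (P *\<^sub>v u j) $ i)"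
  have N: "N \<in> carrier_mat n n" by (simp add: N_def)
  have Pu: "P *\<^sub>v u j \<in> last_coords n a" if "j < n" "n - b \<le> j" for j
    using P u[OF that] Uc by (auto simp: adapted_def)
  have colN: "col N j = (if j < n - b then 0\<^sub>v n else P *\<^sub>v u j)" if "j < n" for j
    using that c Uc by (intro eq_vecI) (auto simp: N_def simp del: index_mult_mat_vec)
  have MN: "(M * N) $$ (i,j) = (if j < n - b then 0 else 1\<^sub>m n $$ (i,j))" if ij: "i < n" "j < n" for i j
  proof -
    have "(M * N) $$ (i,j) = (M *\<^sub>v col N j) $ i" using M N ij by simp
    also have "\<dots> = (if j < n - b then 0 else 1\<^sub>m n $$ (i,j))"
    proof (cases "j < n - b")
      case True then show ?thesis using colN[OF ij(2)] M ij by auto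
    next
      case False
      then have uj: "u j \<in> U" "R *\<^sub>v (D *\<^sub>v u j) = unit_vec n j" using u[OF ij(2)] by auto
      have "M *\<^sub>v (P *\<^sub>v u j) = unit_vec n j"
        using Mv[of "P *\<^sub>v u j"] inverse_mats_cancel(1)[OF Pinv, of "u j"] uj Uc c by auto
      then show ?thesis using colN[OF ij(2)] False ij by (auto simp: unit_vec_def simp del: index_mult_mat_vec)
    qed
    finally show ?thesis .
  qed
  have "b \<le> a"
  proof (rule last_coords_inj_le[OF N ab(2,1)])
    fix v :: "'k vec" assume v: "v \<in> last_coords n b"
    show "N *\<^sub>v v \<in> last_coords n a"
    proof (rule last_coordsI)
      show "N *\<^sub>v v \<in> carrier_vec n" using N lc[OF v] by auto
      fix i assume i: "i < n - a"
      have "(N *\<^sub>v v) $ i = (\<Sum>j<n. N $$ (i,j) * v $ j)"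
        using mult_mat_vec_sum[OF N lc[OF v]] i by simp
      also have "\<dots> = 0"
      proof (rule sum.neutral, rule ballI)
        fix j assume "j \<in> {..<n}"
        then show "N $$ (i,j) * v $ j = 0"
          using Pu[of j] i by (auto simp: N_def last_coords_def simp del: index_mult_mat_vec)
      qed
      finally show "(N *\<^sub>v v) $ i = 0" .
    qed
    assume 0: "N *\<^sub>v v = 0\<^sub>v n"
    have "v = (M * N) *\<^sub>v v"
    proof (rule eq_vecI)
      fix i assume "i < dim_vec ((M * N) *\<^sub>v v)"
      then have i: "i < n" using M by simp
      have "((M * N) *\<^sub>v v) $ i = (\<Sum>j<n. (M * N) $$ (i,j) * v $ j)"
        using mult_mat_vec_sum[of "M * N" n n v i] M N lc[OF v] i by simp
      also have "\<dots> = (\<Sum>j<n. if j = i then v $ j else 0)"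
        by (rule sum.cong) (use v i MN in \<open>auto simp: last_coords_def simp del: index_mult_mat\<close>)
      finally show "v $ i = ((M * N) *\<^sub>v v) $ i" using i by simp
    qed (use M lc[OF v] in auto)
    also have "\<dots> = M *\<^sub>v (N *\<^sub>v v)" using M N lc[OF v] by simp
    finally show "v = 0\<^sub>v n" using 0 M by auto
  qed
  \<comment> \<open>Identity on the first \<open>n - a\<close> coordinates, \<open>M\<close> on the
    last \<open>a\<close>. A kernel vector has vanishing leading coordinates, because
    \<open>M\<close> contributes nothing there, and then vanishes by injectivity of
    \<open>M\<close>.\<close>
  define H0 where "H0 = mat n n (\<lambda>(i,j). if j < n - a then 1\<^sub>m n $$ (i,j) else M $$ (i,j))"
  have H0: "H0 \<in> carrier_mat n n" by (simp add: H0_def)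
  define tl where "tl v = vec n (\<lambda>j. if j < n - a then 0 else v $ j)" for v :: "'k vec"
  have tl: "tl v \<in> last_coords n a" for v by (auto simp: tl_def last_coords_def)
  have H0v: "(H0 *\<^sub>v v) $ i = (if i < n - a then v $ i else 0) + (M *\<^sub>v tl v) $ i"
    if v: "v \<in> carrier_vec n" and i: "i < n" for v i
  proof -
    have "(H0 *\<^sub>v v) $ i = (\<Sum>j<n. H0 $$ (i,j) * v $ j)"
      by (rule mult_mat_vec_sum[OF H0 v i])
    also have "\<dots> = (\<Sum>j<n. (if j = i then (if i < n - a then v $ i else 0) else 0) + M $$ (i,j) * tl v $ j)"
      by (rule sum.cong) (use i in \<open>auto simp: H0_def tl_def\<close>)
    also have "\<dots> = (if i < n - a then v $ i else 0) + (\<Sum>j<n. M $$ (i,j) * tl v $ j)"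
      using i by (simp add: sum.distrib)
    finally show ?thesis using mult_mat_vec_sum[OF M lc[OF tl] i] by simp
  qed
  have Mtl: "M *\<^sub>v tl v \<in> last_coords n a" for v
    using M_maps[OF tl] last_coords_mono[OF \<open>b \<le> a\<close>] by blast
  have H0_last: "H0 *\<^sub>v v = M *\<^sub>v v" if v: "v \<in> last_coords n a" for v
  proof -
    have "tl v = v" using v by (intro eq_vecI) (auto simp: tl_def last_coords_def)
    then show ?thesis using H0v[OF lc[OF v]] v H0 M
      by (intro eq_vecI) (auto simp: last_coords_def simp del: index_mult_mat_vec)
  qed
  have "v = 0\<^sub>v n" if v: "v \<in> carrier_vec n" and 0: "H0 *\<^sub>v v = 0\<^sub>v n" for v
  proof -
    have "v $ i = 0" if "i < n - a" for i
      using H0v[OF v, of i] 0 that Mtl[of v] by (auto simp: last_coords_def simp del: index_mult_mat_vec)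
    then have "v \<in> last_coords n a" using v by (auto simp: last_coords_def)
    then show ?thesis using M_inj H0_last 0 by simp
  qed
  then obtain H0' where H0': "inverse_mats n H0 H0'" using inverse_mats_of_inj[OF H0] by blast
  have inv: "inverse_mats n (R' * (H0 * P)) (P' * H0' * R)"
    by (rule inverse_mats_mult[OF inverse_mats_mult[OF Pinv H0'] inverse_mats_sym[OF Rinv]])
  show thesis
  proof (rule that[OF inv])
    fix u assume u: "u \<in> U"
    then have uc: "u \<in> carrier_vec n" using Uc by blast
    have Pu: "P *\<^sub>v u \<in> last_coords n a" using P u uc by (auto simp: adapted_def)
    have "(R' * (H0 * P)) *\<^sub>v u = R' *\<^sub>v (H0 *\<^sub>v (P *\<^sub>v u))"
      using c H0 uc by (simp add: assoc_mult_mat_vec[of _ n n _ n])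
    also have "\<dots> = R' *\<^sub>v (R *\<^sub>v (D *\<^sub>v (P' *\<^sub>v (P *\<^sub>v u))))"
      using H0_last[OF Pu] Mv[OF lc[OF Pu]] by simp
    also have "\<dots> = D *\<^sub>v u"
      using inverse_mats_cancel(1)[OF Pinv uc] inverse_mats_cancel(1)[OF Rinv, of "D *\<^sub>v u"] D uc by simp
    finally show "(R' * (H0 * P)) *\<^sub>v u = D *\<^sub>v u" .
  qed
qed

text \<open>The Leibniz formula writes the determinant through constants, sums and products of
  entries.\<close>

lemma det_in_function_algebra:
  fixes A :: "'x \<Rightarrow> 'k::field mat"
  assumes const: "\<And>c. (\<lambda>_. c) \<in> F"
    and add: "\<And>f g. f \<in> F \<Longrightarrow> g \<in> F \<Longrightarrow> (\<lambda>x. f x + g x) \<in> F"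
    and mult: "\<And>f g. f \<in> F \<Longrightarrow> g \<in> F \<Longrightarrow> (\<lambda>x. f x * g x) \<in> F"
    and A: "\<And>x. A x \<in> carrier_mat n n"
    and entry: "\<And>i j. i < n \<Longrightarrow> j < n \<Longrightarrow> (\<lambda>x. A x $$ (i,j)) \<in> F"
  shows "(\<lambda>x. det (A x)) \<in> F"
proof -
  have sum: "(\<lambda>x. \<Sum>s\<in>S. f s x) \<in> F" if "finite S" "\<And>s. s \<in> S \<Longrightarrow> f s \<in> F"
    for S :: "(nat \<Rightarrow> nat) set" and f
    using that by (induction S rule: finite_induct) (auto intro: const add)
  have prod: "(\<lambda>x. \<Prod>s\<in>S. f s x) \<in> F" if "finite S" "\<And>s. s \<in> S \<Longrightarrow> f s \<in> F"
    for S :: "nat set" and f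
    using that by (induction S rule: finite_induct) (auto intro: const mult)
  have "(\<lambda>x. \<Sum>p\<in>{p. p permutes {0..<n}}. signof p * (\<Prod>i = 0..<n. A x $$ (i, p i))) \<in> F"
  proof (rule sum)
    show "finite {p. p permutes {0..<n}}" by (simp add: finite_permutations)
    fix p assume p: "p \<in> {p. p permutes {0..<n}}"
    then have "p i < n" if "i < n" for i
      using that permutes_in_image[of p "{0..<n}" i] by auto
    then show "(\<lambda>x. signof p * (\<Prod>i = 0..<n. A x $$ (i, p i))) \<in> F"
      by (intro mult const prod entry) auto
  qed
  then show ?thesis using det_def'[OF A] by (simp add: fun_eq_iff)
qed


locale finite_quiver = fin_digraph Q for Q :: "('v, 'a) pre_digraph"
begin

section \<open>The path algebra\<close>

lemma awlast_append: "awlast u (p @ q) = awlast (awlast u p) q"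
  by (cases q rule: rev_cases) (auto simp: awalk_verts_conv)

lemma quiver_paths_iff: "(u, p) \<in> quiver_paths Q \<longleftrightarrow> awalk u p (awlast u p)"
  unfolding quiver_paths_def using awalk_ends by fastforce

lemma quiver_paths_append:
  "(u, p @ q) \<in> quiver_paths Q \<longleftrightarrow> (u, p) \<in> quiver_paths Q \<and> (awlast u p, q) \<in> quiver_paths Q"
  by (auto simp: quiver_paths_iff awlast_append)

lemma quiver_paths_take_drop:
  "(u, p) \<in> quiver_paths Q \<longleftrightarrow>
     (u, take k p) \<in> quiver_paths Q \<and> (awlast u (take k p), drop k p) \<in> quiver_paths Q"
  using quiver_paths_append[of u "take k p" "drop k p"] by simp

lemma quiver_paths_Nil: "(u, []) \<in> quiver_paths Q \<longleftrightarrow> u \<in> verts Q"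
  by (auto simp: quiver_paths_iff awalk_Nil_iff)

lemma quiver_paths_single: "(u, [a]) \<in> quiver_paths Q \<longleftrightarrow> a \<in> arcs Q \<and> u = tail Q a"
  by (auto simp: quiver_paths_iff awalk_def)

lemma awlast_in_verts: "(u, p) \<in> quiver_paths Q \<Longrightarrow> awlast u p \<in> verts Q"
  by (auto simp: quiver_paths_iff intro: awalk_last_in_verts)

lemma path_mult_apply:
  "(f \<otimes>\<^bsub>path_algebra Q\<^esub> g) (u, p) =
     (\<Sum>k\<le>length p. f (awlast u (take k p), drop k p) * g (u, take k p))"
  by (simp add: path_algebra_def)

lemma path_add_apply: "(f \<oplus>\<^bsub>path_algebra Q\<^esub> g) q = f q + g q"
  by (simp add: path_algebra_def)

lemma path_zero_apply: "\<zero>\<^bsub>path_algebra Q\<^esub> q = 0"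
  by (simp add: path_algebra_def)

lemma path_one_apply: "\<one>\<^bsub>path_algebra Q\<^esub> (u, p) = (if u \<in> verts Q \<and> p = [] then 1 else 0)"
  by (simp add: path_algebra_def)

lemma path_carrier_iff:
  "f \<in> carrier (path_algebra Q) \<longleftrightarrow> finite {p. f p \<noteq> 0} \<and> (\<forall>p. f p \<noteq> 0 \<longrightarrow> p \<in> quiver_paths Q)"
  by (auto simp: path_algebra_def)

lemma path_mult_closed:
  fixes f g :: "'v \<times> 'a list \<Rightarrow> 'k::field"
  assumes f: "f \<in> carrier (path_algebra Q)" and g: "g \<in> carrier (path_algebra Q)"
  shows "f \<otimes>\<^bsub>path_algebra Q\<^esub> g \<in> carrier (path_algebra Q)"
proof -
  let ?h = "f \<otimes>\<^bsub>path_algebra Q\<^esub> g"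
  have *: "\<exists>k. f (awlast u (take k p), drop k p) \<noteq> 0 \<and> g (u, take k p) \<noteq> 0"
    if "?h (u, p) \<noteq> 0" for u p
  proof (rule ccontr)
    assume "\<not> ?thesis"
    then have "?h (u, p) = 0" unfolding path_mult_apply by (intro sum.neutral) auto
    with that show False by simp
  qed
  have "{q. ?h q \<noteq> 0} \<subseteq> (\<lambda>((w, q), (u, p)). (u, p @ q)) ` ({q. f q \<noteq> 0} \<times> {q. g q \<noteq> 0})"
  proof
    fix q assume "q \<in> {q. ?h q \<noteq> 0}"
    moreover obtain u p where q: "q = (u, p)" by (cases q)
    ultimately obtain k where "f (awlast u (take k p), drop k p) \<noteq> 0" "g (u, take k p) \<noteq> 0"
      using *[of u p] by auto
    with q show "q \<in> (\<lambda>((w, q), (u, p)). (u, p @ q)) ` ({q. f q \<noteq> 0} \<times> {q. g q \<noteq> 0})"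
      by (intro image_eqI[where x = "((awlast u (take k p), drop k p), (u, take k p))"]) auto
  qed
  moreover have "finite ({q. f q \<noteq> 0} \<times> {q. g q \<noteq> 0})"
    using f g by (auto simp: path_carrier_iff)
  ultimately have "finite {q. ?h q \<noteq> 0}" by (meson finite_imageI finite_subset)
  moreover have "q \<in> quiver_paths Q" if "?h q \<noteq> 0" for q
  proof -
    obtain u p where q: "q = (u, p)" by (cases q)
    obtain k where "f (awlast u (take k p), drop k p) \<noteq> 0" "g (u, take k p) \<noteq> 0"
      using *[of u p] \<open>?h q \<noteq> 0\<close> q by blast
    then have "(u, take k p) \<in> quiver_paths Q" "(awlast u (take k p), drop k p) \<in> quiver_paths Q"
      using f g by (simp_all add: path_carrier_iff)
    then show ?thesis using quiver_paths_take_drop[of u p k] q by simp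
  qed
  ultimately show ?thesis by (simp add: path_carrier_iff)
qed

text \<open>Both sides sum over the ways to cut a path into three consecutive pieces.
  \<open>T k l\<close> is the term whose first two pieces have lengths \<open>k\<close> and
  \<open>l\<close>; the bracketings differ by summing first over \<open>k\<close> or first over
  \<open>m = k + l\<close>.\<close>

lemma path_mult_assoc:
  fixes f g h :: "'v \<times> 'a list \<Rightarrow> 'k::field"
  shows "(f \<otimes>\<^bsub>path_algebra Q\<^esub> g) \<otimes>\<^bsub>path_algebra Q\<^esub> h = f \<otimes>\<^bsub>path_algebra Q\<^esub> (g \<otimes>\<^bsub>path_algebra Q\<^esub> h)"
proof
  fix q :: "'v \<times> 'a list"
  obtain u p where q: "q = (u, p)" by (cases q)
  define n where "n = length p"
  define w where "w k = awlast u (take k p)" for k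
  define T where "T k l = f (w (k + l), drop (k + l) p) * g (w k, take l (drop k p)) * h (u, take k p)"
    for k l
  have w: "awlast (w k) (take l (drop k p)) = w (k + l)" for k l
    by (simp add: w_def awlast_append take_add)
  have "((f \<otimes>\<^bsub>path_algebra Q\<^esub> g) \<otimes>\<^bsub>path_algebra Q\<^esub> h) q = (\<Sum>k\<le>n. \<Sum>l\<le>n-k. T k l)"
    by (simp add: q path_mult_apply n_def T_def sum_distrib_right w[unfolded w_def] w_def
        add.commute)
  also have "\<dots> = (\<Sum>(k,l)\<in>(SIGMA k:{..n}. {..n-k}). T k l)" by (rule sum.Sigma) auto
  also have "(SIGMA k:{..n}. {..n-k}) = {(k,l). k + l \<le> n}" by auto
  also have "(\<Sum>(k,l)\<in>{(k,l). k + l \<le> n}. T k l) = (\<Sum>m\<le>n. \<Sum>k\<le>m. T k (m - k))"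
    by (rule sum.triangle_reindex_eq)
  also have "\<dots> = (\<Sum>m\<le>n. f (w m, drop m p) * (\<Sum>k\<le>m. g (awlast u (take k (take m p)),
      drop k (take m p)) * h (u, take k (take m p))))"
    unfolding sum_distrib_left
    by (intro sum.cong refl) (auto simp: T_def w_def min_absorb2 min_absorb1 mult.assoc drop_take)
  also have "\<dots> = (f \<otimes>\<^bsub>path_algebra Q\<^esub> (g \<otimes>\<^bsub>path_algebra Q\<^esub> h)) q"
    by (simp add: q path_mult_apply n_def w_def min_absorb2)
  finally show "((f \<otimes>\<^bsub>path_algebra Q\<^esub> g) \<otimes>\<^bsub>path_algebra Q\<^esub> h) q =
      (f \<otimes>\<^bsub>path_algebra Q\<^esub> (g \<otimes>\<^bsub>path_algebra Q\<^esub> h)) q" .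
qed

lemma path_add_closed:
  fixes f g :: "'v \<times> 'a list \<Rightarrow> 'k::field"
  assumes "f \<in> carrier (path_algebra Q)" "g \<in> carrier (path_algebra Q)"
  shows "f \<oplus>\<^bsub>path_algebra Q\<^esub> g \<in> carrier (path_algebra Q)"
proof -
  have "{q. f q + g q \<noteq> 0} \<subseteq> {q. f q \<noteq> 0} \<union> {q. g q \<noteq> 0}" by auto
  moreover have "finite ({q. f q \<noteq> 0} \<union> {q. g q \<noteq> 0})" using assms by (auto simp: path_carrier_iff)
  ultimately have "finite {q. f q + g q \<noteq> 0}" by (rule finite_subset)
  moreover have "q \<in> quiver_paths Q" if "f q + g q \<noteq> 0" for q
  proof -
    have "f q \<noteq> 0 \<or> g q \<noteq> 0" using that by auto
    then show ?thesis using assms unfolding path_carrier_iff by blast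
  qed
  ultimately show ?thesis by (simp add: path_carrier_iff path_add_apply)
qed

lemma path_algebra_ring: "ring (path_algebra Q :: ('v \<times> 'a list \<Rightarrow> 'k::field) ring)"
proof (rule ringI)
  let ?A = "path_algebra Q :: ('v \<times> 'a list \<Rightarrow> 'k) ring"
  show "abelian_group ?A"
  proof (rule abelian_groupI)
    fix f assume f: "f \<in> carrier ?A"
    show "\<exists>g\<in>carrier ?A. g \<oplus>\<^bsub>?A\<^esub> f = \<zero>\<^bsub>?A\<^esub>"
      by (rule bexI[of _ "\<lambda>q. - f q"])
        (use f in \<open>auto simp: fun_eq_iff path_add_apply path_zero_apply path_carrier_iff\<close>)
  qed (auto simp: fun_eq_iff path_add_apply path_zero_apply algebra_simps path_carrier_iff[of "\<zero>\<^bsub>?A\<^esub>"]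
      intro: path_add_closed)
  show "Group.monoid ?A"
  proof (rule monoidI)
    have "{q. \<one>\<^bsub>?A\<^esub> q \<noteq> 0} \<subseteq> (\<lambda>u. (u, [])) ` verts Q"
      by (auto simp: path_one_apply split: if_splits)
    then have "finite {q. \<one>\<^bsub>?A\<^esub> q \<noteq> 0}" using finite_verts by (meson finite_imageI finite_subset)
    then show "\<one>\<^bsub>?A\<^esub> \<in> carrier ?A"
      by (auto simp: path_carrier_iff path_one_apply quiver_paths_Nil split: if_splits)
    fix f assume f: "f \<in> carrier ?A"
    have "(\<one>\<^bsub>?A\<^esub> \<otimes>\<^bsub>?A\<^esub> f) (u, p) = f (u, p)" for u p
    proof -
      have "(\<one>\<^bsub>?A\<^esub> \<otimes>\<^bsub>?A\<^esub> f) (u, p) = (\<Sum>k\<le>length p.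
          if k = length p then (if awlast u p \<in> verts Q then f (u, p) else 0) else 0)"
        unfolding path_mult_apply by (intro sum.cong refl) (auto simp: path_one_apply)
      also have "\<dots> = (if awlast u p \<in> verts Q then f (u, p) else 0)" by simp
      also have "\<dots> = f (u, p)" using f awlast_in_verts by (auto simp: path_carrier_iff)
      finally show ?thesis .
    qed
    then show "\<one>\<^bsub>?A\<^esub> \<otimes>\<^bsub>?A\<^esub> f = f" by (simp add: fun_eq_iff)
    have "(f \<otimes>\<^bsub>?A\<^esub> \<one>\<^bsub>?A\<^esub>) (u, p) = f (u, p)" for u p
    proof -
      have "(f \<otimes>\<^bsub>?A\<^esub> \<one>\<^bsub>?A\<^esub>) (u, p) = (\<Sum>k\<le>length p.
          if k = 0 then (if u \<in> verts Q then f (u, p) else 0) else 0)"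
        unfolding path_mult_apply by (intro sum.cong refl) (auto simp: path_one_apply)
      also have "\<dots> = (if u \<in> verts Q then f (u, p) else 0)" by simp
      also have "\<dots> = f (u, p)"
        using f quiver_paths_take_drop[of u p 0] by (auto simp: path_carrier_iff quiver_paths_Nil)
      finally show ?thesis .
    qed
    then show "f \<otimes>\<^bsub>?A\<^esub> \<one>\<^bsub>?A\<^esub> = f" by (simp add: fun_eq_iff)
  qed (simp_all add: path_mult_closed path_mult_assoc)
qed (auto simp: fun_eq_iff path_add_apply path_mult_apply sum.distrib algebra_simps)

lemma path_elem_carrier: "q \<in> quiver_paths Q \<Longrightarrow> path_elem q \<in> carrier (path_algebra Q)"
  by (auto simp: path_carrier_iff path_elem_def)

lemma path_scale_carrier:
  "f \<in> carrier (path_algebra Q) \<Longrightarrow> (\<lambda>q. c * f q) \<in> carrier (path_algebra Q)"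
  by (auto simp: path_carrier_iff elim: finite_subset[rotated])

text \<open>Of all cuts of \<open>p @ r\<close>, just the one after \<open>p\<close> is seen by both
  factors. This exhibits a long path as a left multiple of its initial segment, the segment
  traversed first being the right factor.\<close>

lemma path_elem_mult:
  fixes c :: "'k::field"
  shows "(\<lambda>q. c * path_elem (awlast u p, r) q) \<otimes>\<^bsub>path_algebra Q\<^esub> path_elem (u, p) =
    (\<lambda>q. c * path_elem (u, p @ r) q)"
proof
  fix q :: "'v \<times> 'a list"
  obtain u' p' where q: "q = (u', p')" by (cases q)
  have *: "c * path_elem (awlast u p, r) (awlast u' (take k p'), drop k p') * path_elem (u, p) (u', take k p')
      = (if k = length p then c * path_elem (u, p @ r) (u', p') else 0)" if k: "k \<le> length p'" for k
  proof (cases "u' = u \<and> take k p' = p")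
    case True
    then have "k = length p" using k by auto
    moreover have "p' = p @ drop k p'" using True by (metis append_take_drop_id)
    then have "p' = p @ r \<longleftrightarrow> drop k p' = r" by auto
    ultimately show ?thesis using True by (auto simp: path_elem_def)
  next
    case False
    then have "path_elem (u, p) (u', take k p') = (0::'k)" by (auto simp: path_elem_def)
    moreover have "path_elem (u, p @ r) (u', p') = (0::'k)" if "k = length p"
      using False that by (auto simp: path_elem_def)
    ultimately show ?thesis by simp
  qed
  have "((\<lambda>q. c * path_elem (awlast u p, r) q) \<otimes>\<^bsub>path_algebra Q\<^esub> path_elem (u, p)) q
      = (\<Sum>k\<le>length p'. if k = length p then c * path_elem (u, p @ r) (u', p') else 0)"
    unfolding q path_mult_apply by (intro sum.cong refl) (use * in auto)
  also have "\<dots> = c * path_elem (u, p @ r) q"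
    by (auto simp: q path_elem_def)
  finally show "((\<lambda>q. c * path_elem (awlast u p, r) q) \<otimes>\<^bsub>path_algebra Q\<^esub> path_elem (u, p)) q =
      c * path_elem (u, p @ r) q" .
qed

lemma length2_gens_carrier:
  "path_elem ` {(u, p) \<in> quiver_paths Q. length p = 2} \<subseteq> carrier (path_algebra Q)"
  by (auto intro: path_elem_carrier)

lemma length2_ideal_is_ideal:
  "ideal (length2_ideal Q) (path_algebra Q :: ('v \<times> 'a list \<Rightarrow> 'k::field) ring)"
  unfolding length2_ideal_def
  by (rule ring.genideal_ideal[OF path_algebra_ring length2_gens_carrier])

text \<open>Both factors of a path of length below 2 are again that short, so the condition survives
  multiplication on either side. This ideal contains the generators and thus bounds
  \<open>length2_ideal\<close> from above.\<close>

lemma long_elements_ideal: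
  "ideal {f \<in> carrier (path_algebra Q). \<forall>q. length (snd q) < 2 \<longrightarrow> f q = (0::'k::field)} (path_algebra Q)"
  (is "ideal ?I ?A")
proof (rule idealI)
  interpret ring ?A by (rule path_algebra_ring)
  show "ring ?A" by (rule path_algebra_ring)
  show "subgroup ?I (add_monoid ?A)"
  proof (rule add.subgroupI)
    show "?I \<noteq> {}" by (auto simp: path_zero_apply intro!: exI[of _ "\<zero>\<^bsub>?A\<^esub>"])
    fix f assume f: "f \<in> ?I"
    have "\<ominus>\<^bsub>?A\<^esub> f = (\<lambda>q. - f q)"
      by (rule minus_equality)
        (use f in \<open>auto simp: fun_eq_iff path_add_apply path_zero_apply path_carrier_iff\<close>)
    then show "\<ominus>\<^bsub>?A\<^esub> f \<in> ?I" using f a_inv_closed[of f] by simp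
  qed (auto simp: path_add_apply)
  fix f g assume f: "f \<in> ?I" and g: "g \<in> carrier ?A"
  have "(g \<otimes>\<^bsub>?A\<^esub> f) q = 0" "(f \<otimes>\<^bsub>?A\<^esub> g) q = 0" if "length (snd q) < 2" for q
    using f that by (cases q; auto simp: path_mult_apply intro!: sum.neutral)+
  then show "g \<otimes>\<^bsub>?A\<^esub> f \<in> ?I" "f \<otimes>\<^bsub>?A\<^esub> g \<in> ?I" using f g by auto
qed

text \<open>Every path of length at least 2 starts with a path of length 2 and so lies in the ideal;
  an element supported on such paths is treated by removing one path of its support at a
  time.\<close>

lemma length2_ideal_eq:
  "length2_ideal Q = {f \<in> carrier (path_algebra Q). \<forall>q. length (snd q) < 2 \<longrightarrow> f q = (0::'k::field)}"
  (is "?J = ?I")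
proof
  let ?A = "path_algebra Q :: ('v \<times> 'a list \<Rightarrow> 'k) ring"
  interpret ring ?A by (rule path_algebra_ring)
  interpret J: ideal ?J ?A by (rule length2_ideal_is_ideal)
  show "?J \<subseteq> ?I"
    unfolding length2_ideal_def
    by (rule genideal_minimal[OF long_elements_ideal]) (use length2_gens_carrier in \<open>auto simp: path_elem_def\<close>)
  have elem: "(\<lambda>q. c * path_elem r q) \<in> ?J" if r: "r \<in> quiver_paths Q" "2 \<le> length (snd r)" for c :: 'k and r
  proof -
    obtain u a b p where up: "r = (u, [a, b] @ p)"
      using r by (cases r, cases "snd r", simp, cases "tl (snd r)") auto
    have paths: "(u, [a, b]) \<in> quiver_paths Q" "(awlast u [a, b], p) \<in> quiver_paths Q"
      using r quiver_paths_append[of u "[a, b]" p] up by auto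
    have "path_elem (u, [a, b]) \<in> ?J"
      unfolding length2_ideal_def
      by (rule subsetD[OF genideal_self[OF length2_gens_carrier]]) (use paths in auto)
    from J.I_l_closed[OF this path_scale_carrier[OF path_elem_carrier[OF paths(2)], of c]]
    show ?thesis unfolding path_elem_mult up .
  qed
  have "f \<in> ?J" if "f \<in> ?I" for f
    using that
  proof (induction "card {q. f q \<noteq> 0}" arbitrary: f)
    case 0
    then have "f = \<zero>\<^bsub>?A\<^esub>" by (auto simp: path_carrier_iff fun_eq_iff path_zero_apply)
    then show ?case by (simp add: J.zero_closed)
  next
    case (Suc n)
    then obtain r where r: "f r \<noteq> 0" by (cases "{q. f q \<noteq> 0} = {}") auto
    define g where "g = f(r := 0)"
    have "{q. g q \<noteq> 0} = {q. f q \<noteq> 0} - {r}" by (auto simp: g_def)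
    moreover have "finite {q. f q \<noteq> 0}" using Suc by (simp add: path_carrier_iff)
    ultimately have "n = card {q. g q \<noteq> 0}" "finite {q. g q \<noteq> 0}" using Suc.hyps(2) r by simp_all
    moreover have "g \<in> ?I" using Suc.prems \<open>finite {q. g q \<noteq> 0}\<close> by (auto simp: path_carrier_iff g_def)
    ultimately have "g \<in> ?J" using Suc.hyps(1) by blast
    moreover have "(\<lambda>q. f r * path_elem r q) \<in> ?J"
    proof (rule elem)
      show "r \<in> quiver_paths Q" using Suc.prems r unfolding path_carrier_iff by blast
      show "2 \<le> length (snd r)" using Suc.prems r by (metis (mono_tags, lifting) mem_Collect_eq not_less)
    qed
    ultimately have "g \<oplus>\<^bsub>?A\<^esub> (\<lambda>q. f r * path_elem r q) \<in> ?J" by (rule J.a_closed)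
    moreover have "g \<oplus>\<^bsub>?A\<^esub> (\<lambda>q. f r * path_elem r q) = f"
      by (auto simp: fun_eq_iff path_add_apply g_def path_elem_def)
    ultimately show ?case by simp
  qed
  then show "?I \<subseteq> ?J" by blast
qed


section \<open>The algebra \<open>\<Lambda>\<close> in coordinates\<close>

lemma bound_algebra_ring: "ring (bound_algebra Q :: ('v \<times> 'a list \<Rightarrow> 'k::field) set ring)"
  unfolding bound_algebra_def by (rule ideal.quotient_is_ring[OF length2_ideal_is_ideal])

lemma bound_algebra_carrier:
  "carrier (bound_algebra Q) = residue Q ` carrier (path_algebra Q)"
  by (auto simp: bound_algebra_def FactRing_def A_RCOSETS_def' residue_def)

lemma residue_carrier: "f \<in> carrier (path_algebra Q) \<Longrightarrow> residue Q f \<in> carrier (bound_algebra Q)"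
  by (simp add: bound_algebra_carrier)

lemma residue_hom:
  fixes f g :: "'v \<times> 'a list \<Rightarrow> 'k::field"
  assumes "f \<in> carrier (path_algebra Q)" "g \<in> carrier (path_algebra Q)"
  shows "residue Q f \<oplus>\<^bsub>bound_algebra Q\<^esub> residue Q g = residue Q (f \<oplus>\<^bsub>path_algebra Q\<^esub> g)"
    and "residue Q f \<otimes>\<^bsub>bound_algebra Q\<^esub> residue Q g = residue Q (f \<otimes>\<^bsub>path_algebra Q\<^esub> g)"
  using ring_hom_add[OF ideal.rcos_ring_hom[OF length2_ideal_is_ideal] assms]
    ring_hom_mult[OF ideal.rcos_ring_hom[OF length2_ideal_is_ideal] assms]
  by (simp_all add: residue_def bound_algebra_def)

lemma bound_algebra_zero: "\<zero>\<^bsub>bound_algebra Q\<^esub> = residue Q \<zero>\<^bsub>path_algebra Q\<^esub>"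
proof -
  interpret ideal "length2_ideal Q" "path_algebra Q :: ('v \<times> 'a list \<Rightarrow> 'k::field) ring"
    by (rule length2_ideal_is_ideal)
  show "\<zero>\<^bsub>bound_algebra Q\<^esub> = residue Q (\<zero>\<^bsub>path_algebra Q\<^esub> :: 'v \<times> 'a list \<Rightarrow> 'k)"
    by (simp add: residue_def bound_algebra_def FactRing_def a_coset_add_zero a_subset)
qed

lemma bound_algebra_one: "\<one>\<^bsub>bound_algebra Q\<^esub> = residue Q \<one>\<^bsub>path_algebra Q\<^esub>"
  by (simp add: residue_def bound_algebra_def FactRing_def)

lemma path_minus_apply:
  fixes f :: "'v \<times> 'a list \<Rightarrow> 'k::field"
  assumes f: "f \<in> carrier (path_algebra Q)"
  shows "(\<ominus>\<^bsub>path_algebra Q\<^esub> f) q = - f q"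
proof -
  interpret ring "path_algebra Q :: ('v \<times> 'a list \<Rightarrow> 'k) ring" by (rule path_algebra_ring)
  have "\<ominus>\<^bsub>path_algebra Q\<^esub> f = (\<lambda>q. - f q)"
    by (rule minus_equality)
      (use f in \<open>auto simp: fun_eq_iff path_add_apply path_zero_apply path_carrier_iff\<close>)
  then show ?thesis by simp
qed

lemma residue_eq_iff:
  fixes f g :: "'v \<times> 'a list \<Rightarrow> 'k::field"
  assumes f: "f \<in> carrier (path_algebra Q)" and g: "g \<in> carrier (path_algebra Q)"
  shows "residue Q f = residue Q g \<longleftrightarrow> (\<forall>q. length (snd q) < 2 \<longrightarrow> f q = g q)"
proof -
  interpret ring "path_algebra Q :: ('v \<times> 'a list \<Rightarrow> 'k) ring" by (rule path_algebra_ring)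
  have "residue Q f = residue Q g \<longleftrightarrow> f \<ominus>\<^bsub>path_algebra Q\<^esub> g \<in> length2_ideal Q"
    unfolding residue_def using quotient_eq_iff_same_a_r_cos[OF length2_ideal_is_ideal f g] by simp
  also have "\<dots> \<longleftrightarrow> (\<forall>q. length (snd q) < 2 \<longrightarrow> f q = g q)"
    using f g by (auto simp: length2_ideal_eq a_minus_def path_add_apply path_minus_apply)
  finally show ?thesis .
qed

text \<open>The same choice of representative as in \<open>operator_module\<close>, so
  \<open>X\<close> acts through \<open>coef X\<close>. At paths of length 0 and 1 its values are
  determined by \<open>X\<close>; at longer paths they depend on the choice.\<close>

definition coef :: "('v \<times> 'a list \<Rightarrow> 'k::field) set \<Rightarrow> 'v \<times> 'a list \<Rightarrow> 'k" where
  "coef X = (SOME f. f \<in> X)"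

lemma coef_residue_long:
  fixes f :: "'v \<times> 'a list \<Rightarrow> 'k::field"
  assumes f: "f \<in> carrier (path_algebra Q)"
  obtains h where "h \<in> length2_ideal Q" "coef (residue Q f) = h \<oplus>\<^bsub>path_algebra Q\<^esub> f"
proof -
  interpret ideal "length2_ideal Q" "path_algebra Q :: ('v \<times> 'a list \<Rightarrow> 'k) ring"
    by (rule length2_ideal_is_ideal)
  have "f \<in> residue Q f" unfolding residue_def by (rule a_rcos_self[OF f])
  then have "coef (residue Q f) \<in> residue Q f"     unfolding coef_def by (rule someI[of "\<lambda>g. g \<in> residue Q f" f])
  then show thesis using that by (auto simp: residue_def a_r_coset_def')
qed

lemma coef_residue:
  assumes f: "f \<in> carrier (path_algebra Q)" and q: "length (snd q) < 2"
  shows "coef (residue Q f) q = (f q :: 'k::field)"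
proof -
  obtain h where h: "h \<in> length2_ideal Q" "coef (residue Q f) = h \<oplus>\<^bsub>path_algebra Q\<^esub> f"
    using coef_residue_long[OF f] by blast
  then have "h q = 0" using q unfolding length2_ideal_eq by blast
  then show ?thesis using h(2) by (simp add: path_add_apply)
qed

text \<open>\<open>ev\<close> and \<open>ar\<close> are coordinates on the algebra: modulo the
  ideal, an element is determined by its coefficients at the trivial paths and at the
  arrows.\<close>

definition ev :: "('v \<times> 'a list \<Rightarrow> 'k::field) set \<Rightarrow> 'v \<Rightarrow> 'k" where
  "ev X i = coef X (i, [])"

definition ar :: "('v \<times> 'a list \<Rightarrow> 'k::field) set \<Rightarrow> 'a \<Rightarrow> 'k" where
  "ar X a = coef X (tail Q a, [a])"

lemma ev_residue: "f \<in> carrier (path_algebra Q) \<Longrightarrow> ev (residue Q f) i = f (i, [])"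
  by (simp add: ev_def coef_residue)

lemma ar_residue: "f \<in> carrier (path_algebra Q) \<Longrightarrow> ar (residue Q f) a = f (tail Q a, [a])"
  by (simp add: ar_def coef_residue)

lemma bound_algebra_eqI:
  fixes X Y :: "('v \<times> 'a list \<Rightarrow> 'k::field) set"
  assumes X: "X \<in> carrier (bound_algebra Q)" and Y: "Y \<in> carrier (bound_algebra Q)"
    and e: "\<And>i. i \<in> verts Q \<Longrightarrow> ev X i = ev Y i" and r: "\<And>a. a \<in> arcs Q \<Longrightarrow> ar X a = ar Y a"
  shows "X = Y"
proof -
  obtain f g where f: "f \<in> carrier (path_algebra Q)" "X = residue Q f"
    and g: "g \<in> carrier (path_algebra Q)" "Y = residue Q g"
    using X Y by (auto simp: bound_algebra_carrier)
  have "f q = g q" if len: "length (snd q) < 2" for q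
  proof (cases "q \<in> quiver_paths Q")
    case True
    obtain u p where q: "q = (u, p)" by (cases q)
    then consider "p = []" | a where "p = [a]" using len unfolding q by (cases p; cases "tl p") auto
    then show ?thesis
    proof cases
      case 1
      then show ?thesis
        using e[of u] f g True q by (simp add: ev_residue quiver_paths_Nil)
    next
      case 2
      then show ?thesis
        using r[of a] f g True q by (simp add: ar_residue quiver_paths_single)
    qed
  next
    case False
    then have "f q = 0" "g q = 0" using f g unfolding path_carrier_iff by blast+
    then show ?thesis by simp
  qed
  then show ?thesis using f g residue_eq_iff by blast
qed

lemma ev_add:
  fixes X Y :: "('v \<times> 'a list \<Rightarrow> 'k::field) set"
  assumes "X \<in> carrier (bound_algebra Q)" "Y \<in> carrier (bound_algebra Q)"
  shows "ev (X \<oplus>\<^bsub>bound_algebra Q\<^esub> Y) i = ev X i + ev Y i"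
    and "ar (X \<oplus>\<^bsub>bound_algebra Q\<^esub> Y) a = ar X a + ar Y a"
  using assms
  by (auto simp: bound_algebra_carrier residue_hom ev_residue ar_residue path_add_closed path_add_apply)

text \<open>A trivial path has one factorization and an arrow has two: the cut lies before it or
  after it.\<close>

lemma ev_mult:
  fixes X Y :: "('v \<times> 'a list \<Rightarrow> 'k::field) set"
  assumes "X \<in> carrier (bound_algebra Q)" "Y \<in> carrier (bound_algebra Q)"
  shows "ev (X \<otimes>\<^bsub>bound_algebra Q\<^esub> Y) i = ev X i * ev Y i"
    and "ar (X \<otimes>\<^bsub>bound_algebra Q\<^esub> Y) a = ar X a * ev Y (tail Q a) + ev X (head Q a) * ar Y a"
proof -
  have 2: "{..Suc 0} = {0, 1}" by auto
  show "ev (X \<otimes>\<^bsub>bound_algebra Q\<^esub> Y) i = ev X i * ev Y i"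
    "ar (X \<otimes>\<^bsub>bound_algebra Q\<^esub> Y) a = ar X a * ev Y (tail Q a) + ev X (head Q a) * ar Y a"
    using assms
    by (auto simp: bound_algebra_carrier residue_hom ev_residue ar_residue path_mult_closed
        path_mult_apply 2)
qed

lemma ev_one: "i \<in> verts Q \<Longrightarrow> ev (\<one>\<^bsub>bound_algebra Q\<^esub> :: ('v \<times> 'a list \<Rightarrow> 'k::field) set) i = 1"
  and ar_one: "ar (\<one>\<^bsub>bound_algebra Q\<^esub> :: ('v \<times> 'a list \<Rightarrow> 'k::field) set) a = 0"
proof -
  interpret ring "path_algebra Q :: ('v \<times> 'a list \<Rightarrow> 'k) ring" by (rule path_algebra_ring)
  show "i \<in> verts Q \<Longrightarrow> ev (\<one>\<^bsub>bound_algebra Q\<^esub> :: ('v \<times> 'a list \<Rightarrow> 'k::field) set) i = 1"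
    "ar (\<one>\<^bsub>bound_algebra Q\<^esub> :: ('v \<times> 'a list \<Rightarrow> 'k::field) set) a = 0"
    by (simp_all add: bound_algebra_one ev_residue ar_residue path_one_apply)
qed

lemma ev_zero: "ev (\<zero>\<^bsub>bound_algebra Q\<^esub> :: ('v \<times> 'a list \<Rightarrow> 'k::field) set) i = 0"
  and ar_zero: "ar (\<zero>\<^bsub>bound_algebra Q\<^esub> :: ('v \<times> 'a list \<Rightarrow> 'k::field) set) a = 0"
proof -
  interpret ring "path_algebra Q :: ('v \<times> 'a list \<Rightarrow> 'k) ring" by (rule path_algebra_ring)
  show "ev (\<zero>\<^bsub>bound_algebra Q\<^esub> :: ('v \<times> 'a list \<Rightarrow> 'k::field) set) i = 0"
    "ar (\<zero>\<^bsub>bound_algebra Q\<^esub> :: ('v \<times> 'a list \<Rightarrow> 'k::field) set) a = 0"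
    by (simp_all add: bound_algebra_zero ev_residue ar_residue path_zero_apply)
qed

text \<open>This supplies, in particular, the elements that act as a single arrow.\<close>

lemma bound_algebra_coords_exist:
  fixes e :: "'v \<Rightarrow> 'k::field" and r :: "'a \<Rightarrow> 'k"
  obtains X where "X \<in> carrier (bound_algebra Q)"
    "\<And>i. i \<in> verts Q \<Longrightarrow> ev X i = e i" "\<And>a. a \<in> arcs Q \<Longrightarrow> ar X a = r a"
proof -
  define f where "f = (\<lambda>(u, p). if p = [] \<and> u \<in> verts Q then e u
    else if length p = 1 \<and> hd p \<in> arcs Q \<and> u = tail Q (hd p) then r (hd p) else 0)"
  have "{q. f q \<noteq> 0} \<subseteq> (\<lambda>u. (u, [])) ` verts Q \<union> (\<lambda>a. (tail Q a, [a])) ` arcs Q"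
    by (auto simp: f_def length_Suc_conv split: if_splits)
  moreover have "finite ((\<lambda>u. (u, [])) ` verts Q \<union> (\<lambda>a. (tail Q a, [a])) ` arcs Q)" by simp
  ultimately have "finite {q. f q \<noteq> 0}" by (rule finite_subset)
  moreover have "q \<in> quiver_paths Q" if "f q \<noteq> 0" for q
    using that by (cases q) (auto simp: f_def length_Suc_conv quiver_paths_Nil quiver_paths_single split: if_splits)
  ultimately have f: "f \<in> carrier (path_algebra Q)" by (simp add: path_carrier_iff)
  show thesis
    by (rule that[OF residue_carrier[OF f]]) (simp_all add: ev_residue[OF f] ar_residue[OF f], simp_all add: f_def)
qed

lemma vertex_idem_coords:
  assumes i: "i \<in> verts Q"
  shows "(vertex_idem Q i :: ('v \<times> 'a list \<Rightarrow> 'k::field) set) \<in> carrier (bound_algebra Q)"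
    and "ev (vertex_idem Q i :: ('v \<times> 'a list \<Rightarrow> 'k::field) set) j = (if j = i then 1 else 0)"
    and "ar (vertex_idem Q i :: ('v \<times> 'a list \<Rightarrow> 'k::field) set) a = 0"
proof -
  have c: "path_elem (i, []) \<in> carrier (path_algebra Q :: ('v \<times> 'a list \<Rightarrow> 'k) ring)"
    using i by (auto intro: path_elem_carrier simp: quiver_paths_Nil)
  show "(vertex_idem Q i :: ('v \<times> 'a list \<Rightarrow> 'k::field) set) \<in> carrier (bound_algebra Q)"
    "ev (vertex_idem Q i :: ('v \<times> 'a list \<Rightarrow> 'k::field) set) j = (if j = i then 1 else 0)"
    "ar (vertex_idem Q i :: ('v \<times> 'a list \<Rightarrow> 'k::field) set) a = 0"
    using residue_carrier[OF c] ev_residue[OF c] ar_residue[OF c]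
    by (auto simp: vertex_idem_def path_elem_def)
qed

lemma scalar_coords:
  fixes c :: "'k::field"
  shows "scalar Q c \<in> carrier (bound_algebra Q)"
    and "i \<in> verts Q \<Longrightarrow> ev (scalar Q c) i = c"
    and "ar (scalar Q c) a = 0"
proof -
  interpret ring "path_algebra Q :: ('v \<times> 'a list \<Rightarrow> 'k) ring" by (rule path_algebra_ring)
  note f = path_scale_carrier[OF one_closed, of c]
  show "scalar Q c \<in> carrier (bound_algebra Q)" "i \<in> verts Q \<Longrightarrow> ev (scalar Q c) i = c"
    "ar (scalar Q c) a = 0"
    using residue_carrier[OF f] ev_residue[OF f] ar_residue[OF f]
    by (auto simp: scalar_def path_one_apply)
qed

text \<open>This is the kernel of the ring homomorphism \<open>X \<mapsto> ev X i\<close> onto the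
  field. It is maximal: if \<open>ev F i \<noteq> 0\<close>, every \<open>G\<close> differs from a
  scalar multiple of \<open>F\<close> by an element of the kernel.\<close>

lemma coordinate_left_ideal:
  assumes i: "i \<in> verts Q"
  shows "maximal_left_ideal (bound_algebra Q)
    {X \<in> carrier (bound_algebra Q). ev X i = (0::'k::field)}" (is "maximal_left_ideal ?L ?M")
proof -
  interpret ring ?L by (rule bound_algebra_ring)
  have ev_minus: "ev (\<ominus>\<^bsub>?L\<^esub> X) i = - ev X i" if "X \<in> carrier ?L" for X
  proof -
    have "ev X i + ev (\<ominus>\<^bsub>?L\<^esub> X) i = ev (X \<oplus>\<^bsub>?L\<^esub> \<ominus>\<^bsub>?L\<^esub> X) i"
      by (rule ev_add(1)[symmetric]) (use that in auto)
    also have "\<dots> = 0" unfolding r_neg[OF that] by (rule ev_zero)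
    finally show ?thesis by (metis add_eq_0_iff)
  qed
  have sub: "subgroup ?M (add_monoid ?L)"
  proof (rule add.subgroupI)
    show "?M \<noteq> {}" using ev_zero zero_closed by blast
  qed (auto simp: ev_add ev_minus)
  have "\<one>\<^bsub>?L\<^esub> \<in> carrier ?L - ?M" by (simp add: ev_one[OF i])
  then have ne: "?M \<noteq> carrier ?L" by blast
  have "L' = ?M \<or> L' = carrier ?L" if L': "left_ideal ?L L'" and MsubL: "?M \<subseteq> L'" for L'
  proof (rule disjCI)
    have L'g: "subgroup L' (add_monoid ?L)" using L' by (simp add: left_ideal_def)
    have L'c: "L' \<subseteq> carrier ?L" using subgroup.subset[OF L'g] by simp
    have L'add: "X \<oplus>\<^bsub>?L\<^esub> Y \<in> L'" if "X \<in> L'" "Y \<in> L'" for X Y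
      using subgroup.m_closed[OF L'g that] by simp
    assume "L' \<noteq> carrier ?L"
    show "L' = ?M"
    proof (rule ccontr)
      assume "L' \<noteq> ?M"
      then obtain F where F: "F \<in> L'" "ev F i \<noteq> 0" using MsubL L'c by blast
      have Fc: "F \<in> carrier ?L" using F L'c by blast
      have "G \<in> L'" if G: "G \<in> carrier ?L" for G
      proof -
        define S where "S = scalar Q (ev G i / ev F i)"
        have S: "S \<in> carrier ?L" "ev S i = ev G i / ev F i"
          using scalar_coords i by (auto simp: S_def)
        have SF: "S \<otimes>\<^bsub>?L\<^esub> F \<in> L'" using L' S F by (auto simp: left_ideal_def)
        have SFc: "S \<otimes>\<^bsub>?L\<^esub> F \<in> carrier ?L" using S Fc by simp
        have "G \<ominus>\<^bsub>?L\<^esub> (S \<otimes>\<^bsub>?L\<^esub> F) \<in> ?M"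
          using G SFc ev_minus[OF SFc] F S Fc
          by (auto simp: a_minus_def ev_add(1) ev_mult(1))
        then have "(G \<ominus>\<^bsub>?L\<^esub> (S \<otimes>\<^bsub>?L\<^esub> F)) \<oplus>\<^bsub>?L\<^esub> (S \<otimes>\<^bsub>?L\<^esub> F) \<in> L'" using MsubL SF L'add by blast
        moreover have "(G \<ominus>\<^bsub>?L\<^esub> (S \<otimes>\<^bsub>?L\<^esub> F)) \<oplus>\<^bsub>?L\<^esub> (S \<otimes>\<^bsub>?L\<^esub> F) = G"
          using G SFc by (simp add: a_minus_def a_assoc l_neg)
        ultimately show ?thesis by simp
      qed
      with \<open>L' \<noteq> carrier ?L\<close> L'c show False by blast
    qed
  qed
  with sub ne show ?thesis by (auto simp: maximal_left_ideal_def left_ideal_def ev_mult)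
qed

text \<open>The elements without idempotent part form an ideal of square zero, and a nilpotent left
  ideal lies in every maximal one.\<close>

lemma jacobson_radical_eq:
  "jacobson_radical (bound_algebra Q) =
     {X \<in> carrier (bound_algebra Q). \<forall>i\<in>verts Q. ev X i = (0::'k::field)}" (is "_ = ?J")
proof
  let ?L = "bound_algebra Q :: ('v \<times> 'a list \<Rightarrow> 'k) set ring"
  interpret ring ?L by (rule bound_algebra_ring)
  show "jacobson_radical ?L \<subseteq> ?J"
    using coordinate_left_ideal by (auto simp: jacobson_radical_def)
  show "?J \<subseteq> jacobson_radical ?L"
  proof
    fix X assume X: "X \<in> ?J"
    have "X \<in> L" if L: "maximal_left_ideal ?L L" for L
    proof (rule ccontr)
      assume XL: "X \<notin> L"
      have Lli: "left_ideal ?L L" using L by (simp add: maximal_left_ideal_def)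
      then have Lg: "subgroup L (add_monoid ?L)" and Lm: "\<And>A Y. A \<in> carrier ?L \<Longrightarrow> Y \<in> L \<Longrightarrow> A \<otimes>\<^bsub>?L\<^esub> Y \<in> L"
        by (auto simp: left_ideal_def)
      have Lc: "L \<subseteq> carrier ?L" using subgroup.subset[OF Lg] by simp
      have L0: "\<zero>\<^bsub>?L\<^esub> \<in> L" using subgroup.one_closed[OF Lg] by simp
      have La: "Y \<oplus>\<^bsub>?L\<^esub> Z \<in> L" if "Y \<in> L" "Z \<in> L" for Y Z using subgroup.m_closed[OF Lg that] by simp
      have Li: "\<ominus>\<^bsub>?L\<^esub> Y \<in> L" if "Y \<in> L" for Y
        using subgroup.m_inv_closed[OF Lg that] by (simp add: a_inv_def)
      \<comment> \<open>The left ideal generated by \<open>L\<close> and \<open>X\<close>;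
        maximality of \<open>L\<close> will force it to contain 1.\<close>
      define L' where "L' = {Y \<oplus>\<^bsub>?L\<^esub> A \<otimes>\<^bsub>?L\<^esub> X | Y A. Y \<in> L \<and> A \<in> carrier ?L}"
      have L'I: "Y \<oplus>\<^bsub>?L\<^esub> A \<otimes>\<^bsub>?L\<^esub> X \<in> L'" if "Y \<in> L" "A \<in> carrier ?L" for Y A
        using that by (auto simp: L'_def)
      have Xc: "X \<in> carrier ?L" using X by simp
      have "left_ideal ?L L'"
        unfolding left_ideal_def
      proof (intro conjI ballI)
        show "subgroup L' (add_monoid ?L)"
        proof (rule add.subgroupI)
          show "L' \<subseteq> carrier ?L" using Lc Xc by (auto simp: L'_def)
          show "L' \<noteq> {}" using L'I[OF L0 zero_closed] by blast
          fix Z assume "Z \<in> L'"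
          then obtain Y A where Z: "Y \<in> L" "A \<in> carrier ?L" "Z = Y \<oplus>\<^bsub>?L\<^esub> A \<otimes>\<^bsub>?L\<^esub> X"
            by (auto simp: L'_def)
          have Yc: "Y \<in> carrier ?L" using Z Lc by blast
          have "\<ominus>\<^bsub>?L\<^esub> Z = \<ominus>\<^bsub>?L\<^esub> Y \<oplus>\<^bsub>?L\<^esub> (\<ominus>\<^bsub>?L\<^esub> A) \<otimes>\<^bsub>?L\<^esub> X"
            using Z Yc Xc by (simp add: minus_add l_minus)
          then show "\<ominus>\<^bsub>?L\<^esub> Z \<in> L'" using L'I[OF Li[OF Z(1)], of "\<ominus>\<^bsub>?L\<^esub> A"] Z by simp
          fix Z' assume "Z' \<in> L'"
          then obtain Y' A' where Z': "Y' \<in> L" "A' \<in> carrier ?L" "Z' = Y' \<oplus>\<^bsub>?L\<^esub> A' \<otimes>\<^bsub>?L\<^esub> X"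
            by (auto simp: L'_def)
          have Y'c: "Y' \<in> carrier ?L" using Z' Lc by blast
          have "Z \<oplus>\<^bsub>?L\<^esub> Z' = (Y \<oplus>\<^bsub>?L\<^esub> Y') \<oplus>\<^bsub>?L\<^esub> (A \<oplus>\<^bsub>?L\<^esub> A') \<otimes>\<^bsub>?L\<^esub> X"
            using Z Z' Yc Y'c Xc by (simp add: l_distr a_ac)
          then show "Z \<oplus>\<^bsub>?L\<^esub> Z' \<in> L'" using L'I[OF La[OF Z(1) Z'(1)], of "A \<oplus>\<^bsub>?L\<^esub> A'"] Z Z' by simp
        qed
        fix B Z assume B: "B \<in> carrier ?L" and "Z \<in> L'"
        then obtain Y A where Z: "Y \<in> L" "A \<in> carrier ?L" "Z = Y \<oplus>\<^bsub>?L\<^esub> A \<otimes>\<^bsub>?L\<^esub> X"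
          by (auto simp: L'_def)
        have Yc: "Y \<in> carrier ?L" using Z Lc by blast
        have "B \<otimes>\<^bsub>?L\<^esub> Z = B \<otimes>\<^bsub>?L\<^esub> Y \<oplus>\<^bsub>?L\<^esub> (B \<otimes>\<^bsub>?L\<^esub> A) \<otimes>\<^bsub>?L\<^esub> X"
          using Z Yc B Xc by (simp add: r_distr m_assoc)
        then show "B \<otimes>\<^bsub>?L\<^esub> Z \<in> L'" using L'I[OF Lm[OF B Z(1)], of "B \<otimes>\<^bsub>?L\<^esub> A"] B Z by simp
      qed
      moreover have "L \<subseteq> L'"
      proof
        fix Y assume Y: "Y \<in> L"
        then have "Y \<oplus>\<^bsub>?L\<^esub> \<zero>\<^bsub>?L\<^esub> \<otimes>\<^bsub>?L\<^esub> X = Y" using Lc Xc by auto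
        then show "Y \<in> L'" using L'I[OF Y zero_closed] by simp
      qed
      moreover have "X \<in> L'" using L'I[OF L0 one_closed] Xc by simp
      ultimately have "L' = carrier ?L" using L XL by (auto simp: maximal_left_ideal_def)
      then obtain Y A where YA: "Y \<in> L" "A \<in> carrier ?L" "\<one>\<^bsub>?L\<^esub> = Y \<oplus>\<^bsub>?L\<^esub> A \<otimes>\<^bsub>?L\<^esub> X"
        using one_closed unfolding L'_def by blast
      have Yc: "Y \<in> carrier ?L" using YA Lc by blast
      \<comment> \<open>Both factors \<open>X\<close> lack a vertex part, so \<open>X A X\<close>
        has neither a vertex part nor an arrow part. Multiplying \<open>1 = Y + A X\<close> by
        \<open>X\<close> from the left then gives \<open>X = X Y\<close>, an element of
        \<open>L\<close>.\<close>
      have "X \<otimes>\<^bsub>?L\<^esub> (A \<otimes>\<^bsub>?L\<^esub> X) = \<zero>\<^bsub>?L\<^esub>"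
        by (rule bound_algebra_eqI)
          (use X YA Xc in \<open>auto simp: ev_mult ev_zero ar_zero\<close>)
      then have "X = X \<otimes>\<^bsub>?L\<^esub> Y"
        using arg_cong[OF YA(3), of "\<lambda>Z. X \<otimes>\<^bsub>?L\<^esub> Z"] Xc Yc YA(2) by (simp add: r_distr)
      then show False using Lm[OF Xc YA(1)] XL by simp
    qed
    then show "X \<in> jacobson_radical ?L" using X by (auto simp: jacobson_radical_def)
  qed
qed

end


section \<open>Point modules\<close>

text \<open>The vector has the shape of one component of \<open>point_smult\<close>; the lemma lets
  a matrix pass through the action of an algebra element.\<close>

lemma mult_mat_vec_lincomb:
  assumes A: "(A :: 'k::field mat) \<in> carrier_mat m n" and w: "w \<in> carrier_vec n"
    and u: "\<And>b. b \<in> S \<Longrightarrow> u b \<in> carrier_vec n" and i: "i < m"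
  shows "(A *\<^sub>v vec n (\<lambda>k. c * w $ k + (\<Sum>b\<in>S. r b * u b $ k))) $ i =
    c * (A *\<^sub>v w) $ i + (\<Sum>b\<in>S. r b * (A *\<^sub>v u b) $ i)"
proof -
  have "(A *\<^sub>v vec n (\<lambda>k. c * w $ k + (\<Sum>b\<in>S. r b * u b $ k))) $ i =
      (\<Sum>j<n. A $$ (i,j) * (c * w $ j + (\<Sum>b\<in>S. r b * u b $ j)))"
    by (subst mult_mat_vec_sum[OF A _ i]) auto
  also have "\<dots> = c * (\<Sum>j<n. A $$ (i,j) * w $ j) + (\<Sum>j<n. \<Sum>b\<in>S. r b * (A $$ (i,j) * u b $ j))"
    by (simp add: distrib_left sum.distrib sum_distrib_left mult.left_commute)
  also have "(\<Sum>j<n. \<Sum>b\<in>S. r b * (A $$ (i,j) * u b $ j)) = (\<Sum>b\<in>S. r b * (\<Sum>j<n. A $$ (i,j) * u b $ j))"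
    by (subst sum.swap) (simp add: sum_distrib_left)
  also have "\<dots> = (\<Sum>b\<in>S. r b * (A *\<^sub>v u b) $ i)"
    using mult_mat_vec_sum[OF A u i] by simp
  finally show ?thesis using mult_mat_vec_sum[OF A w i] by simp
qed

lemma module_homI:
  assumes "h \<in> carrier M \<rightarrow> carrier N"
    and "\<And>x y. x \<in> carrier M \<Longrightarrow> y \<in> carrier M \<Longrightarrow> h (x \<oplus>\<^bsub>M\<^esub> y) = h x \<oplus>\<^bsub>N\<^esub> h y"
    and "\<And>a x. a \<in> carrier R \<Longrightarrow> x \<in> carrier M \<Longrightarrow> h (a \<odot>\<^bsub>M\<^esub> x) = a \<odot>\<^bsub>N\<^esub> h x"
  shows "h \<in> module_hom R M N"
  using assms by (simp add: module_hom_def)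

lemma module_iso_iff_hom:
  "h \<in> module_iso R M N \<longleftrightarrow> h \<in> module_hom R M N \<and> bij_betw h (carrier M) (carrier N)"
  by (auto simp: module_iso_def module_hom_def bij_betw_def)

lemma modules_isomorphic_trans:
  assumes "modules_isomorphic R M N" "modules_isomorphic R N P"
  shows "modules_isomorphic R M P"
proof -
  obtain g h where g: "g \<in> module_iso R M N" and h: "h \<in> module_iso R N P"
    using assms by (auto simp: modules_isomorphic_def)
  have "g x \<in> carrier N" if "x \<in> carrier M" for x
    using g that by (auto simp: module_iso_def bij_betw_def)
  then have "h \<circ> g \<in> module_iso R M P"
    using g h by (auto simp: module_iso_def intro: bij_betw_trans)
  then show ?thesis by (auto simp: modules_isomorphic_def)
qed

lemma modules_isomorphic_sym:
  assumes M: "left_module R M" and MN: "modules_isomorphic R M N"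
  shows "modules_isomorphic R N M"
proof -
  interpret left_module R M by (rule M)
  obtain h where h: "h \<in> module_iso R M N" using MN by (auto simp: modules_isomorphic_def)
  define g where "g = inv_into (carrier M) h"
  have bij: "bij_betw h (carrier M) (carrier N)" using h by (simp add: module_iso_def)
  have g: "bij_betw g (carrier N) (carrier M)" unfolding g_def by (rule bij_betw_inv_into[OF bij])
  have gh: "g (h x) = x" if "x \<in> carrier M" for x
    using bij that by (simp add: g_def bij_betw_inv_into_left)
  have hg: "h (g y) = y" "g y \<in> carrier M" if "y \<in> carrier N" for y
    using bij that g by (auto simp: g_def bij_betw_inv_into_right bij_betw_def)
  have "g (y \<oplus>\<^bsub>N\<^esub> z) = g y \<oplus>\<^bsub>M\<^esub> g z" if "y \<in> carrier N" "z \<in> carrier N" for y z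
  proof -
    have "y \<oplus>\<^bsub>N\<^esub> z = h (g y \<oplus>\<^bsub>M\<^esub> g z)" using h that hg by (simp add: module_iso_def)
    then show ?thesis using gh hg that by simp
  qed
  moreover have "g (a \<odot>\<^bsub>N\<^esub> y) = a \<odot>\<^bsub>M\<^esub> g y" if "a \<in> carrier R" "y \<in> carrier N" for a y
  proof -
    have "a \<odot>\<^bsub>N\<^esub> y = h (a \<odot>\<^bsub>M\<^esub> g y)" using h that hg by (simp add: module_iso_def)
    then show ?thesis using gh hg that smult_closed by simp
  qed
  ultimately have "g \<in> module_iso R N M" using g by (simp add: module_iso_def)
  then show ?thesis by (auto simp: modules_isomorphic_def)
qed

context finite_quiver
begin

lemma coord_carrier: "v \<in> carrier (coord_space Q d) \<longleftrightarrow> v \<in> (\<Pi>\<^sub>E i\<in>verts Q. carrier_vec (d i))"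
  by (simp add: coord_space_def)

lemma coord_memD: "v \<in> carrier (coord_space Q d) \<Longrightarrow> i \<in> verts Q \<Longrightarrow> v i \<in> carrier_vec (d i)"
  by (auto simp: coord_space_def)

lemma coord_ops:
  "i \<in> verts Q \<Longrightarrow> (v \<oplus>\<^bsub>coord_space Q d\<^esub> w) i = v i + w i"
  "i \<in> verts Q \<Longrightarrow> (c \<odot>\<^bsub>coord_space Q d\<^esub> v) i = c \<cdot>\<^sub>v v i"
  "i \<in> verts Q \<Longrightarrow> \<zero>\<^bsub>coord_space Q d\<^esub> i = 0\<^sub>v (d i)"
  by (simp_all add: coord_space_def)

lemma coord_closed:
  "v \<in> carrier (coord_space Q d) \<Longrightarrow> w \<in> carrier (coord_space Q d) \<Longrightarrow>
     v \<oplus>\<^bsub>coord_space Q d\<^esub> w \<in> carrier (coord_space Q d)"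
  "v \<in> carrier (coord_space Q d) \<Longrightarrow> c \<odot>\<^bsub>coord_space Q d\<^esub> v \<in> carrier (coord_space Q d)"
  "\<zero>\<^bsub>coord_space Q d\<^esub> \<in> carrier (coord_space Q d)"
  by (auto simp: coord_space_def PiE_iff)

lemma coord_eqI:
  assumes "v \<in> carrier (coord_space Q d)" "w \<in> carrier (coord_space Q d)"
    and "\<And>i k. i \<in> verts Q \<Longrightarrow> k < d i \<Longrightarrow> v i $ k = w i $ k"
  shows "v = w"
proof (rule PiE_ext)
  show "v \<in> (\<Pi>\<^sub>E i\<in>verts Q. carrier_vec (d i))" "w \<in> (\<Pi>\<^sub>E i\<in>verts Q. carrier_vec (d i))"
    using assms by (simp_all add: coord_carrier)
  fix i assume i: "i \<in> verts Q"
  show "v i = w i"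
    using coord_memD[OF assms(1) i] coord_memD[OF assms(2) i] assms(3)[OF i] by (intro eq_vecI) auto
qed

lemma coord_abelian_group: "abelian_group (coord_space Q d :: ('k::field, 'v \<Rightarrow> 'k vec) module)"
proof (rule abelian_groupI)
  let ?V = "coord_space Q d :: ('k, 'v \<Rightarrow> 'k vec) module"
  fix x y z assume x: "x \<in> carrier ?V" and y: "y \<in> carrier ?V" and z: "z \<in> carrier ?V"
  note c = coord_memD[OF x, THEN carrier_vecD] coord_memD[OF y, THEN carrier_vecD]
    coord_memD[OF z, THEN carrier_vecD]
  show "x \<oplus>\<^bsub>?V\<^esub> y \<in> carrier ?V" by (rule coord_closed(1)[OF x y])
  show "(x \<oplus>\<^bsub>?V\<^esub> y) \<oplus>\<^bsub>?V\<^esub> z = x \<oplus>\<^bsub>?V\<^esub> (y \<oplus>\<^bsub>?V\<^esub> z)"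
    by (rule coord_eqI) (use c in \<open>auto simp: coord_ops add.assoc intro!: coord_closed x y z\<close>)
  show "x \<oplus>\<^bsub>?V\<^esub> y = y \<oplus>\<^bsub>?V\<^esub> x"
    by (rule coord_eqI) (use c in \<open>auto simp: coord_ops add.commute intro!: coord_closed x y z\<close>)
  show "\<zero>\<^bsub>?V\<^esub> \<oplus>\<^bsub>?V\<^esub> x = x"
    by (rule coord_eqI) (use c in \<open>auto simp: coord_ops intro!: coord_closed x\<close>)
  have m: "(-1) \<odot>\<^bsub>?V\<^esub> x \<in> carrier ?V" by (rule coord_closed(2)[OF x])
  have "(-1) \<odot>\<^bsub>?V\<^esub> x \<oplus>\<^bsub>?V\<^esub> x = \<zero>\<^bsub>?V\<^esub>"
    by (rule coord_eqI) (use c in \<open>auto simp: coord_ops intro!: coord_closed x\<close>)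
  with m show "\<exists>y\<in>carrier ?V. y \<oplus>\<^bsub>?V\<^esub> x = \<zero>\<^bsub>?V\<^esub>" by blast
qed (rule coord_closed(3))

lemma coord_finsum:
  fixes g :: "'b \<Rightarrow> 'v \<Rightarrow> 'k::field vec"
  assumes S: "finite S" and g: "\<And>p. p \<in> S \<Longrightarrow> g p \<in> carrier (coord_space Q d)"
    and j: "j \<in> verts Q" and k: "k < d j"
  shows "finsum (coord_space Q d) g S j $ k = (\<Sum>p\<in>S. g p j $ k)"
proof -
  interpret abelian_group "coord_space Q d :: ('k, 'v \<Rightarrow> 'k vec) module" by (rule coord_abelian_group)
  show ?thesis
    using S g
  proof (induction S rule: finite_induct)
    case empty
    then show ?case using j k by (simp add: coord_ops)
  next
    case (insert p S)
    then have c: "g p \<in> carrier (coord_space Q d)" "g \<in> S \<rightarrow> carrier (coord_space Q d)" by auto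
    have "finsum (coord_space Q d) g S \<in> carrier (coord_space Q d)" using c by (simp add: finsum_closed)
    then have "finsum (coord_space Q d) g S j \<in> carrier_vec (d j)" "g p j \<in> carrier_vec (d j)"
      using coord_memD[OF _ j] c(1) by blast+
    then show ?case using insert c j k by (simp add: coord_ops)
  qed
qed

lemma matrix_tuplesD: "y \<in> matrix_tuples Q m n \<Longrightarrow> a \<in> arcs Q \<Longrightarrow> y a \<in> carrier_mat (n (head Q a)) (m (tail Q a))"
  by (auto simp: matrix_tuples_def)

lemma coord_proj_closed:
  "v \<in> carrier (coord_space Q d) \<Longrightarrow> coord_proj Q d i v \<in> carrier (coord_space Q d)"
  by (auto simp: coord_space_def coord_proj_def)

lemma arrow_map_closed:
  "y \<in> matrix_tuples Q m d \<Longrightarrow> a \<in> arcs Q \<Longrightarrow> v \<in> carrier (coord_space Q m) \<Longrightarrow>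
    arrow_map Q d y a v \<in> carrier (coord_space Q d)"
  using matrix_tuplesD[of y m d a] coord_memD[of v m "tail Q a"]
  by (auto simp: coord_carrier arrow_map_def)

definition square_zero :: "('v \<Rightarrow> nat) \<Rightarrow> ('a \<Rightarrow> 'k::field mat) \<Rightarrow> bool" where
  "square_zero d y \<longleftrightarrow> (\<forall>a\<in>arcs Q. \<forall>b\<in>arcs Q. head Q a = tail Q b \<longrightarrow>
     (\<forall>v\<in>carrier_vec (d (tail Q a)). y b *\<^sub>v (y a *\<^sub>v v) = 0\<^sub>v (d (head Q b))))"

lemma path_act_closed:
  assumes y: "y \<in> matrix_tuples Q d d" and q: "q \<in> quiver_paths Q" and v: "v \<in> carrier (coord_space Q d)"
  shows "path_act (coord_proj Q d) (arrow_map Q d y) q v \<in> carrier (coord_space Q d)"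
proof -
  obtain u p where up: "q = (u, p)" by (cases q)
  have "set p \<subseteq> arcs Q" using q up by (auto simp: quiver_paths_iff awalk_def)
  then have "fold (arrow_map Q d y) p w \<in> carrier (coord_space Q d)" if "w \<in> carrier (coord_space Q d)" for w
    using that by (induction p arbitrary: w) (auto intro: arrow_map_closed[OF y])
  then show ?thesis using up coord_proj_closed[OF v] by (simp add: path_act_def)
qed

lemma fold_arrow_map_zero:
  assumes y: "y \<in> matrix_tuples Q d d" and p: "set p \<subseteq> arcs Q"
  shows "fold (arrow_map Q d y) p \<zero>\<^bsub>coord_space Q d\<^esub> = (\<zero>\<^bsub>coord_space Q d\<^esub> :: 'v \<Rightarrow> 'k::field vec)"
proof -
  have "arrow_map Q d y a \<zero>\<^bsub>coord_space Q d\<^esub> = \<zero>\<^bsub>coord_space Q d\<^esub>" if a: "a \<in> arcs Q" for a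
  proof (rule coord_eqI)
    fix i k assume "i \<in> verts Q" "k < d i"
    then show "arrow_map Q d y a \<zero>\<^bsub>coord_space Q d\<^esub> i $ k = \<zero>\<^bsub>coord_space Q d\<^esub> i $ k"
      using matrix_tuplesD[OF y a] a by (auto simp: arrow_map_def coord_ops)
  qed (auto intro!: arrow_map_closed[OF y a] coord_closed)
  then show ?thesis using p by (induction p) auto
qed

lemma path_act_two:
  assumes y: "y \<in> matrix_tuples Q d d" and ab: "a \<in> arcs Q" "b \<in> arcs Q" "head Q a = tail Q b"
    and v: "v \<in> carrier (coord_space Q d)"
  shows "path_act (coord_proj Q d) (arrow_map Q d y) (tail Q a, [a, b]) v =
    (\<lambda>j\<in>verts Q. if j = head Q b then y b *\<^sub>v (y a *\<^sub>v v (tail Q a)) else 0\<^sub>v (d j))"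
  using ab by (auto simp: path_act_def arrow_map_def coord_proj_def fun_eq_iff)

text \<open>The first two arrows already give zero, and the remaining ones keep it.\<close>

lemma path_act_long:
  assumes y: "y \<in> matrix_tuples Q d d" and sq: "square_zero d y" and q: "q \<in> quiver_paths Q"
    and len: "2 \<le> length (snd q)" and v: "v \<in> carrier (coord_space Q d)"
  shows "path_act (coord_proj Q d) (arrow_map Q d y) q v = (\<zero>\<^bsub>coord_space Q d\<^esub> :: 'v \<Rightarrow> 'k::field vec)"
proof -
  obtain u a b p where up: "q = (u, a # b # p)"
    using len by (cases q, cases "snd q", simp, cases "tl (snd q)") auto
  have arcs: "a \<in> arcs Q" "b \<in> arcs Q" "set p \<subseteq> arcs Q" "u = tail Q a" "head Q a = tail Q b"
    using q up by (auto simp: quiver_paths_iff awalk_def)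
  have "path_act (coord_proj Q d) (arrow_map Q d y) (u, [a, b]) v = \<zero>\<^bsub>coord_space Q d\<^esub>"
    unfolding arcs(4) path_act_two[OF y arcs(1,2,5) v]
    using sq arcs coord_memD[OF v, of "tail Q a"]
    by (auto simp: square_zero_def coord_space_def fun_eq_iff)
  then show ?thesis
    using fold_arrow_map_zero[OF y arcs(3)] up by (simp add: path_act_def)
qed

text \<open>Component \<open>j\<close> receives contributions from the trivial path at
  \<open>j\<close> and from the arrows into \<open>j\<close>; the other short paths end elsewhere,
  and longer paths act as zero.\<close>

lemma path_algebra_act_apply:
  fixes f :: "'v \<times> 'a list \<Rightarrow> 'k::field"
  assumes y: "y \<in> matrix_tuples Q d d" and sq: "square_zero d y"
    and f: "f \<in> carrier (path_algebra Q)" and v: "v \<in> carrier (coord_space Q d)"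
  shows "path_algebra_act (coord_space Q d) (coord_proj Q d) (arrow_map Q d y) f v \<in> carrier (coord_space Q d)"
    and "j \<in> verts Q \<Longrightarrow> k < d j \<Longrightarrow>
      path_algebra_act (coord_space Q d) (coord_proj Q d) (arrow_map Q d y) f v j $ k =
      f (j, []) * v j $ k + (\<Sum>a | a \<in> arcs Q \<and> head Q a = j. f (tail Q a, [a]) * (y a *\<^sub>v v (tail Q a)) $ k)"
proof -
  let ?V = "coord_space Q d :: ('k, 'v \<Rightarrow> 'k vec) module"
  let ?P = "\<lambda>q. path_act (coord_proj Q d) (arrow_map Q d y) q v"
  interpret abelian_group ?V by (rule coord_abelian_group)
  define S where "S = {q. f q \<noteq> 0}"
  have S: "finite S" "S \<subseteq> quiver_paths Q" using f by (auto simp: S_def path_algebra_def)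
  have c: "f q \<odot>\<^bsub>?V\<^esub> ?P q \<in> carrier ?V" if "q \<in> S" for q
    by (rule coord_closed(2)[OF path_act_closed[OF y subsetD[OF S(2) that] v]])
  then show "path_algebra_act ?V (coord_proj Q d) (arrow_map Q d y) f v \<in> carrier ?V"
    unfolding path_algebra_act_def S_def[symmetric] by (intro finsum_closed) auto
  assume j: "j \<in> verts Q" and k: "k < d j"
  define h where "h q = f q * ?P q j $ k" for q
  define A where "A = {a \<in> arcs Q. head Q a = j}"
  \<comment> \<open>The paths that can contribute. Neither the support of \<open>f\<close> nor
    \<open>T\<close> need contain the other, so the sum passes through their union.\<close>
  define T where "T = insert (j, []) ((\<lambda>a. (tail Q a, [a])) ` A)"
  have finA: "finite A" by (simp add: A_def)
  have T: "finite T" by (simp add: T_def finA)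
  have PQ: "T \<subseteq> quiver_paths Q" using j by (auto simp: T_def A_def quiver_paths_Nil quiver_paths_single)
  have h0: "h q = 0" if "q \<in> S" "q \<notin> T" for q
  proof -
    obtain u p where up: "q = (u, p)" by (cases q)
    have q: "q \<in> quiver_paths Q" using that S by blast
    consider "p = []" | a where "p = [a]" | "2 \<le> length p" by (cases p; cases "tl p") auto
    then have "?P q j $ k = 0"
    proof cases
      case 1
      then show ?thesis using that up j k by (auto simp: T_def path_act_def coord_proj_def)
    next
      case (2 a)
      then have "a \<in> arcs Q" "u = tail Q a" using q up by (auto simp: quiver_paths_single)
      then show ?thesis using 2 that up j k by (auto simp: T_def A_def path_act_def arrow_map_def)
    next
      case 3
      then have "?P q = \<zero>\<^bsub>?V\<^esub>" using path_act_long[OF y sq q _ v] up by simp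
      then show ?thesis using j k by (simp add: coord_ops)
    qed
    then show ?thesis by (simp add: h_def)
  qed
  have "path_algebra_act ?V (coord_proj Q d) (arrow_map Q d y) f v j $ k =
      (\<Sum>q\<in>S. (f q \<odot>\<^bsub>?V\<^esub> ?P q) j $ k)"
    unfolding path_algebra_act_def S_def[symmetric] by (rule coord_finsum[OF S(1) c j k])
  also have "\<dots> = (\<Sum>q\<in>S. h q)"
  proof (rule sum.cong[OF refl])
    fix q assume "q \<in> S"
    then have "?P q j \<in> carrier_vec (d j)" using coord_memD[OF path_act_closed[OF y _ v] j] S by blast
    then show "(f q \<odot>\<^bsub>?V\<^esub> ?P q) j $ k = h q" using j k by (simp add: h_def coord_ops)
  qed
  also have "\<dots> = (\<Sum>q\<in>S \<union> T. h q)"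
    by (rule sum.mono_neutral_left) (use S T in \<open>auto simp: h_def S_def\<close>)
  also have "\<dots> = (\<Sum>q\<in>T. h q)"
    by (rule sum.mono_neutral_right) (use S T h0 in auto)
  also have "\<dots> = h (j, []) + (\<Sum>a\<in>A. h (tail Q a, [a]))"
    unfolding T_def using finA by (subst sum.insert) (auto simp: sum.reindex inj_on_def)
  also have "h (j, []) = f (j, []) * v j $ k"
    using j by (simp add: h_def path_act_def coord_proj_def)
  also have "(\<Sum>a\<in>A. h (tail Q a, [a])) = (\<Sum>a\<in>A. f (tail Q a, [a]) * (y a *\<^sub>v v (tail Q a)) $ k)"
    by (rule sum.cong) (use j in \<open>auto simp: h_def A_def path_act_def arrow_map_def coord_proj_def\<close>)
  finally show "path_algebra_act ?V (coord_proj Q d) (arrow_map Q d y) f v j $ k =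
      f (j, []) * v j $ k + (\<Sum>a | a \<in> arcs Q \<and> head Q a = j. f (tail Q a, [a]) * (y a *\<^sub>v v (tail Q a)) $ k)"
    by (simp add: A_def)
qed

text \<open>The relation for the path \<open>[a, b]\<close> is tested on vectors concentrated at the
  tail of \<open>a\<close>. Conversely, \<open>path_algebra_act_apply\<close> computes the action of
  an element of the ideal, and all coefficients that occur there are zero.\<close>

lemma rep_variety_iff:
  "y \<in> rep_variety Q d \<longleftrightarrow> y \<in> matrix_tuples Q d d \<and> square_zero d (y :: 'a \<Rightarrow> 'k::field mat)"
proof (intro iffI conjI)
  let ?V = "coord_space Q d :: ('k, 'v \<Rightarrow> 'k vec) module"
  interpret abelian_group ?V by (rule coord_abelian_group)
  assume y: "y \<in> rep_variety Q d"
  then show yt: "y \<in> matrix_tuples Q d d" by (simp add: rep_variety_def)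
  show "square_zero d y"
    unfolding square_zero_def
  proof (intro ballI impI)
    fix a b and v :: "'k vec"
    assume ab: "a \<in> arcs Q" "b \<in> arcs Q" "head Q a = tail Q b" and v: "v \<in> carrier_vec (d (tail Q a))"
    let ?q = "(tail Q a, [a, b])"
    have q: "?q \<in> quiver_paths Q" using ab by (auto simp: quiver_paths_iff awalk_def)
    then have f: "path_elem ?q \<in> (length2_ideal Q :: ('v \<times> 'a list \<Rightarrow> 'k) set)"
      unfolding length2_ideal_eq using path_elem_carrier[OF q] by (auto simp: path_elem_def)
    define w where "w = (\<lambda>i\<in>verts Q. if i = tail Q a then v else 0\<^sub>v (d i))"
    have w: "w \<in> carrier ?V" using v by (auto simp: w_def coord_carrier)
    have supp: "{q. path_elem ?q q \<noteq> (0::'k)} = {?q}" by (auto simp: path_elem_def)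
    let ?P = "path_act (coord_proj Q d) (arrow_map Q d y) ?q w"
    have P: "?P \<in> carrier ?V" by (rule path_act_closed[OF yt q w])
    have "\<zero>\<^bsub>?V\<^esub> = path_algebra_act ?V (coord_proj Q d) (arrow_map Q d y) (path_elem ?q) w"
      using y f w by (auto simp: rep_variety_def)
    also have "\<dots> = 1 \<odot>\<^bsub>?V\<^esub> ?P"
      using P coord_closed(2)[OF P, of 1] unfolding path_algebra_act_def supp
      by (simp add: path_elem_def finsum_insert)
    finally have "\<zero>\<^bsub>?V\<^esub> (head Q b) = (1 \<odot>\<^bsub>?V\<^esub> ?P) (head Q b)" by simp
    then have "0\<^sub>v (d (head Q b)) = 1 \<cdot>\<^sub>v (y b *\<^sub>v (y a *\<^sub>v v))"
      unfolding path_act_two[OF yt ab w] using ab by (simp add: coord_ops w_def)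
    then show "y b *\<^sub>v (y a *\<^sub>v v) = 0\<^sub>v (d (head Q b))" by simp
  qed
next
  assume y: "y \<in> matrix_tuples Q d d \<and> square_zero d y"
  have "path_algebra_act (coord_space Q d) (coord_proj Q d) (arrow_map Q d y) f v = \<zero>\<^bsub>coord_space Q d\<^esub>"
    if f: "f \<in> length2_ideal Q" and v: "v \<in> carrier (coord_space Q d)" for f v
  proof (rule coord_eqI)
    have fc: "f \<in> carrier (path_algebra Q)" and f0: "\<And>q. length (snd q) < 2 \<Longrightarrow> f q = 0"
      using f unfolding length2_ideal_eq by auto
    note * = path_algebra_act_apply[OF conjunct1[OF y] conjunct2[OF y] fc v]
    show "path_algebra_act (coord_space Q d) (coord_proj Q d) (arrow_map Q d y) f v \<in> carrier (coord_space Q d)"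
      by (rule *(1))
    fix i k assume ik: "i \<in> verts Q" "k < d i"
    show "path_algebra_act (coord_space Q d) (coord_proj Q d) (arrow_map Q d y) f v i $ k = \<zero>\<^bsub>coord_space Q d\<^esub> i $ k"
      unfolding *(2)[OF ik] using ik by (simp add: f0 coord_ops)
  qed (rule coord_closed(3))
  then show "y \<in> rep_variety Q d" using y by (simp add: rep_variety_def)
qed

lemma coef_carrier:
  fixes X :: "('v \<times> 'a list \<Rightarrow> 'k::field) set"
  assumes "X \<in> carrier (bound_algebra Q)" shows "coef X \<in> carrier (path_algebra Q)"
proof -
  obtain f where f: "f \<in> carrier (path_algebra Q)" "X = residue Q f"
    using assms by (auto simp: bound_algebra_carrier)
  obtain h where "h \<in> length2_ideal Q" "coef X = h \<oplus>\<^bsub>path_algebra Q\<^esub> f"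
    using coef_residue_long[OF f(1)] f(2) by blast
  then show ?thesis using f(1) path_add_closed unfolding length2_ideal_eq by auto
qed

lemma point_module_simps:
  "carrier (point_module Q d y) = carrier (coord_space Q d)"
  "add (point_module Q d y) = add (coord_space Q d)"
  "zero (point_module Q d y) = zero (coord_space Q d)"
  by (simp_all add: point_module_def operator_module_def)

text \<open>From here on the chosen representative of a residue class is gone: the action is
  expressed by the coordinates \<open>ev\<close> and \<open>ar\<close>.\<close>

lemma point_smult:
  fixes X :: "('v \<times> 'a list \<Rightarrow> 'k::field) set"
  assumes y: "y \<in> rep_variety Q d" and X: "X \<in> carrier (bound_algebra Q)" and v: "v \<in> carrier (coord_space Q d)"
  shows "X \<odot>\<^bsub>point_module Q d y\<^esub> v = (\<lambda>j\<in>verts Q. vec (d j) (\<lambda>k. ev X j * v j $ k +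
      (\<Sum>a | a \<in> arcs Q \<and> head Q a = j. ar X a * (y a *\<^sub>v v (tail Q a)) $ k)))" (is "_ = ?w")
proof (rule coord_eqI)
  have yt: "y \<in> matrix_tuples Q d d" and sq: "square_zero d y" using y by (auto simp: rep_variety_iff)
  note * = path_algebra_act_apply[OF yt sq coef_carrier[OF X] v]
  have eq: "X \<odot>\<^bsub>point_module Q d y\<^esub> v =
      path_algebra_act (coord_space Q d) (coord_proj Q d) (arrow_map Q d y) (coef X) v"
    by (simp add: point_module_def operator_module_def coef_def)
  show "X \<odot>\<^bsub>point_module Q d y\<^esub> v \<in> carrier (coord_space Q d)" unfolding eq by (rule *(1))
  show "?w \<in> carrier (coord_space Q d)" by (simp add: coord_carrier)
  fix i k assume "i \<in> verts Q" "k < d i"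
  then show "(X \<odot>\<^bsub>point_module Q d y\<^esub> v) i $ k = ?w i $ k"
    unfolding eq by (simp add: *(2) ev_def ar_def)
qed

lemma point_smult_closed:
  fixes X :: "('v \<times> 'a list \<Rightarrow> 'k::field) set"
  assumes "y \<in> rep_variety Q d" "X \<in> carrier (bound_algebra Q)" "v \<in> carrier (coord_space Q d)"
  shows "X \<odot>\<^bsub>point_module Q d y\<^esub> v \<in> carrier (coord_space Q d)"
  unfolding point_smult[OF assms] by (simp add: coord_carrier)

lemma point_smult_nth:
  fixes X :: "('v \<times> 'a list \<Rightarrow> 'k::field) set"
  assumes "y \<in> rep_variety Q d" "X \<in> carrier (bound_algebra Q)" "v \<in> carrier (coord_space Q d)"
    and "j \<in> verts Q" "k < d j"
  shows "(X \<odot>\<^bsub>point_module Q d y\<^esub> v) j $ k = ev X j * v j $ k +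
      (\<Sum>a | a \<in> arcs Q \<and> head Q a = j. ar X a * (y a *\<^sub>v v (tail Q a)) $ k)"
  unfolding point_smult[OF assms(1-3)] using assms(4,5) by simp

lemma mult_point_smult:
  fixes X :: "('v \<times> 'a list \<Rightarrow> 'k::field) set"
  assumes y: "y \<in> rep_variety Q d" and X: "X \<in> carrier (bound_algebra Q)" and v: "v \<in> carrier (coord_space Q d)"
    and j: "j \<in> verts Q" and A: "A \<in> carrier_mat m (d j)" and k: "k < m"
  shows "(A *\<^sub>v (X \<odot>\<^bsub>point_module Q d y\<^esub> v) j) $ k = ev X j * (A *\<^sub>v v j) $ k +
      (\<Sum>a | a \<in> arcs Q \<and> head Q a = j. ar X a * (A *\<^sub>v (y a *\<^sub>v v (tail Q a))) $ k)"
proof -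
  have yt: "y \<in> matrix_tuples Q d d" using y by (auto simp: rep_variety_iff)
  have "(X \<odot>\<^bsub>point_module Q d y\<^esub> v) j = vec (d j) (\<lambda>k. ev X j * v j $ k +
      (\<Sum>a | a \<in> arcs Q \<and> head Q a = j. ar X a * (y a *\<^sub>v v (tail Q a)) $ k))"
    unfolding point_smult[OF y X v] using j by simp
  then show ?thesis
    using mult_mat_vec_lincomb[OF A coord_memD[OF v j] _ k, of "{a \<in> arcs Q. head Q a = j}"
        "\<lambda>a. y a *\<^sub>v v (tail Q a)" "ev X j" "ar X"] matrix_tuplesD[OF yt] coord_memD[OF v]
    by force
qed

lemma point_left_module:
  assumes y: "y \<in> rep_variety Q d"
  shows "left_module (bound_algebra Q) (point_module Q d (y :: 'a \<Rightarrow> 'k::field mat))"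
proof -
  let ?L = "bound_algebra Q :: ('v \<times> 'a list \<Rightarrow> 'k) set ring"
  let ?M = "point_module Q d y" and ?V = "coord_space Q d :: ('k, 'v \<Rightarrow> 'k vec) module"
  interpret L: ring ?L by (rule bound_algebra_ring)
  interpret V: abelian_group ?V by (rule coord_abelian_group)
  have yt: "y \<in> matrix_tuples Q d d" and sq: "square_zero d y" using y by (auto simp: rep_variety_iff)
  have yv: "y a *\<^sub>v v (tail Q a) \<in> carrier_vec (d (head Q a))" "v (tail Q a) \<in> carrier_vec (d (tail Q a))"
    if "a \<in> arcs Q" "v \<in> carrier ?V" for a v
    using matrix_tuplesD[OF yt that(1)] coord_memD[OF that(2), of "tail Q a"] that by auto
  have "abelian_group ?M"
  proof (rule abelian_groupI)
    fix x assume "x \<in> carrier ?M"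
    then show "\<exists>y\<in>carrier ?M. y \<oplus>\<^bsub>?M\<^esub> x = \<zero>\<^bsub>?M\<^esub>"
      using V.l_neg V.a_inv_closed unfolding point_module_simps by blast
  qed (auto simp: point_module_simps V.a_ac)
  moreover have "left_module_axioms ?L ?M"
  proof
    fix v assume "v \<in> carrier ?M"
    then have vV: "v \<in> carrier ?V" by (simp add: point_module_simps)
    show "\<one>\<^bsub>?L\<^esub> \<odot>\<^bsub>?M\<^esub> v = v"
      by (rule coord_eqI[OF point_smult_closed[OF y L.one_closed vV] vV])
        (simp add: point_smult_nth[OF y L.one_closed vV] ev_one ar_one)
  next
    fix X Y v w assume X: "X \<in> carrier ?L" and v: "v \<in> carrier ?M"
    note vV = v[unfolded point_module_simps]
    show "X \<odot>\<^bsub>?M\<^esub> v \<in> carrier ?M" using point_smult_closed[OF y X vV] by (simp add: point_module_simps)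
    {
      assume Y: "Y \<in> carrier ?L"
      note XY = L.a_closed[OF X Y] and XYm = L.m_closed[OF X Y]
      note Yv = point_smult_closed[OF y Y vV]
      show "(X \<oplus>\<^bsub>?L\<^esub> Y) \<odot>\<^bsub>?M\<^esub> v = X \<odot>\<^bsub>?M\<^esub> v \<oplus>\<^bsub>?M\<^esub> Y \<odot>\<^bsub>?M\<^esub> v"
        unfolding point_module_simps
      proof (rule coord_eqI[OF point_smult_closed[OF y XY vV]
            coord_closed(1)[OF point_smult_closed[OF y X vV] Yv]])
        fix j k assume jk: "j \<in> verts Q" "k < d j"
        have "(Y \<odot>\<^bsub>?M\<^esub> v) j \<in> carrier_vec (d j)" by (rule coord_memD[OF Yv jk(1)])
        then show "((X \<oplus>\<^bsub>?L\<^esub> Y) \<odot>\<^bsub>?M\<^esub> v) j $ k = (X \<odot>\<^bsub>?M\<^esub> v \<oplus>\<^bsub>?V\<^esub> Y \<odot>\<^bsub>?M\<^esub> v) j $ k"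
          using jk by (simp add: coord_ops point_smult_nth[OF y XY vV] point_smult_nth[OF y X vV]
              point_smult_nth[OF y Y vV] ev_add[OF X Y] algebra_simps sum.distrib)
      qed
      show "(X \<otimes>\<^bsub>?L\<^esub> Y) \<odot>\<^bsub>?M\<^esub> v = X \<odot>\<^bsub>?M\<^esub> (Y \<odot>\<^bsub>?M\<^esub> v)"
      proof (rule coord_eqI[OF point_smult_closed[OF y XYm vV] point_smult_closed[OF y X Yv]])
        fix j k assume jk: "j \<in> verts Q" "k < d j"
        \<comment> \<open>The arrow part of \<open>Y\<close> disappears behind a second arrow
          \<open>a\<close>, which is where the zero relations enter; what is left matches the
          product formula \<open>ev_mult\<close>.\<close>
        have *: "(y a *\<^sub>v (Y \<odot>\<^bsub>?M\<^esub> v) (tail Q a)) $ k = ev Y (tail Q a) * (y a *\<^sub>v v (tail Q a)) $ k"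
          if a: "a \<in> arcs Q" "head Q a = j" for a
        proof -
          have "y a *\<^sub>v (y b *\<^sub>v v (tail Q b)) = 0\<^sub>v (d j)" if "b \<in> arcs Q" "head Q b = tail Q a" for b
            using sq a that yv(2)[OF that(1) vV] by (auto simp: square_zero_def)
          then show ?thesis
            using mult_point_smult[OF y Y vV, of "tail Q a" "y a" "d j" k] a jk(2) matrix_tuplesD[OF yt a(1)]
            by simp
        qed
        show "((X \<otimes>\<^bsub>?L\<^esub> Y) \<odot>\<^bsub>?M\<^esub> v) j $ k = (X \<odot>\<^bsub>?M\<^esub> (Y \<odot>\<^bsub>?M\<^esub> v)) j $ k"
          using jk by (simp add: point_smult_nth[OF y XYm vV] point_smult_nth[OF y X Yv]
              point_smult_nth[OF y Y vV] ev_mult[OF X Y] * algebra_simps sum.distrib sum_distrib_left)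
      qed
    }
    assume w: "w \<in> carrier ?M"
    note wV = w[unfolded point_module_simps]
    note vw = coord_closed(1)[OF vV wV]
    show "X \<odot>\<^bsub>?M\<^esub> (v \<oplus>\<^bsub>?M\<^esub> w) = X \<odot>\<^bsub>?M\<^esub> v \<oplus>\<^bsub>?M\<^esub> X \<odot>\<^bsub>?M\<^esub> w"
      unfolding point_module_simps
    proof (rule coord_eqI[OF point_smult_closed[OF y X vw]
          coord_closed(1)[OF point_smult_closed[OF y X vV] point_smult_closed[OF y X wV]]])
      fix j k assume jk: "j \<in> verts Q" "k < d j"
      have "(X \<odot>\<^bsub>?M\<^esub> w) j \<in> carrier_vec (d j)" "w j \<in> carrier_vec (d j)"
        using coord_memD[OF _ jk(1)] point_smult_closed[OF y X wV] wV by auto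
      moreover have "(y a *\<^sub>v (v (tail Q a) + w (tail Q a))) $ k =
          (y a *\<^sub>v v (tail Q a)) $ k + (y a *\<^sub>v w (tail Q a)) $ k" if a: "a \<in> arcs Q" "head Q a = j" for a
        using mult_add_distrib_mat_vec[OF matrix_tuplesD[OF yt a(1)] yv(2)[OF a(1) vV] yv(2)[OF a(1) wV]]
          carrier_matD(1)[OF matrix_tuplesD[OF yt a(1)]] a jk by simp
      ultimately show "(X \<odot>\<^bsub>?M\<^esub> (v \<oplus>\<^bsub>?V\<^esub> w)) j $ k = (X \<odot>\<^bsub>?M\<^esub> v \<oplus>\<^bsub>?V\<^esub> X \<odot>\<^bsub>?M\<^esub> w) j $ k"
        using jk by (simp add: coord_ops point_smult_nth[OF y X vw] point_smult_nth[OF y X vV]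
            point_smult_nth[OF y X wV] algebra_simps sum.distrib)
    qed
  qed
  ultimately show ?thesis by (simp add: left_module_def bound_algebra_ring)
qed

end


section \<open>Sums of images of matrices, and quotients of modules\<close>

lemma mat_eqI_vec:
  assumes A: "(A :: 'k::field mat) \<in> carrier_mat m n" and B: "B \<in> carrier_mat m n"
    and eq: "\<And>v. v \<in> carrier_vec n \<Longrightarrow> A *\<^sub>v v = B *\<^sub>v v"
  shows "A = B"
proof (rule eq_matI)
  have *: "(M *\<^sub>v unit_vec n j) $ i = M $$ (i,j)" if "M \<in> carrier_mat m n" "i < m" "j < n" for M :: "'k mat" and i j
  proof -
    have "(M *\<^sub>v unit_vec n j) $ i = (\<Sum>l<n. M $$ (i,l) * unit_vec n j $ l)"
      by (rule mult_mat_vec_sum[OF that(1) _ that(2)]) simp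
    also have "\<dots> = (\<Sum>l<n. if l = j then M $$ (i,l) else 0)"
      by (rule sum.cong) (use that in \<open>auto simp: unit_vec_def\<close>)
    finally show ?thesis using that by simp
  qed
  fix i j assume "i < dim_row B" "j < dim_col B"
  then show "A $$ (i,j) = B $$ (i,j)"
    using *[OF A, of i j] *[OF B, of i j] eq[of "unit_vec n j"] B by simp
qed (use A B in auto)

text \<open>The length \<open>n\<close> is given separately because \<open>S\<close> may be empty,
  as at a vertex without incoming arrows. Applied to the arrows into a vertex this is U_i; applied
  to transposed matrices it yields row spaces.\<close>

definition sum_range :: "nat \<Rightarrow> 'i set \<Rightarrow> ('i \<Rightarrow> 'k::field mat) \<Rightarrow> 'k vec set" where
  "sum_range n S Y = {vec n (\<lambda>k. \<Sum>a\<in>S. (Y a *\<^sub>v w a) $ k) | w. \<forall>a\<in>S. w a \<in> carrier_vec (dim_col (Y a))}"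

lemma sum_rangeI:
  "(\<And>a. a \<in> S \<Longrightarrow> w a \<in> carrier_vec (dim_col (Y a))) \<Longrightarrow>
    vec n (\<lambda>k. \<Sum>a\<in>S. (Y a *\<^sub>v w a) $ k) \<in> sum_range n S Y"
  by (auto simp: sum_range_def)

lemma sum_rangeE:
  assumes "v \<in> sum_range n S Y"
  obtains w where "\<And>a. a \<in> S \<Longrightarrow> w a \<in> carrier_vec (dim_col (Y a))"
    "v = vec n (\<lambda>k. \<Sum>a\<in>S. (Y a *\<^sub>v w a) $ k)"
  using assms by (auto simp: sum_range_def)

lemma sum_range_subspace:
  assumes Y: "\<And>a. a \<in> S \<Longrightarrow> dim_row (Y a) = n"
  shows "vec_subspace n (sum_range n S Y)"
  unfolding vec_subspace_def
proof (intro conjI ballI allI)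
  show "sum_range n S Y \<subseteq> carrier_vec n" by (auto simp: sum_range_def)
  have "vec n (\<lambda>k. \<Sum>a\<in>S. (Y a *\<^sub>v 0\<^sub>v (dim_col (Y a))) $ k) = 0\<^sub>v n"
    by (intro eq_vecI) (auto simp: Y)
  then show "0\<^sub>v n \<in> sum_range n S Y"
    using sum_rangeI[of S "\<lambda>a. 0\<^sub>v (dim_col (Y a))" Y n] by simp
  fix u assume "u \<in> sum_range n S Y"
  then obtain w where w: "\<And>a. a \<in> S \<Longrightarrow> w a \<in> carrier_vec (dim_col (Y a))"
    "u = vec n (\<lambda>k. \<Sum>a\<in>S. (Y a *\<^sub>v w a) $ k)" by (rule sum_rangeE) blast
  { fix v assume "v \<in> sum_range n S Y"
    then obtain z where z: "\<And>a. a \<in> S \<Longrightarrow> z a \<in> carrier_vec (dim_col (Y a))"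
      "v = vec n (\<lambda>k. \<Sum>a\<in>S. (Y a *\<^sub>v z a) $ k)" by (rule sum_rangeE) blast
    have "Y a *\<^sub>v (w a + z a) = Y a *\<^sub>v w a + Y a *\<^sub>v z a" if "a \<in> S" for a
      by (rule mult_add_distrib_mat_vec[of _ "dim_row (Y a)" "dim_col (Y a)"]) (use w z that in auto)
    then have "u + v = vec n (\<lambda>k. \<Sum>a\<in>S. (Y a *\<^sub>v (w a + z a)) $ k)"
      unfolding w(2) z(2) by (intro eq_vecI) (simp_all add: Y sum.distrib del: index_mult_mat_vec)
    then show "u + v \<in> sum_range n S Y" using sum_rangeI[of S "\<lambda>a. w a + z a" Y n] w z by simp }
  fix c
  have "Y a *\<^sub>v (c \<cdot>\<^sub>v w a) = c \<cdot>\<^sub>v (Y a *\<^sub>v w a)" if "a \<in> S" for a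
    by (rule mult_mat_vec[of _ "dim_row (Y a)" "dim_col (Y a)"]) (use w that in auto)
  then have "c \<cdot>\<^sub>v u = vec n (\<lambda>k. \<Sum>a\<in>S. (Y a *\<^sub>v (c \<cdot>\<^sub>v w a)) $ k)"
    unfolding w(2) by (intro eq_vecI) (simp_all add: Y sum_distrib_left del: index_mult_mat_vec)
  then show "c \<cdot>\<^sub>v u \<in> sum_range n S Y" using sum_rangeI[of S "\<lambda>a. c \<cdot>\<^sub>v w a" Y n] w by simp
qed

lemma sum_range_member:
  assumes S: "finite S" and Y: "\<And>a. a \<in> S \<Longrightarrow> dim_row (Y a) = n"
    and a: "a \<in> S" and v: "v \<in> carrier_vec (dim_col (Y a))"
  shows "Y a *\<^sub>v v \<in> sum_range n S Y"
proof -
  define w where "w b = (if b = a then v else 0\<^sub>v (dim_col (Y b)))" for b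
  have "Y a *\<^sub>v v = vec n (\<lambda>k. \<Sum>b\<in>S. (Y b *\<^sub>v w b) $ k)"
  proof (rule eq_vecI)
    fix k assume "k < dim_vec (vec n (\<lambda>k. \<Sum>b\<in>S. (Y b *\<^sub>v w b) $ k))"
    then have k: "k < n" by simp
    have "(\<Sum>b\<in>S. (Y b *\<^sub>v w b) $ k) = (\<Sum>b\<in>S. if b = a then (Y a *\<^sub>v v) $ k else 0)"
      by (rule sum.cong) (use k Y in \<open>auto simp: w_def\<close>)
    also have "\<dots> = (Y a *\<^sub>v v) $ k" using S a by simp
    finally show "(Y a *\<^sub>v v) $ k = vec n (\<lambda>k. \<Sum>b\<in>S. (Y b *\<^sub>v w b) $ k) $ k" using k by simp
  qed (use Y[OF a] in auto)
  then show ?thesis using sum_rangeI[of S w Y n] v by (auto simp: w_def)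
qed

text \<open>In this way containments of U_i and of row spaces are reduced to single arrows.\<close>

lemma sum_range_least:
  assumes S: "finite S" and Y: "\<And>a. a \<in> S \<Longrightarrow> dim_row (Y a) = n" and W: "vec_subspace n W"
    and mem: "\<And>a v. a \<in> S \<Longrightarrow> v \<in> carrier_vec (dim_col (Y a)) \<Longrightarrow> Y a *\<^sub>v v \<in> W"
  shows "sum_range n S Y \<subseteq> W"
proof
  fix v assume "v \<in> sum_range n S Y"
  then obtain w where w: "\<And>a. a \<in> S \<Longrightarrow> w a \<in> carrier_vec (dim_col (Y a))"
    "v = vec n (\<lambda>k. \<Sum>a\<in>S. (Y a *\<^sub>v w a) $ k)" by (rule sum_rangeE) blast
  have "vec n (\<lambda>k. \<Sum>a\<in>T. (Y a *\<^sub>v w a) $ k) \<in> W" if "finite T" "T \<subseteq> S" for T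
    using that
  proof (induction T rule: finite_induct)
    case empty
    have *: "vec n (\<lambda>k. \<Sum>a\<in>{}. (Y a *\<^sub>v w a) $ k) = 0\<^sub>v n" by (intro eq_vecI) auto
    show ?case unfolding * using W by (simp add: vec_subspace_def)
  next
    case (insert a T)
    have "vec n (\<lambda>k. \<Sum>a\<in>insert a T. (Y a *\<^sub>v w a) $ k) = Y a *\<^sub>v w a + vec n (\<lambda>k. \<Sum>a\<in>T. (Y a *\<^sub>v w a) $ k)"
      using insert Y by (intro eq_vecI) auto
    then show ?case using insert mem w W by (auto simp: vec_subspace_def)
  qed
  then show "v \<in> W" using w(2) S by blast
qed

text \<open>The map \<open>p x \<mapsto> q x\<close> is well defined and injective because both
  surjections identify the same pairs. It serves to recognize modules of cosets, namely S_i and the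
  top of a module.\<close>

lemma isomorphic_of_common_quotient:
  assumes M: "left_module R M"
    and p: "p \<in> module_hom R M P" "p ` carrier M = carrier P"
    and q: "q \<in> module_hom R M N" "q ` carrier M = carrier N"
    and ker: "\<And>x y. x \<in> carrier M \<Longrightarrow> y \<in> carrier M \<Longrightarrow> p x = p y \<longleftrightarrow> q x = q y"
  shows "modules_isomorphic R P N"
proof -
  interpret left_module R M by (rule M)
  define h where "h X = q (SOME x. x \<in> carrier M \<and> p x = X)" for X
  have hp: "h (p x) = q x" if "x \<in> carrier M" for x
  proof -
    have "(SOME z. z \<in> carrier M \<and> p z = p x) \<in> carrier M \<and> p (SOME z. z \<in> carrier M \<and> p z = p x) = p x"
      by (rule someI[of _ x]) (use that in simp)
    then show ?thesis using ker that by (auto simp: h_def)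
  qed
  have "inj_on h (carrier P)"
    unfolding p(2)[symmetric] by (auto simp: inj_on_def hp ker)
  moreover have "h ` carrier P = carrier N"
    unfolding p(2)[symmetric] q(2)[symmetric] by (auto simp: hp image_iff)
  moreover have "h (X \<oplus>\<^bsub>P\<^esub> Y) = h X \<oplus>\<^bsub>N\<^esub> h Y" if XY: "X \<in> carrier P" "Y \<in> carrier P" for X Y
  proof -
    obtain x y where xy: "x \<in> carrier M" "y \<in> carrier M" "X = p x" "Y = p y"
      using XY unfolding p(2)[symmetric] by blast
    then have "h (X \<oplus>\<^bsub>P\<^esub> Y) = h (p (x \<oplus>\<^bsub>M\<^esub> y))" using p(1) by (simp add: module_hom_def)
    then show ?thesis using xy hp q(1) by (simp add: module_hom_def)
  qed
  moreover have "h (a \<odot>\<^bsub>P\<^esub> X) = a \<odot>\<^bsub>N\<^esub> h X" if aX: "a \<in> carrier R" "X \<in> carrier P" for a X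
  proof -
    obtain x where x: "x \<in> carrier M" "X = p x" using aX unfolding p(2)[symmetric] by blast
    then have "h (a \<odot>\<^bsub>P\<^esub> X) = h (p (a \<odot>\<^bsub>M\<^esub> x))" using p(1) aX by (simp add: module_hom_def)
    then show ?thesis using x hp q(1) aX smult_closed by (simp add: module_hom_def)
  qed
  ultimately have "h \<in> module_iso R P N" by (simp add: module_iso_def bij_betw_def)
  then show ?thesis by (auto simp: modules_isomorphic_def)
qed

lemma quotient_module_projection:
  assumes M: "left_module R M" and K: "subgroup K (add_monoid M)"
    and smult: "\<And>a x. a \<in> carrier R \<Longrightarrow> x \<in> K \<Longrightarrow> a \<odot>\<^bsub>M\<^esub> x \<in> K"
  shows "(\<lambda>x. K +>\<^bsub>M\<^esub> x) \<in> module_hom R M (quotient_module M K)"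
    and "(\<lambda>x. K +>\<^bsub>M\<^esub> x) ` carrier M = carrier (quotient_module M K)"
    and "\<And>x y. x \<in> carrier M \<Longrightarrow> y \<in> carrier M \<Longrightarrow> K +>\<^bsub>M\<^esub> x = K +>\<^bsub>M\<^esub> y \<longleftrightarrow> x \<ominus>\<^bsub>M\<^esub> y \<in> K"
proof -
  interpret left_module R M by (rule M)
  interpret K: abelian_subgroup K M
    by (rule abelian_subgroupI3) (use K in \<open>auto simp: additive_subgroup_def abelian_group_axioms\<close>)
  have Kc: "K \<subseteq> carrier M" by (rule K.a_subset)
  show eq: "K +>\<^bsub>M\<^esub> x = K +>\<^bsub>M\<^esub> y \<longleftrightarrow> x \<ominus>\<^bsub>M\<^esub> y \<in> K"
    if xy: "x \<in> carrier M" "y \<in> carrier M" for x y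
  proof
    assume "K +>\<^bsub>M\<^esub> x = K +>\<^bsub>M\<^esub> y"
    then have "x \<in> K +>\<^bsub>M\<^esub> y" using K.a_rcos_self[OF xy(1)] by simp
    then show "x \<ominus>\<^bsub>M\<^esub> y \<in> K" using K.a_rcos_module_imp[OF xy(2)] by (simp add: a_minus_def)
  next
    assume "x \<ominus>\<^bsub>M\<^esub> y \<in> K"
    then have "x \<in> K +>\<^bsub>M\<^esub> y" using K.a_rcos_module_rev[OF xy(2,1)] by (simp add: a_minus_def)
    then show "K +>\<^bsub>M\<^esub> x = K +>\<^bsub>M\<^esub> y" using K.a_repr_independence'[of x y] xy by simp
  qed
  show im: "(\<lambda>x. K +>\<^bsub>M\<^esub> x) ` carrier M = carrier (quotient_module M K)"
    by (auto simp: quotient_module_def A_RCOSETS_def')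
  show "(\<lambda>x. K +>\<^bsub>M\<^esub> x) \<in> module_hom R M (quotient_module M K)"
  proof (rule module_homI)
    show "(\<lambda>x. K +>\<^bsub>M\<^esub> x) \<in> carrier M \<rightarrow> carrier (quotient_module M K)" using im by blast
    fix x y assume "x \<in> carrier M" "y \<in> carrier M"
    then show "K +>\<^bsub>M\<^esub> (x \<oplus>\<^bsub>M\<^esub> y) = (K +>\<^bsub>M\<^esub> x) \<oplus>\<^bsub>quotient_module M K\<^esub> (K +>\<^bsub>M\<^esub> y)"
      using K.a_rcos_sum by (simp add: quotient_module_def)
  next
    fix a x assume a: "a \<in> carrier R" and x: "x \<in> carrier M"
    \<comment> \<open>All members of a coset give the same coset after multiplication by
      \<open>a\<close>, so the union that defines the quotient action has a single value.\<close>
    have *: "K +>\<^bsub>M\<^esub> (a \<odot>\<^bsub>M\<^esub> z) = K +>\<^bsub>M\<^esub> (a \<odot>\<^bsub>M\<^esub> x)" if z: "z \<in> K +>\<^bsub>M\<^esub> x" for z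
    proof -
      obtain k where k: "k \<in> K" "z = k \<oplus>\<^bsub>M\<^esub> x" using z by (auto simp: a_r_coset_def')
      have kc: "k \<in> carrier M" using k Kc by blast
      have ak: "a \<odot>\<^bsub>M\<^esub> k \<in> K" using smult a k by blast
      have c: "a \<odot>\<^bsub>M\<^esub> x \<in> carrier M" "a \<odot>\<^bsub>M\<^esub> k \<in> carrier M" using smult_closed a x kc by auto
      have "a \<odot>\<^bsub>M\<^esub> z = a \<odot>\<^bsub>M\<^esub> k \<oplus>\<^bsub>M\<^esub> a \<odot>\<^bsub>M\<^esub> x" using k kc a x smult_r_distr by simp
      then have "a \<odot>\<^bsub>M\<^esub> z \<in> carrier M" "a \<odot>\<^bsub>M\<^esub> z \<ominus>\<^bsub>M\<^esub> a \<odot>\<^bsub>M\<^esub> x = a \<odot>\<^bsub>M\<^esub> k"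
        using c by (simp_all add: a_minus_def M.a_assoc M.r_neg)
      then show ?thesis using eq[of "a \<odot>\<^bsub>M\<^esub> z" "a \<odot>\<^bsub>M\<^esub> x"] c ak by simp
    qed
    then have "(\<Union>z\<in>K +>\<^bsub>M\<^esub> x. K +>\<^bsub>M\<^esub> (a \<odot>\<^bsub>M\<^esub> z)) = (\<Union>z\<in>K +>\<^bsub>M\<^esub> x. K +>\<^bsub>M\<^esub> (a \<odot>\<^bsub>M\<^esub> x))"
      by (intro SUP_cong refl)
    also have "\<dots> = K +>\<^bsub>M\<^esub> (a \<odot>\<^bsub>M\<^esub> x)" using K.a_rcos_self[OF x] by (rule UN_constant_eq) simp
    finally have "(\<Union>z\<in>K +>\<^bsub>M\<^esub> x. K +>\<^bsub>M\<^esub> (a \<odot>\<^bsub>M\<^esub> z)) = K +>\<^bsub>M\<^esub> (a \<odot>\<^bsub>M\<^esub> x)" .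
    then show "K +>\<^bsub>M\<^esub> (a \<odot>\<^bsub>M\<^esub> x) = a \<odot>\<^bsub>quotient_module M K\<^esub> (K +>\<^bsub>M\<^esub> x)"
      by (simp add: quotient_module_def)
  qed
qed

context finite_quiver
begin

section \<open>Homomorphisms between point modules\<close>

definition family_map :: "('v \<Rightarrow> 'k::field mat) \<Rightarrow> ('v \<Rightarrow> 'k vec) \<Rightarrow> ('v \<Rightarrow> 'k vec)" where
  "family_map F v = (\<lambda>i\<in>verts Q. F i *\<^sub>v v i)"

lemma family_map_closed:
  assumes "\<And>i. i \<in> verts Q \<Longrightarrow> F i \<in> carrier_mat (d' i) (d i)" "v \<in> carrier (coord_space Q d)"
  shows "family_map F v \<in> carrier (coord_space Q d')"
  using mult_mat_vec_carrier[OF assms(1) coord_memD[OF assms(2)]]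
  by (simp add: family_map_def coord_carrier PiE_iff)

text \<open>An algebra element acts through \<open>ev\<close> and \<open>ar\<close>, so
  compatibility with the arrows implies compatibility with the whole algebra.\<close>

lemma family_map_hom:
  fixes y y' :: "'a \<Rightarrow> 'k::field mat"
  assumes y: "y \<in> rep_variety Q d" and y': "y' \<in> rep_variety Q d'"
    and F: "\<And>i. i \<in> verts Q \<Longrightarrow> F i \<in> carrier_mat (d' i) (d i)"
    and comm: "\<And>a. a \<in> arcs Q \<Longrightarrow> F (head Q a) * y a = y' a * F (tail Q a)"
  shows "family_map F \<in> module_hom (bound_algebra Q) (point_module Q d y) (point_module Q d' y')"
proof (rule module_homI)
  have yt: "y \<in> matrix_tuples Q d d" "y' \<in> matrix_tuples Q d' d'" using y y' by (auto simp: rep_variety_iff)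
  show "family_map F \<in> carrier (point_module Q d y) \<rightarrow> carrier (point_module Q d' y')"
    using family_map_closed[OF F] by (auto simp: point_module_simps)
  fix v assume "v \<in> carrier (point_module Q d y)"
  then have v: "v \<in> carrier (coord_space Q d)" by (simp add: point_module_simps)
  {
    fix w assume "w \<in> carrier (point_module Q d y)"
    then have w: "w \<in> carrier (coord_space Q d)" by (simp add: point_module_simps)
    show "family_map F (v \<oplus>\<^bsub>point_module Q d y\<^esub> w) =
        family_map F v \<oplus>\<^bsub>point_module Q d' y'\<^esub> family_map F w"
      unfolding point_module_simps
    proof (rule coord_eqI)
      fix i k assume ik: "i \<in> verts Q" "k < d' i"
      have "F i *\<^sub>v (v i + w i) = F i *\<^sub>v v i + F i *\<^sub>v w i"
        by (rule mult_add_distrib_mat_vec[OF F coord_memD[OF v] coord_memD[OF w]]) (use ik in auto)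
      then show "family_map F (v \<oplus>\<^bsub>coord_space Q d\<^esub> w) i $ k =
          (family_map F v \<oplus>\<^bsub>coord_space Q d'\<^esub> family_map F w) i $ k"
        using ik by (simp add: family_map_def coord_ops)
    qed (auto intro!: family_map_closed[OF F] coord_closed v w)
  }
  fix X :: "('v \<times> 'a list \<Rightarrow> 'k) set" assume X: "X \<in> carrier (bound_algebra Q)"
  note Fv = family_map_closed[OF F v]
  show "family_map F (X \<odot>\<^bsub>point_module Q d y\<^esub> v) = X \<odot>\<^bsub>point_module Q d' y'\<^esub> family_map F v"
  proof (rule coord_eqI)
    fix j k assume jk: "j \<in> verts Q" "k < d' j"
    have "F j *\<^sub>v (y a *\<^sub>v v (tail Q a)) = y' a *\<^sub>v (F (tail Q a) *\<^sub>v v (tail Q a))"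
      if a: "a \<in> arcs Q" "head Q a = j" for a
    proof -
      have t: "tail Q a \<in> verts Q" using a by simp
      show ?thesis
        using assoc_mult_mat_vec[OF F[OF jk(1)] _ coord_memD[OF v t], of "y a"]
          assoc_mult_mat_vec[OF matrix_tuplesD[OF yt(2) a(1)] F[OF t] coord_memD[OF v t]]
          matrix_tuplesD[OF yt(1) a(1)] a comm[OF a(1)] by simp
    qed
    then show "family_map F (X \<odot>\<^bsub>point_module Q d y\<^esub> v) j $ k =
        (X \<odot>\<^bsub>point_module Q d' y'\<^esub> family_map F v) j $ k"
      using jk mult_point_smult[OF y X v jk(1) F[OF jk(1)] jk(2)] point_smult_nth[OF y' X Fv jk]
      by (simp add: family_map_def)
  qed (auto intro!: family_map_closed[OF F] point_smult_closed y y' X v)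
qed

text \<open>The vertex idempotents force a homomorphism to act componentwise, the scalars make each
  component linear, and the algebra element with coordinate 1 at the arrow \<open>a\<close> and 0
  elsewhere gives the commuting square for \<open>a\<close>.\<close>

lemma point_hom_family_map:
  fixes y y' :: "'a \<Rightarrow> 'k::field mat"
  assumes y: "y \<in> rep_variety Q d" and y': "y' \<in> rep_variety Q d'"
    and h: "h \<in> module_hom (bound_algebra Q) (point_module Q d y) (point_module Q d' y')"
  obtains F where "\<And>i. i \<in> verts Q \<Longrightarrow> F i \<in> carrier_mat (d' i) (d i)"
    "\<And>a. a \<in> arcs Q \<Longrightarrow> F (head Q a) * y a = y' a * F (tail Q a)"
    "\<And>v. v \<in> carrier (coord_space Q d) \<Longrightarrow> h v = family_map F v"
proof -
  let ?V = "coord_space Q d :: ('k, 'v \<Rightarrow> 'k vec) module"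
  let ?V' = "coord_space Q d' :: ('k, 'v \<Rightarrow> 'k vec) module"
  have yt: "y \<in> matrix_tuples Q d d" "y' \<in> matrix_tuples Q d' d'" using y y' by (auto simp: rep_variety_iff)
  have hc: "h v \<in> carrier ?V'" if "v \<in> carrier ?V" for v
    using h that by (auto simp: module_hom_def point_module_simps)
  have ha: "h (v \<oplus>\<^bsub>?V\<^esub> w) = h v \<oplus>\<^bsub>?V'\<^esub> h w" if "v \<in> carrier ?V" "w \<in> carrier ?V" for v w
    using h that by (auto simp: module_hom_def point_module_simps)
  have hs: "h (X \<odot>\<^bsub>point_module Q d y\<^esub> v) = X \<odot>\<^bsub>point_module Q d' y'\<^esub> h v"
    if "v \<in> carrier ?V" "X \<in> carrier (bound_algebra Q)" for v X
    using h that by (auto simp: module_hom_def point_module_simps)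
  define inc where "inc i u = (\<lambda>j\<in>verts Q. if j = i then u else 0\<^sub>v (d j))" for i and u :: "'k vec"
  have inc: "inc i u \<in> carrier ?V" if "u \<in> carrier_vec (d i)" for i u
    using that by (auto simp: inc_def coord_carrier)
  have proj: "h v i = h (inc i (v i)) i" if i: "i \<in> verts Q" and v: "v \<in> carrier ?V" for i v
  proof -
    note e = vertex_idem_coords[OF i, where 'k = 'k]
    note iv = inc[OF coord_memD[OF v i]]
    have "vertex_idem Q i \<odot>\<^bsub>point_module Q d y\<^esub> v = inc i (v i)"
    proof (rule coord_eqI[OF point_smult_closed[OF y e(1) v] iv])
      fix j k assume "j \<in> verts Q" "k < d j"
      then show "(vertex_idem Q i \<odot>\<^bsub>point_module Q d y\<^esub> v) j $ k = inc i (v i) j $ k"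
        using point_smult_nth[OF y e(1) v] by (simp add: e inc_def)
    qed
    then have *: "h (inc i (v i)) = vertex_idem Q i \<odot>\<^bsub>point_module Q d' y'\<^esub> h v" using hs[OF v e(1)] by simp
    show ?thesis
    proof (rule eq_vecI)
      fix k assume "k < dim_vec (h (inc i (v i)) i)"
      then have k: "k < d' i" using coord_memD[OF hc[OF iv] i] by simp
      show "h v i $ k = h (inc i (v i)) i $ k"
        unfolding * using point_smult_nth[OF y' e(1) hc[OF v] i k] by (simp add: e)
    qed (use coord_memD[OF hc[OF iv] i] coord_memD[OF hc[OF v] i] in simp)
  qed
  have "\<exists>F. F \<in> carrier_mat (d' i) (d i) \<and> (\<forall>u\<in>carrier_vec (d i). h (inc i u) i = F *\<^sub>v u)"
    if i: "i \<in> verts Q" for i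
  proof -
    have *: "h (inc i u) i \<in> carrier_vec (d' i)" if "u \<in> carrier_vec (d i)" for u
      using coord_memD[OF hc[OF inc[OF that]] i] .
    have **: "h (inc i (u + v)) i = h (inc i u) i + h (inc i v) i"
      if "u \<in> carrier_vec (d i)" "v \<in> carrier_vec (d i)" for u v
    proof -
      have "inc i (u + v) = inc i u \<oplus>\<^bsub>?V\<^esub> inc i v"
        by (rule coord_eqI[OF inc[OF add_carrier_vec[OF that]]
              coord_closed(1)[OF inc[OF that(1)] inc[OF that(2)]]])
          (auto simp: inc_def coord_ops)
      then show ?thesis using ha[OF inc[OF that(1)] inc[OF that(2)]] i by (simp add: coord_ops)
    qed
    have ***: "h (inc i (c \<cdot>\<^sub>v u)) i = c \<cdot>\<^sub>v h (inc i u) i" if u: "u \<in> carrier_vec (d i)" for c u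
    proof -
      note s = scalar_coords[where c = c]
      have "scalar Q c \<odot>\<^bsub>point_module Q d y\<^esub> inc i u = inc i (c \<cdot>\<^sub>v u)"
      proof (rule coord_eqI[OF point_smult_closed[OF y s(1) inc[OF u]]])
        show "inc i (c \<cdot>\<^sub>v u) \<in> carrier ?V" using u by (intro inc) auto
        fix j k assume "j \<in> verts Q" "k < d j"
        then show "(scalar Q c \<odot>\<^bsub>point_module Q d y\<^esub> inc i u) j $ k = inc i (c \<cdot>\<^sub>v u) j $ k"
          using point_smult_nth[OF y s(1) inc[OF u]] u by (auto simp: s inc_def)
      qed
      then have eq: "h (inc i (c \<cdot>\<^sub>v u)) = scalar Q c \<odot>\<^bsub>point_module Q d' y'\<^esub> h (inc i u)"
        using hs[OF inc[OF u] s(1)] by simp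
      show ?thesis
        unfolding eq
      proof (rule eq_vecI)
        fix k assume "k < dim_vec (c \<cdot>\<^sub>v h (inc i u) i)"
        then have k: "k < d' i" using *[OF u] by simp
        show "(scalar Q c \<odot>\<^bsub>point_module Q d' y'\<^esub> h (inc i u)) i $ k = (c \<cdot>\<^sub>v h (inc i u) i) $ k"
          using point_smult_nth[OF y' s(1) hc[OF inc[OF u]] i k] *[OF u] k i by (simp add: s)
      next
        show "dim_vec ((scalar Q c \<odot>\<^bsub>point_module Q d' y'\<^esub> h (inc i u)) i) = dim_vec (c \<cdot>\<^sub>v h (inc i u) i)"
          using coord_memD[OF point_smult_closed[OF y' s(1) hc[OF inc[OF u]]] i] *[OF u] by simp
      qed
    qed
    show ?thesis
      by (rule linear_map_mat[of "d i" "\<lambda>u. h (inc i u) i" "d' i", OF * ** ***]) auto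
  qed
  then obtain F where F: "\<And>i. i \<in> verts Q \<Longrightarrow> F i \<in> carrier_mat (d' i) (d i)"
      "\<And>i u. i \<in> verts Q \<Longrightarrow> u \<in> carrier_vec (d i) \<Longrightarrow> h (inc i u) i = F i *\<^sub>v u"
    by metis
  have hF: "h v = family_map F v" if v: "v \<in> carrier ?V" for v
  proof (rule coord_eqI[OF hc[OF v] family_map_closed[OF F(1) v]])
    fix i k assume ik: "i \<in> verts Q" "k < d' i"
    show "h v i $ k = family_map F v i $ k"
      using proj[OF ik(1) v] F(2)[OF ik(1) coord_memD[OF v ik(1)]] ik by (simp add: family_map_def)
  qed
  have "F (head Q a) * y a = y' a * F (tail Q a)" if a: "a \<in> arcs Q" for a
  proof (rule mat_eqI_vec)
    have ht: "head Q a \<in> verts Q" "tail Q a \<in> verts Q" using a by auto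
    note ya = matrix_tuplesD[OF yt(1) a] and y'a = matrix_tuplesD[OF yt(2) a]
    show "F (head Q a) * y a \<in> carrier_mat (d' (head Q a)) (d (tail Q a))" using F(1)[OF ht(1)] ya by simp
    show "y' a * F (tail Q a) \<in> carrier_mat (d' (head Q a)) (d (tail Q a))" using F(1)[OF ht(2)] y'a by simp
    fix u :: "'k vec" assume u: "u \<in> carrier_vec (d (tail Q a))"
    obtain X :: "('v \<times> 'a list \<Rightarrow> 'k) set" where X: "X \<in> carrier (bound_algebra Q)"
      "\<And>i. i \<in> verts Q \<Longrightarrow> ev X i = 0" "\<And>b. b \<in> arcs Q \<Longrightarrow> ar X b = (if b = a then 1 else 0)"
      using bound_algebra_coords_exist[of "\<lambda>_. 0" "\<lambda>b. if b = a then 1 else 0"] by blast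
    define w where "w = inc (tail Q a) u"
    have w: "w \<in> carrier ?V" unfolding w_def by (rule inc[OF u])
    have wt: "w (tail Q a) = u" using ht by (simp add: w_def inc_def)
    have sum: "(\<Sum>b | b \<in> arcs Q \<and> head Q b = head Q a. ar X b * f b) = f a" for f :: "'a \<Rightarrow> 'k"
    proof -
      have "(\<Sum>b | b \<in> arcs Q \<and> head Q b = head Q a. ar X b * f b) =
          (\<Sum>b | b \<in> arcs Q \<and> head Q b = head Q a. if b = a then f a else 0)"
        by (rule sum.cong) (auto simp: X(3))
      also have "\<dots> = f a" using a by simp
      finally show ?thesis .
    qed
    have "F (head Q a) *\<^sub>v (y a *\<^sub>v u) = y' a *\<^sub>v (F (tail Q a) *\<^sub>v u)"
    proof (rule eq_vecI)
      fix k assume "k < dim_vec (y' a *\<^sub>v (F (tail Q a) *\<^sub>v u))"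
      then have k: "k < d' (head Q a)" using y'a by simp
      have "h (X \<odot>\<^bsub>point_module Q d y\<^esub> w) (head Q a) $ k = (F (head Q a) *\<^sub>v (y a *\<^sub>v u)) $ k"
        unfolding hF[OF point_smult_closed[OF y X(1) w]]
        using mult_point_smult[OF y X(1) w ht(1) F(1)[OF ht(1)] k] ht
        by (simp add: family_map_def sum X(2) wt)
      moreover have "(X \<odot>\<^bsub>point_module Q d' y'\<^esub> h w) (head Q a) $ k = (y' a *\<^sub>v (F (tail Q a) *\<^sub>v u)) $ k"
        unfolding point_smult_nth[OF y' X(1) hc[OF w] ht(1) k]
        using ht by (simp add: sum X(2) hF[OF w] family_map_def wt)
      ultimately show "(F (head Q a) *\<^sub>v (y a *\<^sub>v u)) $ k = (y' a *\<^sub>v (F (tail Q a) *\<^sub>v u)) $ k"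
        using hs[OF w X(1)] by simp
    qed (use F(1)[OF ht(1)] y'a in auto)
    then show "(F (head Q a) * y a) *\<^sub>v u = (y' a * F (tail Q a)) *\<^sub>v u"
      using F(1)[OF ht(1)] F(1)[OF ht(2)] ya y'a u by simp
  qed
  with F(1) hF show thesis using that by blast
qed

text \<open>Injectivity on vectors concentrated at \<open>i\<close> makes \<open>F i\<close>
  injective, and it is square as both points have the dimension vector \<open>d\<close>.\<close>

lemma point_isomorphic_iff:
  fixes y y' :: "'a \<Rightarrow> 'k::field mat"
  assumes y: "y \<in> rep_variety Q d" and y': "y' \<in> rep_variety Q d"
  shows "modules_isomorphic (bound_algebra Q) (point_module Q d y) (point_module Q d y') \<longleftrightarrow>
    (\<exists>F F'. (\<forall>i\<in>verts Q. inverse_mats (d i) (F i) (F' i)) \<and>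
       (\<forall>a\<in>arcs Q. F (head Q a) * y a = y' a * F (tail Q a)))"
proof
  assume "modules_isomorphic (bound_algebra Q) (point_module Q d y) (point_module Q d y')"
  then obtain h where h: "h \<in> module_hom (bound_algebra Q) (point_module Q d y) (point_module Q d y')"
      and bij: "bij_betw h (carrier (coord_space Q d)) (carrier (coord_space Q d))"
    by (auto simp: modules_isomorphic_def module_iso_iff_hom point_module_simps)
  obtain F where F: "\<And>i. i \<in> verts Q \<Longrightarrow> F i \<in> carrier_mat (d i) (d i)"
    "\<And>a. a \<in> arcs Q \<Longrightarrow> F (head Q a) * y a = y' a * F (tail Q a)"
    "\<And>v. v \<in> carrier (coord_space Q d) \<Longrightarrow> h v = family_map F v"
    using point_hom_family_map[OF y y' h] by blast
  have "\<exists>F'. inverse_mats (d i) (F i) F'" if i: "i \<in> verts Q" for i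
  proof -
    have "u = 0\<^sub>v (d i)" if u: "u \<in> carrier_vec (d i)" and 0: "F i *\<^sub>v u = 0\<^sub>v (d i)" for u
    proof -
      define w where "w = (\<lambda>j\<in>verts Q. if j = i then u else 0\<^sub>v (d j))"
      define z where "z = (\<lambda>j\<in>verts Q. 0\<^sub>v (d j) :: 'k vec)"
      have wz: "w \<in> carrier (coord_space Q d)" "z \<in> carrier (coord_space Q d)"
        using u by (auto simp: w_def z_def coord_carrier)
      have "family_map F w = family_map F z"
        using 0 F(1) mult_mat_zero_vec[OF F(1)] by (auto simp: family_map_def w_def z_def fun_eq_iff)
      then have "h w = h z" using F(3) wz by simp
      then have "w = z" using bij wz by (auto simp: bij_betw_def inj_on_def)
      then have "w i = z i" by simp
      then show ?thesis using i by (simp add: w_def z_def)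
    qed
    then show ?thesis using inverse_mats_of_inj[OF F(1)[OF i]] by metis
  qed
  then show "\<exists>F F'. (\<forall>i\<in>verts Q. inverse_mats (d i) (F i) (F' i)) \<and>
       (\<forall>a\<in>arcs Q. F (head Q a) * y a = y' a * F (tail Q a))"
    using F(2) by metis
next
  assume "\<exists>F F'. (\<forall>i\<in>verts Q. inverse_mats (d i) (F i) (F' i)) \<and>
       (\<forall>a\<in>arcs Q. F (head Q a) * y a = y' a * F (tail Q a))"
  then obtain F F' where F: "\<And>i. i \<in> verts Q \<Longrightarrow> inverse_mats (d i) (F i) (F' i)"
    "\<And>a. a \<in> arcs Q \<Longrightarrow> F (head Q a) * y a = y' a * F (tail Q a)" by blast
  note Fc = inverse_matsD(1)[OF F(1)] and F'c = inverse_matsD(2)[OF F(1)]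
  have "family_map F' (family_map F v) = v" "family_map F (family_map F' v) = v"
    if v: "v \<in> carrier (coord_space Q d)" for v
  proof -
    have c: "F' i *\<^sub>v (F i *\<^sub>v v i) = v i" "F i *\<^sub>v (F' i *\<^sub>v v i) = v i" if "i \<in> verts Q" for i
      using inverse_mats_cancel[OF F(1)[OF that] coord_memD[OF v that]] by auto
    show "family_map F' (family_map F v) = v"
      by (rule coord_eqI[OF family_map_closed[OF F'c family_map_closed[OF Fc v]] v])
        (auto simp: family_map_def c simp del: index_mult_mat_vec)
    show "family_map F (family_map F' v) = v"
      by (rule coord_eqI[OF family_map_closed[OF Fc family_map_closed[OF F'c v]] v])
        (auto simp: family_map_def c simp del: index_mult_mat_vec)
  qed
  then have "bij_betw (family_map F) (carrier (coord_space Q d)) (carrier (coord_space Q d))"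
    by (intro bij_betw_byWitness[where f' = "family_map F'"])
      (auto intro: family_map_closed[OF F'c] family_map_closed[OF Fc])
  then have "family_map F \<in> module_iso (bound_algebra Q) (point_module Q d y) (point_module Q d y')"
    using family_map_hom[OF y y' Fc F(2)] by (simp add: module_iso_iff_hom point_module_simps)
  then show "modules_isomorphic (bound_algebra Q) (point_module Q d y) (point_module Q d y')"
    by (auto simp: modules_isomorphic_def)
qed

end


section \<open>Rank-nullity in adapted coordinates, and submodules\<close>

lemma subspace_lincomb:
  assumes "vec_subspace n W" "u \<in> W" "v \<in> W" shows "u + v \<in> W" "c \<cdot>\<^sub>v u \<in> W" "u - v \<in> W"
proof -
  have c: "u \<in> carrier_vec n" "v \<in> carrier_vec n" using assms by (auto simp: vec_subspace_def)
  show "u + v \<in> W" "c \<cdot>\<^sub>v u \<in> W" using assms by (auto simp: vec_subspace_def)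
  have "u + (-1) \<cdot>\<^sub>v v \<in> W" using assms by (auto simp: vec_subspace_def)
  moreover have "u + (-1) \<cdot>\<^sub>v v = u - v" using c by (intro eq_vecI) auto
  ultimately show "u - v \<in> W" by simp
qed

text \<open>Rank-nullity, by two kernel arguments. If \<open>t > d - k\<close>, a nonzero
  combination of chosen preimages of the unit vectors lies in the kernel \<open>W\<close>, although
  \<open>F\<close> is injective on such combinations. If \<open>d - k > t\<close>, \<open>F\<close>
  kills a nonzero vector of the complement spanned by the first \<open>d - k\<close> columns of
  \<open>P'\<close>.\<close>

lemma adapted_kernel_dim:
  assumes F: "(F :: 'k::field mat) \<in> carrier_mat t d" and P: "adapted d W k P P'"
    and surj: "\<And>z. z \<in> carrier_vec t \<Longrightarrow> \<exists>u\<in>carrier_vec d. F *\<^sub>v u = z"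
    and ker: "\<And>u. u \<in> carrier_vec d \<Longrightarrow> u \<in> W \<longleftrightarrow> F *\<^sub>v u = 0\<^sub>v t"
  shows "k + t = d"
proof -
  have Pinv: "inverse_mats d P P'" and kd: "k \<le> d" using P by (auto simp: adapted_def)
  note c = inverse_matsD[OF Pinv]
  have "t \<le> d - k"
  proof (rule ccontr)
    assume lt: "\<not> t \<le> d - k"
    have "\<forall>j. \<exists>u. u \<in> carrier_vec d \<and> F *\<^sub>v u = unit_vec t j"
      using surj[OF unit_vec_carrier] by blast
    then obtain u where u: "\<And>j. u j \<in> carrier_vec d \<and> F *\<^sub>v u j = unit_vec t j" by metis
    define U where "U = mat d t (\<lambda>(i,j). u j $ i)"
    have U: "U \<in> carrier_mat d t" by (simp add: U_def)
    have FU: "F * U = 1\<^sub>m t"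
    proof (rule eq_matI)
      fix i j assume "i < dim_row (1\<^sub>m t :: 'k mat)" "j < dim_col (1\<^sub>m t :: 'k mat)"
      then have ij: "i < t" "j < t" by auto
      have "col U j = u j" using u[of j] ij by (intro eq_vecI) (auto simp: U_def)
      then have "(F * U) $$ (i,j) = (F *\<^sub>v u j) $ i" using F U ij by simp
      also have "\<dots> = 1\<^sub>m t $$ (i,j)" using u[of j] ij by (simp add: unit_vec_def del: index_mult_mat_vec)
      finally show "(F * U) $$ (i,j) = 1\<^sub>m t $$ (i,j)" .
    qed (use F U in auto)
    define B where "B = mat (d - k) t (\<lambda>(i,j). (P * U) $$ (i,j))"
    obtain z where z: "z \<in> carrier_vec t" "z \<noteq> 0\<^sub>v t" "B *\<^sub>v z = 0\<^sub>v (d - k)"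
      using wide_mat_kernel[of B "d - k" t] lt by (auto simp: B_def)
    have Uz: "U *\<^sub>v z \<in> carrier_vec d" using U z by simp
    have "P *\<^sub>v (U *\<^sub>v z) \<in> last_coords d k"
    proof (rule last_coordsI)
      show "P *\<^sub>v (U *\<^sub>v z) \<in> carrier_vec d" using c Uz by simp
      fix i assume i: "i < d - k"
      have "(P *\<^sub>v (U *\<^sub>v z)) $ i = ((P * U) *\<^sub>v z) $ i" using c U z by simp
      also have "\<dots> = (B *\<^sub>v z) $ i"
        using mult_mat_vec_sum[of "P * U" d t z i] mult_mat_vec_sum[of B "d - k" t z i] c U z i
        by (simp add: B_def del: index_mult_mat_vec index_mult_mat)
      finally show "(P *\<^sub>v (U *\<^sub>v z)) $ i = 0" using z i by simp
    qed
    then have "U *\<^sub>v z \<in> W" using P Uz by (auto simp: adapted_def)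
    then have "F *\<^sub>v (U *\<^sub>v z) = 0\<^sub>v t" using ker[OF Uz] by simp
    then show False using assoc_mult_mat_vec[OF F U z(1)] FU z by simp
  qed
  moreover have "d - k \<le> t"
  proof (rule ccontr)
    assume lt: "\<not> d - k \<le> t"
    define B where "B = mat t (d - k) (\<lambda>(i,j). (F * P') $$ (i,j))"
    have B: "B \<in> carrier_mat t (d - k)" by (simp add: B_def)
    obtain z where z: "z \<in> carrier_vec (d - k)" "z \<noteq> 0\<^sub>v (d - k)" "B *\<^sub>v z = 0\<^sub>v t"
      using wide_mat_kernel[OF B] lt by auto
    define v where "v = vec d (\<lambda>j. if j < d - k then z $ j else 0)"
    have v: "v \<in> carrier_vec d" by (simp add: v_def)
    have FP: "F * P' \<in> carrier_mat t d" using F c by simp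
    have "(F * P') *\<^sub>v v = 0\<^sub>v t"
    proof (rule eq_vecI)
      fix i assume "i < dim_vec (0\<^sub>v t :: 'k vec)"
      then have i: "i < t" by simp
      have "((F * P') *\<^sub>v v) $ i = (\<Sum>j<d. (F * P') $$ (i,j) * v $ j)" by (rule mult_mat_vec_sum[OF FP v i])
      also have "\<dots> = (\<Sum>j<d-k. (F * P') $$ (i,j) * v $ j)"
        by (rule sum.mono_neutral_right) (auto simp: v_def)
      also have "\<dots> = (\<Sum>j<d-k. B $$ (i,j) * z $ j)"
        by (rule sum.cong) (use i in \<open>auto simp: v_def B_def simp del: index_mult_mat\<close>)
      also have "\<dots> = (B *\<^sub>v z) $ i" using mult_mat_vec_sum[OF B z(1) i] by simp
      finally show "((F * P') *\<^sub>v v) $ i = 0\<^sub>v t $ i" using z i by simp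
    qed (use FP in auto)
    then have "F *\<^sub>v (P' *\<^sub>v v) = 0\<^sub>v t" using assoc_mult_mat_vec[OF F c(2) v] by simp
    then have "P' *\<^sub>v v \<in> W" using ker c v by simp
    then have "P *\<^sub>v (P' *\<^sub>v v) \<in> last_coords d k" using P c v by (auto simp: adapted_def)
    then have "v \<in> last_coords d k" using inverse_mats_cancel(2)[OF Pinv v] by simp
    then have "z $ j = 0" if "j < d - k" for j using that by (auto simp: last_coords_def v_def)
    then have "z = 0\<^sub>v (d - k)" using z(1) by (intro eq_vecI) auto
    with z(2) show False by simp
  qed
  ultimately show ?thesis using kd by simp
qed

text \<open>Closure under negatives comes from acting with -1; that zero acts as zero is derived on
  the way.\<close>

lemma (in left_module) submodule_subgroup:
  assumes K: "K \<subseteq> carrier M" "\<zero>\<^bsub>M\<^esub> \<in> K"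
    and add: "\<And>x y. x \<in> K \<Longrightarrow> y \<in> K \<Longrightarrow> x \<oplus>\<^bsub>M\<^esub> y \<in> K"
    and smult: "\<And>a x. a \<in> carrier R \<Longrightarrow> x \<in> K \<Longrightarrow> a \<odot>\<^bsub>M\<^esub> x \<in> K"
  shows "subgroup K (add_monoid M)"
proof (rule M.add.subgroupI)
  fix x assume x: "x \<in> K"
  have xc: "x \<in> carrier M" using x K by blast
  define z where "z = \<zero> \<odot>\<^bsub>M\<^esub> x"
  have z: "z \<in> carrier M" using xc smult_closed[of \<zero> x] by (simp add: z_def)
  have zz: "z \<oplus>\<^bsub>M\<^esub> z = z" using smult_l_distr[of \<zero> \<zero> x] xc by (simp add: z_def)
  have "z = z \<oplus>\<^bsub>M\<^esub> (z \<oplus>\<^bsub>M\<^esub> \<ominus>\<^bsub>M\<^esub> z)" using z by (simp add: M.r_neg)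
  also have "\<dots> = (z \<oplus>\<^bsub>M\<^esub> z) \<oplus>\<^bsub>M\<^esub> \<ominus>\<^bsub>M\<^esub> z" using z by (simp only: M.a_assoc M.a_inv_closed)
  also have "\<dots> = \<zero>\<^bsub>M\<^esub>" unfolding zz using z by (rule M.r_neg)
  finally have 0: "\<zero> \<odot>\<^bsub>M\<^esub> x = \<zero>\<^bsub>M\<^esub>" by (simp add: z_def)
  have "(\<ominus> \<one>) \<odot>\<^bsub>M\<^esub> x \<oplus>\<^bsub>M\<^esub> x = (\<ominus> \<one> \<oplus> \<one>) \<odot>\<^bsub>M\<^esub> x"
    using smult_l_distr[of "\<ominus> \<one>" \<one> x] xc smult_one by simp
  then have "(\<ominus> \<one>) \<odot>\<^bsub>M\<^esub> x \<oplus>\<^bsub>M\<^esub> x = \<zero>\<^bsub>M\<^esub>" using 0 by (simp add: R.l_neg)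
  then have "\<ominus>\<^bsub>M\<^esub> x = (\<ominus> \<one>) \<odot>\<^bsub>M\<^esub> x"
    using xc smult_closed[of "\<ominus> \<one>" x] by (intro M.minus_equality) auto
  then show "\<ominus>\<^bsub>M\<^esub> x \<in> K" using smult[of "\<ominus> \<one>" x] x by simp
qed (use K add in auto)

context finite_quiver
begin

section \<open>Radical, top and dimension vector of point modules\<close>

text \<open>The space U_i; \<open>radical_eq\<close> identifies it with the component at
  \<open>i\<close> of JM. It is defined also off the variety, because minors are evaluated at
  arbitrary tuples of matrices.\<close>

definition rad :: "('v \<Rightarrow> nat) \<Rightarrow> ('a \<Rightarrow> 'k::field mat) \<Rightarrow> 'v \<Rightarrow> 'k vec set" where
  "rad d y i = sum_range (d i) {a \<in> arcs Q. head Q a = i} y"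

lemma rad_subspace: "y \<in> matrix_tuples Q m d \<Longrightarrow> vec_subspace (d i) (rad d y i)"
  unfolding rad_def by (rule sum_range_subspace) (auto dest: matrix_tuplesD)

lemma rad_member:
  "y \<in> matrix_tuples Q m d \<Longrightarrow> a \<in> arcs Q \<Longrightarrow> v \<in> carrier_vec (m (tail Q a)) \<Longrightarrow>
    y a *\<^sub>v v \<in> rad d y (head Q a)"
  unfolding rad_def by (rule sum_range_member) (auto dest: matrix_tuplesD)

lemma point_minus_nth:
  assumes y: "y \<in> rep_variety Q d" and v: "v \<in> carrier (coord_space Q d)" and w: "w \<in> carrier (coord_space Q d)"
    and i: "i \<in> verts Q"
  shows "(v \<ominus>\<^bsub>point_module Q d (y :: 'a \<Rightarrow> 'k::field mat)\<^esub> w) i = v i - w i"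
proof -
  interpret left_module "bound_algebra Q" "point_module Q d y" by (rule point_left_module[OF y])
  have vw: "v \<in> carrier (point_module Q d y)" "w \<in> carrier (point_module Q d y)"
    using v w by (simp_all add: point_module_simps)
  define z where "z = v \<ominus>\<^bsub>point_module Q d y\<^esub> w"
  have "z \<in> carrier (point_module Q d y)" using vw by (simp add: z_def)
  then have z: "z \<in> carrier (coord_space Q d)" by (simp add: point_module_simps)
  have "z \<oplus>\<^bsub>point_module Q d y\<^esub> w = v" using vw by (simp add: z_def a_minus_def M.a_assoc M.l_neg)
  then have "z i + w i = v i" using i by (auto simp: point_module_simps coord_ops)
  then have "v i - w i = z i + w i - w i" by simp
  also have "\<dots> = z i" using coord_memD[OF z i] coord_memD[OF w i] by (intro eq_vecI) auto
  finally show ?thesis by (simp add: z_def)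
qed

lemma radical_submodule:
  assumes y: "y \<in> rep_variety Q d"
  defines "N \<equiv> {v \<in> carrier (coord_space Q d). \<forall>i\<in>verts Q. v i \<in> rad d (y :: 'a \<Rightarrow> 'k::field mat) i}"
  shows "X \<in> carrier (bound_algebra Q) \<Longrightarrow> v \<in> N \<Longrightarrow> X \<odot>\<^bsub>point_module Q d y\<^esub> v \<in> N"
    and "subgroup N (add_monoid (point_module Q d y))"
    and "X \<in> jacobson_radical (bound_algebra Q) \<Longrightarrow> v \<in> carrier (coord_space Q d) \<Longrightarrow>
      X \<odot>\<^bsub>point_module Q d y\<^esub> v \<in> N"
proof -
  interpret left_module "bound_algebra Q" "point_module Q d y" by (rule point_left_module[OF y])
  have yt: "y \<in> matrix_tuples Q d d" using y by (simp add: rep_variety_iff)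
  \<comment> \<open>The coefficients \<open>ar X a\<close> are moved into the arguments of the
    matrices, which shows the arrow part of \<open>X v\<close> as an element of \<open>rad\<close>.
    Closure under the algebra and the containment of JM both rest on this.\<close>
  have part: "vec (d j) (\<lambda>k. \<Sum>a | a \<in> arcs Q \<and> head Q a = j. ar X a * (y a *\<^sub>v v (tail Q a)) $ k) \<in> rad d y j"
    if v: "v \<in> carrier (coord_space Q d)" and j: "j \<in> verts Q" for v j and X :: "('v \<times> 'a list \<Rightarrow> 'k) set"
  proof -
    have t: "v (tail Q a) \<in> carrier_vec (dim_col (y a))" if "a \<in> arcs Q" for a
      using coord_memD[OF v, of "tail Q a"] matrix_tuplesD[OF yt that] that by auto
    have "vec (d j) (\<lambda>k. \<Sum>a | a \<in> arcs Q \<and> head Q a = j. ar X a * (y a *\<^sub>v v (tail Q a)) $ k) =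
        vec (d j) (\<lambda>k. \<Sum>a | a \<in> arcs Q \<and> head Q a = j. (y a *\<^sub>v (ar X a \<cdot>\<^sub>v v (tail Q a))) $ k)"
    proof (rule eq_vecI)
      fix k assume "k < dim_vec (vec (d j) (\<lambda>k. \<Sum>a | a \<in> arcs Q \<and> head Q a = j. (y a *\<^sub>v (ar X a \<cdot>\<^sub>v v (tail Q a))) $ k))"
      then have k: "k < d j" by simp
      have "ar X a * (y a *\<^sub>v v (tail Q a)) $ k = (y a *\<^sub>v (ar X a \<cdot>\<^sub>v v (tail Q a))) $ k"
        if a: "a \<in> arcs Q" "head Q a = j" for a
        using mult_mat_vec[OF matrix_tuplesD[OF yt a(1)], of "v (tail Q a)" "ar X a"]
          t[OF a(1)] matrix_tuplesD[OF yt a(1)] a k by simp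
      then show "vec (d j) (\<lambda>k. \<Sum>a | a \<in> arcs Q \<and> head Q a = j. ar X a * (y a *\<^sub>v v (tail Q a)) $ k) $ k =
        vec (d j) (\<lambda>k. \<Sum>a | a \<in> arcs Q \<and> head Q a = j. (y a *\<^sub>v (ar X a \<cdot>\<^sub>v v (tail Q a))) $ k) $ k"
        using k by (simp del: index_mult_mat_vec)
    qed simp
    also have "\<dots> \<in> rad d y j" unfolding rad_def by (rule sum_rangeI) (use t in auto)
    finally show ?thesis .
  qed
  have act: "(X \<odot>\<^bsub>point_module Q d y\<^esub> v) j = ev X j \<cdot>\<^sub>v v j +
      vec (d j) (\<lambda>k. \<Sum>a | a \<in> arcs Q \<and> head Q a = j. ar X a * (y a *\<^sub>v v (tail Q a)) $ k)"
    if X: "X \<in> carrier (bound_algebra Q)" and v: "v \<in> carrier (coord_space Q d)" and j: "j \<in> verts Q" for X v j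
    unfolding point_smult[OF y X v] using j coord_memD[OF v j] by (intro eq_vecI) auto
  show smult: "X \<odot>\<^bsub>point_module Q d y\<^esub> v \<in> N" if X: "X \<in> carrier (bound_algebra Q)" and v: "v \<in> N" for X v
  proof -
    have vc: "v \<in> carrier (coord_space Q d)" using v by (simp add: N_def)
    have "(X \<odot>\<^bsub>point_module Q d y\<^esub> v) j \<in> rad d y j" if j: "j \<in> verts Q" for j
      unfolding act[OF X vc j] using v j part[OF vc j] subspace_lincomb[OF rad_subspace[OF yt]]
      by (auto simp: N_def)
    then show ?thesis using point_smult_closed[OF y X vc] by (simp add: N_def)
  qed
  show "subgroup N (add_monoid (point_module Q d y))"
  proof (rule submodule_subgroup)
    show "N \<subseteq> carrier (point_module Q d y)" by (auto simp: N_def point_module_simps)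
    show "\<zero>\<^bsub>point_module Q d y\<^esub> \<in> N"
      using rad_subspace[OF yt] by (auto simp: N_def point_module_simps coord_closed coord_ops vec_subspace_def)
    show "v \<oplus>\<^bsub>point_module Q d y\<^esub> w \<in> N" if "v \<in> N" "w \<in> N" for v w
      using that subspace_lincomb(1)[OF rad_subspace[OF yt]]
      by (auto simp: N_def point_module_simps coord_closed coord_ops)
  qed (rule smult)
  assume X: "X \<in> jacobson_radical (bound_algebra Q)" and v: "v \<in> carrier (coord_space Q d)"
  have Xc: "X \<in> carrier (bound_algebra Q)" and X0: "\<And>i. i \<in> verts Q \<Longrightarrow> ev X i = 0"
    using X by (auto simp: jacobson_radical_eq)
  have "(X \<odot>\<^bsub>point_module Q d y\<^esub> v) j \<in> rad d y j" if j: "j \<in> verts Q" for j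
  proof -
    have "(X \<odot>\<^bsub>point_module Q d y\<^esub> v) j =
        vec (d j) (\<lambda>k. \<Sum>a | a \<in> arcs Q \<and> head Q a = j. ar X a * (y a *\<^sub>v v (tail Q a)) $ k)"
      unfolding act[OF Xc v j] using X0[OF j] coord_memD[OF v j] by (intro eq_vecI) auto
    then show ?thesis using part[OF v j] by simp
  qed
  then show "X \<odot>\<^bsub>point_module Q d y\<^esub> v \<in> N" using point_smult_closed[OF y Xc v] by (simp add: N_def)
qed

text \<open>Elements of J have no vertex part, so JM lies in the sums of images. Conversely such a
  sum is taken apart arrow by arrow: each summand is \<open>X u\<close>, where \<open>X\<close> in J
  has coordinate 1 at that arrow and 0 elsewhere, and \<open>u\<close> is concentrated at its
  tail.\<close>

lemma radical_eq:
  assumes y: "y \<in> rep_variety Q d"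
  shows "ideal_times_module (jacobson_radical (bound_algebra Q)) (point_module Q d y) =
    {v \<in> carrier (coord_space Q d). \<forall>i\<in>verts Q. v i \<in> rad d (y :: 'a \<Rightarrow> 'k::field mat) i}" (is "?JM = ?N")
proof
  let ?L = "bound_algebra Q :: ('v \<times> 'a list \<Rightarrow> 'k) set ring" and ?M = "point_module Q d y"
  interpret left_module ?L ?M by (rule point_left_module[OF y])
  have yt: "y \<in> matrix_tuples Q d d" using y by (simp add: rep_variety_iff)
  let ?S = "{X \<odot>\<^bsub>?M\<^esub> v | X v. X \<in> jacobson_radical ?L \<and> v \<in> carrier ?M}"
  show "?JM \<subseteq> ?N"
    unfolding ideal_times_module_def
    by (rule M.add.generate_subgroup_incl[OF _ radical_submodule(2)[OF y]])
      (use radical_submodule(3)[OF y] in \<open>auto simp: point_module_simps\<close>)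
  show "?N \<subseteq> ?JM"
  proof
    fix v assume v: "v \<in> ?N"
    then have vc: "v \<in> carrier (coord_space Q d)" by simp
    have "\<forall>i\<in>verts Q. \<exists>w. (\<forall>a\<in>{a \<in> arcs Q. head Q a = i}. w a \<in> carrier_vec (dim_col (y a))) \<and>
        v i = vec (d i) (\<lambda>k. \<Sum>a | a \<in> arcs Q \<and> head Q a = i. (y a *\<^sub>v w a) $ k)"
      using v unfolding rad_def sum_range_def by blast
    from bchoice[OF this] obtain W where W0: "\<forall>i\<in>verts Q.
        (\<forall>a\<in>{a \<in> arcs Q. head Q a = i}. W i a \<in> carrier_vec (dim_col (y a))) \<and>
        v i = vec (d i) (\<lambda>k. \<Sum>a | a \<in> arcs Q \<and> head Q a = i. (y a *\<^sub>v W i a) $ k)" by blast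
    then have W: "\<And>i a. i \<in> verts Q \<Longrightarrow> a \<in> arcs Q \<Longrightarrow> head Q a = i \<Longrightarrow> W i a \<in> carrier_vec (dim_col (y a))"
      "\<And>i. i \<in> verts Q \<Longrightarrow> v i = vec (d i) (\<lambda>k. \<Sum>a | a \<in> arcs Q \<and> head Q a = i. (y a *\<^sub>v W i a) $ k)"
      by simp_all
    \<comment> \<open>The part of \<open>v\<close> that comes from the arrows in \<open>A\<close>,
      for all vertices at once; induction over \<open>A\<close> adds one product \<open>X u\<close>
      per arrow.\<close>
    define s where "s A = (\<lambda>j\<in>verts Q. vec (d j) (\<lambda>k. \<Sum>a | a \<in> A \<and> head Q a = j. (y a *\<^sub>v W j a) $ k))" for A
    have sc: "s A \<in> carrier (coord_space Q d)" for A by (simp add: s_def coord_carrier)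
    have "s A \<in> generate (add_monoid ?M) ?S" if "finite A" "A \<subseteq> arcs Q" for A
      using that
    proof (induction A rule: finite_induct)
      case empty
      have "s {} = \<zero>\<^bsub>?M\<^esub>"
        unfolding point_module_simps by (rule coord_eqI[OF sc coord_closed(3)]) (simp add: s_def coord_ops)
      then show ?case using generate.one[of "add_monoid ?M" ?S] by simp
    next
      case (insert a A)
      have a: "a \<in> arcs Q" "head Q a \<in> verts Q" "tail Q a \<in> verts Q" using insert by auto
      obtain X :: "('v \<times> 'a list \<Rightarrow> 'k) set" where X: "X \<in> carrier ?L"
        "\<And>i. i \<in> verts Q \<Longrightarrow> ev X i = 0" "\<And>b. b \<in> arcs Q \<Longrightarrow> ar X b = (if b = a then 1 else 0)"
        using bound_algebra_coords_exist[of "\<lambda>_. 0" "\<lambda>b. if b = a then 1 else 0"] by blast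
      define u where "u = (\<lambda>j\<in>verts Q. if j = tail Q a then W (head Q a) a else 0\<^sub>v (d j))"
      have Wc: "W (head Q a) a \<in> carrier_vec (d (tail Q a))"
        using W(1)[OF a(2,1)] matrix_tuplesD[OF yt a(1)] by simp
      then have u: "u \<in> carrier (coord_space Q d)" by (auto simp: u_def coord_carrier)
      have "X \<in> jacobson_radical ?L" using X by (simp add: jacobson_radical_eq)
      then have "X \<odot>\<^bsub>?M\<^esub> u \<in> ?S" using u by (auto simp: point_module_simps)
      then have "X \<odot>\<^bsub>?M\<^esub> u \<in> generate (add_monoid ?M) ?S" by (rule generate.incl)
      then have "X \<odot>\<^bsub>?M\<^esub> u \<oplus>\<^bsub>?M\<^esub> s A \<in> generate (add_monoid ?M) ?S"
        using generate.eng[of "X \<odot>\<^bsub>?M\<^esub> u" "add_monoid ?M" ?S "s A"] insert by simp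
      moreover have "X \<odot>\<^bsub>?M\<^esub> u \<oplus>\<^bsub>?M\<^esub> s A = s (insert a A)"
        unfolding point_module_simps
      proof (rule coord_eqI[OF coord_closed(1)[OF point_smult_closed[OF y X(1) u] sc] sc])
        fix j k assume jk: "j \<in> verts Q" "k < d j"
        have "(X \<odot>\<^bsub>?M\<^esub> u) j $ k = (\<Sum>b | b \<in> arcs Q \<and> head Q b = j. ar X b * (y b *\<^sub>v u (tail Q b)) $ k)"
          unfolding point_smult_nth[OF y X(1) u jk] by (simp add: X(2) jk)
        also have "\<dots> = (\<Sum>b | b \<in> arcs Q \<and> head Q b = j. if b = a then (y a *\<^sub>v W (head Q a) a) $ k else 0)"
          by (rule sum.cong) (use a in \<open>auto simp: X(3) u_def\<close>)
        also have "\<dots> = (if head Q a = j then (y a *\<^sub>v W j a) $ k else 0)"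
          using a by (auto simp: sum.delta')
        finally have 1: "(X \<odot>\<^bsub>?M\<^esub> u) j $ k = (if head Q a = j then (y a *\<^sub>v W j a) $ k else 0)" .
        have "{b. b \<in> insert a A \<and> head Q b = j} =
            (if head Q a = j then insert a {b. b \<in> A \<and> head Q b = j} else {b. b \<in> A \<and> head Q b = j})" by auto
        then have "s (insert a A) j $ k = (if head Q a = j then (y a *\<^sub>v W j a) $ k else 0) + s A j $ k"
          using jk insert by (simp add: s_def del: index_mult_mat_vec)
        then show "(X \<odot>\<^bsub>?M\<^esub> u \<oplus>\<^bsub>coord_space Q d\<^esub> s A) j $ k = s (insert a A) j $ k"
          using jk 1 coord_memD[OF sc jk(1), of A] by (simp add: coord_ops)
      qed
      ultimately show ?case by simp
    qed
    moreover have "s (arcs Q) = v"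
      by (rule coord_eqI[OF sc vc]) (use W(2) in \<open>simp add: s_def\<close>)
    ultimately show "v \<in> ?JM" unfolding ideal_times_module_def using finite_arcs by fastforce
  qed
qed

lemma top_projection:
  assumes y: "y \<in> rep_variety Q d"
  defines "M \<equiv> point_module Q d (y :: 'a \<Rightarrow> 'k::field mat)"
  defines "N \<equiv> ideal_times_module (jacobson_radical (bound_algebra Q)) M"
  shows "(\<lambda>v. N +>\<^bsub>M\<^esub> v) \<in> module_hom (bound_algebra Q) M (module_top (bound_algebra Q) M)"
    and "(\<lambda>v. N +>\<^bsub>M\<^esub> v) ` carrier M = carrier (module_top (bound_algebra Q) M)"
    and "v \<in> carrier (coord_space Q d) \<Longrightarrow> w \<in> carrier (coord_space Q d) \<Longrightarrow>
      N +>\<^bsub>M\<^esub> v = N +>\<^bsub>M\<^esub> w \<longleftrightarrow> (\<forall>i\<in>verts Q. v i - w i \<in> rad d y i)"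
proof -
  interpret left_module "bound_algebra Q" M unfolding M_def by (rule point_left_module[OF y])
  have N: "N = {v \<in> carrier (coord_space Q d). \<forall>i\<in>verts Q. v i \<in> rad d y i}"
    unfolding N_def M_def by (rule radical_eq[OF y])
  have sub: "subgroup N (add_monoid M)" unfolding N M_def by (rule radical_submodule(2)[OF y])
  have sm: "X \<odot>\<^bsub>M\<^esub> v \<in> N" if "X \<in> carrier (bound_algebra Q)" "v \<in> N" for X v
    using radical_submodule(1)[OF y that(1)] that(2) unfolding N M_def by blast
  have *: "(\<lambda>v. N +>\<^bsub>M\<^esub> v) \<in> module_hom (bound_algebra Q) M (quotient_module M N)"
    by (rule quotient_module_projection(1)[OF left_module_axioms sub]) (rule sm)
  have **: "(\<lambda>v. N +>\<^bsub>M\<^esub> v) ` carrier M = carrier (quotient_module M N)"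
    by (rule quotient_module_projection(2)[OF left_module_axioms sub]) (rule sm)
  have ***: "N +>\<^bsub>M\<^esub> x = N +>\<^bsub>M\<^esub> z \<longleftrightarrow> x \<ominus>\<^bsub>M\<^esub> z \<in> N" if "x \<in> carrier M" "z \<in> carrier M" for x z
    by (rule quotient_module_projection(3)[OF left_module_axioms sub _ that]) (rule sm)
  show "(\<lambda>v. N +>\<^bsub>M\<^esub> v) \<in> module_hom (bound_algebra Q) M (module_top (bound_algebra Q) M)"
    "(\<lambda>v. N +>\<^bsub>M\<^esub> v) ` carrier M = carrier (module_top (bound_algebra Q) M)"
    using * ** by (simp_all add: module_top_def N_def)
  assume v: "v \<in> carrier (coord_space Q d)" and w: "w \<in> carrier (coord_space Q d)"
  then have vw: "v \<in> carrier M" "w \<in> carrier M" by (simp_all add: M_def point_module_simps)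
  have "v \<ominus>\<^bsub>M\<^esub> w \<in> carrier M" using vw by simp
  then have "v \<ominus>\<^bsub>M\<^esub> w \<in> carrier (coord_space Q d)" by (simp add: M_def point_module_simps)
  then show "N +>\<^bsub>M\<^esub> v = N +>\<^bsub>M\<^esub> w \<longleftrightarrow> (\<forall>i\<in>verts Q. v i - w i \<in> rad d y i)"
    using ***[OF vw] point_minus_nth[OF y v w] unfolding N by (simp add: M_def)
qed


section \<open>The simple modules and T in coordinates\<close>

text \<open>The simple module S_i with \<open>K\<close> as its space, the class of
  \<open>e_i\<close> being the basis vector 1.\<close>

definition one_dim :: "'v \<Rightarrow> (('v \<times> 'a list \<Rightarrow> 'k::field) set, 'k) module" where
  "one_dim i = \<lparr>carrier = UNIV, mult = undefined, one = undefined, zero = 0, add = (+),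
     smult = (\<lambda>X c. ev X i * c)\<rparr>"

text \<open>Evaluation at \<open>i\<close> and the projection to the quotient are two surjections
  from the left ideal generated by \<open>e = e_i\<close>. They have the same kernel: elements of
  that ideal have \<open>ev\<close> equal to 0 at all other vertices, so \<open>ev Z i = 0\<close>
  puts \<open>Z\<close> into J, and \<open>Z = Z e\<close> puts it into Je.\<close>

lemma simple_module_iso:
  assumes i: "i \<in> verts Q"
  shows "modules_isomorphic (bound_algebra Q) (one_dim i) (simple_module Q i :: (('v \<times> 'a list \<Rightarrow> 'k::field) set, _) module)"
proof -
  let ?L = "bound_algebra Q :: ('v \<times> 'a list \<Rightarrow> 'k) set ring"
  interpret L: ring ?L by (rule bound_algebra_ring)
  define e where "e = (vertex_idem Q i :: ('v \<times> 'a list \<Rightarrow> 'k) set)"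
  note e = vertex_idem_coords[OF i, where 'k = 'k, folded e_def]
  have ec: "e \<in> carrier ?L" by (rule e(1))
  have ee: "e \<otimes>\<^bsub>?L\<^esub> e = e"
    by (rule bound_algebra_eqI) (auto simp: e(1) ev_mult[OF ec ec] e(2,3))
  let ?Le = "{a \<otimes>\<^bsub>?L\<^esub> e | a. a \<in> carrier ?L}"
  let ?Je = "{a \<otimes>\<^bsub>?L\<^esub> e | a. a \<in> jacobson_radical ?L}"
  define M where "M = left_ideal_module ?L ?Le"
  have Ms: "carrier M = ?Le" "add M = add ?L" "zero M = zero ?L" "smult M = mult ?L"
    by (simp_all add: M_def left_ideal_module_def)
  have LeI: "X \<otimes>\<^bsub>?L\<^esub> e \<in> ?Le" if "X \<in> carrier ?L" for X using that by blast
  have Lec: "?Le \<subseteq> carrier ?L" using ec by auto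
  have Le_add: "X \<oplus>\<^bsub>?L\<^esub> Y \<in> ?Le" if XY: "X \<in> ?Le" "Y \<in> ?Le" for X Y
  proof -
    obtain a b where ab: "a \<in> carrier ?L" "X = a \<otimes>\<^bsub>?L\<^esub> e" "b \<in> carrier ?L" "Y = b \<otimes>\<^bsub>?L\<^esub> e" using XY by blast
    have "X \<oplus>\<^bsub>?L\<^esub> Y = (a \<oplus>\<^bsub>?L\<^esub> b) \<otimes>\<^bsub>?L\<^esub> e" using ab ec by (simp add: L.l_distr)
    then show ?thesis using LeI[of "a \<oplus>\<^bsub>?L\<^esub> b"] ab by simp
  qed
  have Le_mult: "X \<otimes>\<^bsub>?L\<^esub> Y \<in> ?Le" if X: "X \<in> carrier ?L" and Y: "Y \<in> ?Le" for X Y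
  proof -
    obtain b where b: "b \<in> carrier ?L" "Y = b \<otimes>\<^bsub>?L\<^esub> e" using Y by blast
    have "X \<otimes>\<^bsub>?L\<^esub> Y = (X \<otimes>\<^bsub>?L\<^esub> b) \<otimes>\<^bsub>?L\<^esub> e" using X b ec by (simp add: L.m_assoc)
    then show ?thesis using LeI[of "X \<otimes>\<^bsub>?L\<^esub> b"] X b by simp
  qed
  have Le_zero: "\<zero>\<^bsub>?L\<^esub> \<in> ?Le" using LeI[of "\<zero>\<^bsub>?L\<^esub>"] ec by simp
  have abM: "abelian_group M"
  proof (rule abelian_groupI)
    fix X assume X: "X \<in> carrier M"
    then obtain a where a: "a \<in> carrier ?L" "X = a \<otimes>\<^bsub>?L\<^esub> e" by (auto simp: Ms)
    have "\<ominus>\<^bsub>?L\<^esub> X = (\<ominus>\<^bsub>?L\<^esub> a) \<otimes>\<^bsub>?L\<^esub> e" using a ec by (simp add: L.l_minus)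
    then have "\<ominus>\<^bsub>?L\<^esub> X \<in> carrier M" using LeI[of "\<ominus>\<^bsub>?L\<^esub> a"] a unfolding Ms by simp
    moreover have "\<ominus>\<^bsub>?L\<^esub> X \<oplus>\<^bsub>?L\<^esub> X = \<zero>\<^bsub>?L\<^esub>" using X Lec unfolding Ms by (intro L.l_neg) auto
    ultimately show "\<exists>Y\<in>carrier M. Y \<oplus>\<^bsub>M\<^esub> X = \<zero>\<^bsub>M\<^esub>" unfolding Ms(2,3) by blast
  next
    fix X Y assume "X \<in> carrier M" "Y \<in> carrier M"
    then show "X \<oplus>\<^bsub>M\<^esub> Y \<in> carrier M" unfolding Ms by (rule Le_add)
  next
    show "\<zero>\<^bsub>M\<^esub> \<in> carrier M" unfolding Ms by (rule Le_zero)
  next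
    fix X Y Z assume "X \<in> carrier M" "Y \<in> carrier M" "Z \<in> carrier M"
    then have "X \<in> carrier ?L" "Y \<in> carrier ?L" "Z \<in> carrier ?L" using Lec unfolding Ms by blast+
    then show "X \<oplus>\<^bsub>M\<^esub> Y \<oplus>\<^bsub>M\<^esub> Z = X \<oplus>\<^bsub>M\<^esub> (Y \<oplus>\<^bsub>M\<^esub> Z)" unfolding Ms by (rule L.a_assoc)
  next
    fix X Y assume "X \<in> carrier M" "Y \<in> carrier M"
    then have "X \<in> carrier ?L" "Y \<in> carrier ?L" using Lec unfolding Ms by blast+
    then show "X \<oplus>\<^bsub>M\<^esub> Y = Y \<oplus>\<^bsub>M\<^esub> X" unfolding Ms by (rule L.a_comm)
  next
    fix X assume "X \<in> carrier M"
    then have "X \<in> carrier ?L" using Lec unfolding Ms by blast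
    then show "\<zero>\<^bsub>M\<^esub> \<oplus>\<^bsub>M\<^esub> X = X" unfolding Ms by (rule L.l_zero)
  qed
  have lm: "left_module ?L M"
  proof -
    interpret abelian_group M by (rule abM)
    show ?thesis
    proof (unfold_locales, goal_cases)
      case (1 a x)
      then show ?case unfolding Ms by (rule Le_mult)
    next
      case (2 a b x)
      then show ?case using Lec unfolding Ms by (intro L.l_distr) auto
    next
      case (3 a x y)
      then show ?case using Lec unfolding Ms by (intro L.r_distr) auto
    next
      case (4 a b x)
      then show ?case using Lec unfolding Ms by (intro L.m_assoc) auto
    next
      case (5 x)
      then show ?case using Lec unfolding Ms by (intro L.l_one) auto
    qed
  qed
  interpret M: left_module ?L M by (rule lm)
  have J: "X \<in> jacobson_radical ?L \<longleftrightarrow> X \<in> carrier ?L \<and> (\<forall>j\<in>verts Q. ev X j = 0)" for X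
    by (simp add: jacobson_radical_eq)
  have JeI: "X \<otimes>\<^bsub>?L\<^esub> e \<in> ?Je" if "X \<in> jacobson_radical ?L" for X using that by blast
  have Je_iff: "Z \<in> ?Je \<longleftrightarrow> ev Z i = 0" if Z: "Z \<in> ?Le" for Z
  proof
    assume "Z \<in> ?Je"
    then obtain b where "b \<in> jacobson_radical ?L" "Z = b \<otimes>\<^bsub>?L\<^esub> e" by blast
    then show "ev Z i = 0" using i by (auto simp: J ev_mult(1)[OF _ ec])
  next
    assume 0: "ev Z i = 0"
    obtain a where a: "a \<in> carrier ?L" "Z = a \<otimes>\<^bsub>?L\<^esub> e" using Z by blast
    have "Z \<in> jacobson_radical ?L"
      using 0 a ec by (auto simp: J ev_mult(1)[OF _ ec] e(2))
    moreover have "Z = Z \<otimes>\<^bsub>?L\<^esub> e" using a ec ee by (simp add: L.m_assoc)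
    ultimately show "Z \<in> ?Je" using JeI[of Z] by simp
  qed
  have Je_sub: "?Je \<subseteq> ?Le" using J by blast
  have smJ: "X \<odot>\<^bsub>M\<^esub> Y \<in> ?Je" if X: "X \<in> carrier ?L" and Y: "Y \<in> ?Je" for X Y
  proof -
    have "Y \<in> ?Le" using Y Je_sub by blast
    then show ?thesis
      using Je_iff[OF Le_mult[OF X \<open>Y \<in> ?Le\<close>]] Je_iff[OF \<open>Y \<in> ?Le\<close>] Y X Lec ev_mult(1)[OF X, of Y i]
      unfolding Ms by (metis (no_types, lifting) mult_zero_right subsetD)
  qed
  have Jg: "subgroup ?Je (add_monoid M)"
  proof (rule M.submodule_subgroup)
    show "?Je \<subseteq> carrier M" using Je_sub unfolding Ms .
    show "\<zero>\<^bsub>M\<^esub> \<in> ?Je" unfolding Ms using Je_iff[OF Le_zero] ev_zero by blast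
    fix X Y assume XY: "X \<in> ?Je" "Y \<in> ?Je"
    then have XY': "X \<in> ?Le" "Y \<in> ?Le" using Je_sub by blast+
    then have c: "X \<in> carrier ?L" "Y \<in> carrier ?L" using Lec by blast+
    have "ev X i = 0" "ev Y i = 0" using Je_iff XY XY' by blast+
    then have "ev (X \<oplus>\<^bsub>?L\<^esub> Y) i = 0" by (simp add: ev_add(1)[OF c])
    then show "X \<oplus>\<^bsub>M\<^esub> Y \<in> ?Je" unfolding Ms using Je_iff[OF Le_add[OF XY']] by blast
  qed (rule smJ)
  have S: "simple_module Q i = quotient_module M ?Je"
    by (simp add: simple_module_def Let_def M_def e_def)
  have q1: "(\<lambda>x. ?Je +>\<^bsub>M\<^esub> x) \<in> module_hom ?L M (quotient_module M ?Je)"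
    by (rule quotient_module_projection(1)[OF lm Jg]) (rule smJ)
  have q2: "(\<lambda>x. ?Je +>\<^bsub>M\<^esub> x) ` carrier M = carrier (quotient_module M ?Je)"
    by (rule quotient_module_projection(2)[OF lm Jg]) (rule smJ)
  have q3: "?Je +>\<^bsub>M\<^esub> x = ?Je +>\<^bsub>M\<^esub> z \<longleftrightarrow> x \<ominus>\<^bsub>M\<^esub> z \<in> ?Je" if "x \<in> carrier M" "z \<in> carrier M" for x z
    by (rule quotient_module_projection(3)[OF lm Jg _ that]) (rule smJ)
  have p1: "(\<lambda>X. ev X i) \<in> module_hom ?L M (one_dim i)"
  proof (rule module_homI)
    fix X Y assume "X \<in> carrier M" "Y \<in> carrier M"
    then have "X \<in> carrier ?L" "Y \<in> carrier ?L" using Lec unfolding Ms by blast+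
    then show "ev (X \<oplus>\<^bsub>M\<^esub> Y) i = ev X i \<oplus>\<^bsub>one_dim i\<^esub> ev Y i"
      unfolding Ms by (simp add: one_dim_def ev_add)
  next
    fix X Y assume X: "X \<in> carrier ?L" and "Y \<in> carrier M"
    then have "Y \<in> carrier ?L" using Lec unfolding Ms by blast
    then show "ev (X \<odot>\<^bsub>M\<^esub> Y) i = X \<odot>\<^bsub>one_dim i\<^esub> ev Y i"
      unfolding Ms using X by (simp add: one_dim_def ev_mult)
  qed (simp add: one_dim_def)
  have "c \<in> (\<lambda>X. ev X i) ` carrier M" for c :: 'k
  proof (rule image_eqI)
    note s = scalar_coords[where c = c]
    show "scalar Q c \<otimes>\<^bsub>?L\<^esub> e \<in> carrier M" unfolding Ms by (rule LeI[OF s(1)])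
    show "c = ev (scalar Q c \<otimes>\<^bsub>?L\<^esub> e) i" using i by (simp add: ev_mult(1)[OF s(1) ec] s e(2))
  qed
  then have p2: "(\<lambda>X. ev X i) ` carrier M = carrier (one_dim i :: (('v \<times> 'a list \<Rightarrow> 'k) set, 'k) module)"
    by (auto simp: one_dim_def)
  have ker: "ev X i = ev Y i \<longleftrightarrow> ?Je +>\<^bsub>M\<^esub> X = ?Je +>\<^bsub>M\<^esub> Y" if XY: "X \<in> carrier M" "Y \<in> carrier M" for X Y
  proof -
    define Z where "Z = X \<ominus>\<^bsub>M\<^esub> Y"
    have Z: "Z \<in> carrier M" using XY by (simp add: Z_def)
    have "Z \<oplus>\<^bsub>M\<^esub> Y = X" using XY by (simp add: Z_def a_minus_def M.M.a_assoc M.M.l_neg)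
    then have ZX: "Z \<oplus>\<^bsub>?L\<^esub> Y = X" unfolding Ms .
    have "Z \<in> carrier ?L" "Y \<in> carrier ?L" using Z XY Lec unfolding Ms by blast+
    then have "ev X i = ev Z i + ev Y i" unfolding ZX[symmetric] by (rule ev_add(1))
    then have "ev X i = ev Y i \<longleftrightarrow> ev Z i = 0" by simp
    also have "\<dots> \<longleftrightarrow> Z \<in> ?Je" using Je_iff[OF Z[unfolded Ms]] by blast
    finally show ?thesis unfolding q3[OF XY] Z_def .
  qed
  show ?thesis unfolding S by (rule isomorphic_of_common_quotient[OF lm p1 p2 q1 q2 ker])
qed

text \<open>All arrows act as zero, hence so does J; with dimension vector \<open>t\<close> this
  point represents T.\<close>

definition zero_rep :: "('v \<Rightarrow> nat) \<Rightarrow> 'a \<Rightarrow> 'k::field mat" where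
  "zero_rep t = (\<lambda>a\<in>arcs Q. 0\<^sub>m (t (head Q a)) (t (tail Q a)))"

lemma zero_mat_mult_vec: "v \<in> carrier_vec m \<Longrightarrow> 0\<^sub>m n m *\<^sub>v v = (0\<^sub>v n :: 'k::field vec)"
  by (intro eq_vecI) auto

lemma zero_rep: "(zero_rep t :: 'a \<Rightarrow> 'k::field mat) \<in> rep_variety Q t"
  by (auto simp: rep_variety_iff zero_rep_def matrix_tuples_def square_zero_def zero_mat_mult_vec)

lemma zero_rep_smult_nth:
  assumes "X \<in> carrier (bound_algebra Q)" "v \<in> carrier (coord_space Q t)" "j \<in> verts Q" "k < t j"
  shows "(X \<odot>\<^bsub>point_module Q t (zero_rep t)\<^esub> v) j $ k = ev X j * (v j $ k :: 'k::field)"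
proof -
  have "(\<Sum>a | a \<in> arcs Q \<and> head Q a = j. ar X a * ((zero_rep t a :: 'k mat) *\<^sub>v v (tail Q a)) $ k) = 0"
    by (rule sum.neutral)
      (use assms coord_memD[OF assms(2)] in \<open>auto simp: zero_rep_def zero_mat_mult_vec simp del: index_mult_mat_vec\<close>)
  then show ?thesis using point_smult_nth[OF zero_rep assms] by simp
qed

text \<open>Coordinate \<open>j\<close> of the component at \<open>i\<close> goes to copy
  \<open>j\<close> of S_i, through a chosen isomorphism with \<open>one_dim i\<close>.\<close>

lemma semisimple_module_iso:
  "modules_isomorphic (bound_algebra Q) (point_module Q t (zero_rep t :: 'a \<Rightarrow> 'k::field mat)) (semisimple_module Q t)"
proof -
  let ?L = "bound_algebra Q :: ('v \<times> 'a list \<Rightarrow> 'k) set ring" and ?P = "point_module Q t (zero_rep t :: 'a \<Rightarrow> 'k mat)"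
  let ?S = "\<lambda>i. simple_module Q i :: (('v \<times> 'a list \<Rightarrow> 'k) set, _) module"
  have "\<forall>i\<in>verts Q. \<exists>f. f \<in> module_iso ?L (one_dim i) (?S i)"
    using simple_module_iso by (auto simp: modules_isomorphic_def)
  from bchoice[OF this] obtain f where f: "\<And>i. i \<in> verts Q \<Longrightarrow> f i \<in> module_iso ?L (one_dim i) (?S i)" by blast
  have fbij: "bij_betw (f i) UNIV (carrier (?S i))" if "i \<in> verts Q" for i
    using f[OF that] by (simp add: module_iso_def one_dim_def)
  have fadd: "f i (c + c') = f i c \<oplus>\<^bsub>?S i\<^esub> f i c'" if "i \<in> verts Q" for i c c'
    using f[OF that] by (simp add: module_iso_def one_dim_def)
  have fsmult: "f i (ev X i * c) = X \<odot>\<^bsub>?S i\<^esub> f i c" if "i \<in> verts Q" "X \<in> carrier ?L" for i c X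
    using f[OF that(1)] that(2) by (simp add: module_iso_def one_dim_def)
  define I where "I = (SIGMA i:verts Q. {..<t i})"
  define h where "h u = (\<lambda>(i,j)\<in>I. f i (u i $ j))" for u
  define g where "g Z = (\<lambda>i\<in>verts Q. vec (t i) (\<lambda>j. inv_into UNIV (f i) (Z (i,j))))" for Z
  have car: "carrier (semisimple_module Q t :: (('v \<times> 'a list \<Rightarrow> 'k) set, _) module) = (\<Pi>\<^sub>E (i,j)\<in>I. carrier (?S i))"
    by (auto simp: semisimple_module_def direct_sum_module_def I_def case_prod_unfold)
  have finv: "f i (inv_into UNIV (f i) z) = z" if "i \<in> verts Q" "z \<in> carrier (?S i)" for i z
    using fbij[OF that(1)] that(2) by (simp add: bij_betw_inv_into_right)
  have invf: "inv_into UNIV (f i) (f i c) = c" if "i \<in> verts Q" for i c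
    using fbij[OF that] by (simp add: bij_betw_inv_into_left)
  have fc: "f i c \<in> carrier (?S i)" if "i \<in> verts Q" for i c
    using fbij[OF that] by (auto simp: bij_betw_def)
  have "bij_betw h (carrier ?P) (carrier (semisimple_module Q t :: (('v \<times> 'a list \<Rightarrow> 'k) set, _) module))"
  proof (rule bij_betw_byWitness[where f' = g])
    show "\<forall>u\<in>carrier ?P. g (h u) = u"
    proof
      fix u assume "u \<in> carrier ?P"
      then have u: "u \<in> carrier (coord_space Q t)" by (simp add: point_module_simps)
      show "g (h u) = u"
        by (rule coord_eqI[OF _ u]) (auto simp: g_def h_def I_def invf coord_carrier)
    qed
    show "\<forall>Z\<in>carrier (semisimple_module Q t). h (g Z) = Z"
    proof
      fix Z :: "'v \<times> nat \<Rightarrow> ('v \<times> 'a list \<Rightarrow> 'k) set set"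
      assume "Z \<in> carrier (semisimple_module Q t)"
      then have Z: "Z \<in> (\<Pi>\<^sub>E (i,j)\<in>I. carrier (?S i))" by (simp add: car)
      show "h (g Z) = Z"
      proof (rule PiE_ext[OF _ Z])
        show "h (g Z) \<in> (\<Pi>\<^sub>E (i,j)\<in>I. carrier (?S i))" by (auto simp: h_def I_def fc)
        fix p assume p: "p \<in> I"
        then show "h (g Z) p = Z p"
          using PiE_mem[OF Z p] by (cases p) (auto simp: h_def g_def I_def finv)
      qed
    qed
    show "h ` carrier ?P \<subseteq> carrier (semisimple_module Q t)"       unfolding car by (intro image_subsetI) (auto simp: h_def I_def fc)
    show "g ` carrier (semisimple_module Q t) \<subseteq> carrier ?P"
      by (auto simp: g_def point_module_simps coord_carrier)
  qed
  moreover have "h (u \<oplus>\<^bsub>?P\<^esub> w) = h u \<oplus>\<^bsub>semisimple_module Q t\<^esub> h w" if "u \<in> carrier ?P" "w \<in> carrier ?P" for u w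
  proof -
    have uw: "u \<in> carrier (coord_space Q t)" "w \<in> carrier (coord_space Q t)" using that by (simp_all add: point_module_simps)
    have "(u \<oplus>\<^bsub>coord_space Q t\<^esub> w) i $ j = u i $ j + w i $ j" if "i \<in> verts Q" "j < t i" for i j
      using that coord_memD[OF uw(2) that(1)] by (simp add: coord_ops)
    then show ?thesis
      by (auto simp: h_def I_def point_module_simps semisimple_module_def direct_sum_module_def fadd fun_eq_iff)
  qed
  moreover have "h (X \<odot>\<^bsub>?P\<^esub> u) = X \<odot>\<^bsub>semisimple_module Q t\<^esub> h u" if X: "X \<in> carrier ?L" and "u \<in> carrier ?P" for X u
  proof -
    have u: "u \<in> carrier (coord_space Q t)" using that by (simp add: point_module_simps)
    then show ?thesis
      by (auto simp: h_def I_def semisimple_module_def direct_sum_module_def fun_eq_iff zero_rep_smult_nth[OF X u] fsmult[OF _ X])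
  qed
  ultimately have "h \<in> module_iso ?L ?P (semisimple_module Q t)" by (simp add: module_iso_def)
  then show ?thesis by (auto simp: modules_isomorphic_def)
qed

text \<open>An isomorphism of the top with T, composed with the projection, is a family of
  surjective matrices \<open>F i\<close> with kernel \<open>rad d y i\<close>, and rank-nullity
  gives the dimension of the latter. Conversely the first \<open>t i\<close> rows of an adapting
  matrix form such a family. The condition \<open>t i \<le> d i\<close> is part of the equivalence
  because the truncated difference \<open>d i - t i\<close> would hide its failure.\<close>

lemma rep_with_top_iff:
  fixes y :: "'a \<Rightarrow> 'k::field mat"
  assumes y: "y \<in> rep_variety Q d"
  shows "y \<in> rep_with_top Q t d \<longleftrightarrow>
    (\<forall>i\<in>verts Q. t i \<le> d i \<and> (\<exists>P P'. adapted (d i) (rad d y i) (d i - t i) P P'))"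
proof
  let ?L = "bound_algebra Q :: ('v \<times> 'a list \<Rightarrow> 'k) set ring"
  let ?M = "point_module Q d y" and ?Z = "point_module Q t (zero_rep t :: 'a \<Rightarrow> 'k mat)"
  define N where "N = ideal_times_module (jacobson_radical ?L) ?M"
  note proj = top_projection[OF y, folded N_def]
  have yt: "y \<in> matrix_tuples Q d d" using y by (simp add: rep_variety_iff)
  note M = point_left_module[OF y]
  {
    assume "y \<in> rep_with_top Q t d"
    then have "modules_isomorphic ?L (module_top ?L ?M) (semisimple_module Q t)" by (simp add: rep_with_top_def)
    then have "modules_isomorphic ?L (module_top ?L ?M) ?Z"
      by (rule modules_isomorphic_trans[OF _ modules_isomorphic_sym[OF point_left_module[OF zero_rep] semisimple_module_iso]])
    then obtain g where g: "g \<in> module_iso ?L (module_top ?L ?M) ?Z" by (auto simp: modules_isomorphic_def)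
    define h where "h v = g (N +>\<^bsub>?M\<^esub> v)" for v
    have top_c: "N +>\<^bsub>?M\<^esub> v \<in> carrier (module_top ?L ?M)" if "v \<in> carrier ?M" for v
      using proj(2) that by blast
    have hhom: "h \<in> module_hom ?L ?M ?Z"
    proof (rule module_homI)
      show "h \<in> carrier ?M \<rightarrow> carrier ?Z" using g top_c by (auto simp: h_def module_iso_def bij_betw_def)
      show "h (v \<oplus>\<^bsub>?M\<^esub> w) = h v \<oplus>\<^bsub>?Z\<^esub> h w" if "v \<in> carrier ?M" "w \<in> carrier ?M" for v w
        using g top_c that module_hom_add[OF proj(1) that] by (simp add: h_def module_iso_def)
      show "h (X \<odot>\<^bsub>?M\<^esub> v) = X \<odot>\<^bsub>?Z\<^esub> h v" if "X \<in> carrier ?L" "v \<in> carrier ?M" for X v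
        using g top_c that module_hom_smult[OF proj(1) that] by (simp add: h_def module_iso_def)
    qed
    obtain F where F: "\<And>i. i \<in> verts Q \<Longrightarrow> F i \<in> carrier_mat (t i) (d i)"
      "\<And>a. a \<in> arcs Q \<Longrightarrow> F (head Q a) * y a = zero_rep t a * F (tail Q a)"
      "\<And>v. v \<in> carrier (coord_space Q d) \<Longrightarrow> h v = family_map F v"
      using point_hom_family_map[OF y zero_rep hhom] by blast
    have hsurj: "h ` carrier ?M = carrier ?Z"
    proof -
      have "h ` carrier ?M = g ` carrier (module_top ?L ?M)" unfolding proj(2)[symmetric] by (auto simp: h_def)
      then show ?thesis using g by (simp add: module_iso_def bij_betw_def)
    qed
    have hker: "h v = h w \<longleftrightarrow> (\<forall>i\<in>verts Q. v i - w i \<in> rad d y i)"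
      if "v \<in> carrier (coord_space Q d)" "w \<in> carrier (coord_space Q d)" for v w
    proof -
      have "h v = h w \<longleftrightarrow> N +>\<^bsub>?M\<^esub> v = N +>\<^bsub>?M\<^esub> w"
        using g top_c[of v] top_c[of w] that
        by (auto simp: h_def module_iso_def bij_betw_def inj_on_def point_module_simps)
      then show ?thesis using proj(3)[OF that] by simp
    qed
    show "\<forall>i\<in>verts Q. t i \<le> d i \<and> (\<exists>P P'. adapted (d i) (rad d y i) (d i - t i) P P')"
    proof
      fix i assume i: "i \<in> verts Q"
      obtain k P P' where P: "adapted (d i) (rad d y i) k P P'" using adapted_exists[OF rad_subspace[OF yt]] by blast
      have "k + t i = d i"
      proof (rule adapted_kernel_dim[OF F(1)[OF i] P])
        fix z :: "'k vec" assume z: "z \<in> carrier_vec (t i)"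
        have "(\<lambda>j\<in>verts Q. if j = i then z else 0\<^sub>v (t j)) \<in> carrier ?Z"
          using z by (auto simp: point_module_simps coord_carrier)
        then obtain v where v: "v \<in> carrier ?M" "h v = (\<lambda>j\<in>verts Q. if j = i then z else 0\<^sub>v (t j))"
          unfolding hsurj[symmetric] by auto
        then have vc: "v \<in> carrier (coord_space Q d)" by (simp add: point_module_simps)
        have "F i *\<^sub>v v i = z" using F(3)[OF vc] v(2) i by (auto simp: family_map_def dest: fun_cong[of _ _ i])
        then show "\<exists>u\<in>carrier_vec (d i). F i *\<^sub>v u = z" using coord_memD[OF vc i] by blast
      next
        fix u :: "'k vec" assume u: "u \<in> carrier_vec (d i)"
        define v where "v = (\<lambda>j\<in>verts Q. if j = i then u else 0\<^sub>v (d j))"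
        have v: "v \<in> carrier (coord_space Q d)" using u by (auto simp: v_def coord_carrier)
        have z: "\<zero>\<^bsub>coord_space Q d\<^esub> \<in> carrier (coord_space Q d)" by (rule coord_closed(3))
        have "u \<in> rad d y i \<longleftrightarrow> (\<forall>j\<in>verts Q. v j - \<zero>\<^bsub>coord_space Q d\<^esub> j \<in> rad d y j)"
          using i u rad_subspace[OF yt] by (auto simp: v_def coord_ops vec_subspace_def)
        also have "\<dots> \<longleftrightarrow> h v = h \<zero>\<^bsub>coord_space Q d\<^esub>" using hker[OF v z] by simp
        also have "\<dots> \<longleftrightarrow> family_map F v = family_map F \<zero>\<^bsub>coord_space Q d\<^esub>" using F(3)[OF v] F(3)[OF z] by simp
        also have "\<dots> \<longleftrightarrow> F i *\<^sub>v u = 0\<^sub>v (t i)"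
        proof
          assume "family_map F v = family_map F \<zero>\<^bsub>coord_space Q d\<^esub>"
          then have "family_map F v i = family_map F \<zero>\<^bsub>coord_space Q d\<^esub> i" by simp
          then show "F i *\<^sub>v u = 0\<^sub>v (t i)"
            using i mult_mat_zero_vec[OF F(1)[OF i]] by (simp add: family_map_def v_def coord_ops)
        next
          assume "F i *\<^sub>v u = 0\<^sub>v (t i)"
          then show "family_map F v = family_map F \<zero>\<^bsub>coord_space Q d\<^esub>"
            using mult_mat_zero_vec[OF F(1)] by (auto simp: family_map_def v_def coord_ops fun_eq_iff)
        qed
        finally show "u \<in> rad d y i \<longleftrightarrow> F i *\<^sub>v u = 0\<^sub>v (t i)" .
      qed
      then have "k = d i - t i" "t i \<le> d i" by auto
      then show "t i \<le> d i \<and> (\<exists>P P'. adapted (d i) (rad d y i) (d i - t i) P P')" using P by blast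
    qed
  }
  assume asm: "\<forall>i\<in>verts Q. t i \<le> d i \<and> (\<exists>P P'. adapted (d i) (rad d y i) (d i - t i) P P')"
  then have td: "t i \<le> d i" if "i \<in> verts Q" for i using that by blast
  have "\<forall>i\<in>verts Q. \<exists>PP. adapted (d i) (rad d y i) (d i - t i) (fst PP) (snd PP)" using asm by auto
  from bchoice[OF this] obtain PP where PP: "\<forall>i\<in>verts Q. adapted (d i) (rad d y i) (d i - t i) (fst (PP i)) (snd (PP i))" by blast
  define P P' where "P i = fst (PP i)" and "P' i = snd (PP i)" for i
  have P: "adapted (d i) (rad d y i) (d i - t i) (P i) (P' i)" if "i \<in> verts Q" for i
    using PP that by (simp add: P_def P'_def)
  then have Pinv: "inverse_mats (d i) (P i) (P' i)" if "i \<in> verts Q" for i using that by (auto simp: adapted_def)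
  \<comment> \<open>These rows of \<open>P i\<close> vanish exactly on the vectors that
    \<open>P i\<close> sends into the last \<open>d i - t i\<close> coordinates, that is, on the
    radical.\<close>
  define F where "F i = mat (t i) (d i) (\<lambda>(k,l). P i $$ (k,l))" for i
  have F: "F i \<in> carrier_mat (t i) (d i)" for i by (simp add: F_def)
  have Fnth: "(F i *\<^sub>v v) $ k = (P i *\<^sub>v v) $ k" if "i \<in> verts Q" "v \<in> carrier_vec (d i)" "k < t i" for i v k
    using mult_mat_vec_sum[OF F that(2,3)] mult_mat_vec_sum[OF inverse_matsD(1)[OF Pinv[OF that(1)]] that(2), of k]
      td[OF that(1)] that by (simp add: F_def)
  have Fker: "F i *\<^sub>v v = 0\<^sub>v (t i) \<longleftrightarrow> v \<in> rad d y i" if i: "i \<in> verts Q" and v: "v \<in> carrier_vec (d i)" for i v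
  proof -
    have "F i *\<^sub>v v = 0\<^sub>v (t i) \<longleftrightarrow> (\<forall>k<t i. (F i *\<^sub>v v) $ k = 0)"
      using F[of i] by (auto intro!: eq_vecI simp del: index_mult_mat_vec)
    also have "\<dots> \<longleftrightarrow> P i *\<^sub>v v \<in> last_coords (d i) (d i - t i)"
      using Fnth[OF i v] td[OF i] inverse_matsD(1)[OF Pinv[OF i]] v
      by (auto simp: last_coords_def simp del: index_mult_mat_vec)
    finally show ?thesis using P[OF i] v by (simp add: adapted_def)
  qed
  have "family_map F \<in> module_hom ?L ?M ?Z"
  proof (rule family_map_hom[OF y zero_rep F])
    fix a assume a: "a \<in> arcs Q"
    show "F (head Q a) * y a = zero_rep t a * F (tail Q a)"
    proof (rule mat_eqI_vec)
      show "F (head Q a) * y a \<in> carrier_mat (t (head Q a)) (d (tail Q a))"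
        using F[of "head Q a"] matrix_tuplesD[OF yt a] by simp
      show "zero_rep t a * F (tail Q a) \<in> carrier_mat (t (head Q a)) (d (tail Q a))"
        using F[of "tail Q a"] a by (simp add: zero_rep_def)
      fix v :: "'k vec" assume v: "v \<in> carrier_vec (d (tail Q a))"
      have "(F (head Q a) * y a) *\<^sub>v v = F (head Q a) *\<^sub>v (y a *\<^sub>v v)"
        by (rule assoc_mult_mat_vec[OF F matrix_tuplesD[OF yt a] v])
      also have "\<dots> = 0\<^sub>v (t (head Q a))"
        using Fker[of "head Q a" "y a *\<^sub>v v"] rad_member[OF yt a v] a matrix_tuplesD[OF yt a] v by auto
      also have "\<dots> = (zero_rep t a * F (tail Q a)) *\<^sub>v v"
        using a v F[of "tail Q a"] by (intro eq_vecI) (auto simp: zero_rep_def left_mult_zero_mat[OF F])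
      finally show "(F (head Q a) * y a) *\<^sub>v v = (zero_rep t a * F (tail Q a)) *\<^sub>v v" .
    qed
  qed
  moreover have "family_map F ` carrier ?M = carrier ?Z"
  proof (intro equalityI subsetI)
    fix z assume "z \<in> family_map F ` carrier ?M"
    then show "z \<in> carrier ?Z" using family_map_closed[OF F] by (auto simp: point_module_simps)
  next
    fix z assume "z \<in> carrier ?Z"
    then have z: "z \<in> carrier (coord_space Q t)" by (simp add: point_module_simps)
    \<comment> \<open>A preimage of \<open>z\<close>: each component is padded with zeros to length
      \<open>d i\<close> and pulled back by \<open>P' i\<close>.\<close>
    define v where "v = (\<lambda>i\<in>verts Q. P' i *\<^sub>v vec (d i) (\<lambda>k. if k < t i then z i $ k else 0))"
    have v: "v \<in> carrier (coord_space Q d)"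
      using inverse_matsD(2)[OF Pinv] by (auto simp: v_def coord_carrier intro!: mult_mat_vec_carrier)
    have "z = family_map F v"
    proof (rule coord_eqI[OF z family_map_closed[OF F v]])
      fix i k assume ik: "i \<in> verts Q" "k < t i"
      have "family_map F v i $ k = (P i *\<^sub>v v i) $ k"
        using ik Fnth[OF ik(1) coord_memD[OF v ik(1)] ik(2)] by (simp add: family_map_def)
      also have "P i *\<^sub>v v i = vec (d i) (\<lambda>k. if k < t i then z i $ k else 0)"
        using inverse_mats_cancel(2)[OF Pinv[OF ik(1)]] ik by (simp add: v_def)
      finally show "z i $ k = family_map F v i $ k" using ik td[OF ik(1)] by simp
    qed
    then show "z \<in> family_map F ` carrier ?M" using v by (auto simp: point_module_simps)
  qed
  moreover have "N +>\<^bsub>?M\<^esub> v = N +>\<^bsub>?M\<^esub> w \<longleftrightarrow> family_map F v = family_map F w"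
    if "v \<in> carrier ?M" "w \<in> carrier ?M" for v w
  proof -
    have vw: "v \<in> carrier (coord_space Q d)" "w \<in> carrier (coord_space Q d)" using that by (simp_all add: point_module_simps)
    have "v i - w i \<in> rad d y i \<longleftrightarrow> F i *\<^sub>v v i = F i *\<^sub>v w i" if i: "i \<in> verts Q" for i
    proof -
      note c = coord_memD[OF vw(1) i] coord_memD[OF vw(2) i]
      have "F i *\<^sub>v (v i - w i) = F i *\<^sub>v v i - F i *\<^sub>v w i"
        by (rule mult_minus_distrib_mat_vec[OF F c])
      moreover have "F i *\<^sub>v v i - F i *\<^sub>v w i = 0\<^sub>v (t i) \<longleftrightarrow> F i *\<^sub>v v i = F i *\<^sub>v w i"
      proof
        assume *: "F i *\<^sub>v v i - F i *\<^sub>v w i = 0\<^sub>v (t i)"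
        show "F i *\<^sub>v v i = F i *\<^sub>v w i"
        proof (rule eq_vecI)
          fix k assume "k < dim_vec (F i *\<^sub>v w i)"
          then have k: "k < t i" using F[of i] by simp
          have "(F i *\<^sub>v v i - F i *\<^sub>v w i) $ k = 0" unfolding * using k by simp
          then show "(F i *\<^sub>v v i) $ k = (F i *\<^sub>v w i) $ k" using k F[of i] by simp
        qed (use F[of i] in simp)
      next
        assume "F i *\<^sub>v v i = F i *\<^sub>v w i"
        then show "F i *\<^sub>v v i - F i *\<^sub>v w i = 0\<^sub>v (t i)" using F[of i] by (intro eq_vecI) auto
      qed
      ultimately show ?thesis using Fker[OF i, of "v i - w i"] c by simp
    qed
    then show ?thesis
      unfolding proj(3)[OF vw] by (auto simp: family_map_def fun_eq_iff)
  qed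
  ultimately have "modules_isomorphic ?L (module_top ?L ?M) ?Z"
    by (intro isomorphic_of_common_quotient[OF M proj(1,2)])
  then have "modules_isomorphic ?L (module_top ?L ?M) (semisimple_module Q t)"
    by (rule modules_isomorphic_trans[OF _ semisimple_module_iso])
  then show "y \<in> rep_with_top Q t d" using y by (simp add: rep_with_top_def)
qed

text \<open>The inclusion \<open>inc\<close> of \<open>K^(d i)\<close> as the component at
  \<open>i\<close> is a linear isomorphism onto \<open>e_i M\<close>, through which the dimension is
  transported.\<close>

lemma point_has_dim_vector:
  assumes y: "y \<in> rep_variety Q d"
  shows "has_dim_vector Q d (point_module Q d (y :: 'a \<Rightarrow> 'k::field mat))"
  unfolding has_dim_vector_def
proof
  fix i assume i: "i \<in> verts Q"
  let ?M = "point_module Q d y"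
  define W where "W = vertex_space Q ?M i"
  define inc where "inc u = (\<lambda>j\<in>verts Q. if j = i then u else 0\<^sub>v (d j))" for u :: "'k vec"
  note e = vertex_idem_coords[OF i, where 'k = 'k]
  have inc_c: "inc u \<in> carrier (coord_space Q d)" if "u \<in> carrier_vec (d i)" for u
    using that by (auto simp: inc_def coord_carrier)
  have idem: "vertex_idem Q i \<odot>\<^bsub>?M\<^esub> v = inc (v i)" if v: "v \<in> carrier (coord_space Q d)" for v
  proof (rule coord_eqI[OF point_smult_closed[OF y e(1) v] inc_c[OF coord_memD[OF v i]]])
    fix j k assume "j \<in> verts Q" "k < d j"
    then show "(vertex_idem Q i \<odot>\<^bsub>?M\<^esub> v) j $ k = inc (v i) j $ k"
      using point_smult_nth[OF y e(1) v] by (simp add: e inc_def)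
  qed
  have sc: "scalar Q c \<odot>\<^bsub>?M\<^esub> inc u = inc (c \<cdot>\<^sub>v u)" if u: "u \<in> carrier_vec (d i)" for c u
  proof -
    note s = scalar_coords[where c = c]
    show ?thesis
    proof (rule coord_eqI[OF point_smult_closed[OF y s(1) inc_c[OF u]]])
      show "inc (c \<cdot>\<^sub>v u) \<in> carrier (coord_space Q d)" using u by (intro inc_c) auto
      fix j k assume "j \<in> verts Q" "k < d j"
      then show "(scalar Q c \<odot>\<^bsub>?M\<^esub> inc u) j $ k = inc (c \<cdot>\<^sub>v u) j $ k"
        using point_smult_nth[OF y s(1) inc_c[OF u]] u by (auto simp: s inc_def)
    qed
  qed
  have inc_add: "inc u \<oplus>\<^bsub>coord_space Q d\<^esub> inc v = inc (u + v)" if "u \<in> carrier_vec (d i)" "v \<in> carrier_vec (d i)" for u v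
    by (rule coord_eqI[OF coord_closed(1)[OF inc_c[OF that(1)] inc_c[OF that(2)]] inc_c[OF add_carrier_vec[OF that]]])
      (auto simp: inc_def coord_ops)
  have inc_zero: "inc (0\<^sub>v (d i)) = \<zero>\<^bsub>coord_space Q d\<^esub>"
    by (rule coord_eqI[OF inc_c coord_closed(3)]) (auto simp: inc_def coord_ops)
  have inc_i: "inc u i = u" for u using i by (simp add: inc_def)
  have Wc: "carrier W = inc ` carrier_vec (d i)"
  proof -
    have "carrier W = (\<lambda>v. vertex_idem Q i \<odot>\<^bsub>?M\<^esub> v) ` carrier (coord_space Q d)"
      by (auto simp: W_def vertex_space_def point_module_simps)
    also have "\<dots> = (\<lambda>v. inc (v i)) ` carrier (coord_space Q d)" using idem by (intro image_cong refl)
    also have "\<dots> = inc ` carrier_vec (d i)"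
    proof (intro equalityI subsetI)
      fix w assume "w \<in> (\<lambda>v. inc (v i)) ` carrier (coord_space Q d)"
      then show "w \<in> inc ` carrier_vec (d i)" using coord_memD[OF _ i] by blast
    next
      fix w assume "w \<in> inc ` carrier_vec (d i)"
      then obtain u where u: "u \<in> carrier_vec (d i)" "w = inc (inc u i)" using inc_i by auto
      then show "w \<in> (\<lambda>v. inc (v i)) ` carrier (coord_space Q d)" using inc_c[OF u(1)] by blast
    qed
    finally show ?thesis .
  qed
  have Ws: "add W = add (coord_space Q d)" "zero W = zero (coord_space Q d)" "smult W = (\<lambda>c x. scalar Q c \<odot>\<^bsub>?M\<^esub> x)"
    by (simp_all add: W_def vertex_space_def point_module_simps)
  have Wadd: "inc u \<oplus>\<^bsub>W\<^esub> inc v = inc (u + v)" if "u \<in> carrier_vec (d i)" "v \<in> carrier_vec (d i)" for u v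
    unfolding Ws by (rule inc_add[OF that])
  have Wsm: "c \<odot>\<^bsub>W\<^esub> inc u = inc (c \<cdot>\<^sub>v u)" if "u \<in> carrier_vec (d i)" for c u
    unfolding Ws by (rule sc[OF that])
  have W0: "\<zero>\<^bsub>W\<^esub> = inc (0\<^sub>v (d i))" unfolding Ws inc_zero ..
  have vs: "vectorspace class_ring W"
  proof (rule vs_criteria)
    show "field (class_ring :: 'k ring)" by (rule class_field)
    show "\<zero>\<^bsub>W\<^esub> \<in> carrier W" unfolding W0 Wc by auto
    show "\<forall>v\<in>carrier W. \<exists>neg_v\<in>carrier W. v \<oplus>\<^bsub>W\<^esub> neg_v = \<zero>\<^bsub>W\<^esub>"
    proof
      fix v assume "v \<in> carrier W"
      then obtain u where u: "u \<in> carrier_vec (d i)" "v = inc u" by (auto simp: Wc)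
      have "v \<oplus>\<^bsub>W\<^esub> inc (- u) = \<zero>\<^bsub>W\<^esub>" unfolding u(2) W0 using u(1) by (subst Wadd) auto
      then show "\<exists>neg_v\<in>carrier W. v \<oplus>\<^bsub>W\<^esub> neg_v = \<zero>\<^bsub>W\<^esub>" using u(1) by (auto simp: Wc)
    qed
    show "\<forall>v w. v \<in> carrier W \<and> w \<in> carrier W \<longrightarrow> v \<oplus>\<^bsub>W\<^esub> w = w \<oplus>\<^bsub>W\<^esub> v"
      by (auto simp: Wc Wadd comm_add_vec[of _ "d i"])
  qed (auto simp: Wc Wadd Wsm W0 assoc_add_vec[of _ "d i"] smult_smult_assoc add_smult_distrib_vec smult_add_distrib_vec[of _ "d i"])
  have lin: "linear_map class_ring (module_vec TYPE('k) (d i)) W inc"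
  proof -
    interpret V: vec_space "TYPE('k)" "d i" .
    interpret W: vectorspace class_ring W by (rule vs)
    show ?thesis
      by unfold_locales (auto simp: module_hom_def module_vec_simps Wc Wadd Wsm)
  qed
  interpret V: vec_space "TYPE('k)" "d i" .
  interpret T: linear_map class_ring "module_vec TYPE('k) (d i)" W inc by (rule lin)
  have "inj_on inc (carrier (module_vec TYPE('k) (d i)))" using inc_i by (metis inj_onI)
  moreover have surj: "inc ` carrier (module_vec TYPE('k) (d i)) = carrier W" by (simp add: module_vec_simps Wc)
  ultimately have "T.W.dim = d i" using T.dim_eq V.fin_dim V.dim_is_n by simp
  moreover have "T.W.fin_dim" using T.rank_nullity_main(2)[OF V.fin_dim surj] .
  ultimately show "vectorspace.fin_dim class_ring (vertex_space Q ?M i) \<and> vectorspace.dim class_ring (vertex_space Q ?M i) = d i"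
    by (simp add: W_def)
qed

end


section \<open>The modules \<open>\<rho>(x)\<close> as points of the variety\<close>

lemma append_vec_eqD:
  assumes "a @\<^sub>v b = a' @\<^sub>v b'" "a \<in> carrier_vec n" "a' \<in> carrier_vec n" "b \<in> carrier_vec m" "b' \<in> carrier_vec m"
  shows "a = a'" "b = b'"
proof -
  have *: "(a @\<^sub>v b) $ i = (a' @\<^sub>v b') $ i" for i using assms(1) by simp
  show "a = a'" using *[of i for i] assms(2-5)
    by (intro eq_vecI) (auto simp: index_append_vec dest: spec, metis (no_types, lifting) * carrier_vecD index_append_vec(1) trans_less_add1)
  show "b = b'"
  proof (rule eq_vecI)
    fix i assume "i < dim_vec b'"
    then show "b $ i = b' $ i" using *[of "n + i"] assms(2-5) by simp
  qed (use assms in simp)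
qed

lemma four_block_mult_append:
  assumes c: "(A :: 'k::field mat) \<in> carrier_mat m1 n1" "B \<in> carrier_mat m1 n2" "C \<in> carrier_mat m2 n1" "D \<in> carrier_mat m2 n2"
    and v: "a \<in> carrier_vec n1" "b \<in> carrier_vec n2"
  shows "four_block_mat A B C D *\<^sub>v (a @\<^sub>v b) = (A *\<^sub>v a + B *\<^sub>v b) @\<^sub>v (C *\<^sub>v a + D *\<^sub>v b)"
proof (rule eq_vecI)
  have app: "(x @\<^sub>v y) \<bullet> (a @\<^sub>v b) = x \<bullet> a + y \<bullet> b" if "x \<in> carrier_vec n1" "y \<in> carrier_vec n2" for x y :: "'k vec"
    by (rule scalar_prod_append[OF that v])
  fix i assume "i < dim_vec ((A *\<^sub>v a + B *\<^sub>v b) @\<^sub>v (C *\<^sub>v a + D *\<^sub>v b))"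
  then have i: "i < m1 + m2" using c by simp
  show "(four_block_mat A B C D *\<^sub>v (a @\<^sub>v b)) $ i = ((A *\<^sub>v a + B *\<^sub>v b) @\<^sub>v (C *\<^sub>v a + D *\<^sub>v b)) $ i"
  proof (cases "i < m1")
    case True
    have r: "row A i \<in> carrier_vec n1" "row B i \<in> carrier_vec n2" using c True by auto
    show ?thesis using row_four_block_mat(1)[OF c True] app[OF r] True i c by simp
  next
    case False
    have r: "row C (i - m1) \<in> carrier_vec n1" "row D (i - m1) \<in> carrier_vec n2" using c by auto
    show ?thesis using row_four_block_mat(2)[OF c False i] app[OF r] False i c by simp
  qed
qed (use c in simp)

lemma four_block_mat_eqD:
  assumes eq: "four_block_mat A B C D = four_block_mat A' B' C' D'"
    and c: "(A :: 'k::field mat) \<in> carrier_mat m1 n1" "B \<in> carrier_mat m1 n2" "C \<in> carrier_mat m2 n1" "D \<in> carrier_mat m2 n2"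
    and c': "A' \<in> carrier_mat m1 n1" "B' \<in> carrier_mat m1 n2" "C' \<in> carrier_mat m2 n1" "D' \<in> carrier_mat m2 n2"
  shows "A = A'" "B = B'" "C = C'" "D = D'"
proof -
  have *: "four_block_mat A B C D $$ (i,j) = four_block_mat A' B' C' D' $$ (i,j)" for i j using eq by simp
  show "A = A'"
  proof (rule eq_matI)
    fix i j assume "i < dim_row A'" "j < dim_col A'"
    then show "A $$ (i,j) = A' $$ (i,j)" using *[of i j] c c' by simp
  qed (use c c' in auto)
  show "B = B'"
  proof (rule eq_matI)
    fix i j assume "i < dim_row B'" "j < dim_col B'"
    then show "B $$ (i,j) = B' $$ (i,j)" using *[of i "n1 + j"] c c' by simp
  qed (use c c' in auto)
  show "C = C'"
  proof (rule eq_matI)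
    fix i j assume "i < dim_row C'" "j < dim_col C'"
    then show "C $$ (i,j) = C' $$ (i,j)" using *[of "m1 + i" j] c c' by simp
  qed (use c c' in auto)
  show "D = D'"
  proof (rule eq_matI)
    fix i j assume "i < dim_row D'" "j < dim_col D'"
    then show "D $$ (i,j) = D' $$ (i,j)" using *[of "m1 + i" "n1 + j"] c c' by simp
  qed (use c c' in auto)
qed

lemma GL_carrier: "g \<in> carrier (GL n) \<longleftrightarrow> (\<exists>g'. inverse_mats n g (g' :: 'k::field mat))"
  by (auto simp: GL_def units_of_carrier Units_def ring_mat_def inverse_mats_def)

lemma GL_inv: "inverse_mats n g g' \<Longrightarrow> inv\<^bsub>GL n\<^esub> g = (g' :: 'k::field mat)"
proof -
  assume g: "inverse_mats n g g'"
  interpret ring "ring_mat TYPE('k) n ()" by (rule ring_mat)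
  interpret U: group "GL n :: 'k mat monoid" unfolding GL_def by (rule units_group)
  have "g \<in> carrier (GL n)" "g' \<in> carrier (GL n)" using g inverse_mats_sym[OF g] by (auto simp: GL_carrier)
  moreover have "g' \<otimes>\<^bsub>GL n\<^esub> g = \<one>\<^bsub>GL n\<^esub>"
    using g by (simp add: GL_def units_of_mult units_of_one ring_mat_def inverse_mats_def)
  ultimately show ?thesis by (intro U.inv_equality)
qed

context finite_quiver
begin

text \<open>The arrow matrices of rho(x) on T + R, with T first: only the block from T to R is
  nonzero. This makes rho(x) a point of the variety.\<close>

definition blk :: "('v \<Rightarrow> nat) \<Rightarrow> ('v \<Rightarrow> nat) \<Rightarrow> ('a \<Rightarrow> 'k::field mat) \<Rightarrow> 'a \<Rightarrow> 'k mat" where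
  "blk t d x = (\<lambda>a\<in>arcs Q. four_block_mat (0\<^sub>m (t (head Q a)) (t (tail Q a)))
     (0\<^sub>m (t (head Q a)) (d (tail Q a) - t (tail Q a))) (x a)
     (0\<^sub>m (d (head Q a) - t (head Q a)) (d (tail Q a) - t (tail Q a))))"

lemma C_spaceD:
  "x \<in> C_space Q t d \<Longrightarrow> a \<in> arcs Q \<Longrightarrow> x a \<in> carrier_mat (d (head Q a) - t (head Q a)) (t (tail Q a))"
  by (auto simp: C_space_def matrix_tuples_def)

lemma blk_tuple:
  assumes td: "\<forall>i\<in>verts Q. t i \<le> d i" and x: "x \<in> C_space Q t d"
  shows "blk t d x \<in> matrix_tuples Q d d"
proof -
  have "blk t d x a \<in> carrier_mat (d (head Q a)) (d (tail Q a))" if a: "a \<in> arcs Q" for a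
    using bspec[OF td, of "head Q a"] bspec[OF td, of "tail Q a"] a by (auto simp: blk_def intro!: carrier_matI)
  then show ?thesis by (auto simp: matrix_tuples_def blk_def)
qed

lemma blk_mult:
  assumes x: "x \<in> C_space Q t d" and a: "a \<in> arcs Q"
    and v: "v \<in> carrier_vec (t (tail Q a))" and w: "w \<in> carrier_vec (d (tail Q a) - t (tail Q a))"
  shows "blk t d x a *\<^sub>v (v @\<^sub>v w) = 0\<^sub>v (t (head Q a)) @\<^sub>v (x a *\<^sub>v (v :: 'k::field vec))"
proof -
  have "blk t d x a *\<^sub>v (v @\<^sub>v w) = (0\<^sub>m (t (head Q a)) (t (tail Q a)) *\<^sub>v v + 0\<^sub>m (t (head Q a)) (d (tail Q a) - t (tail Q a)) *\<^sub>v w) @\<^sub>v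
      (x a *\<^sub>v v + 0\<^sub>m (d (head Q a) - t (head Q a)) (d (tail Q a) - t (tail Q a)) *\<^sub>v w)"
    unfolding blk_def using a by (simp add: four_block_mult_append[OF zero_carrier_mat zero_carrier_mat C_spaceD[OF x a] zero_carrier_mat v w])
  then show ?thesis
    using C_spaceD[OF x a] v w by (simp add: zero_mat_mult_vec)
qed

lemma vec_split:
  assumes "v \<in> carrier_vec n" "m \<le> n"
  obtains u w where "u \<in> carrier_vec m" "w \<in> carrier_vec (n - m)" "v = u @\<^sub>v w"
proof -
  have v: "v \<in> carrier_vec (m + (n - m))" using assms by simp
  show thesis
    by (rule that[of "vec_first v m" "vec_last v (n - m)"]) (simp_all add: vec_first_last_append[OF v])
qed

text \<open>The arrows map into R and kill R, so all products of two arrows vanish.\<close>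

lemma blk_maps:
  assumes td: "\<forall>i\<in>verts Q. t i \<le> d i" and x: "x \<in> C_space Q t d" and a: "a \<in> arcs Q"
    and v: "v \<in> carrier_vec (d (tail Q a))"
  shows "blk t d x a *\<^sub>v v \<in> last_coords (d (head Q a)) (d (head Q a) - t (head Q a))"
    and "v \<in> last_coords (d (tail Q a)) (d (tail Q a) - t (tail Q a)) \<Longrightarrow>
      blk t d x a *\<^sub>v v = (0\<^sub>v (d (head Q a)) :: 'k::field vec)"
proof -
  have h: "t (head Q a) \<le> d (head Q a)" "t (tail Q a) \<le> d (tail Q a)" using td a by auto
  obtain u w where uw: "u \<in> carrier_vec (t (tail Q a))" "w \<in> carrier_vec (d (tail Q a) - t (tail Q a))" "v = u @\<^sub>v w"
    using vec_split[OF v h(2)] by blast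
  have bv: "blk t d x a *\<^sub>v v = 0\<^sub>v (t (head Q a)) @\<^sub>v (x a *\<^sub>v u)" unfolding uw(3) by (rule blk_mult[OF x a uw(1,2)])
  show "blk t d x a *\<^sub>v v \<in> last_coords (d (head Q a)) (d (head Q a) - t (head Q a))"
    unfolding bv using C_spaceD[OF x a] h by (intro last_coordsI carrier_vecI) auto
  assume "v \<in> last_coords (d (tail Q a)) (d (tail Q a) - t (tail Q a))"
  then have "v $ i = 0" if "i < t (tail Q a)" for i using that h by (auto simp: last_coords_def)
  then have "u $ i = 0" if "i < t (tail Q a)" for i using that uw by (metis carrier_vecD index_append_vec(1) trans_less_add1)
  then have "u = 0\<^sub>v (t (tail Q a))" using uw(1) by (intro eq_vecI) auto
  then have "x a *\<^sub>v u = 0\<^sub>v (d (head Q a) - t (head Q a))" using mult_mat_zero_vec[OF C_spaceD[OF x a]] by simp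
  then show "blk t d x a *\<^sub>v v = 0\<^sub>v (d (head Q a))"
    unfolding bv using h by (intro eq_vecI) auto
qed

lemma blk_rep:
  fixes x :: "'a \<Rightarrow> 'k::field mat"
  assumes td: "\<forall>i\<in>verts Q. t i \<le> d i" and x: "x \<in> C_space Q t d"
  shows "blk t d x \<in> rep_variety Q d"
  unfolding rep_variety_iff square_zero_def
proof (intro conjI ballI impI blk_tuple[OF td x])
  fix a b and v :: "'k vec"
  assume a: "a \<in> arcs Q" and b: "b \<in> arcs Q" and ab: "head Q a = tail Q b"
    and v: "v \<in> carrier_vec (d (tail Q a))"
  have w: "blk t d x a *\<^sub>v v \<in> last_coords (d (tail Q b)) (d (tail Q b) - t (tail Q b))"
    using blk_maps(1)[OF td x a v] ab by simp
  then have "blk t d x a *\<^sub>v v \<in> carrier_vec (d (tail Q b))" by (simp add: last_coords_def)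
  then show "blk t d x b *\<^sub>v (blk t d x a *\<^sub>v v) = 0\<^sub>v (d (head Q b))" using blk_maps(2)[OF td x b] w by blast
qed

text \<open>A linear map that intertwines the vertex and arrow operators intertwines all paths, and
  then all elements. The spaces are general because \<open>rho_module\<close> lives on pairs, to
  which the coordinate formula for point modules does not apply. Conditions at the arrows of
  \<open>Q\<close> suffice, as supports consist of paths.\<close>

lemma path_algebra_act_transfer:
  fixes f :: "'v \<times> 'a list \<Rightarrow> 'k::field"
  assumes V: "abelian_monoid V" and V': "abelian_monoid V'"
    and sm: "\<And>c x. x \<in> carrier V \<Longrightarrow> c \<odot>\<^bsub>V\<^esub> x \<in> carrier V"
    and h: "\<And>x. x \<in> carrier V \<Longrightarrow> h x \<in> carrier V'"
    and h0: "h \<zero>\<^bsub>V\<^esub> = \<zero>\<^bsub>V'\<^esub>"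
    and hadd: "\<And>x y. x \<in> carrier V \<Longrightarrow> y \<in> carrier V \<Longrightarrow> h (x \<oplus>\<^bsub>V\<^esub> y) = h x \<oplus>\<^bsub>V'\<^esub> h y"
    and hsm: "\<And>c x. x \<in> carrier V \<Longrightarrow> h (c \<odot>\<^bsub>V\<^esub> x) = c \<odot>\<^bsub>V'\<^esub> h x"
    and E: "\<And>i x. x \<in> carrier V \<Longrightarrow> E i x \<in> carrier V"
    and A: "\<And>a x. a \<in> arcs Q \<Longrightarrow> x \<in> carrier V \<Longrightarrow> A a x \<in> carrier V"
    and hE: "\<And>i x. x \<in> carrier V \<Longrightarrow> h (E i x) = E' i (h x)"
    and hA: "\<And>a x. a \<in> arcs Q \<Longrightarrow> x \<in> carrier V \<Longrightarrow> h (A a x) = A' a (h x)"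
    and f: "f \<in> carrier (path_algebra Q)" and x: "x \<in> carrier V"
  shows "h (path_algebra_act V E A f x) = path_algebra_act V' E' A' f (h x)"
proof -
  interpret V: abelian_monoid V by (rule V)
  interpret V': abelian_monoid V' by (rule V')
  have fold: "fold A p z \<in> carrier V \<and> h (fold A p z) = fold A' p (h z)" if "set p \<subseteq> arcs Q" "z \<in> carrier V" for p z
    using that
  proof (induction p arbitrary: z)
    case (Cons a p)
    then show ?case using Cons.IH[of "A a z"] A[of a z] hA[of a z] by simp
  qed simp
  have act: "path_act E A q x \<in> carrier V \<and> h (path_act E A q x) = path_act E' A' q (h x)" if q: "q \<in> quiver_paths Q" for q
  proof -
    obtain u p where up: "q = (u, p)" by (cases q)
    have "set p \<subseteq> arcs Q" using q up by (auto simp: quiver_paths_iff awalk_def)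
    then show ?thesis using fold[of p "E u x"] E[OF x, of u] hE[OF x] up by (simp add: path_act_def)
  qed
  have "h (\<Oplus>\<^bsub>V\<^esub>p\<in>S. f p \<odot>\<^bsub>V\<^esub> path_act E A p x) = (\<Oplus>\<^bsub>V'\<^esub>p\<in>S. f p \<odot>\<^bsub>V'\<^esub> path_act E' A' p (h x))"
    if "finite S" "S \<subseteq> quiver_paths Q" for S
    using that
  proof (induction S rule: finite_induct)
    case empty
    then show ?case by (simp add: h0)
  next
    case (insert q S)
    have c: "f p \<odot>\<^bsub>V\<^esub> path_act E A p x \<in> carrier V" if "p \<in> insert q S" for p
      using that insert act sm by blast
    have c': "f p \<odot>\<^bsub>V'\<^esub> path_act E' A' p (h x) = h (f p \<odot>\<^bsub>V\<^esub> path_act E A p x)" if "p \<in> insert q S" for p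
      using that insert.prems act hsm by (metis subsetD)
    have c'': "f p \<odot>\<^bsub>V'\<^esub> path_act E' A' p (h x) \<in> carrier V'" if "p \<in> insert q S" for p
      unfolding c'[OF that] by (rule h[OF c[OF that]])
    have fs: "(\<Oplus>\<^bsub>V\<^esub>p\<in>S. f p \<odot>\<^bsub>V\<^esub> path_act E A p x) \<in> carrier V"
      using c by (intro V.finsum_closed) auto
    have "(\<Oplus>\<^bsub>V\<^esub>p\<in>insert q S. f p \<odot>\<^bsub>V\<^esub> path_act E A p x) =
        f q \<odot>\<^bsub>V\<^esub> path_act E A q x \<oplus>\<^bsub>V\<^esub> (\<Oplus>\<^bsub>V\<^esub>p\<in>S. f p \<odot>\<^bsub>V\<^esub> path_act E A p x)"
      by (rule V.finsum_insert) (use insert c in auto)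
    moreover have "(\<Oplus>\<^bsub>V'\<^esub>p\<in>insert q S. f p \<odot>\<^bsub>V'\<^esub> path_act E' A' p (h x)) =
        f q \<odot>\<^bsub>V'\<^esub> path_act E' A' q (h x) \<oplus>\<^bsub>V'\<^esub> (\<Oplus>\<^bsub>V'\<^esub>p\<in>S. f p \<odot>\<^bsub>V'\<^esub> path_act E' A' p (h x))"
      by (rule V'.finsum_insert) (use insert c'' in auto)
    ultimately show ?case using insert hadd[OF c[of q] fs] c'[of q] by simp
  qed
  moreover have "finite {q. f q \<noteq> 0}" "{q. f q \<noteq> 0} \<subseteq> quiver_paths Q" using f by (auto simp: path_algebra_def)
  ultimately show ?thesis unfolding path_algebra_act_def by blast
qed

lemma sum_space_abelian:
  assumes V: "abelian_group V" and W: "abelian_group W"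
  shows "abelian_group (sum_space V W)"
proof -
  interpret V: abelian_group V by (rule V)
  interpret W: abelian_group W by (rule W)
  show ?thesis
  proof (rule abelian_groupI)
    fix x assume "x \<in> carrier (sum_space V W)"
    then show "\<exists>y\<in>carrier (sum_space V W). y \<oplus>\<^bsub>sum_space V W\<^esub> x = \<zero>\<^bsub>sum_space V W\<^esub>"
      by (intro bexI[of _ "(\<ominus>\<^bsub>V\<^esub> fst x, \<ominus>\<^bsub>W\<^esub> snd x)"]) (auto simp: sum_space_def V.l_neg W.l_neg)
  qed (auto simp: sum_space_def V.a_ac W.a_ac)
qed

lemma rho_module_iso:
  fixes x :: "'a \<Rightarrow> 'k::field mat"
  assumes td: "\<forall>i\<in>verts Q. t i \<le> d i" and x: "x \<in> C_space Q t d"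
  shows "modules_isomorphic (bound_algebra Q) (point_module Q d (blk t d x)) (rho_module Q t d x)"
proof -
  let ?r = "dim_R t d"
  let ?V = "coord_space Q d :: ('k, 'v \<Rightarrow> 'k vec) module"
  let ?T = "coord_space Q t :: ('k, 'v \<Rightarrow> 'k vec) module" and ?R = "coord_space Q ?r :: ('k, 'v \<Rightarrow> 'k vec) module"
  let ?W = "sum_space ?T ?R"
  let ?E' = "\<lambda>i (v, w). (coord_proj Q t i v, coord_proj Q ?r i w)"
  let ?A' = "\<lambda>a (v, w). (\<zero>\<^bsub>?T\<^esub>, arrow_map Q ?r x a v)"
  interpret V: abelian_group ?V by (rule coord_abelian_group)
  interpret W: abelian_group ?W by (rule sum_space_abelian[OF coord_abelian_group coord_abelian_group])
  \<comment> \<open>\<open>h\<close> cuts each component after \<open>t i\<close> coordinates and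
    \<open>g\<close> glues the pieces. Equality of pairs is checked after gluing, by
    \<open>h_eqI\<close>.\<close>
  define h where "h v = ((\<lambda>i\<in>verts Q. vec_first (v i) (t i)), (\<lambda>i\<in>verts Q. vec_last (v i) (?r i)))" for v :: "'v \<Rightarrow> 'k vec"
  define g where "g = (\<lambda>(v :: 'v \<Rightarrow> 'k vec, w). (\<lambda>i\<in>verts Q. v i @\<^sub>v w i))"
  have dr: "t i + ?r i = d i" if "i \<in> verts Q" for i using bspec[OF td that] by simp
  have hc: "h v \<in> carrier ?W" for v by (simp add: h_def sum_space_def coord_carrier)
  have hgi: "fst (h v) i @\<^sub>v snd (h v) i = v i" if "v \<in> carrier ?V" "i \<in> verts Q" for v i
    using coord_memD[OF that] dr[OF that(2)] that(2) vec_first_last_append[of "v i" "t i" "?r i"] by (simp add: h_def)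
  have h_eqI: "h v = p" if v: "v \<in> carrier ?V" and p: "p \<in> carrier ?W"
    and eq: "\<And>i. i \<in> verts Q \<Longrightarrow> v i = fst p i @\<^sub>v snd p i" for v p
  proof -
    obtain p1 p2 where pp: "p = (p1, p2)" by (cases p)
    have pc: "p1 \<in> carrier ?T" "p2 \<in> carrier ?R" using p pp by (auto simp: sum_space_def)
    have "fst (h v) i = p1 i \<and> snd (h v) i = p2 i" if i: "i \<in> verts Q" for i
    proof -
      have "fst (h v) i @\<^sub>v snd (h v) i = p1 i @\<^sub>v p2 i" using hgi[OF v i] eq[OF i] pp by simp
      moreover have "fst (h v) i \<in> carrier_vec (t i)" "snd (h v) i \<in> carrier_vec (?r i)" using i by (simp_all add: h_def)
      ultimately show ?thesis using append_vec_eqD[of _ _ _ _ "t i" "?r i"] coord_memD[OF pc(1) i] coord_memD[OF pc(2) i] by metis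
    qed
    moreover have "fst (h v) \<in> carrier ?T" "snd (h v) \<in> carrier ?R" using hc[of v] by (auto simp: sum_space_def)
    ultimately have "fst (h v) = p1" "snd (h v) = p2" using pc by (auto intro!: coord_eqI)
    then show ?thesis using pp by (metis prod.collapse)
  qed
  have gc: "g p \<in> carrier ?V" if "p \<in> carrier ?W" for p
    using that coord_memD[of "fst p" t] coord_memD[of "snd p" ?r] dr
    by (auto simp: g_def sum_space_def coord_carrier split: prod.split intro!: carrier_vecI dest!: coord_memD)
  have bij: "bij_betw h (carrier ?V) (carrier ?W)"
  proof (rule bij_betw_byWitness[where f' = g])
    show "\<forall>v\<in>carrier ?V. g (h v) = v"
    proof
      fix v assume v: "v \<in> carrier ?V"
      show "g (h v) = v"
        by (rule coord_eqI[OF gc[OF hc] v]) (use hgi[OF v] in \<open>simp add: g_def case_prod_unfold\<close>)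
    qed
    show "\<forall>p\<in>carrier ?W. h (g p) = p"
    proof
      fix p assume p: "p \<in> carrier ?W"
      show "h (g p) = p" by (rule h_eqI[OF gc[OF p] p]) (simp add: g_def case_prod_unfold)
    qed
  qed (use hc gc in auto)
  have blkt: "blk t d x \<in> matrix_tuples Q d d" by (rule blk_tuple[OF td x])
  have xt: "x \<in> matrix_tuples Q t ?r" using x by (simp add: C_space_def)
  have hadd: "h (v \<oplus>\<^bsub>?V\<^esub> w) = h v \<oplus>\<^bsub>?W\<^esub> h w" if vw: "v \<in> carrier ?V" "w \<in> carrier ?V" for v w
  proof (rule h_eqI[OF coord_closed(1)[OF vw] W.a_closed[OF hc hc]])
    fix i assume i: "i \<in> verts Q"
    have "(v \<oplus>\<^bsub>?V\<^esub> w) i = (fst (h v) i @\<^sub>v snd (h v) i) + (fst (h w) i @\<^sub>v snd (h w) i)"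
      using hgi[OF vw(1) i] hgi[OF vw(2) i] i by (simp add: coord_ops)
    also have "\<dots> = (fst (h v) i + fst (h w) i) @\<^sub>v (snd (h v) i + snd (h w) i)"
      using i by (intro eq_vecI) (auto simp: h_def)
    finally show "(v \<oplus>\<^bsub>?V\<^esub> w) i = fst (h v \<oplus>\<^bsub>?W\<^esub> h w) i @\<^sub>v snd (h v \<oplus>\<^bsub>?W\<^esub> h w) i"
      using i by (simp add: sum_space_def case_prod_unfold coord_ops)
  qed
  have smc: "c \<odot>\<^bsub>?W\<^esub> p \<in> carrier ?W" if "p \<in> carrier ?W" for c p
    using that by (auto simp: sum_space_def coord_closed)
  have hsm: "h (c \<odot>\<^bsub>?V\<^esub> v) = c \<odot>\<^bsub>?W\<^esub> h v" if v: "v \<in> carrier ?V" for c v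
  proof (rule h_eqI[OF coord_closed(2)[OF v] smc[OF hc]])
    fix i assume i: "i \<in> verts Q"
    have "(c \<odot>\<^bsub>?V\<^esub> v) i = c \<cdot>\<^sub>v (fst (h v) i @\<^sub>v snd (h v) i)" using hgi[OF v i] i by (simp add: coord_ops)
    also have "\<dots> = (c \<cdot>\<^sub>v fst (h v) i) @\<^sub>v (c \<cdot>\<^sub>v snd (h v) i)" by (intro eq_vecI) auto
    finally show "(c \<odot>\<^bsub>?V\<^esub> v) i = fst (c \<odot>\<^bsub>?W\<^esub> h v) i @\<^sub>v snd (c \<odot>\<^bsub>?W\<^esub> h v) i"
      using i by (simp add: sum_space_def case_prod_unfold coord_ops)
  qed
  have h0: "h \<zero>\<^bsub>?V\<^esub> = \<zero>\<^bsub>?W\<^esub>"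
  proof (rule h_eqI[OF coord_closed(3) W.zero_closed])
    fix i assume i: "i \<in> verts Q"
    then show "\<zero>\<^bsub>?V\<^esub> i = fst \<zero>\<^bsub>?W\<^esub> i @\<^sub>v snd \<zero>\<^bsub>?W\<^esub> i"
      using bspec[OF td i] by (auto simp: sum_space_def coord_ops intro!: eq_vecI)
  qed
  have E'c: "?E' i p \<in> carrier ?W" if "p \<in> carrier ?W" for i p
    using that by (auto simp: sum_space_def coord_proj_closed)
  have A'c: "?A' a p \<in> carrier ?W" if "a \<in> arcs Q" "p \<in> carrier ?W" for a p
    using that arrow_map_closed[OF xt] by (auto simp: sum_space_def coord_closed)
  have hE: "h (coord_proj Q d i v) = ?E' i (h v)" if v: "v \<in> carrier ?V" for i v
  proof (rule h_eqI[OF coord_proj_closed[OF v] E'c[OF hc]])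
    fix j assume j: "j \<in> verts Q"
    then show "coord_proj Q d i v j = fst (?E' i (h v)) j @\<^sub>v snd (?E' i (h v)) j"
      using hgi[OF v j] bspec[OF td j] by (auto simp: coord_proj_def case_prod_unfold intro!: eq_vecI)
  qed
  have hA: "h (arrow_map Q d (blk t d x) a v) = ?A' a (h v)" if a: "a \<in> arcs Q" and v: "v \<in> carrier ?V" for a v
  proof (rule h_eqI[OF arrow_map_closed[OF blkt a v] A'c[OF a hc]])
    fix j assume j: "j \<in> verts Q"
    have tl: "tail Q a \<in> verts Q" using a by simp
    have "blk t d x a *\<^sub>v v (tail Q a) = 0\<^sub>v (t (head Q a)) @\<^sub>v (x a *\<^sub>v fst (h v) (tail Q a))"
      unfolding hgi[OF v tl, symmetric] by (rule blk_mult[OF x a]) (use tl in \<open>simp_all add: h_def\<close>)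
    then show "arrow_map Q d (blk t d x) a v j = fst (?A' a (h v)) j @\<^sub>v snd (?A' a (h v)) j"
      using j bspec[OF td j] by (auto simp: arrow_map_def coord_ops case_prod_unfold intro!: eq_vecI simp del: index_mult_mat_vec)
  qed
  have "h \<in> module_iso (bound_algebra Q) (point_module Q d (blk t d x)) (rho_module Q t d x)"
    unfolding module_iso_def
  proof (intro CollectI conjI ballI)
    show "bij_betw h (carrier (point_module Q d (blk t d x))) (carrier (rho_module Q t d x))"
      using bij by (simp add: point_module_simps rho_module_def operator_module_def)
    fix v assume "v \<in> carrier (point_module Q d (blk t d x))"
    then have v: "v \<in> carrier ?V" by (simp add: point_module_simps)
    {
      fix w assume "w \<in> carrier (point_module Q d (blk t d x))"
      then show "h (v \<oplus>\<^bsub>point_module Q d (blk t d x)\<^esub> w) = h v \<oplus>\<^bsub>rho_module Q t d x\<^esub> h w"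
        using hadd[OF v] by (simp add: point_module_simps rho_module_def operator_module_def)
    }
    fix X :: "('v \<times> 'a list \<Rightarrow> 'k) set" assume X: "X \<in> carrier (bound_algebra Q)"
    \<comment> \<open>Both modules let the class \<open>X\<close> act through the same
      representative \<open>coef X\<close>, so the transfer applies although both actions are
      defined by a choice.\<close>
    have "h (path_algebra_act ?V (coord_proj Q d) (arrow_map Q d (blk t d x)) (coef X) v) =
        path_algebra_act ?W ?E' ?A' (coef X) (h v)"
      by (rule path_algebra_act_transfer[OF V.abelian_monoid_axioms W.abelian_monoid_axioms, where h = h])
        (rule coord_closed(2) hc h0 hadd hsm coord_proj_closed arrow_map_closed[OF blkt] hE hA coef_carrier[OF X] v; assumption)+
    then show "h (X \<odot>\<^bsub>point_module Q d (blk t d x)\<^esub> v) = X \<odot>\<^bsub>rho_module Q t d x\<^esub> h v"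
      by (simp add: point_module_def rho_module_def operator_module_def coef_def)
  qed
  then show ?thesis by (auto simp: modules_isomorphic_def)
qed

text \<open>Symmetry of isomorphism is invoked from \<open>M\<close> alone, so \<open>N\<close> may
  be \<open>rho_module\<close> without a separate proof of its module laws.\<close>

lemma iso_class_eq:
  assumes M: "left_module (bound_algebra Q) M" and MN: "modules_isomorphic (bound_algebra Q) M N"
  shows "iso_class Q M = iso_class Q (N :: (('v \<times> 'a list \<Rightarrow> 'k::field) set, 'n) module)"
  using modules_isomorphic_trans[OF MN] modules_isomorphic_trans[OF modules_isomorphic_sym[OF M MN]]
  by (auto simp: iso_class_def)

lemma modules_isomorphic_refl: "modules_isomorphic R M M"
  by (auto simp: modules_isomorphic_def module_iso_def intro!: exI[of _ "\<lambda>x. x"] bij_betw_id[unfolded id_def])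

lemma iso_class_eq_iff:
  fixes M N :: "(('v \<times> 'a list \<Rightarrow> 'k::field) set, 'v \<Rightarrow> 'k vec) module"
  assumes M: "left_module (bound_algebra Q) M" and N: "left_module (bound_algebra Q) N"
  shows "iso_class Q M = iso_class Q N \<longleftrightarrow> modules_isomorphic (bound_algebra Q) M N"
proof
  assume "iso_class Q M = iso_class Q N"
  moreover have "N \<in> iso_class Q N" using N modules_isomorphic_refl by (auto simp: iso_class_def)
  ultimately have "N \<in> iso_class Q M" by simp
  then show "modules_isomorphic (bound_algebra Q) M N" by (simp add: iso_class_def)
qed (rule iso_class_eq[OF M])

lemma rho_eq:
  assumes td: "\<forall>i\<in>verts Q. t i \<le> d i" and x: "x \<in> C_space Q t d"
  shows "rho Q t d x = iso_class Q (point_module Q d (blk t d (x :: 'a \<Rightarrow> 'k::field mat)))"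
  unfolding rho_def
  using iso_class_eq[OF point_left_module[OF blk_rep[OF td x]] rho_module_iso[OF td x]] by simp

lemma rho_in_iso_classes:
  assumes td: "\<forall>i\<in>verts Q. t i \<le> d i" and x: "x \<in> C_space Q t d"
  shows "rho Q t d (x :: 'a \<Rightarrow> 'k::field mat) \<in> iso_classes Q d"
  unfolding rho_eq[OF td x] iso_classes_def
  using point_left_module[OF blk_rep[OF td x]] point_has_dim_vector[OF blk_rep[OF td x]] by blast

text \<open>\<open>P i\<close> turns the subspace that is to become R_i into the last coordinates.
  The hypothesis on images, U_i inside R_i, makes the upper rows of the transformed matrices vanish;
  the hypothesis on kernels, R_i inside K_i, their right columns. The remaining block is
  \<open>x\<close>.\<close>

lemma adapted_normal_form:
  fixes y :: "'a \<Rightarrow> 'k::field mat"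
  assumes td: "\<forall>i\<in>verts Q. t i \<le> d i" and y: "y \<in> rep_variety Q d"
    and P: "\<And>i. i \<in> verts Q \<Longrightarrow> inverse_mats (d i) (P i) (P' i)"
    and im: "\<And>a v. a \<in> arcs Q \<Longrightarrow> v \<in> carrier_vec (d (tail Q a)) \<Longrightarrow>
      P (head Q a) *\<^sub>v (y a *\<^sub>v v) \<in> last_coords (d (head Q a)) (d (head Q a) - t (head Q a))"
    and ker: "\<And>a v. a \<in> arcs Q \<Longrightarrow> v \<in> carrier_vec (d (tail Q a)) \<Longrightarrow>
      P (tail Q a) *\<^sub>v v \<in> last_coords (d (tail Q a)) (d (tail Q a) - t (tail Q a)) \<Longrightarrow> y a *\<^sub>v v = 0\<^sub>v (d (head Q a))"
  obtains x where "x \<in> C_space Q t d" "\<And>a. a \<in> arcs Q \<Longrightarrow> P (head Q a) * y a = blk t d x a * P (tail Q a)"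
    "modules_isomorphic (bound_algebra Q) (point_module Q d y) (point_module Q d (blk t d x))"
proof -
  have yt: "y \<in> matrix_tuples Q d d" using y by (simp add: rep_variety_iff)
  define z where "z a = P (head Q a) * y a * P' (tail Q a)" for a
  define x where "x = (\<lambda>a\<in>arcs Q. mat (d (head Q a) - t (head Q a)) (t (tail Q a)) (\<lambda>(i,j). z a $$ (t (head Q a) + i, j)))"
  have x: "x \<in> C_space Q t d" by (auto simp: x_def C_space_def matrix_tuples_def)
  have zx: "z a = blk t d x a" if a: "a \<in> arcs Q" for a
  proof -
    have ht: "head Q a \<in> verts Q" "tail Q a \<in> verts Q" using a by auto
    note c = inverse_matsD[OF P[OF ht(1)]] inverse_matsD[OF P[OF ht(2)]] matrix_tuplesD[OF yt a]
    note cb = matrix_tuplesD[OF blk_tuple[OF td x] a]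
    have zc: "z a \<in> carrier_mat (d (head Q a)) (d (tail Q a))" using c by (simp add: z_def)
    have zv: "z a *\<^sub>v v = P (head Q a) *\<^sub>v (y a *\<^sub>v (P' (tail Q a) *\<^sub>v v))" if "v \<in> carrier_vec (d (tail Q a))" for v
      using that c by (simp add: z_def assoc_mult_mat_vec[of _ "d (head Q a)" "d (tail Q a)" _ "d (tail Q a)"]
          assoc_mult_mat_vec[of _ "d (head Q a)" "d (head Q a)" _ "d (tail Q a)"])
    have entry: "z a $$ (i,j) = (z a *\<^sub>v unit_vec (d (tail Q a)) j) $ i" if "i < d (head Q a)" "j < d (tail Q a)" for i j
      using that zc by simp
    show ?thesis
    proof (rule eq_matI)
      fix i j assume "i < dim_row (blk t d x a)" "j < dim_col (blk t d x a)"
      then have ij: "i < d (head Q a)" "j < d (tail Q a)" using cb by auto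
      have up: "z a $$ (i,j) = 0" if "i < t (head Q a)"
        unfolding entry[OF ij] zv[OF unit_vec_carrier]
        using im[OF a, of "P' (tail Q a) *\<^sub>v unit_vec (d (tail Q a)) j"] that bspec[OF td ht(1)] c
        by (auto simp: last_coords_def simp del: index_mult_mat_vec)
      have right: "z a $$ (i,j) = 0" if "t (tail Q a) \<le> j"
      proof -
        have "P (tail Q a) *\<^sub>v (P' (tail Q a) *\<^sub>v unit_vec (d (tail Q a)) j) = (unit_vec (d (tail Q a)) j :: 'k vec)"
          by (rule inverse_mats_cancel(2)[OF P[OF ht(2)] unit_vec_carrier])
        also have "\<dots> \<in> last_coords (d (tail Q a)) (d (tail Q a) - t (tail Q a))"
          using that bspec[OF td ht(2)] ij by (auto simp: last_coords_def unit_vec_def)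
        finally have "y a *\<^sub>v (P' (tail Q a) *\<^sub>v unit_vec (d (tail Q a)) j) = 0\<^sub>v (d (head Q a))"
          using ker[OF a, of "P' (tail Q a) *\<^sub>v unit_vec (d (tail Q a)) j"] c by simp
        then show ?thesis
          unfolding entry[OF ij] zv[OF unit_vec_carrier] using mult_mat_zero_vec[OF c(1)] ij by simp
      qed
      show "z a $$ (i,j) = blk t d x a $$ (i,j)"
        using up right a ij bspec[OF td ht(1)] bspec[OF td ht(2)] by (auto simp: blk_def x_def)
    qed (use zc cb in auto)
  qed
  have comm: "P (head Q a) * y a = blk t d x a * P (tail Q a)" if a: "a \<in> arcs Q" for a
  proof -
    have ht: "head Q a \<in> verts Q" "tail Q a \<in> verts Q" using a by auto
    note c = inverse_matsD[OF P[OF ht(1)]] inverse_matsD[OF P[OF ht(2)]] matrix_tuplesD[OF yt a]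
    have "blk t d x a * P (tail Q a) = (P (head Q a) * y a) * (P' (tail Q a) * P (tail Q a))"
      unfolding zx[OF a, symmetric] z_def by (rule assoc_mult_mat) (use c in auto)
    also have "\<dots> = P (head Q a) * y a" unfolding c(8) using c by simp
    finally show ?thesis by simp
  qed
  moreover have "modules_isomorphic (bound_algebra Q) (point_module Q d y) (point_module Q d (blk t d x))"
    unfolding point_isomorphic_iff[OF y blk_rep[OF td x]] using P comm by blast
  ultimately show thesis using that x by blast
qed

end


lemma subspace_kernel:
  assumes B: "(B :: 'k::field mat) \<in> carrier_mat m n"
  shows "vec_subspace n {u \<in> carrier_vec n. B *\<^sub>v u = 0\<^sub>v m}"
  unfolding vec_subspace_def
proof (intro conjI ballI allI)
  show "0\<^sub>v n \<in> {u \<in> carrier_vec n. B *\<^sub>v u = 0\<^sub>v m}" using mult_mat_zero_vec[OF B] by simp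
  fix u assume u: "u \<in> {u \<in> carrier_vec n. B *\<^sub>v u = 0\<^sub>v m}"
  show "c \<cdot>\<^sub>v u \<in> {u \<in> carrier_vec n. B *\<^sub>v u = 0\<^sub>v m}" for c
    using u mult_mat_vec[OF B, of u c] by (auto intro!: eq_vecI)
  fix v assume v: "v \<in> {u \<in> carrier_vec n. B *\<^sub>v u = 0\<^sub>v m}"
  show "u + v \<in> {u \<in> carrier_vec n. B *\<^sub>v u = 0\<^sub>v m}"
    using u v mult_add_distrib_mat_vec[OF B, of u v] by auto
qed auto

lemma zero_of_orthogonal:
  assumes u: "u \<in> carrier_vec n" and o: "\<And>v. v \<in> carrier_vec n \<Longrightarrow> u \<bullet> v = (0 :: 'k::field)"
  shows "u = 0\<^sub>v n"
proof (rule eq_vecI)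
  fix i assume "i < dim_vec (0\<^sub>v n :: 'k vec)"
  then show "u $ i = 0\<^sub>v n $ i" using o[of "unit_vec n i"] u by simp
qed (use u in simp)

context finite_quiver
begin

section \<open>Fibres of \<open>\<rho>\<close>\<close>

text \<open>An isomorphism \<open>((A, B), (C, D))\<close> between the modules of \<open>x\<close> and \<open>x'\<close> satisfies
  \<open>D x = x' A\<close>, but \<open>A\<close> and \<open>D\<close> need not be invertible. However \<open>D\<close> is injective on the radical,
  the sum of the images of the \<open>x\<^sub>\<alpha>\<close>, and dually the transpose of \<open>A\<close> is injective on the sum of
  the row spaces of the \<open>x'\<^sub>\<alpha>\<close>; on these subspaces they agree with invertible maps.\<close>

lemma isomorphic_imp_same_orbit:
  fixes x x' :: "'a \<Rightarrow> 'k::field mat"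
  assumes td: "\<forall>i\<in>verts Q. t i \<le> d i" and x: "x \<in> C_space Q t d" and x': "x' \<in> C_space Q t d"
    and F: "\<And>i. i \<in> verts Q \<Longrightarrow> inverse_mats (d i) (F i) (F' i)"
    and comm: "\<And>a. a \<in> arcs Q \<Longrightarrow> F (head Q a) * blk t d x a = blk t d x' a * F (tail Q a)"
  obtains g h where "\<And>i. i \<in> verts Q \<Longrightarrow> g i \<in> carrier (GL (t i))"
    "\<And>i. i \<in> verts Q \<Longrightarrow> h i \<in> carrier (GL (dim_R t d i))"
    "\<And>a. a \<in> arcs Q \<Longrightarrow> x' a = h (head Q a) * x a * inv\<^bsub>GL (t (tail Q a))\<^esub> g (tail Q a)"
proof -
  let ?r = "dim_R t d"
  have dr: "t i + ?r i = d i" if "i \<in> verts Q" for i using td that by simp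
  define A where "A i = fst (split_block (F i) (t i) (t i))" for i
  define B where "B i = fst (snd (split_block (F i) (t i) (t i)))" for i
  define CC where "CC i = fst (snd (snd (split_block (F i) (t i) (t i))))" for i
  define D where "D i = snd (snd (snd (split_block (F i) (t i) (t i))))" for i
  have split: "A i \<in> carrier_mat (t i) (t i)" "B i \<in> carrier_mat (t i) (?r i)" "CC i \<in> carrier_mat (?r i) (t i)"
    "D i \<in> carrier_mat (?r i) (?r i)" "F i = four_block_mat (A i) (B i) (CC i) (D i)" if i: "i \<in> verts Q" for i
  proof -
    have "split_block (F i) (t i) (t i) = (A i, B i, CC i, D i)" by (simp add: A_def B_def CC_def D_def)
    from split_block[OF this, of "?r i" "?r i"] inverse_matsD(1)[OF F[OF i]] dr[OF i]
    show "A i \<in> carrier_mat (t i) (t i)" "B i \<in> carrier_mat (t i) (?r i)" "CC i \<in> carrier_mat (?r i) (t i)"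
      "D i \<in> carrier_mat (?r i) (?r i)" "F i = four_block_mat (A i) (B i) (CC i) (D i)" by auto
  qed
  \<comment> \<open>Block by block the relation says more than \<open>D x = x' A\<close>: the
    equations \<open>B x = 0\<close> and \<open>x' B = 0\<close> are what makes \<open>D\<close> and
    the transpose of \<open>A\<close> injective on the subspaces in question.\<close>
  have blocks: "B (head Q a) * x a = 0\<^sub>m (t (head Q a)) (t (tail Q a))"
    "D (head Q a) * x a = x' a * A (tail Q a)" "x' a * B (tail Q a) = 0\<^sub>m (?r (head Q a)) (?r (tail Q a))"
    if a: "a \<in> arcs Q" for a
  proof -
    have ht: "head Q a \<in> verts Q" "tail Q a \<in> verts Q" using a by auto
    note sh = split[OF ht(1)] and st = split[OF ht(2)] and xa = C_spaceD[OF x a] and x'a = C_spaceD[OF x' a]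
    have l: "F (head Q a) * blk t d x a = four_block_mat (B (head Q a) * x a) (0\<^sub>m (t (head Q a)) (?r (tail Q a)))
        (D (head Q a) * x a) (0\<^sub>m (?r (head Q a)) (?r (tail Q a)))"
      unfolding sh(5) blk_def using a
      by (simp add: mult_four_block_mat[OF sh(1-4) zero_carrier_mat zero_carrier_mat xa zero_carrier_mat]
          left_add_zero_mat[OF mult_carrier_mat[OF sh(2) xa]] left_add_zero_mat[OF mult_carrier_mat[OF sh(4) xa]]
          right_mult_zero_mat[OF sh(1)] right_mult_zero_mat[OF sh(2)] right_mult_zero_mat[OF sh(3)] right_mult_zero_mat[OF sh(4)])
    have r: "blk t d x' a * F (tail Q a) = four_block_mat (0\<^sub>m (t (head Q a)) (t (tail Q a))) (0\<^sub>m (t (head Q a)) (?r (tail Q a)))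
        (x' a * A (tail Q a)) (x' a * B (tail Q a))"
      unfolding st(5) blk_def using a
      by (simp add: mult_four_block_mat[OF zero_carrier_mat zero_carrier_mat x'a zero_carrier_mat st(1-4)]
          right_add_zero_mat[OF mult_carrier_mat[OF x'a st(1)]] right_add_zero_mat[OF mult_carrier_mat[OF x'a st(2)]]
          left_mult_zero_mat[OF st(1)] left_mult_zero_mat[OF st(2)] left_mult_zero_mat[OF st(3)] left_mult_zero_mat[OF st(4)])
    have eq: "four_block_mat (B (head Q a) * x a) (0\<^sub>m (t (head Q a)) (?r (tail Q a)))
        (D (head Q a) * x a) (0\<^sub>m (?r (head Q a)) (?r (tail Q a))) =
       four_block_mat (0\<^sub>m (t (head Q a)) (t (tail Q a))) (0\<^sub>m (t (head Q a)) (?r (tail Q a)))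
        (x' a * A (tail Q a)) (x' a * B (tail Q a))"
      using comm[OF a] unfolding l r .
    note eqD = four_block_mat_eqD[OF eq mult_carrier_mat[OF sh(2) xa] zero_carrier_mat mult_carrier_mat[OF sh(4) xa]
        zero_carrier_mat zero_carrier_mat zero_carrier_mat mult_carrier_mat[OF x'a st(1)] mult_carrier_mat[OF x'a st(2)]]
    show "B (head Q a) * x a = 0\<^sub>m (t (head Q a)) (t (tail Q a))" "D (head Q a) * x a = x' a * A (tail Q a)"
      "x' a * B (tail Q a) = 0\<^sub>m (?r (head Q a)) (?r (tail Q a))" using eqD by auto
  qed
  define U where "U i = sum_range (?r i) {a \<in> arcs Q. head Q a = i} x" for i
  define Ud where "Ud i = sum_range (t i) {a \<in> arcs Q. tail Q a = i} (\<lambda>a. (x' a)\<^sup>T)" for i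
  have U: "vec_subspace (?r i) (U i)" for i
    unfolding U_def by (rule sum_range_subspace) (auto dest: C_spaceD[OF x])
  have Ud: "vec_subspace (t i) (Ud i)" for i
    unfolding Ud_def by (rule sum_range_subspace) (auto dest: C_spaceD[OF x'])
  have H: "\<exists>H. \<exists>H'. inverse_mats (?r i) H H' \<and> (\<forall>u\<in>U i. H *\<^sub>v u = D i *\<^sub>v u)" if i: "i \<in> verts Q" for i
  proof -
    note s = split[OF i]
    have "U i \<subseteq> {u \<in> carrier_vec (?r i). B i *\<^sub>v u = 0\<^sub>v (t i)}"
      unfolding U_def
    proof (rule sum_range_least[OF _ _ subspace_kernel[OF s(2)]])
      fix a and v :: "'k vec" assume a: "a \<in> {a \<in> arcs Q. head Q a = i}" and v: "v \<in> carrier_vec (dim_col (x a))"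
      have xa: "x a \<in> carrier_mat (?r i) (t (tail Q a))" using C_spaceD[OF x, of a] a by auto
      then have vc: "v \<in> carrier_vec (t (tail Q a))" using v by simp
      have "B i *\<^sub>v (x a *\<^sub>v v) = (B i * x a) *\<^sub>v v" using assoc_mult_mat_vec[OF s(2) xa vc] by simp
      then show "x a *\<^sub>v v \<in> {u \<in> carrier_vec (?r i). B i *\<^sub>v u = 0\<^sub>v (t i)}"
        using blocks(1)[of a] a xa vc zero_mat_mult_vec[OF vc] by auto
    qed (auto dest: C_spaceD[OF x])
    then have BU: "u \<in> carrier_vec (?r i)" "B i *\<^sub>v u = 0\<^sub>v (t i)" if "u \<in> U i" for u using that by auto
    have inj: "u = 0\<^sub>v (?r i)" if u: "u \<in> U i" and 0: "D i *\<^sub>v u = 0\<^sub>v (?r i)" for u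
    proof -
      \<comment> \<open>As \<open>B\<close> vanishes on \<open>U i\<close>, the invertible
        \<open>F i\<close> acts on \<open>(0, u)\<close> by \<open>D\<close> alone.\<close>
      have "F i *\<^sub>v (0\<^sub>v (t i) @\<^sub>v u) = (A i *\<^sub>v 0\<^sub>v (t i) + B i *\<^sub>v u) @\<^sub>v (CC i *\<^sub>v 0\<^sub>v (t i) + D i *\<^sub>v u)"
        unfolding s(5) by (rule four_block_mult_append[OF s(1-4) zero_carrier_vec BU(1)[OF u]])
      also have "\<dots> = 0\<^sub>v (t i) @\<^sub>v 0\<^sub>v (?r i)"
        using BU(2)[OF u] 0 mult_mat_zero_vec[OF s(1)] mult_mat_zero_vec[OF s(3)] by simp
      also have "\<dots> = 0\<^sub>v (d i)" using dr[OF i] by (intro eq_vecI) auto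
      finally have "F i *\<^sub>v (0\<^sub>v (t i) @\<^sub>v u) = 0\<^sub>v (d i)" .
      moreover have "0\<^sub>v (t i) @\<^sub>v u \<in> carrier_vec (d i)"
        using append_carrier_vec[OF zero_carrier_vec BU(1)[OF u], of "t i"] unfolding dr[OF i] .
      ultimately have "0\<^sub>v (t i) @\<^sub>v u = 0\<^sub>v (d i)" using inverse_mats_inj[OF F[OF i]] by blast
      then have "0\<^sub>v (t i) @\<^sub>v u = 0\<^sub>v (t i) @\<^sub>v 0\<^sub>v (?r i)" using dr[OF i] by (intro eq_vecI) auto
      then show ?thesis by (rule append_vec_eqD(2)[OF _ zero_carrier_vec zero_carrier_vec BU(1)[OF u] zero_carrier_vec])
    qed
    obtain H H' where "inverse_mats (?r i) H H'" "\<And>u. u \<in> U i \<Longrightarrow> H *\<^sub>v u = D i *\<^sub>v u"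
      by (rule extend_injection_to_invertible[OF s(4) U inj]) auto
    then show ?thesis by blast
  qed
  have G: "\<exists>G. \<exists>G'. inverse_mats (t i) G G' \<and> (\<forall>u\<in>Ud i. G\<^sup>T *\<^sub>v u = (A i)\<^sup>T *\<^sub>v u)" if i: "i \<in> verts Q" for i
  proof -
    note s = split[OF i]
    have sT: "(A i)\<^sup>T \<in> carrier_mat (t i) (t i)" "(B i)\<^sup>T \<in> carrier_mat (?r i) (t i)" using s by auto
    have "Ud i \<subseteq> {u \<in> carrier_vec (t i). (B i)\<^sup>T *\<^sub>v u = 0\<^sub>v (?r i)}"
      unfolding Ud_def
    proof (rule sum_range_least[OF _ _ subspace_kernel[OF sT(2)]])
      fix a and v :: "'k vec" assume a: "a \<in> {a \<in> arcs Q. tail Q a = i}" and v: "v \<in> carrier_vec (dim_col ((x' a)\<^sup>T))"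
      have xa: "x' a \<in> carrier_mat (?r (head Q a)) (t i)" using C_spaceD[OF x', of a] a by auto
      then have xaT: "(x' a)\<^sup>T \<in> carrier_mat (t i) (?r (head Q a))" by simp
      have vc: "v \<in> carrier_vec (?r (head Q a))" using v xa by simp
      have "(B i)\<^sup>T * (x' a)\<^sup>T = (x' a * B i)\<^sup>T" using transpose_mult[OF xa s(2)] by simp
      also have "\<dots> = 0\<^sub>m (?r i) (?r (head Q a))" using blocks(3)[of a] a by auto
      finally have "(B i)\<^sup>T *\<^sub>v ((x' a)\<^sup>T *\<^sub>v v) = 0\<^sub>v (?r i)"
        using assoc_mult_mat_vec[OF sT(2) xaT vc] zero_mat_mult_vec[OF vc] by simp
      then show "(x' a)\<^sup>T *\<^sub>v v \<in> {u \<in> carrier_vec (t i). (B i)\<^sup>T *\<^sub>v u = 0\<^sub>v (?r i)}"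
        using mult_mat_vec_carrier[OF xaT vc] by simp
    qed (auto dest: C_spaceD[OF x'])
    then have BU: "u \<in> carrier_vec (t i)" "(B i)\<^sup>T *\<^sub>v u = 0\<^sub>v (?r i)" if "u \<in> Ud i" for u using that by auto
    have inj: "u = 0\<^sub>v (t i)" if u: "u \<in> Ud i" and 0: "(A i)\<^sup>T *\<^sub>v u = 0\<^sub>v (t i)" for u
    \<comment> \<open>Surjectivity of \<open>F i\<close> writes every \<open>v\<close> as
      \<open>A a + B b\<close>, and \<open>u\<close> is orthogonal to the images of both
      \<open>A\<close> and \<open>B\<close>.\<close>
    proof (rule zero_of_orthogonal[OF BU(1)[OF u]])
      fix v :: "'k vec" assume v: "v \<in> carrier_vec (t i)"
      have vd: "v @\<^sub>v 0\<^sub>v (?r i) \<in> carrier_vec (d i)"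
        using append_carrier_vec[OF v zero_carrier_vec, of "?r i"] unfolding dr[OF i] .
      have "F' i *\<^sub>v (v @\<^sub>v 0\<^sub>v (?r i)) \<in> carrier_vec (d i)" using inverse_matsD(2)[OF F[OF i]] vd by auto
      from vec_split[OF this bspec[OF td i]]
      obtain a b where ab: "a \<in> carrier_vec (t i)" "b \<in> carrier_vec (?r i)" "F' i *\<^sub>v (v @\<^sub>v 0\<^sub>v (?r i)) = a @\<^sub>v b"
        by blast
      have "v @\<^sub>v 0\<^sub>v (?r i) = F i *\<^sub>v (a @\<^sub>v b)" unfolding ab(3)[symmetric] using inverse_mats_cancel(2)[OF F[OF i] vd] by simp
      also have "\<dots> = (A i *\<^sub>v a + B i *\<^sub>v b) @\<^sub>v (CC i *\<^sub>v a + D i *\<^sub>v b)"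
        unfolding s(5) by (rule four_block_mult_append[OF s(1-4) ab(1,2)])
      finally have "v = A i *\<^sub>v a + B i *\<^sub>v b"
        by (rule append_vec_eqD(1)[OF _ v _ zero_carrier_vec]) (use s ab in auto)
      then have "u \<bullet> v = u \<bullet> (A i *\<^sub>v a) + u \<bullet> (B i *\<^sub>v b)"
        using scalar_prod_add_distrib[OF BU(1)[OF u] mult_mat_vec_carrier[OF s(1) ab(1)] mult_mat_vec_carrier[OF s(2) ab(2)]] by simp
      also have "u \<bullet> (A i *\<^sub>v a) = 0"
        using transpose_vec_mult_scalar[OF s(1) ab(1) BU(1)[OF u]] 0 ab(1) by simp
      also have "u \<bullet> (B i *\<^sub>v b) = 0"
        using transpose_vec_mult_scalar[OF s(2) ab(2) BU(1)[OF u]] BU(2)[OF u] ab(2) by simp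
      finally show "u \<bullet> v = 0" by simp
    qed
    obtain G G' where G: "inverse_mats (t i) G G'" "\<And>u. u \<in> Ud i \<Longrightarrow> G *\<^sub>v u = (A i)\<^sup>T *\<^sub>v u"
      by (rule extend_injection_to_invertible[OF sT(1) Ud inj]) auto
    have "inverse_mats (t i) (G\<^sup>T) (G'\<^sup>T)" by (rule inverse_mats_transpose[OF G(1)])
    then show ?thesis using G(2) by (metis transpose_transpose)
  qed
  from H have "\<forall>i\<in>verts Q. \<exists>H. \<exists>H'. inverse_mats (?r i) H H' \<and> (\<forall>u\<in>U i. H *\<^sub>v u = D i *\<^sub>v u)" by blast
  from bchoice[OF this] obtain h where h: "\<forall>i\<in>verts Q. \<exists>H'. inverse_mats (?r i) (h i) H' \<and> (\<forall>u\<in>U i. h i *\<^sub>v u = D i *\<^sub>v u)" by blast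
  from G have "\<forall>i\<in>verts Q. \<exists>G. \<exists>G'. inverse_mats (t i) G G' \<and> (\<forall>u\<in>Ud i. G\<^sup>T *\<^sub>v u = (A i)\<^sup>T *\<^sub>v u)" by blast
  from bchoice[OF this] obtain g where g: "\<forall>i\<in>verts Q. \<exists>G'. inverse_mats (t i) (g i) G' \<and> (\<forall>u\<in>Ud i. (g i)\<^sup>T *\<^sub>v u = (A i)\<^sup>T *\<^sub>v u)" by blast
  have "x' a = h (head Q a) * x a * inv\<^bsub>GL (t (tail Q a))\<^esub> g (tail Q a)" if a: "a \<in> arcs Q" for a
  proof -
    have ht: "head Q a \<in> verts Q" "tail Q a \<in> verts Q" using a by auto
    note sh = split[OF ht(1)] and st = split[OF ht(2)] and xa = C_spaceD[OF x a] and x'a = C_spaceD[OF x' a]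
    obtain H' where h': "inverse_mats (?r (head Q a)) (h (head Q a)) H'" "\<And>u. u \<in> U (head Q a) \<Longrightarrow> h (head Q a) *\<^sub>v u = D (head Q a) *\<^sub>v u"
      using bspec[OF h ht(1)] by blast
    obtain G' where g': "inverse_mats (t (tail Q a)) (g (tail Q a)) G'"
        "\<And>u. u \<in> Ud (tail Q a) \<Longrightarrow> (g (tail Q a))\<^sup>T *\<^sub>v u = (A (tail Q a))\<^sup>T *\<^sub>v u"
      using bspec[OF g ht(2)] by blast
    note hc = inverse_matsD[OF h'(1)] and gc = inverse_matsD[OF g'(1)]
    \<comment> \<open>\<open>h\<close> may replace \<open>D\<close> in \<open>D x\<close>, since the
      image of \<open>x a\<close> lies in \<open>U\<close>. Dually, after transposition,
      \<open>g\<close> may replace \<open>A\<close> in \<open>x' A\<close>. Thus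
      \<open>D x = x' A\<close> becomes \<open>h x = x' g\<close>.\<close>
    have 1: "h (head Q a) * x a = D (head Q a) * x a"
    proof (rule mat_eqI_vec[OF mult_carrier_mat[OF hc(1) xa] mult_carrier_mat[OF sh(4) xa]])
      fix v :: "'k vec" assume v: "v \<in> carrier_vec (t (tail Q a))"
      have "x a *\<^sub>v v \<in> U (head Q a)"
        unfolding U_def by (rule sum_range_member) (use a v xa in \<open>auto dest: C_spaceD[OF x]\<close>)
      then show "(h (head Q a) * x a) *\<^sub>v v = (D (head Q a) * x a) *\<^sub>v v"
        using h'(2) assoc_mult_mat_vec[OF hc(1) xa v] assoc_mult_mat_vec[OF sh(4) xa v] by simp
    qed
    have x'T: "(x' a)\<^sup>T \<in> carrier_mat (t (tail Q a)) (?r (head Q a))" and gT: "(g (tail Q a))\<^sup>T \<in> carrier_mat (t (tail Q a)) (t (tail Q a))"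
      and AT: "(A (tail Q a))\<^sup>T \<in> carrier_mat (t (tail Q a)) (t (tail Q a))" using x'a gc st by auto
    have "(g (tail Q a))\<^sup>T * (x' a)\<^sup>T = (A (tail Q a))\<^sup>T * (x' a)\<^sup>T"
    proof (rule mat_eqI_vec[OF mult_carrier_mat[OF gT x'T] mult_carrier_mat[OF AT x'T]])
      fix v :: "'k vec" assume v: "v \<in> carrier_vec (?r (head Q a))"
      have "(x' a)\<^sup>T *\<^sub>v v \<in> Ud (tail Q a)"
        unfolding Ud_def by (rule sum_range_member) (use a v x'a in \<open>auto dest: C_spaceD[OF x']\<close>)
      then show "((g (tail Q a))\<^sup>T * (x' a)\<^sup>T) *\<^sub>v v = ((A (tail Q a))\<^sup>T * (x' a)\<^sup>T) *\<^sub>v v"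
        using g'(2) assoc_mult_mat_vec[OF gT x'T v] assoc_mult_mat_vec[OF AT x'T v] by simp
    qed
    then have "(x' a * g (tail Q a))\<^sup>T = (x' a * A (tail Q a))\<^sup>T"
      using transpose_mult[OF x'a gc(1)] transpose_mult[OF x'a st(1)] by simp
    then have 2: "x' a * g (tail Q a) = x' a * A (tail Q a)" by (metis transpose_transpose)
    have "h (head Q a) * x a * G' = x' a * g (tail Q a) * G'" unfolding 1 2 blocks(2)[OF a] ..
    also have "\<dots> = x' a * (g (tail Q a) * G')" by (rule assoc_mult_mat[OF x'a gc(1,2)])
    also have "\<dots> = x' a" unfolding gc(3) using x'a by simp
    finally show ?thesis unfolding GL_inv[OF g'(1)] by simp
  qed
  moreover have "h i \<in> carrier (GL (?r i))" "g i \<in> carrier (GL (t i))" if "i \<in> verts Q" for i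
    using bspec[OF h that] bspec[OF g that] by (auto simp: GL_carrier)
  ultimately show thesis using that by blast
qed

text \<open>The block diagonal matrices with blocks \<open>g i\<close> and \<open>h i\<close>
  intertwine the two points.\<close>

lemma same_orbit_imp_isomorphic:
  fixes x :: "'a \<Rightarrow> 'k::field mat"
  assumes td: "\<forall>i\<in>verts Q. t i \<le> d i" and x: "x \<in> C_space Q t d"
    and g: "\<And>i. i \<in> verts Q \<Longrightarrow> g i \<in> carrier (GL (t i))"
    and h: "\<And>i. i \<in> verts Q \<Longrightarrow> h i \<in> carrier (GL (dim_R t d i))"
  shows "G_action Q t (g, h) x \<in> C_space Q t d"
    and "modules_isomorphic (bound_algebra Q) (point_module Q d (blk t d x))
      (point_module Q d (blk t d (G_action Q t (g, h) x)))"
proof -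
  let ?r = "dim_R t d"
  define x' where "x' = G_action Q t (g, h) x"
  have "\<forall>i\<in>verts Q. \<exists>g'. inverse_mats (t i) (g i) g'" using g by (auto simp: GL_carrier)
  from bchoice[OF this] obtain g' where g': "\<forall>i\<in>verts Q. inverse_mats (t i) (g i) (g' i)" by blast
  have "\<forall>i\<in>verts Q. \<exists>h'. inverse_mats (?r i) (h i) h'" using h by (auto simp: GL_carrier)
  from bchoice[OF this] obtain h' where h': "\<forall>i\<in>verts Q. inverse_mats (?r i) (h i) (h' i)" by blast
  have x'_eq: "x' a = h (head Q a) * x a * g' (tail Q a)" if "a \<in> arcs Q" for a
    using that GL_inv[OF bspec[OF g', of "tail Q a"]] by (simp add: x'_def G_action_def)
  have x'a: "x' a \<in> carrier_mat (?r (head Q a)) (t (tail Q a))" if a: "a \<in> arcs Q" for a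
    unfolding x'_eq[OF a]
    using inverse_matsD(1)[OF bspec[OF h', of "head Q a"]] inverse_matsD(2)[OF bspec[OF g', of "tail Q a"]]
      C_spaceD[OF x a] a by auto
  then have x': "x' \<in> C_space Q t d" by (auto simp: C_space_def matrix_tuples_def x'_def G_action_def)
  then show "G_action Q t (g, h) x \<in> C_space Q t d" by (simp add: x'_def)
  define F where "F i = four_block_mat (g i) (0\<^sub>m (t i) (?r i)) (0\<^sub>m (?r i) (t i)) (h i)" for i
  define F' where "F' i = four_block_mat (g' i) (0\<^sub>m (t i) (?r i)) (0\<^sub>m (?r i) (t i)) (h' i)" for i
  have F: "inverse_mats (d i) (F i) (F' i)" if i: "i \<in> verts Q" for i
  proof -
    note gc = inverse_matsD[OF bspec[OF g' i]] and hc = inverse_matsD[OF bspec[OF h' i]]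
    have di: "t i + ?r i = d i" using td i by simp
    have "F i * F' i = 1\<^sub>m (t i + ?r i)" "F' i * F i = 1\<^sub>m (t i + ?r i)"
      unfolding F_def F'_def mult_four_block_mat[OF gc(1) zero_carrier_mat zero_carrier_mat hc(1) gc(2) zero_carrier_mat zero_carrier_mat hc(2)]
        mult_four_block_mat[OF gc(2) zero_carrier_mat zero_carrier_mat hc(2) gc(1) zero_carrier_mat zero_carrier_mat hc(1)]
      unfolding four_block_one_mat[symmetric] using gc hc by (auto intro!: cong_four_block_mat)
    moreover have "F i \<in> carrier_mat (t i + ?r i) (t i + ?r i)" "F' i \<in> carrier_mat (t i + ?r i) (t i + ?r i)"
      unfolding F_def F'_def by (rule four_block_carrier_mat[OF gc(1) hc(1)], rule four_block_carrier_mat[OF gc(2) hc(2)])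
    ultimately show ?thesis unfolding di by (simp add: inverse_mats_def)
  qed
  have "F (head Q a) * blk t d x a = blk t d x' a * F (tail Q a)" if a: "a \<in> arcs Q" for a
  proof -
    have ht: "head Q a \<in> verts Q" "tail Q a \<in> verts Q" using a by auto
    note gh = inverse_matsD[OF bspec[OF g' ht(1)]] and gt = inverse_matsD[OF bspec[OF g' ht(2)]]
      and hh = inverse_matsD[OF bspec[OF h' ht(1)]] and htl = inverse_matsD[OF bspec[OF h' ht(2)]]
    note xa = C_spaceD[OF x a]
    have "x' a * g (tail Q a) = h (head Q a) * x a * (g' (tail Q a) * g (tail Q a))"
      unfolding x'_eq[OF a] by (rule assoc_mult_mat[OF mult_carrier_mat[OF hh(1) xa] gt(2,1)])
    also have "\<dots> = h (head Q a) * x a" unfolding gt(4) by (rule right_mult_one_mat[OF mult_carrier_mat[OF hh(1) xa]])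
    finally have *: "h (head Q a) * x a = x' a * g (tail Q a)" by simp
    have "F (head Q a) * blk t d x a = four_block_mat (0\<^sub>m (t (head Q a)) (t (tail Q a))) (0\<^sub>m (t (head Q a)) (?r (tail Q a)))
        (h (head Q a) * x a) (0\<^sub>m (?r (head Q a)) (?r (tail Q a)))"
      unfolding F_def blk_def using a gh(1) hh(1) xa
      by (simp add: mult_four_block_mat[OF gh(1) zero_carrier_mat zero_carrier_mat hh(1) zero_carrier_mat zero_carrier_mat xa zero_carrier_mat])
    also have "\<dots> = blk t d x' a * F (tail Q a)"
      unfolding F_def blk_def using a gt(1) htl(1) x'a[OF a] *
      by (simp add: mult_four_block_mat[OF zero_carrier_mat zero_carrier_mat x'a[OF a] zero_carrier_mat gt(1) zero_carrier_mat zero_carrier_mat htl(1)])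
    finally show ?thesis .
  qed
  then show "modules_isomorphic (bound_algebra Q) (point_module Q d (blk t d x))
      (point_module Q d (blk t d (G_action Q t (g, h) x)))"
    unfolding x'_def[symmetric] point_isomorphic_iff[OF blk_rep[OF td x] blk_rep[OF td x']] using F by blast
qed

lemma rho_fibre:
  fixes x :: "'a \<Rightarrow> 'k::field mat"
  assumes td: "\<forall>i\<in>verts Q. t i \<le> d i" and x: "x \<in> C_space Q t d"
  shows "{x' \<in> C_space Q t d. rho Q t d x' = rho Q t d x} = orbit (G_group Q t d) (G_action Q t) x"
proof (intro equalityI subsetI)
  fix x' assume "x' \<in> {x' \<in> C_space Q t d. rho Q t d x' = rho Q t d x}"
  then have x': "x' \<in> C_space Q t d" and eq: "rho Q t d x = rho Q t d x'" by auto
  have "modules_isomorphic (bound_algebra Q) (point_module Q d (blk t d x)) (point_module Q d (blk t d x'))"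
    using eq unfolding rho_eq[OF td x] rho_eq[OF td x']
    by (simp add: iso_class_eq_iff[OF point_left_module[OF blk_rep[OF td x]] point_left_module[OF blk_rep[OF td x']]])
  then obtain F F' where F: "\<forall>i\<in>verts Q. inverse_mats (d i) (F i) (F' i)"
      "\<forall>a\<in>arcs Q. F (head Q a) * blk t d x a = blk t d x' a * F (tail Q a)"
    unfolding point_isomorphic_iff[OF blk_rep[OF td x] blk_rep[OF td x']] by blast
  obtain g h where gh: "\<And>i. i \<in> verts Q \<Longrightarrow> g i \<in> carrier (GL (t i))"
    "\<And>i. i \<in> verts Q \<Longrightarrow> h i \<in> carrier (GL (dim_R t d i))"
    "\<And>a. a \<in> arcs Q \<Longrightarrow> x' a = h (head Q a) * x a * inv\<^bsub>GL (t (tail Q a))\<^esub> g (tail Q a)"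
    using isomorphic_imp_same_orbit[OF td x x' bspec[OF F(1)] bspec[OF F(2)]] by blast
  \<comment> \<open>The carriers of \<open>product_group\<close> consist of extensional functions,
    hence the restriction to the vertices; the action reads no other values.\<close>
  have "G_action Q t (restrict g (verts Q), restrict h (verts Q)) x = x'"
  proof
    fix a show "G_action Q t (restrict g (verts Q), restrict h (verts Q)) x a = x' a"
      using gh(3)[of a] x' by (auto simp: G_action_def C_space_def matrix_tuples_def PiE_iff extensional_def)
  qed
  moreover have "(restrict g (verts Q), restrict h (verts Q)) \<in> carrier (G_group Q t d)"
    using gh(1,2) by (auto simp: G_group_def)
  ultimately show "x' \<in> orbit (G_group Q t d) (G_action Q t) x" unfolding orbit_def by blast
next
  fix x' assume "x' \<in> orbit (G_group Q t d) (G_action Q t) x"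
  then obtain g h where gh: "(g, h) \<in> carrier (G_group Q t d)" "x' = G_action Q t (g, h) x" by (auto simp: orbit_def)
  then have g: "\<And>i. i \<in> verts Q \<Longrightarrow> g i \<in> carrier (GL (t i))" and h: "\<And>i. i \<in> verts Q \<Longrightarrow> h i \<in> carrier (GL (dim_R t d i))"
    by (auto simp: G_group_def)
  have x': "x' \<in> C_space Q t d" unfolding gh(2) by (rule same_orbit_imp_isomorphic(1)[OF td x g h])
  have "modules_isomorphic (bound_algebra Q) (point_module Q d (blk t d x)) (point_module Q d (blk t d x'))"
    unfolding gh(2) by (rule same_orbit_imp_isomorphic(2)[OF td x g h])
  then have "rho Q t d x = rho Q t d x'"
    unfolding rho_eq[OF td x] rho_eq[OF td x'] by (rule iso_class_eq[OF point_left_module[OF blk_rep[OF td x]]])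
  then show "x' \<in> {x' \<in> C_space Q t d. rho Q t d x' = rho Q t d x}" using x' by simp
qed

end


section \<open>Infinite fields and dependent columns\<close>

text \<open>Over a finite field, 1 plus the product of all \<open>X - c\<close> has positive degree
  but no root.\<close>

lemma infinite_alg_closed: "infinite (UNIV :: 'k::alg_closed_field set)"
proof
  assume fin: "finite (UNIV :: 'k set)"
  define p where "p = (\<Prod>c\<in>UNIV. [:- c, 1:]) + (1 :: 'k poly)"
  have deg: "degree (\<Prod>c\<in>(UNIV :: 'k set). [:- c, 1:]) = card (UNIV :: 'k set)"
    using fin by (subst degree_prod_eq_sum_degree) auto
  have pos: "card (UNIV :: 'k set) > 0" using fin by (simp add: card_gt_0_iff)
  have "degree p > 0" unfolding p_def using deg pos by (subst degree_add_eq_left) auto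
  then obtain x where "poly p x = 0" using alg_closed_imp_poly_has_root by blast
  moreover have "poly p x = 1" using fin by (auto simp: p_def poly_prod)
  ultimately show False by simp
qed

text \<open>More columns than the dimension of \<open>W\<close> are dependent: in
  \<open>R * S\<close> just the last \<open>r\<close> rows can be nonzero, so a kernel vector of
  this wide block suffices.\<close>

lemma adapted_dependent:
  assumes R: "adapted n W r R R'" and S: "(S :: 'k::field mat) \<in> carrier_mat n m"
    and col: "\<And>j. j < m \<Longrightarrow> col S j \<in> W" and rm: "r < m"
  obtains c where "c \<in> carrier_vec m" "c \<noteq> 0\<^sub>v m" "S *\<^sub>v c = 0\<^sub>v n"
proof -
  have Rinv: "inverse_mats n R R'" and rn: "r \<le> n" using R by (auto simp: adapted_def)
  note Rc = inverse_matsD[OF Rinv]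
  define B where "B = mat r m (\<lambda>(p,j). (R * S) $$ (n - r + p, j))"
  have B: "B \<in> carrier_mat r m" by (simp add: B_def)
  obtain c where c: "c \<in> carrier_vec m" "c \<noteq> 0\<^sub>v m" "B *\<^sub>v c = 0\<^sub>v r" using wide_mat_kernel[OF B rm] by blast
  have RS: "R * S \<in> carrier_mat n m" using Rc S by simp
  have "R *\<^sub>v (S *\<^sub>v c) = 0\<^sub>v n"
  proof (rule eq_vecI)
    fix i assume "i < dim_vec (0\<^sub>v n :: 'k vec)"
    then have i: "i < n" by simp
    have "(R *\<^sub>v (S *\<^sub>v c)) $ i = ((R * S) *\<^sub>v c) $ i" using Rc S c by simp
    also have "\<dots> = (\<Sum>j<m. (R * S) $$ (i,j) * c $ j)" by (rule mult_mat_vec_sum[OF RS c(1) i])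
    also have "\<dots> = 0"
    proof (cases "i < n - r")
      case True
      have "(R * S) $$ (i,j) = 0" if j: "j < m" for j
      proof -
        have "R *\<^sub>v col S j \<in> last_coords n r"
          using R col[OF j] col_carrier_vec[OF j S] by (auto simp: adapted_def)
        then have "(R *\<^sub>v col S j) $ i = 0" using True by (auto simp: last_coords_def)
        then show ?thesis using Rc S i j by simp
      qed
      then show ?thesis by (intro sum.neutral) simp
    next
      case False
      have "(\<Sum>j<m. (R * S) $$ (i,j) * c $ j) = (\<Sum>j<m. B $$ (i - (n - r),j) * c $ j)"
        by (rule sum.cong) (use False i rn in \<open>auto simp: B_def simp del: index_mult_mat\<close>)
      also have "\<dots> = (B *\<^sub>v c) $ (i - (n - r))"
        using mult_mat_vec_sum[OF B c(1), of "i - (n - r)"] False i rn by simp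
      finally show ?thesis using c(3) False i rn by simp
    qed
    finally show "(R *\<^sub>v (S *\<^sub>v c)) $ i = 0\<^sub>v n $ i" using i by simp
  qed (use Rc in simp)
  then have "S *\<^sub>v c = 0\<^sub>v n" using inverse_mats_inj[OF Rinv, of "S *\<^sub>v c"] S c by simp
  with c that show thesis by blast
qed

context finite_quiver
begin

section \<open>The closure of \<open>Rep\<^sup>T\<^sub>d\<close>\<close>

lemma polynomial_sum:
  "finite S \<Longrightarrow> (\<And>s. s \<in> S \<Longrightarrow> f s \<in> polynomial_functions Q d) \<Longrightarrow>
    (\<lambda>x. \<Sum>s\<in>S. f s x) \<in> polynomial_functions Q d"
  by (induction S rule: finite_induct)
    (auto intro: polynomial_functions.const polynomial_functions.add)

lemma polynomial_scale: "f \<in> polynomial_functions Q d \<Longrightarrow> (\<lambda>x. c * f x) \<in> polynomial_functions Q d"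
  using polynomial_functions.mult[OF polynomial_functions.const] .

lemma polynomial_det:
  assumes "\<And>x. A x \<in> carrier_mat n n"
    and "\<And>i j. i < n \<Longrightarrow> j < n \<Longrightarrow> (\<lambda>x. A x $$ (i,j)) \<in> polynomial_functions Q d"
  shows "(\<lambda>x. det (A x)) \<in> polynomial_functions Q d"
  by (rule det_in_function_algebra[OF polynomial_functions.const polynomial_functions.add polynomial_functions.mult assms])

text \<open>The space K_i; on the variety it is the component at \<open>i\<close> of the socle of
  the module.\<close>

definition soc :: "('v \<Rightarrow> nat) \<Rightarrow> ('a \<Rightarrow> 'k::field mat) \<Rightarrow> 'v \<Rightarrow> 'k vec set" where
  "soc d y i = {v \<in> carrier_vec (d i). \<forall>a\<in>arcs Q. tail Q a = i \<longrightarrow> y a *\<^sub>v v = 0\<^sub>v (d (head Q a))}"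

lemma soc_subspace:
  assumes y: "y \<in> matrix_tuples Q d d"
  shows "vec_subspace (d i) (soc d (y :: 'a \<Rightarrow> 'k::field mat) i)"
  unfolding vec_subspace_def
proof (intro conjI ballI allI)
  show "soc d y i \<subseteq> carrier_vec (d i)" by (auto simp: soc_def)
  show "0\<^sub>v (d i) \<in> soc d y i" using mult_mat_zero_vec[OF matrix_tuplesD[OF y]] by (auto simp: soc_def)
  have z: "c \<cdot>\<^sub>v 0\<^sub>v n = (0\<^sub>v n :: 'k vec)" for c n by (intro eq_vecI) auto
  fix u assume u: "u \<in> soc d y i"
  show "c \<cdot>\<^sub>v u \<in> soc d y i" for c
    using u mult_mat_vec[OF matrix_tuplesD[OF y]] by (auto simp: soc_def z)
  fix v assume v: "v \<in> soc d y i"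
  show "u + v \<in> soc d y i"
    using u v mult_add_distrib_mat_vec[OF matrix_tuplesD[OF y]] by (auto simp: soc_def)
qed

text \<open>This inclusion of U_i in K_i is the form that \<open>J^2 = 0\<close> takes at a point of
  the variety.\<close>

lemma rad_subset_soc:
  assumes y: "y \<in> rep_variety Q d" and i: "i \<in> verts Q"
  shows "rad d (y :: 'a \<Rightarrow> 'k::field mat) i \<subseteq> soc d y i"
proof -
  have yt: "y \<in> matrix_tuples Q d d" and sq: "square_zero d y" using y by (auto simp: rep_variety_iff)
  show ?thesis
    unfolding rad_def
  proof (rule sum_range_least[OF _ _ soc_subspace[OF yt]])
    fix a and v :: "'k vec" assume a: "a \<in> {a \<in> arcs Q. head Q a = i}" and v: "v \<in> carrier_vec (dim_col (y a))"
    have ya: "y a \<in> carrier_mat (d i) (d (tail Q a))" using matrix_tuplesD[OF yt, of a] a by auto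
    then have "v \<in> carrier_vec (d (tail Q a))" using v by simp
    then show "y a *\<^sub>v v \<in> soc d y i"
      using a sq mult_mat_vec_carrier[OF ya] by (auto simp: soc_def square_zero_def)
  qed (auto dest: matrix_tuplesD[OF yt])
qed

text \<open>Lower semicontinuity of rank: a nonvanishing minor of the radical at \<open>y\<close> is a determinant
  \<open>det (L S(z))\<close>, where the columns of \<open>S(z)\<close> lie in the radical at \<open>z\<close>.\<close>

lemma radical_minor:
  fixes y :: "'a \<Rightarrow> 'k::field mat"
  assumes y: "y \<in> matrix_tuples Q d d" and i: "i \<in> verts Q"
    and P: "adapted (d i) (rad d y i) k P P'" and m: "m \<le> k"
  obtains f where "f \<in> polynomial_functions Q d" "f y = 1"
    "\<And>z l R R'. z \<in> matrix_tuples Q d d \<Longrightarrow> f z \<noteq> 0 \<Longrightarrow> adapted (d i) (rad d z i) l R R' \<Longrightarrow> m \<le> l"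
proof -
  let ?A = "{a \<in> arcs Q. head Q a = i}"
  have Pinv: "inverse_mats (d i) P P'" and kd: "k \<le> d i" using P by (auto simp: adapted_def)
  note Pc = inverse_matsD[OF Pinv]
  \<comment> \<open>The last \<open>m\<close> unit vectors, pulled back by \<open>P'\<close>, are
    \<open>m\<close> independent elements of the radical at \<open>y\<close>.\<close>
  define e where "e j = (unit_vec (d i) (d i - m + j) :: 'k vec)" for j
  have "\<forall>j\<in>{..<m}. \<exists>w. (\<forall>a\<in>?A. w a \<in> carrier_vec (dim_col (y a))) \<and>
      P' *\<^sub>v e j = vec (d i) (\<lambda>k. \<Sum>a\<in>?A. (y a *\<^sub>v w a) $ k)"
  proof
    fix j assume "j \<in> {..<m}"
    then have "e j \<in> last_coords (d i) k" using m kd by (auto simp: e_def last_coords_def unit_vec_def)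
    then have "P' *\<^sub>v e j \<in> rad d y i" by (rule adapted_inverse[OF P])
    then show "\<exists>w. (\<forall>a\<in>?A. w a \<in> carrier_vec (dim_col (y a))) \<and>
      P' *\<^sub>v e j = vec (d i) (\<lambda>k. \<Sum>a\<in>?A. (y a *\<^sub>v w a) $ k)" unfolding rad_def sum_range_def by blast
  qed
  from bchoice[OF this] obtain w where w: "\<forall>j\<in>{..<m}. (\<forall>a\<in>?A. w j a \<in> carrier_vec (dim_col (y a))) \<and>
      P' *\<^sub>v e j = vec (d i) (\<lambda>k. \<Sum>a\<in>?A. (y a *\<^sub>v w j a) $ k)" by blast
  have wc: "w j a \<in> carrier_vec (d (tail Q a))" if "j < m" "a \<in> ?A" for j a
  proof -
    have "w j a \<in> carrier_vec (dim_col (y a))" using w that by blast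
    then show ?thesis using matrix_tuplesD[OF y, of a] that by simp
  qed
  \<comment> \<open>The arguments \<open>w\<close> that produce these elements at \<open>y\<close>
    are kept while the point varies, so the entries of \<open>S z\<close> are linear in
    \<open>z\<close>. Taking the last \<open>m\<close> rows of \<open>P\<close> for \<open>L\<close>
    normalizes the minor to 1 at \<open>y\<close>.\<close>
  define L where "L = mat m (d i) (\<lambda>(p,q). P $$ (d i - m + p, q))"
  define S where "S z = mat (d i) m (\<lambda>(q,j). \<Sum>a\<in>?A. \<Sum>l<d (tail Q a). z a $$ (q,l) * w j a $ l)" for z :: "'a \<Rightarrow> 'k mat"
  have L: "L \<in> carrier_mat m (d i)" and S: "S z \<in> carrier_mat (d i) m" for z by (simp_all add: L_def S_def)
  have colS: "col (S z) j = vec (d i) (\<lambda>k. \<Sum>a\<in>?A. (z a *\<^sub>v w j a) $ k)" if z: "z \<in> matrix_tuples Q d d" and j: "j < m" for z j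
  proof (rule eq_vecI)
    fix q assume "q < dim_vec (vec (d i) (\<lambda>k. \<Sum>a\<in>?A. (z a *\<^sub>v w j a) $ k))"
    then have q: "q < d i" by simp
    have "(z a *\<^sub>v w j a) $ q = (\<Sum>l<d (tail Q a). z a $$ (q,l) * w j a $ l)" if "a \<in> ?A" for a
      using mult_mat_vec_sum[OF matrix_tuplesD[OF z] wc[OF j that], of q] that q by auto
    then show "col (S z) j $ q = vec (d i) (\<lambda>k. \<Sum>a\<in>?A. (z a *\<^sub>v w j a) $ k) $ q"
      using q j by (simp add: S_def del: index_mult_mat_vec)
  qed (simp add: S_def)
  define f where "f z = det (L * S z)" for z
  have "f \<in> polynomial_functions Q d"
    unfolding f_def
  proof (rule polynomial_det)
    show "L * S z \<in> carrier_mat m m" for z by (rule mult_carrier_mat[OF L S])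
    fix p j assume pj: "p < m" "j < m"
    have "(\<lambda>z. \<Sum>q<d i. L $$ (p,q) * (\<Sum>a\<in>?A. \<Sum>l<d (tail Q a). w j a $ l * z a $$ (q,l))) \<in> polynomial_functions Q d"
      by (intro polynomial_sum polynomial_scale polynomial_functions.coord) auto
    moreover have "(L * S z) $$ (p,j) = (\<Sum>q<d i. L $$ (p,q) * (\<Sum>a\<in>?A. \<Sum>l<d (tail Q a). w j a $ l * z a $$ (q,l)))" for z
      using pj L S[of z] by (auto simp: scalar_prod_def lessThan_atLeast0 S_def mult.commute intro!: sum.cong)
    ultimately show "(\<lambda>z. (L * S z) $$ (p,j)) \<in> polynomial_functions Q d" by simp
  qed
  moreover have "f y = 1"
  proof -
    have "L * S y = 1\<^sub>m m"
    proof (rule eq_matI)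
      fix p j assume "p < dim_row (1\<^sub>m m :: 'k mat)" "j < dim_col (1\<^sub>m m :: 'k mat)"
      then have pj: "p < m" "j < m" by auto
      have c: "col (S y) j = P' *\<^sub>v e j" using colS[OF y pj(2)] w pj by simp
      have ec: "e j \<in> carrier_vec (d i)" by (simp add: e_def)
      have rL: "row L p = row P (d i - m + p)" using pj m kd Pc by (intro eq_vecI) (auto simp: L_def)
      have "(L * S y) $$ (p,j) = row L p \<bullet> col (S y) j" using pj L S[of y] by simp
      also have "\<dots> = (P *\<^sub>v (P' *\<^sub>v e j)) $ (d i - m + p)" unfolding c rL using pj m kd Pc by simp
      also have "\<dots> = e j $ (d i - m + p)" using inverse_mats_cancel(2)[OF Pinv ec] by simp
      also have "\<dots> = 1\<^sub>m m $$ (p,j)" using pj m kd by (auto simp: e_def unit_vec_def)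
      finally show "(L * S y) $$ (p,j) = 1\<^sub>m m $$ (p,j)" .
    qed (use L S in auto)
    then show ?thesis by (simp add: f_def)
  qed
  moreover have "m \<le> l" if z: "z \<in> matrix_tuples Q d d" and fz: "f z \<noteq> 0" and R: "adapted (d i) (rad d z i) l R R'" for z l R R'
  proof (rule ccontr)
    assume "\<not> m \<le> l"
    then have lm: "l < m" by simp
    have col: "col (S z) j \<in> rad d z i" if j: "j < m" for j
      unfolding colS[OF z j] rad_def
    proof (rule sum_rangeI)
      fix a assume a: "a \<in> ?A"
      then have "dim_col (z a) = d (tail Q a)" using matrix_tuplesD[OF z, of a] by auto
      then show "w j a \<in> carrier_vec (dim_col (z a))" using wc[OF j a] by simp
    qed
    obtain c where c: "c \<in> carrier_vec m" "c \<noteq> 0\<^sub>v m" "S z *\<^sub>v c = 0\<^sub>v (d i)"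
      using adapted_dependent[OF R S col lm] by blast
    have "(L * S z) *\<^sub>v c = 0\<^sub>v m" using assoc_mult_mat_vec[OF L S c(1)] c(3) mult_mat_zero_vec[OF L] by simp
    then show False using det_0_iff_vec_prod_zero_field[of "L * S z" m] L S[of z] c fz by (auto simp: f_def)
  qed
  ultimately show thesis using that by blast
qed

text \<open>The dual bound for the common kernels: \<open>det (T(z) V)\<close>, where \<open>T(z)\<close> vanishes on the common
  kernel at \<open>z\<close> and the columns of \<open>V\<close> span a complement of the common kernel at \<open>y\<close>.\<close>

lemma socle_minor:
  fixes y :: "'a \<Rightarrow> 'k::field mat"
  assumes y: "y \<in> matrix_tuples Q d d" and i: "i \<in> verts Q"
    and P: "adapted (d i) (soc d y i) k P P'" and m: "m + k \<le> d i"
  obtains f where "f \<in> polynomial_functions Q d" "f y = 1"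
    "\<And>z l R R'. z \<in> rep_variety Q d \<Longrightarrow> f z \<noteq> 0 \<Longrightarrow> adapted (d i) (rad d z i) l R R' \<Longrightarrow> m + l \<le> d i"
proof -
  let ?A = "{a \<in> arcs Q. tail Q a = i}"
  have Pinv: "inverse_mats (d i) P P'" and kd: "k \<le> d i" using P by (auto simp: adapted_def)
  note Pc = inverse_matsD[OF Pinv]
  have ya: "y a \<in> carrier_mat (d (head Q a)) (d i)" if "a \<in> ?A" for a using matrix_tuplesD[OF y, of a] that by auto
  \<comment> \<open>The first \<open>m\<close> columns of \<open>P'\<close>. Since
    \<open>m + k \<le> d i\<close>, they are independent modulo the common kernel at
    \<open>y\<close>.\<close>
  define V where "V = mat (d i) m (\<lambda>(l,j). P' $$ (l,j))"
  have V: "V \<in> carrier_mat (d i) m" by (simp add: V_def)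
  have PV: "(P * V) $$ (p,j) = (if p = j then 1 else 0)" if "p < d i" "j < m" for p j
  proof -
    have "col V j = col P' j" using that m Pc by (intro eq_vecI) (auto simp: V_def)
    then have "(P * V) $$ (p,j) = (P * P') $$ (p,j)" using that m V Pc(1,2) by simp
    then show ?thesis using Pc(3) that m by simp
  qed
  have Vsoc: "c = 0\<^sub>v m" if c: "c \<in> carrier_vec m" and s: "V *\<^sub>v c \<in> soc d y i" for c
  proof (rule eq_vecI)
    have PVc: "P * V \<in> carrier_mat (d i) m" using Pc V by simp
    have "P *\<^sub>v (V *\<^sub>v c) \<in> last_coords (d i) k" using P s V c by (auto simp: adapted_def)
    then have *: "(P *\<^sub>v (V *\<^sub>v c)) $ p = 0" if "p < m" for p using that m by (auto simp: last_coords_def)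
    fix p assume "p < dim_vec (0\<^sub>v m :: 'k vec)"
    then have p: "p < m" "p < d i" using m by auto
    have "(P *\<^sub>v (V *\<^sub>v c)) $ p = ((P * V) *\<^sub>v c) $ p" using assoc_mult_mat_vec[OF Pc(1) V c] by simp
    also have "\<dots> = (\<Sum>j<m. (P * V) $$ (p,j) * c $ j)" by (rule mult_mat_vec_sum[OF PVc c p(2)])
    also have "\<dots> = (\<Sum>j<m. if j = p then c $ j else 0)"
      by (rule sum.cong) (use PV[OF p(2)] in \<open>auto simp del: index_mult_mat\<close>)
    also have "\<dots> = c $ p" using p by simp
    finally show "c $ p = 0\<^sub>v m $ p" using *[OF p(1)] p by simp
  qed (use c in simp)
  define Y where "Y a = (y a * V)\<^sup>T" for a
  have Ya: "Y a \<in> carrier_mat m (d (head Q a))" if "a \<in> ?A" for a using ya[OF that] V by (simp add: Y_def)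
  have sub: "vec_subspace m (sum_range m ?A Y)"
    by (rule sum_range_subspace) (use Ya in auto)
  \<comment> \<open>A nonzero \<open>p\<close> orthogonal to all these images would satisfy
    \<open>y a (V p) = 0\<close> for every arrow from \<open>i\<close>, so \<open>V p\<close> would
    lie in the common kernel, against the choice of \<open>V\<close>.\<close>
  have full: "sum_range m ?A Y = carrier_vec m"
  proof (rule ccontr)
    assume "sum_range m ?A Y \<noteq> carrier_vec m"
    then obtain p where p: "p \<in> carrier_vec m" "p \<noteq> 0\<^sub>v m" "\<And>u. u \<in> sum_range m ?A Y \<Longrightarrow> p \<bullet> u = 0"
      using proper_subspace_annihilated[OF sub] by blast
    have "y a *\<^sub>v (V *\<^sub>v p) = 0\<^sub>v (d (head Q a))" if a: "a \<in> ?A" for a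
    proof (rule zero_of_orthogonal)
      show "y a *\<^sub>v (V *\<^sub>v p) \<in> carrier_vec (d (head Q a))" using ya[OF a] V p(1) by auto
      fix u :: "'k vec" assume u: "u \<in> carrier_vec (d (head Q a))"
      have yV: "y a * V \<in> carrier_mat (d (head Q a)) m" using ya[OF a] V by simp
      have "Y a *\<^sub>v u \<in> sum_range m ?A Y"
        by (rule sum_range_member[OF _ _ a]) (use u carrier_matD[OF Ya[OF a]] Ya in auto)
      then have "0 = p \<bullet> (Y a *\<^sub>v u)" using p(3) by simp
      also have "\<dots> = (Y a *\<^sub>v u) \<bullet> p" using Ya[OF a] u p(1) by (intro comm_scalar_prod) auto
      also have "\<dots> = u \<bullet> ((y a * V) *\<^sub>v p)" unfolding Y_def by (rule transpose_vec_mult_scalar[OF yV p(1) u])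
      also have "\<dots> = u \<bullet> (y a *\<^sub>v (V *\<^sub>v p))" using assoc_mult_mat_vec[OF ya[OF a] V p(1)] by simp
      also have "\<dots> = (y a *\<^sub>v (V *\<^sub>v p)) \<bullet> u" using u ya[OF a] V p(1) by (intro comm_scalar_prod) auto
      finally show "(y a *\<^sub>v (V *\<^sub>v p)) \<bullet> u = 0" by simp
    qed
    then have "V *\<^sub>v p \<in> soc d y i" using V p(1) by (auto simp: soc_def)
    then show False using Vsoc[OF p(1)] p(2) by simp
  qed
  have "\<forall>p\<in>{..<m}. \<exists>u. (\<forall>a\<in>?A. u a \<in> carrier_vec (dim_col (Y a))) \<and>
      (unit_vec m p :: 'k vec) = vec m (\<lambda>k. \<Sum>a\<in>?A. (Y a *\<^sub>v u a) $ k)"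
  proof
    fix p assume "p \<in> {..<m}"
    have "(unit_vec m p :: 'k vec) \<in> sum_range m ?A Y" unfolding full by simp
    then show "\<exists>u. (\<forall>a\<in>?A. u a \<in> carrier_vec (dim_col (Y a))) \<and>
      (unit_vec m p :: 'k vec) = vec m (\<lambda>k. \<Sum>a\<in>?A. (Y a *\<^sub>v u a) $ k)" unfolding sum_range_def by blast
  qed
  from bchoice[OF this] obtain u where u: "\<forall>p\<in>{..<m}. (\<forall>a\<in>?A. u p a \<in> carrier_vec (dim_col (Y a))) \<and>
      (unit_vec m p :: 'k vec) = vec m (\<lambda>k. \<Sum>a\<in>?A. (Y a *\<^sub>v u p a) $ k)" by blast
  have uc: "u p a \<in> carrier_vec (d (head Q a))" if "p < m" "a \<in> ?A" for p a
  proof -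
    have "u p a \<in> carrier_vec (dim_col (Y a))" using u that by blast
    then show ?thesis using Ya[OF that(2)] by simp
  qed
  \<comment> \<open>Row \<open>p\<close> combines rows of the matrices \<open>z a\<close> with
    coefficients \<open>u p\<close> that are fixed at \<open>y\<close>; these were chosen so that
    \<open>T y * V\<close> is the identity.\<close>
  define T where "T z = mat m (d i) (\<lambda>(p,l). \<Sum>a\<in>?A. \<Sum>q<d (head Q a). u p a $ q * z a $$ (q,l))" for z :: "'a \<Rightarrow> 'k mat"
  have T: "T z \<in> carrier_mat m (d i)" for z by (simp add: T_def)
  have Tv: "(T z *\<^sub>v v) $ p = (\<Sum>a\<in>?A. u p a \<bullet> (z a *\<^sub>v v))"
    if z: "z \<in> matrix_tuples Q d d" and v: "v \<in> carrier_vec (d i)" and p: "p < m" for z v p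
  proof -
    have za: "z a \<in> carrier_mat (d (head Q a)) (d i)" if "a \<in> ?A" for a using matrix_tuplesD[OF z, of a] that by auto
    have "(T z *\<^sub>v v) $ p = (\<Sum>l<d i. T z $$ (p,l) * v $ l)" by (rule mult_mat_vec_sum[OF T v p])
    also have "\<dots> = (\<Sum>l<d i. \<Sum>a\<in>?A. \<Sum>q<d (head Q a). u p a $ q * (z a $$ (q,l) * v $ l))"
      using p by (intro sum.cong refl) (simp add: T_def sum_distrib_right mult.assoc)
    also have "\<dots> = (\<Sum>a\<in>?A. \<Sum>q<d (head Q a). u p a $ q * (\<Sum>l<d i. z a $$ (q,l) * v $ l))"
      unfolding sum_distrib_left by (subst sum.swap) (intro sum.cong refl sum.swap)
    also have "\<dots> = (\<Sum>a\<in>?A. u p a \<bullet> (z a *\<^sub>v v))"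
    proof (rule sum.cong[OF refl])
      fix a assume a: "a \<in> ?A"
      have "u p a \<bullet> (z a *\<^sub>v v) = (\<Sum>q<d (head Q a). u p a $ q * (z a *\<^sub>v v) $ q)"
        using za[OF a] by (simp add: scalar_prod_def lessThan_atLeast0 del: index_mult_mat_vec)
      also have "\<dots> = (\<Sum>q<d (head Q a). u p a $ q * (\<Sum>l<d i. z a $$ (q,l) * v $ l))"
        by (intro sum.cong refl) (simp add: mult_mat_vec_sum[OF za[OF a] v] del: index_mult_mat_vec)
      finally show "(\<Sum>q<d (head Q a). u p a $ q * (\<Sum>l<d i. z a $$ (q,l) * v $ l)) = u p a \<bullet> (z a *\<^sub>v v)" by simp
    qed
    finally show ?thesis .
  qed
  define f where "f z = det (T z * V)" for z
  have "f \<in> polynomial_functions Q d"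
    unfolding f_def
  proof (rule polynomial_det)
    show "T z * V \<in> carrier_mat m m" for z by (rule mult_carrier_mat[OF T V])
    fix p j assume pj: "p < m" "j < m"
    have "(\<lambda>z. \<Sum>l<d i. V $$ (l,j) * (\<Sum>a\<in>?A. \<Sum>q<d (head Q a). u p a $ q * z a $$ (q,l))) \<in> polynomial_functions Q d"
      by (intro polynomial_sum polynomial_scale polynomial_functions.coord) auto
    moreover have "(T z * V) $$ (p,j) = (\<Sum>l<d i. V $$ (l,j) * (\<Sum>a\<in>?A. \<Sum>q<d (head Q a). u p a $ q * z a $$ (q,l)))" for z
      using pj T[of z] V by (auto simp: scalar_prod_def lessThan_atLeast0 T_def mult.commute intro!: sum.cong)
    ultimately show "(\<lambda>z. (T z * V) $$ (p,j)) \<in> polynomial_functions Q d" by simp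
  qed
  moreover have "f y = 1"
  proof -
    have "T y * V = 1\<^sub>m m"
    proof (rule eq_matI)
      fix p j assume "p < dim_row (1\<^sub>m m :: 'k mat)" "j < dim_col (1\<^sub>m m :: 'k mat)"
      then have pj: "p < m" "j < m" by auto
      have cV: "col V j \<in> carrier_vec (d i)" by (rule col_carrier_vec[OF pj(2) V])
      have "(T y * V) $$ (p,j) = (T y *\<^sub>v col V j) $ p" using pj T[of y] V by simp
      also have "\<dots> = (\<Sum>a\<in>?A. u p a \<bullet> (y a *\<^sub>v col V j))" by (rule Tv[OF y cV pj(1)])
      also have "\<dots> = (\<Sum>a\<in>?A. (Y a *\<^sub>v u p a) $ j)"
      proof (rule sum.cong[OF refl])
        fix a assume a: "a \<in> ?A"
        have eq: "y a *\<^sub>v col V j = col (y a * V) j" using ya[OF a] V pj by (intro eq_vecI) auto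
        have "u p a \<bullet> (y a *\<^sub>v col V j) = col (y a * V) j \<bullet> u p a"
          unfolding eq[symmetric] by (rule comm_scalar_prod[OF uc[OF pj(1) a] mult_mat_vec_carrier[OF ya[OF a] cV]])
        also have "\<dots> = (Y a *\<^sub>v u p a) $ j" using ya[OF a] V pj by (simp add: Y_def)
        finally show "u p a \<bullet> (y a *\<^sub>v col V j) = (Y a *\<^sub>v u p a) $ j" .
      qed
      also have "\<dots> = vec m (\<lambda>k. \<Sum>a\<in>?A. (Y a *\<^sub>v u p a) $ k) $ j" using pj by simp
      also have "vec m (\<lambda>k. \<Sum>a\<in>?A. (Y a *\<^sub>v u p a) $ k) = unit_vec m p" using u pj by simp
      finally show "(T y * V) $$ (p,j) = 1\<^sub>m m $$ (p,j)" using pj by (simp add: unit_vec_def)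
    qed (use T V in auto)
    then show ?thesis by (simp add: f_def)
  qed
  moreover have "m + l \<le> d i" if z: "z \<in> rep_variety Q d" and fz: "f z \<noteq> 0" and R: "adapted (d i) (rad d z i) l R R'" for z l R R'
  proof (rule ccontr)
    assume lt: "\<not> m + l \<le> d i"
    have zt: "z \<in> matrix_tuples Q d d" using z by (simp add: rep_variety_iff)
    have Rinv: "inverse_mats (d i) R R'" and ld: "l \<le> d i" using R by (auto simp: adapted_def)
    note Rc = inverse_matsD[OF Rinv]
    have lt2: "d i - l < m" using lt ld by simp
    define B where "B = mat (d i - l) m (\<lambda>(p,j). (R * V) $$ (p, j))"
    have B: "B \<in> carrier_mat (d i - l) m" by (simp add: B_def)
    obtain c where c: "c \<in> carrier_vec m" "c \<noteq> 0\<^sub>v m" "B *\<^sub>v c = 0\<^sub>v (d i - l)"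
      using wide_mat_kernel[OF B lt2] by blast
    have RV: "R * V \<in> carrier_mat (d i) m" using Rc V by simp
    have Vc: "V *\<^sub>v c \<in> carrier_vec (d i)" using V c by simp
    have "R *\<^sub>v (V *\<^sub>v c) \<in> last_coords (d i) l"
    proof (rule last_coordsI)
      show "R *\<^sub>v (V *\<^sub>v c) \<in> carrier_vec (d i)" using Rc Vc by simp
      fix p assume p: "p < d i - l"
      have "(R *\<^sub>v (V *\<^sub>v c)) $ p = ((R * V) *\<^sub>v c) $ p" using assoc_mult_mat_vec[OF Rc(1) V c(1)] by simp
      also have "\<dots> = (B *\<^sub>v c) $ p"
        using mult_mat_vec_sum[OF RV c(1), of p] mult_mat_vec_sum[OF B c(1) p] p
        by (simp add: B_def del: index_mult_mat_vec index_mult_mat)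
      finally show "(R *\<^sub>v (V *\<^sub>v c)) $ p = 0" using c(3) p by simp
    qed
    then have "V *\<^sub>v c \<in> rad d z i" using R Vc by (auto simp: adapted_def)
    \<comment> \<open>The bound concerns the radical at \<open>z\<close>, whose dimension the top
      determines; being contained in the common kernel, it is killed by \<open>T z\<close>.\<close>
    then have "V *\<^sub>v c \<in> soc d z i" using rad_subset_soc[OF z i] by blast
    then have "z a *\<^sub>v (V *\<^sub>v c) = 0\<^sub>v (d (head Q a))" if "a \<in> ?A" for a using that by (auto simp: soc_def)
    then have "(T z *\<^sub>v (V *\<^sub>v c)) $ p = 0" if "p < m" for p
      unfolding Tv[OF zt Vc that] using uc[OF that] by (intro sum.neutral) auto
    then have "T z *\<^sub>v (V *\<^sub>v c) = 0\<^sub>v m" using T[of z] by (intro eq_vecI) (auto simp del: index_mult_mat_vec)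
    then have "(T z * V) *\<^sub>v c = 0\<^sub>v m" using assoc_mult_mat_vec[OF T V c(1)] by simp
    then show False using det_0_iff_vec_prod_zero_field[of "T z * V" m] T[of z] V c fz by (auto simp: f_def)
  qed
  ultimately show thesis using that by blast
qed

text \<open>If the dimension of U_i at \<open>y\<close> exceeded \<open>d i - t i\<close>, or that
  of K_i fell below it, some minor would equal 1 at \<open>y\<close> and vanish on Rep^T, which the
  closure forbids. Once one matrix straightens both spaces,
  \<open>last_coords (d i) (d i - t i)\<close> lies between them and provides R_i.\<close>

lemma closure_normal_form:
  fixes y :: "'a \<Rightarrow> 'k::field mat"
  assumes td: "\<forall>i\<in>verts Q. t i \<le> d i" and y: "y \<in> closure_in_rep Q d (rep_with_top Q t d)"
  obtains x where "x \<in> C_space Q t d"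
    "modules_isomorphic (bound_algebra Q) (point_module Q d y) (point_module Q d (blk t d x))"
proof -
  have yr: "y \<in> rep_variety Q d" using y by (simp add: closure_in_rep_def)
  then have yt: "y \<in> matrix_tuples Q d d" by (simp add: rep_variety_iff)
  \<comment> \<open>Membership in the closure is used through this consequence alone: the zero set
    of a single polynomial is closed.\<close>
  have vanish: "f y = 0" if f: "f \<in> polynomial_functions Q d" and v: "\<And>z. z \<in> rep_with_top Q t d \<Longrightarrow> f z = 0" for f
  proof -
    let ?Z = "{x \<in> matrix_tuples Q d d. \<forall>g\<in>{f}. g x = 0}"
    have "zariski_closed Q d ?Z" unfolding zariski_closed_def using f by blast
    moreover have "rep_with_top Q t d \<subseteq> ?Z"
      using v by (auto simp: rep_with_top_def rep_variety_def)
    ultimately have "y \<in> ?Z" using y unfolding closure_in_rep_def by blast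
    then show ?thesis by simp
  qed
  have topD: "z \<in> rep_variety Q d" "z \<in> matrix_tuples Q d d" "\<exists>R R'. adapted (d i) (rad d z i) (d i - t i) R R'"
    if "z \<in> rep_with_top Q t d" "i \<in> verts Q" for z :: "'a \<Rightarrow> 'k mat" and i
  proof -
    show z: "z \<in> rep_variety Q d" using that by (simp add: rep_with_top_def)
    then show "z \<in> matrix_tuples Q d d" by (simp add: rep_variety_iff)
    show "\<exists>R R'. adapted (d i) (rad d z i) (d i - t i) R R'" using rep_with_top_iff[OF z] that by blast
  qed
  have "\<exists>PP. inverse_mats (d i) (fst PP) (snd PP) \<and>
      (\<forall>v\<in>rad d y i. fst PP *\<^sub>v v \<in> last_coords (d i) (d i - t i)) \<and>
      (\<forall>v\<in>carrier_vec (d i). fst PP *\<^sub>v v \<in> last_coords (d i) (d i - t i) \<longrightarrow> v \<in> soc d y i)" if i: "i \<in> verts Q" for i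
  proof -
    obtain k b P P' where P: "adapted (d i) (rad d y i) k P P'" "adapted (d i) (soc d y i) b P P'"
      by (rule adapted_flag_exists[OF rad_subspace[OF yt] soc_subspace[OF yt] rad_subset_soc[OF yr i]])
    have ti: "t i \<le> d i" using td i by simp
    have "k \<le> d i - t i"
    proof (rule ccontr)
      assume "\<not> k \<le> d i - t i"
      \<comment> \<open>One more than the dimension of the radical on Rep^T, so that the minor
        vanishes there.\<close>
      then have "Suc (d i - t i) \<le> k" by simp
      from radical_minor[OF yt i P(1) this] obtain f where f: "f \<in> polynomial_functions Q d" "f y = 1"
        "\<And>z l R R'. z \<in> matrix_tuples Q d d \<Longrightarrow> f z \<noteq> 0 \<Longrightarrow> adapted (d i) (rad d z i) l R R' \<Longrightarrow> Suc (d i - t i) \<le> l" by blast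
      have "f z = 0" if z: "z \<in> rep_with_top Q t d" for z
      proof -
        obtain R R' where "adapted (d i) (rad d z i) (d i - t i) R R'" using topD(3)[OF z i] by blast
        then show ?thesis using f(3)[OF topD(2)[OF z i]] by fastforce
      qed
      then show False using vanish[OF f(1)] f(2) by simp
    qed
    moreover have "d i - t i \<le> b"
    proof (rule ccontr)
      assume lt: "\<not> d i - t i \<le> b"
      \<comment> \<open>With \<open>m = t i + 1\<close> the minor vanishes on Rep^T: there the
        radical has dimension \<open>d i - t i\<close>, and together with \<open>m\<close> this
        exceeds \<open>d i\<close>.\<close>
      then have "Suc (t i) + b \<le> d i" by simp
      from socle_minor[OF yt i P(2) this] obtain f where f: "f \<in> polynomial_functions Q d" "f y = 1"
        "\<And>z l R R'. z \<in> rep_variety Q d \<Longrightarrow> f z \<noteq> 0 \<Longrightarrow> adapted (d i) (rad d z i) l R R' \<Longrightarrow> Suc (t i) + l \<le> d i" by blast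
      have "f z = 0" if z: "z \<in> rep_with_top Q t d" for z
      proof -
        obtain R R' where "adapted (d i) (rad d z i) (d i - t i) R R'" using topD(3)[OF z i] by blast
        then show ?thesis using f(3)[OF topD(1)[OF z i]] ti by fastforce
      qed
      then show False using vanish[OF f(1)] f(2) by simp
    qed
    ultimately have lc: "last_coords (d i) k \<subseteq> (last_coords (d i) (d i - t i) :: 'k vec set)"
      "last_coords (d i) (d i - t i) \<subseteq> (last_coords (d i) b :: 'k vec set)"
      by (simp_all add: last_coords_mono)
    have radc: "rad d y i \<subseteq> carrier_vec (d i)" using rad_subspace[OF yt] by (auto simp: vec_subspace_def)
    show ?thesis
      by (rule exI[of _ "(P, P')"]) (use P lc radc in \<open>auto simp: adapted_def\<close>)
  qed
  then have "\<forall>i\<in>verts Q. \<exists>PP. inverse_mats (d i) (fst PP) (snd PP) \<and>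
      (\<forall>v\<in>rad d y i. fst PP *\<^sub>v v \<in> last_coords (d i) (d i - t i)) \<and>
      (\<forall>v\<in>carrier_vec (d i). fst PP *\<^sub>v v \<in> last_coords (d i) (d i - t i) \<longrightarrow> v \<in> soc d y i)" by blast
  from bchoice[OF this] obtain PP where PP: "\<forall>i\<in>verts Q. inverse_mats (d i) (fst (PP i)) (snd (PP i)) \<and>
      (\<forall>v\<in>rad d y i. fst (PP i) *\<^sub>v v \<in> last_coords (d i) (d i - t i)) \<and>
      (\<forall>v\<in>carrier_vec (d i). fst (PP i) *\<^sub>v v \<in> last_coords (d i) (d i - t i) \<longrightarrow> v \<in> soc d y i)" by blast
  show thesis
  proof (rule adapted_normal_form[OF td yr, of "\<lambda>i. fst (PP i)" "\<lambda>i. snd (PP i)"])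
    show "inverse_mats (d i) (fst (PP i)) (snd (PP i))" if "i \<in> verts Q" for i using PP that by blast
    show "fst (PP (head Q a)) *\<^sub>v (y a *\<^sub>v v) \<in> last_coords (d (head Q a)) (d (head Q a) - t (head Q a))"
      if "a \<in> arcs Q" "v \<in> carrier_vec (d (tail Q a))" for a v
      using bspec[OF PP, of "head Q a"] rad_member[OF yt that] that by simp
    show "y a *\<^sub>v v = 0\<^sub>v (d (head Q a))" if "a \<in> arcs Q" "v \<in> carrier_vec (d (tail Q a))"
      "fst (PP (tail Q a)) *\<^sub>v v \<in> last_coords (d (tail Q a)) (d (tail Q a) - t (tail Q a))" for a v
      using bspec[OF PP, of "tail Q a"] that by (simp add: soc_def)
  qed (rule that)
qed

text \<open>Realizability gives the base point of the line: a module with top T in normal form,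
  whose radical fills R_i at every vertex. All radicals along the line are contained in R_i, so top
  T amounts to a lower bound for their dimensions, which one nonvanishing minor per vertex
  guarantees.\<close>

lemma blk_in_closure:
  fixes x :: "'a \<Rightarrow> 'k::alg_closed_field mat"
  assumes td: "\<forall>i\<in>verts Q. t i \<le> d i" and real: "rep_with_top Q t d \<noteq> ({} :: ('a \<Rightarrow> 'k mat) set)"
    and x: "x \<in> C_space Q t d"
  shows "blk t d x \<in> closure_in_rep Q d (rep_with_top Q t d)"
proof -
  obtain y :: "'a \<Rightarrow> 'k mat" where y: "y \<in> rep_with_top Q t d" using real by blast
  have yr: "y \<in> rep_variety Q d" using y by (simp add: rep_with_top_def)
  then have yt: "y \<in> matrix_tuples Q d d" by (simp add: rep_variety_iff)
  have "\<forall>i\<in>verts Q. \<exists>PP. adapted (d i) (rad d y i) (d i - t i) (fst PP) (snd PP) \<and>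
      (\<forall>v\<in>carrier_vec (d i). fst PP *\<^sub>v v \<in> last_coords (d i) (d i - t i) \<longrightarrow> v \<in> soc d y i)"
  proof
    fix i assume i: "i \<in> verts Q"
    obtain R R' where R: "adapted (d i) (rad d y i) (d i - t i) R R'" using rep_with_top_iff[OF yr] y i by blast
    have "v \<in> soc d y i" if "v \<in> carrier_vec (d i)" "R *\<^sub>v v \<in> last_coords (d i) (d i - t i)" for v
      using R that rad_subset_soc[OF yr i] by (auto simp: adapted_def)
    then show "\<exists>PP. adapted (d i) (rad d y i) (d i - t i) (fst PP) (snd PP) \<and>
      (\<forall>v\<in>carrier_vec (d i). fst PP *\<^sub>v v \<in> last_coords (d i) (d i - t i) \<longrightarrow> v \<in> soc d y i)"
      by (intro exI[of _ "(R, R')"]) (use R in auto)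
  qed
  from bchoice[OF this] obtain PP where PP: "\<forall>i\<in>verts Q. adapted (d i) (rad d y i) (d i - t i) (fst (PP i)) (snd (PP i)) \<and>
      (\<forall>v\<in>carrier_vec (d i). fst (PP i) *\<^sub>v v \<in> last_coords (d i) (d i - t i) \<longrightarrow> v \<in> soc d y i)" by blast
  define P where "P i = fst (PP i)" for i
  have Pa: "adapted (d i) (rad d y i) (d i - t i) (P i) (snd (PP i))" if "i \<in> verts Q" for i
    using PP that by (simp add: P_def)
  have Pinv: "inverse_mats (d i) (P i) (snd (PP i))" if "i \<in> verts Q" for i using Pa[OF that] by (simp add: adapted_def)
  obtain x0 where x0: "x0 \<in> C_space Q t d" "\<And>a. a \<in> arcs Q \<Longrightarrow> P (head Q a) * y a = blk t d x0 a * P (tail Q a)"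
  proof (rule adapted_normal_form[OF td yr, of P "\<lambda>i. snd (PP i)"])
    show "inverse_mats (d i) (P i) (snd (PP i))" if "i \<in> verts Q" for i by (rule Pinv[OF that])
    show "P (head Q a) *\<^sub>v (y a *\<^sub>v v) \<in> last_coords (d (head Q a)) (d (head Q a) - t (head Q a))"
      if "a \<in> arcs Q" "v \<in> carrier_vec (d (tail Q a))" for a v
      using Pa[of "head Q a"] rad_member[OF yt that] that matrix_tuplesD[OF yt that(1)] by (auto simp: adapted_def)
    show "y a *\<^sub>v v = 0\<^sub>v (d (head Q a))" if "a \<in> arcs Q" "v \<in> carrier_vec (d (tail Q a))"
      "P (tail Q a) *\<^sub>v v \<in> last_coords (d (tail Q a)) (d (tail Q a) - t (tail Q a))" for a v
      using bspec[OF PP, of "tail Q a"] that by (simp add: soc_def P_def)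
  qed blast
  note b0 = blk_tuple[OF td x0(1)]
  have rad0: "rad d (blk t d x') i \<subseteq> last_coords (d i) (d i - t i)" if x': "x' \<in> C_space Q t d" for x' :: "'a \<Rightarrow> 'k mat" and i
    unfolding rad_def
  proof (rule sum_range_least[OF _ _ subspace_last_coords])
    fix a and v :: "'k vec" assume a: "a \<in> {a \<in> arcs Q. head Q a = i}" and v: "v \<in> carrier_vec (dim_col (blk t d x' a))"
    have "v \<in> carrier_vec (d (tail Q a))" using v matrix_tuplesD[OF blk_tuple[OF td x'], of a] a by simp
    then show "blk t d x' a *\<^sub>v v \<in> last_coords (d i) (d i - t i)" using blk_maps(1)[OF td x', of a v] a by auto
  qed (auto dest: matrix_tuplesD[OF blk_tuple[OF td x']])
  \<comment> \<open>The base change moves the radical at \<open>y\<close> into the one at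
    \<open>blk t d x0\<close>. As \<open>P i\<close> carries the former onto all of R_i, the latter
    is R_i.\<close>
  have rad_eq: "rad d (blk t d x0) i = last_coords (d i) (d i - t i)" if i: "i \<in> verts Q" for i
  proof (rule antisym[OF rad0[OF x0(1)]])
    note Pc = inverse_matsD[OF Pinv[OF i]]
    let ?R = "rad d (blk t d x0) i"
    have R: "vec_subspace (d i) ?R" by (rule rad_subspace[OF b0])
    have sub: "vec_subspace (d i) ((*\<^sub>v) (snd (PP i)) ` ?R)" by (rule subspace_image[OF R Pc(2)])
    have "rad d y i \<subseteq> (*\<^sub>v) (snd (PP i)) ` ?R"
      unfolding rad_def[of d y]
    proof (rule sum_range_least[OF _ _ sub])
      fix a and v :: "'k vec" assume a: "a \<in> {a \<in> arcs Q. head Q a = i}" and v: "v \<in> carrier_vec (dim_col (y a))"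
      have aQ: "a \<in> arcs Q" and hi: "head Q a = i" and tv: "tail Q a \<in> verts Q" using a by auto
      have ya: "y a \<in> carrier_mat (d i) (d (tail Q a))" using matrix_tuplesD[OF yt aQ] hi by simp
      have ba: "blk t d x0 a \<in> carrier_mat (d i) (d (tail Q a))" using matrix_tuplesD[OF b0 aQ] hi by simp
      have vc: "v \<in> carrier_vec (d (tail Q a))" using v ya by simp
      note Pt = inverse_matsD(1)[OF Pinv[OF tv]]
      have "P i *\<^sub>v (y a *\<^sub>v v) = blk t d x0 a *\<^sub>v (P (tail Q a) *\<^sub>v v)"
        using x0(2)[OF aQ] hi assoc_mult_mat_vec[OF Pc(1) ya vc] assoc_mult_mat_vec[OF ba Pt vc] by simp
      then have "P i *\<^sub>v (y a *\<^sub>v v) \<in> ?R"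
        using rad_member[OF b0 aQ, of "P (tail Q a) *\<^sub>v v"] Pt vc hi by simp
      moreover have "y a *\<^sub>v v = snd (PP i) *\<^sub>v (P i *\<^sub>v (y a *\<^sub>v v))"
        using inverse_mats_cancel(1)[OF Pinv[OF i], of "y a *\<^sub>v v"] ya vc by simp
      ultimately show "y a *\<^sub>v v \<in> (*\<^sub>v) (snd (PP i)) ` ?R" by blast
    qed (auto dest: matrix_tuplesD[OF yt])
    then show "last_coords (d i) (d i - t i) \<subseteq> ?R"
    proof -
      assume sub: "rad d y i \<subseteq> (*\<^sub>v) (snd (PP i)) ` ?R"
      show ?thesis
      proof
        fix v :: "'k vec" assume v: "v \<in> last_coords (d i) (d i - t i)"
        then have vc: "v \<in> carrier_vec (d i)" by (simp add: last_coords_def)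
        have "snd (PP i) *\<^sub>v v \<in> rad d y i" by (rule adapted_inverse[OF Pa[OF i] v])
        then obtain u where u: "u \<in> ?R" "snd (PP i) *\<^sub>v v = snd (PP i) *\<^sub>v u" using sub by blast
        have "u \<in> carrier_vec (d i)" using u R by (auto simp: vec_subspace_def)
        then have "v = u" using inverse_mats_cancel(2)[OF Pinv[OF i]] u(2) vc by metis
        then show "v \<in> ?R" using u by simp
      qed
    qed
  qed
  have "\<forall>i\<in>verts Q. \<exists>f. f \<in> polynomial_functions Q d \<and> f (blk t d x0) = 1 \<and>
      (\<forall>z l R R'. z \<in> matrix_tuples Q d d \<longrightarrow> f z \<noteq> 0 \<longrightarrow> adapted (d i) (rad d z i) l R R' \<longrightarrow> d i - t i \<le> l)"
  proof
    fix i assume i: "i \<in> verts Q"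
    have "adapted (d i) (rad d (blk t d x0) i) (d i - t i) (1\<^sub>m (d i)) (1\<^sub>m (d i))"
      unfolding rad_eq[OF i] by (rule adapted_last_coords) simp
    from radical_minor[OF b0 i this order_refl]
    show "\<exists>f. f \<in> polynomial_functions Q d \<and> f (blk t d x0) = 1 \<and>
      (\<forall>z l R R'. z \<in> matrix_tuples Q d d \<longrightarrow> f z \<noteq> 0 \<longrightarrow> adapted (d i) (rad d z i) l R R' \<longrightarrow> d i - t i \<le> l)" by metis
  qed
  from bchoice[OF this] obtain F where F: "\<forall>i\<in>verts Q. F i \<in> polynomial_functions Q d \<and> F i (blk t d x0) = 1 \<and>
      (\<forall>z l R R'. z \<in> matrix_tuples Q d d \<longrightarrow> F i z \<noteq> 0 \<longrightarrow> adapted (d i) (rad d z i) l R R' \<longrightarrow> d i - t i \<le> l)" by blast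
  \<comment> \<open>The line through \<open>x0\<close> at \<open>s = 0\<close> and \<open>x\<close>
    at \<open>s = 1\<close>.\<close>
  define xs where "xs s = (\<lambda>a\<in>arcs Q. mat (d (head Q a) - t (head Q a)) (t (tail Q a))
      (\<lambda>(i,j). (1 - s) * x0 a $$ (i,j) + s * x a $$ (i,j)))" for s :: 'k
  have xs: "xs s \<in> C_space Q t d" for s by (auto simp: xs_def C_space_def matrix_tuples_def)
  have C_eqI: "u = v" if u: "u \<in> C_space Q t d" and v: "v \<in> C_space Q t d"
    and eq: "\<And>a i j. a \<in> arcs Q \<Longrightarrow> i < d (head Q a) - t (head Q a) \<Longrightarrow> j < t (tail Q a) \<Longrightarrow> u a $$ (i,j) = v a $$ (i,j)" for u v :: "'a \<Rightarrow> 'k mat"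
  proof (rule PiE_ext)
    show "u \<in> (\<Pi>\<^sub>E a\<in>arcs Q. carrier_mat (d (head Q a) - t (head Q a)) (t (tail Q a)))"
      "v \<in> (\<Pi>\<^sub>E a\<in>arcs Q. carrier_mat (d (head Q a) - t (head Q a)) (t (tail Q a)))"
      using u v by (simp_all add: C_space_def matrix_tuples_def)
    show "u a = v a" if "a \<in> arcs Q" for a
      by (rule eq_matI) (use C_spaceD[OF u that] C_spaceD[OF v that] eq[OF that] in auto)
  qed
  have xs01: "xs 0 = x0" "xs 1 = x"
    by (rule C_eqI[OF xs x0(1)], simp add: xs_def) (rule C_eqI[OF xs x], simp add: xs_def)
  \<comment> \<open>The entries of \<open>blk t d (xs s)\<close> are zero or affine in
    \<open>s\<close>, so a polynomial function becomes a polynomial in \<open>s\<close>.\<close>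
  have line: "\<exists>p. \<forall>s. poly p s = f (blk t d (xs s))" if "f \<in> polynomial_functions Q d" for f :: "('a \<Rightarrow> 'k mat) \<Rightarrow> 'k"
    using that
  proof induction
    case (const c)
    show ?case by (rule exI[of _ "[:c:]"]) simp
  next
    case (coord a i j)
    have td': "t (head Q a) \<le> d (head Q a)" "t (tail Q a) \<le> d (tail Q a)" using td coord by auto
    have *: "blk t d (xs s) a $$ (i,j) = (if i < t (head Q a) then 0 else if j < t (tail Q a) then
        (1 - s) * x0 a $$ (i - t (head Q a), j) + s * x a $$ (i - t (head Q a), j) else 0)" for s
      using coord td' by (auto simp: blk_def xs_def)
    define c0 c1 where "c0 = x0 a $$ (i - t (head Q a), j)" and "c1 = x a $$ (i - t (head Q a), j)"
    show ?case
      unfolding *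
      by (rule exI[of _ "if i < t (head Q a) then 0 else if j < t (tail Q a) then [:c0, c1 - c0:] else 0"])
        (simp add: c0_def c1_def algebra_simps)
  next
    case (add f g)
    then show ?case by (metis poly_add)
  next
    case (mult f g)
    then show ?case by (metis poly_mult)
  qed
  have "g (blk t d x) = 0" if g: "g \<in> polynomial_functions Q d" and v: "\<And>z. z \<in> rep_with_top Q t d \<Longrightarrow> g z = 0" for g
  proof -
    obtain p where p: "\<And>s. poly p s = g (blk t d (xs s))" using line[OF g] by blast
    have "\<forall>i\<in>verts Q. \<exists>q. \<forall>s. poly q s = F i (blk t d (xs s))" using line F by blast
    from bchoice[OF this] obtain q where q: "\<forall>i\<in>verts Q. \<forall>s. poly (q i) s = F i (blk t d (xs s))" by blast
    \<comment> \<open>Where all minors are nonzero the point has top T, so \<open>p\<close>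
      vanishes; elsewhere some \<open>q i\<close> vanishes. The product has every field element as a
      root and is therefore 0. The product of the \<open>q i\<close> is nonzero because its value at
      \<open>s = 0\<close> is 1, so \<open>p = 0\<close>.\<close>
    have "poly (p * (\<Prod>i\<in>verts Q. q i)) s = 0" for s
    proof (cases "\<forall>i\<in>verts Q. F i (blk t d (xs s)) \<noteq> 0")
      case True
      have "blk t d (xs s) \<in> rep_with_top Q t d"
        unfolding rep_with_top_iff[OF blk_rep[OF td xs]]
      proof
        fix i assume i: "i \<in> verts Q"
        note bt = blk_tuple[OF td xs, of s]
        obtain l R R' where R: "adapted (d i) (rad d (blk t d (xs s)) i) l R R'" using adapted_exists[OF rad_subspace[OF bt]] by blast
        have "d i - t i \<le> l" using F i True bt R by blast
        moreover have "l \<le> d i - t i"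
          using adapted_mono[OF R adapted_last_coords rad0[OF xs]] by simp
        ultimately show "t i \<le> d i \<and> (\<exists>P P'. adapted (d i) (rad d (blk t d (xs s)) i) (d i - t i) P P')"
          using R td i by auto
      qed
      then show ?thesis using v p by simp
    next
      case False
      then have "\<exists>i\<in>verts Q. poly (q i) s = 0" using q by auto
      then show ?thesis by (simp add: poly_prod prod_zero_iff)
    qed
    then have "p * (\<Prod>i\<in>verts Q. q i) = 0"
      using poly_roots_finite[of "p * (\<Prod>i\<in>verts Q. q i)"] infinite_alg_closed[where 'k = 'k] by (metis (mono_tags, lifting) Collect_cong UNIV_def)
    moreover have "poly (\<Prod>i\<in>verts Q. q i) 0 = 1"
      using q F by (simp add: poly_prod xs01)
    then have "(\<Prod>i\<in>verts Q. q i) \<noteq> 0" by (metis poly_0 zero_neq_one)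
    ultimately have "p = 0" by simp
    then show ?thesis using p[of 1] by (simp add: xs01)
  qed
  then have "blk t d x \<in> Z" if "zariski_closed Q d Z" "rep_with_top Q t d \<subseteq> Z" for Z
    using that blk_tuple[OF td x] unfolding zariski_closed_def by blast
  then show ?thesis using blk_rep[OF td x] by (auto simp: closure_in_rep_def)
qed

end

theorem mainTheorem11:
  fixes Q :: "('v, 'a) pre_digraph"
    and t d :: "'v \<Rightarrow> nat"
    and C :: "('a \<Rightarrow> 'k::alg_closed_field mat) set"
  assumes quiver: "fin_digraph Q"
    and realizable: "rep_with_top Q t d \<noteq> ({} :: ('a \<Rightarrow> 'k mat) set)"
    and C: "C = C_space Q t d"
  shows "rho Q t d \<in> C \<rightarrow> iso_classes Q d \<and>
         rho Q t d ` C =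
           (\<lambda>y. iso_class Q (point_module Q d y)) ` closure_in_rep Q d (rep_with_top Q t d) \<and>
         (\<lambda>X. {x \<in> C. rho Q t d x = X}) ` (rho Q t d ` C) =
           orbits (G_group Q t d) C (G_action Q t)"
proof -
  interpret finite_quiver Q using quiver by (simp add: finite_quiver_def)
  obtain y :: "'a \<Rightarrow> 'k mat" where y: "y \<in> rep_with_top Q t d" using realizable by blast
  have yr: "y \<in> rep_variety Q d" using y by (simp add: rep_with_top_def)
  \<comment> \<open>Realizability provides \<open>t \<le> d\<close>, which makes the truncated
    differences \<open>d i - t i\<close> the true dimensions of R_i.\<close>
  have td: "\<forall>i\<in>verts Q. t i \<le> d i" using rep_with_top_iff[OF yr] y by blast
  have "rho Q t d ` C = (\<lambda>y. iso_class Q (point_module Q d y)) ` closure_in_rep Q d (rep_with_top Q t d)"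
  proof (intro equalityI subsetI)
    fix X assume "X \<in> rho Q t d ` C"
    then obtain x where x: "x \<in> C_space Q t d" "X = rho Q t d x" using C by blast
    show "X \<in> (\<lambda>y. iso_class Q (point_module Q d y)) ` closure_in_rep Q d (rep_with_top Q t d)"
      unfolding x(2) rho_eq[OF td x(1)] using blk_in_closure[OF td realizable x(1)] by blast
  next
    fix X assume "X \<in> (\<lambda>y. iso_class Q (point_module Q d y)) ` closure_in_rep Q d (rep_with_top Q t d :: ('a \<Rightarrow> 'k mat) set)"
    then obtain z where z: "z \<in> closure_in_rep Q d (rep_with_top Q t d)" "X = iso_class Q (point_module Q d z)" by blast
    obtain x where x: "x \<in> C_space Q t d"
      "modules_isomorphic (bound_algebra Q) (point_module Q d z) (point_module Q d (blk t d x))"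
      using closure_normal_form[OF td z(1)] by blast
    have "z \<in> rep_variety Q d" using z by (simp add: closure_in_rep_def)
    then have "X = rho Q t d x" unfolding z(2) rho_eq[OF td x(1)] by (rule iso_class_eq[OF point_left_module x(2)])
    then show "X \<in> rho Q t d ` C" using x(1) C by blast
  qed
  \<comment> \<open>Fibres are indexed by values of \<open>rho\<close> and orbits by points;
    \<open>rho_fibre\<close> matches the fibre through \<open>x\<close> with the orbit of
    \<open>x\<close>.\<close>
  moreover have "(\<lambda>X. {x \<in> C. rho Q t d x = X}) ` (rho Q t d ` C) = orbits (G_group Q t d) C (G_action Q t)"
    unfolding C orbits_def image_image using rho_fibre[OF td] by (auto simp: image_iff)
  moreover have "rho Q t d \<in> C \<rightarrow> iso_classes Q d" unfolding C using rho_in_iso_classes[OF td] by blast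
  ultimately show ?thesis by blast
qed

end
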